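(* Let $T>0$, $L^*>0$, and let $c_f,D,K,\rho_a>0$, $p_a$ be constants. Let $(\rho,q)$ solve $$\partial_t\rho+\partial_x q=0,\qquad \partial_t q+\partial_x\Big(\frac{q^2}{\rho}+p(\rho)\Big)=-\frac{c_f|q|q}{2D\rho},\qquad p(\rho)=p_a+K\frac{\rho-\rho_a}{\rho_a},$$ with given initial data $(\rho_0,q_0)$, and assume that $u=(\rho,v)$ with $v=q/\rho$ belongs to $C^\infty([0,T]\times[0,L^*])^2$. Equivalently, $u$ solves the quasi-linear hyperbolic problem $\partial_t u=-A(u)\partial_x u+B(u)$, $u(0,x)=u_0(x)$, with $$A(u)=\begin{pmatrix} v&\rho\\ \frac{K}{\rho_a\rho}&v\end{pmatrix},\qquad B(u)=\begin{pmatrix}0\\ -\frac{c_f}{2D}v|v|\end{pmatrix}.$$ Let $\varphi$ be the finite difference operator of the nonlinear Lax-Wendroff scheme for this problem (written out in the context), and let $U(t,x)$ be the corresponding approximate numerical solution, satisfying $$U(t+\Delta t,x)=\varphi\big(\{U(t,x\pm j\Delta x)\}_{j},\Delta t,t,\Delta x,x\big),\qquad U(0,x)=u_0(x),$$ where $u$ is Taylor expandable in $t$ up to second order on $[0,T]\times[0,L^*]$: $$u(t+\Delta t,x)=u(t,x)+\Delta t\,\partial_t u(t,x)+\frac{\Delta t^2}{2}\partial_t^2u(t,x)+O((\Delta t)^3).$$ Then $\varphi$ is consistent with order of accuracy $p=2$, and its first variation is $\ell_2$-stable under a proper CFL condition on $\Delta t$ and $\Delta x$, of the form $\frac{\Delta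 t}{\Delta x}\sqrt{K/\rho_a}\le\varepsilon$ with $\varepsilon=\varepsilon(\|u\|_{L^\infty})<1$ sufficiently small. Furthermore, $$U(t_0,x_0)=u(t_0,x_0)+O((\Delta t)^2)\qquad(\Delta t\to0,\ r=\Delta t/\Delta x\text{ fixed})$$ for $(t_0,x_0)$ inside the cone dictated by the CFL condition.
   Context: Standing assumptions: $\rho\ne 0$, and the system is hyperbolic, i.e. $A(u(t,x))$ has distinct eigenvalues of opposite sign for all $(t,x)$. The ratio $r=\Delta t/\Delta x$ is fixed. Scheme. Put $C=\frac{c_f}{2D}$, $D_0f(x)=\frac{f(x+\Delta x)-f(x-\Delta x)}{2\Delta x}$, $D_2f(x)=\frac{f(x+\Delta x)-2f(x)+f(x-\Delta x)}{(\Delta x)^2}$, $U=(P,V)$. The Lax-Wendroff operator $\varphi$ is obtained by expanding $u$ in $t$ to second order, replacing $\partial_t u,\partial_t^2u$ by spatial derivatives through the PDE, and replacing $\partial_x,\partial_x^2$ by $D_0,D_2$. Explicitly (all right-hand sides at $(t,x)$): $$P(t+\Delta t,x)=P+\Delta t\big(-P D_0V-V D_0P\big)+\tfrac{(\Delta t)^2}{2}\Big(2P(D_0V)^2+2PV D_2V+4V D_0V\,D_0P+2C|V|P D_0V+CV|V|D_0P+\big(\tfrac{K}{\rho_a}+V^2\big)D_2P\Big),$$ $$V(t+\Delta t,x)=V+\Delta t\Big(-V D_0V-\tfrac{K}{\rho_aP}D_0P-CV|V|\Big)+\tfrac{(\Delta t)^2}{2}\Big(2V(D_0V)^2+\big(\tfrac{K}{\rho_a}+V^2\big)D_2V+5CV|V|D_0V+\tfrac{2K}{\rho_aP}D_0P\,D_0V-\tfrac{2KV}{\rho_aP^2}(D_0P)^2+\tfrac{2KV}{\rho_aP}D_2P+\tfrac{2CK|V|}{\rho_aP}D_0P+2C^2V^3\Big).$$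 Consistency: $\varphi(\{u(t,x\pm j\Delta x)\}_j,\dots)=u+\Delta t(-A(u)\partial_xu+B(u))+O((\Delta t)^2)$. Order of accuracy: writing the scheme's solution as $U(t,x)=u(t,x)+\sum_{k\ge1}^{\mathcal K}(\Delta t)^kV_k(t,x)$ with $V_k(0,x)=0$, where the error terms $V_k$ are classified by powers of $\Delta t$, the order of accuracy $p$ is the index of the first non-vanishing principal error term $V_j$. First variation: let $c_j$ be the Jacobian of $\varphi$ with respect to its argument $U(t,x+j\Delta x)$, $j$ in the stencil $\{-1,0,1\}$. Then $(M(t,\Delta x)f)(x)=\sum_j c_j(u(t,x),\dots,u(t,x),x,t,0)f(x+j\Delta x)$, i.e. all $U$-arguments of the Jacobians are set equal to $u(t,x)$ (and the last argument, the step size, is set to $0$ with $r$ fixed). $\ell_2$-stability: there is a constant, independent of $\Delta t,\Delta x$ but possibly depending on $t$, with $\|M(t-\Delta t,\Delta x)M(t-2\Delta t,\Delta x)\cdots M(t-n\Delta t,\Delta x)\|_{\ell_2}\le \mathrm{const}$ for $n\Delta t\le t\le t_0$. Cone: for $(t_0,x_0)$ the closed cone is $\mathcal C_0=\{(x,t): 0\le t\le t_0,\ r(x-x_0)/(t_0-t)\in[-1,1]\}$, where $[-1,1]$ is the convex hull of the stencil; the points of the mesh used in computing $U(t_0,x_0)$ lie in $\mathcal C_0$. "$(t_0,x_0)$ inside the cone dictated by the CFL condition" means that $\mathcal C_0$ lies in the region $[0,T]\times[0,L^*]$ where $u$ is smooth and the CFL condition holds.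
   Formalization: The equivalence of the two PDE forms is stated for ρ>0 only (for ρ<0 the friction sign flips); order p=2 is a property of the scheme: V_1 vanishes for every flow and V_2 is nonzero for some flow, since at a constant state at rest all error terms vanish. *)

theory Defs
  imports "HOL-Analysis.Analysis" "HOL-Library.Landau_Symbols"
begin

section \<open>Smooth functions on the closed rectangle\<close>

text \<open>All functions of time and space are total; only their values on
  \<open>{0..T} \<times> {0..L}\<close> matter, so derivatives are taken within that rectangle
  (one-sided at its boundary).\<close>

definition dt :: "real \<Rightarrow> (real \<Rightarrow> real \<Rightarrow> 'a::real_normed_vector) \<Rightarrow> real \<Rightarrow> real \<Rightarrow> 'a" where
  "dt T f t x = vector_derivative (\<lambda>s. f s x) (at t within {0..T})"

definition dx :: "real \<Rightarrow> (real \<Rightarrow> real \<Rightarrow> 'a::real_normed_vector) \<Rightarrow> real \<Rightarrow> real \<Rightarrow> 'a" where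
  "dx L f t x = vector_derivative (\<lambda>y. f t y) (at x within {0..L})"

primrec Ck_on :: "nat \<Rightarrow> (real \<times> real) set \<Rightarrow> (real \<times> real \<Rightarrow> 'a::real_normed_vector) \<Rightarrow> bool" where
  "Ck_on 0 S f \<longleftrightarrow> continuous_on S f"
| "Ck_on (Suc k) S f \<longleftrightarrow>
     (\<exists>ft fx. (\<forall>z\<in>S. (f has_derivative (\<lambda>(s, y). s *\<^sub>R ft z + y *\<^sub>R fx z)) (at z within S))
            \<and> Ck_on k S ft \<and> Ck_on k S fx)"

definition Cinf_on :: "(real \<times> real) set \<Rightarrow> (real \<times> real \<Rightarrow> 'a::real_normed_vector) \<Rightarrow> bool" where
  "Cinf_on S f \<longleftrightarrow> (\<forall>k. Ck_on k S f)"

definition taylor2_in_time :: "real \<Rightarrow> real \<Rightarrow> (real \<Rightarrow> real \<Rightarrow> real^2) \<Rightarrow> bool" where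
  "taylor2_in_time T L u \<longleftrightarrow>
     (\<exists>c. \<forall>t\<in>{0..T}. \<forall>x\<in>{0..L}. \<forall>\<tau>. t + \<tau> \<in> {0..T} \<longrightarrow>
        norm (u (t + \<tau>) x - (u t x + \<tau> *\<^sub>R dt T u t x + (\<tau>\<^sup>2 / 2) *\<^sub>R dt T (dt T u) t x))
          \<le> c * \<bar>\<tau>\<bar> ^ 3)"


section \<open>The pipe flow equations\<close>

definition pressure :: "real \<Rightarrow> real \<Rightarrow> real \<Rightarrow> real \<Rightarrow> real" where
  "pressure K \<rho>a pa \<rho> = pa + K * ((\<rho> - \<rho>a) / \<rho>a)"

definition conservation_form ::
  "real \<Rightarrow> real \<Rightarrow> real \<Rightarrow> real \<Rightarrow> real \<Rightarrow> real \<Rightarrow> real \<Rightarrow>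
    (real \<Rightarrow> real \<Rightarrow> real) \<Rightarrow> (real \<Rightarrow> real \<Rightarrow> real) \<Rightarrow> bool" where
  "conservation_form T L cf D K \<rho>a pa \<rho> q \<longleftrightarrow>
     (\<forall>t\<in>{0..T}. \<forall>x\<in>{0..L}.
        dt T \<rho> t x + dx L q t x = 0 \<and>
        dt T q t x + dx L (\<lambda>t x. (q t x)\<^sup>2 / \<rho> t x + pressure K \<rho>a pa (\<rho> t x)) t x
          = - (cf * \<bar>q t x\<bar> * q t x) / (2 * D * \<rho> t x))"

definition density_velocity ::
  "(real \<Rightarrow> real \<Rightarrow> real) \<Rightarrow> (real \<Rightarrow> real \<Rightarrow> real) \<Rightarrow> real \<Rightarrow> real \<Rightarrow> real^2" where
  "density_velocity \<rho> q t x = vector [\<rho> t x, q t x / \<rho> t x]"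

definition A_matrix :: "real \<Rightarrow> real \<Rightarrow> real^2 \<Rightarrow> real^2^2" where
  "A_matrix K \<rho>a w = vector [vector [w$2, w$1], vector [K / (\<rho>a * w$1), w$2]]"

definition B_vector :: "real \<Rightarrow> real \<Rightarrow> real^2 \<Rightarrow> real^2" where
  "B_vector cf D w = vector [0, - (cf / (2 * D)) * w$2 * \<bar>w$2\<bar>]"

definition quasilinear_form ::
  "real \<Rightarrow> real \<Rightarrow> real \<Rightarrow> real \<Rightarrow> real \<Rightarrow> real \<Rightarrow> (real \<Rightarrow> real \<Rightarrow> real^2) \<Rightarrow> bool" where
  "quasilinear_form T L cf D K \<rho>a u \<longleftrightarrow>
     (\<forall>t\<in>{0..T}. \<forall>x\<in>{0..L}.
        dt T u t x = - (A_matrix K \<rho>a (u t x) *v dx L u t x) + B_vector cf D (u t x))"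

definition eigenvalue_of :: "real^'n^'n \<Rightarrow> real \<Rightarrow> bool" where
  "eigenvalue_of M l \<longleftrightarrow> (\<exists>w. w \<noteq> 0 \<and> M *v w = l *\<^sub>R w)"

definition hyperbolic :: "real \<Rightarrow> real \<Rightarrow> real \<Rightarrow> real \<Rightarrow> (real \<Rightarrow> real \<Rightarrow> real^2) \<Rightarrow> bool" where
  "hyperbolic T L K \<rho>a u \<longleftrightarrow>
     (\<forall>t\<in>{0..T}. \<forall>x\<in>{0..L}. \<exists>l1 l2. l1 < 0 \<and> 0 < l2 \<and>
        eigenvalue_of (A_matrix K \<rho>a (u t x)) l1 \<and> eigenvalue_of (A_matrix K \<rho>a (u t x)) l2)"

definition pipe_flows ::
  "real \<Rightarrow> real \<Rightarrow> real \<Rightarrow> real \<Rightarrow> real \<Rightarrow> real \<Rightarrow> (real \<Rightarrow> real \<Rightarrow> real^2) set" where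
  "pipe_flows T L cf D K \<rho>a =
     {u. Cinf_on ({0..T} \<times> {0..L}) (\<lambda>(t, x). u t x) \<and> taylor2_in_time T L u \<and>
         (\<forall>t\<in>{0..T}. \<forall>x\<in>{0..L}. u t x $ 1 \<noteq> 0) \<and>
         hyperbolic T L K \<rho>a u \<and> quasilinear_form T L cf D K \<rho>a u}"

text \<open>For continuous \<open>u\<close> this is the same as a bound on the \<open>L\<^sup>\<infinity>\<close> norm.\<close>

definition sup_bounded :: "real \<Rightarrow> real \<Rightarrow> real \<Rightarrow> (real \<Rightarrow> real \<Rightarrow> real^2) \<Rightarrow> bool" where
  "sup_bounded T L b u \<longleftrightarrow> (\<forall>t\<in>{0..T}. \<forall>x\<in>{0..L}. norm (u t x) \<le> b)"


section \<open>The Lax-Wendroff scheme\<close>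

text \<open>The finite difference operator takes the step sizes and the stencil values
  \<open>W j = U(t, x + j \<Delta>x)\<close>, of which only \<open>j = -1, 0, 1\<close> are used.\<close>

definition D0 :: "real \<Rightarrow> (int \<Rightarrow> real) \<Rightarrow> real" where
  "D0 \<Delta>x f = (f 1 - f (-1)) / (2 * \<Delta>x)"

definition D2 :: "real \<Rightarrow> (int \<Rightarrow> real) \<Rightarrow> real" where
  "D2 \<Delta>x f = (f 1 - 2 * f 0 + f (-1)) / \<Delta>x\<^sup>2"

definition lax_wendroff ::
  "real \<Rightarrow> real \<Rightarrow> real \<Rightarrow> real \<Rightarrow> real \<Rightarrow> real \<Rightarrow> (int \<Rightarrow> real^2) \<Rightarrow> real^2" where
  "lax_wendroff cf D K \<rho>a \<Delta>t \<Delta>x W =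
    (let C = cf / (2 * D); P = W 0 $ 1; V = W 0 $ 2;
         D0P = D0 \<Delta>x (\<lambda>j. W j $ 1); D0V = D0 \<Delta>x (\<lambda>j. W j $ 2);
         D2P = D2 \<Delta>x (\<lambda>j. W j $ 1); D2V = D2 \<Delta>x (\<lambda>j. W j $ 2)
     in vector
       [P + \<Delta>t * (- P * D0V - V * D0P)
          + \<Delta>t\<^sup>2 / 2 * (2 * P * D0V\<^sup>2 + 2 * P * V * D2V + 4 * V * D0V * D0P
              + 2 * C * \<bar>V\<bar> * P * D0V + C * V * \<bar>V\<bar> * D0P + (K / \<rho>a + V\<^sup>2) * D2P),
        V + \<Delta>t * (- V * D0V - K / (\<rho>a * P) * D0P - C * V * \<bar>V\<bar>)
          + \<Delta>t\<^sup>2 / 2 * (2 * V * D0V\<^sup>2 + (K / \<rho>a + V\<^sup>2) * D2V + 5 * C * V * \<bar>V\<bar> * D0V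
              + 2 * K / (\<rho>a * P) * D0P * D0V - 2 * K * V / (\<rho>a * P\<^sup>2) * D0P\<^sup>2
              + 2 * K * V / (\<rho>a * P) * D2P + 2 * C * K * \<bar>V\<bar> / (\<rho>a * P) * D0P
              + 2 * C\<^sup>2 * V ^ 3)])"

text \<open>\<open>lw_solution \<dots> r u0 \<Delta>t n x\<close> is the numerical solution \<open>U(n \<Delta>t, x)\<close> with
  \<open>\<Delta>x = \<Delta>t / r\<close>. It depends only on the values of \<open>u0\<close> at
  \<open>x + k \<Delta>x\<close> with \<open>\<bar>k\<bar> \<le> n\<close>.\<close>

primrec lw_solution ::
  "real \<Rightarrow> real \<Rightarrow> real \<Rightarrow> real \<Rightarrow> real \<Rightarrow> (real \<Rightarrow> real^2) \<Rightarrow> real \<Rightarrow> nat \<Rightarrow> real \<Rightarrow> real^2" where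
  "lw_solution cf D K \<rho>a r u0 \<Delta>t 0 x = u0 x"
| "lw_solution cf D K \<rho>a r u0 \<Delta>t (Suc n) x =
     lax_wendroff cf D K \<rho>a \<Delta>t (\<Delta>t / r)
       (\<lambda>j. lw_solution cf D K \<rho>a r u0 \<Delta>t n (x + of_int j * (\<Delta>t / r)))"

definition consistent ::
  "real \<Rightarrow> real \<Rightarrow> real \<Rightarrow> real \<Rightarrow> real \<Rightarrow> real \<Rightarrow> real \<Rightarrow> (real \<Rightarrow> real \<Rightarrow> real^2) \<Rightarrow> bool" where
  "consistent T L cf D K \<rho>a r u \<longleftrightarrow>
     (\<exists>c. \<forall>t\<in>{0..T}. \<forall>x. \<forall>\<Delta>t>0. x - \<Delta>t / r \<in> {0..L} \<and> x + \<Delta>t / r \<in> {0..L} \<longrightarrow>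
        norm (lax_wendroff cf D K \<rho>a \<Delta>t (\<Delta>t / r) (\<lambda>j. u t (x + of_int j * (\<Delta>t / r)))
              - (u t x + \<Delta>t *\<^sub>R (- (A_matrix K \<rho>a (u t x) *v dx L u t x) + B_vector cf D (u t x))))
          \<le> c * \<Delta>t\<^sup>2)"


section \<open>Cones and order of accuracy\<close>

text \<open>The quotient \<open>r (x - x0) / (t0 - t) \<in> [-1, 1]\<close> is multiplied out, so that the
  slice at \<open>t = t0\<close> is the apex.\<close>

definition cone :: "real \<Rightarrow> real \<Rightarrow> real \<Rightarrow> (real \<times> real) set" where
  "cone r t0 x0 = {(t, x). 0 \<le> t \<and> t \<le> t0 \<and> \<bar>r * (x - x0)\<bar> \<le> t0 - t}"

definition cone_points :: "real \<Rightarrow> real \<Rightarrow> real \<Rightarrow> (real \<times> real) set" where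
  "cone_points T L r = {(t0, x0). 0 < t0 \<and> cone r t0 x0 \<subseteq> {0..T} \<times> {0..L}}"

text \<open>A point \<open>(t0, x0)\<close> is on the time mesh iff \<open>\<Delta>t = t0 / n\<close> for some \<open>n\<close>; hence
  \<open>\<Delta>t \<rightarrow> 0\<close> at this point is \<open>n \<rightarrow> \<infinity>\<close>.\<close>

definition lw_error ::
  "real \<Rightarrow> real \<Rightarrow> real \<Rightarrow> real \<Rightarrow> real \<Rightarrow> (real \<Rightarrow> real \<Rightarrow> real^2) \<Rightarrow> real \<Rightarrow> real \<Rightarrow> nat \<Rightarrow> real^2" where
  "lw_error cf D K \<rho>a r u t0 x0 n =
     lw_solution cf D K \<rho>a r (u 0) (t0 / real n) n x0 - u t0 x0"

definition error_expansion ::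
  "real \<Rightarrow> real \<Rightarrow> real \<Rightarrow> real \<Rightarrow> real \<Rightarrow> real \<Rightarrow> real \<Rightarrow> (real \<Rightarrow> real \<Rightarrow> real^2) \<Rightarrow>
    nat \<Rightarrow> (nat \<Rightarrow> real \<Rightarrow> real \<Rightarrow> real^2) \<Rightarrow> bool" where
  "error_expansion T L cf D K \<rho>a r u m V \<longleftrightarrow>
     (\<forall>k\<in>{1..m}. \<forall>x\<in>{0..L}. V k 0 x = 0) \<and>
     (\<forall>(t0, x0)\<in>cone_points T L r.
        (\<lambda>n. norm (lw_error cf D K \<rho>a r u t0 x0 n - (\<Sum>k=1..m. (t0 / real n) ^ k *\<^sub>R V k t0 x0)))
          \<in> O(\<lambda>n. (t0 / real n) ^ (m + 1)))"

definition vanishes :: "real \<Rightarrow> real \<Rightarrow> real \<Rightarrow> (real \<Rightarrow> real \<Rightarrow> real^2) \<Rightarrow> bool" where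
  "vanishes T L r f \<longleftrightarrow> (\<forall>(t, x)\<in>cone_points T L r. f t x = 0)"

text \<open>The order is a property of the scheme on a class \<open>F\<close> of flows: the error terms
  of index below \<open>p\<close> vanish for every flow, and the one of index \<open>p\<close> does not
  vanish identically for all flows. (For a particular flow, such as a constant state at
  rest, all error terms may vanish.) The error terms are determined at all points of
  \<open>cone_points T L r\<close>.\<close>

definition order_of_accuracy ::
  "real \<Rightarrow> real \<Rightarrow> real \<Rightarrow> real \<Rightarrow> real \<Rightarrow> real \<Rightarrow> real \<Rightarrow> (real \<Rightarrow> real \<Rightarrow> real^2) set \<Rightarrow> nat \<Rightarrow> bool" where
  "order_of_accuracy T L cf D K \<rho>a r F p \<longleftrightarrow>
     1 \<le> p \<and>
     (\<forall>u\<in>F. \<exists>V. error_expansion T L cf D K \<rho>a r u (p - 1) V \<and>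
               (\<forall>k\<in>{1..<p}. vanishes T L r (V k))) \<and>
     (\<exists>u\<in>F. \<exists>V. error_expansion T L cf D K \<rho>a r u p V \<and>
               (\<forall>k\<in>{1..<p}. vanishes T L r (V k)) \<and> \<not> vanishes T L r (V p))"


section \<open>First variation and stability\<close>

text \<open>The operator at step size zero with fixed \<open>r\<close> is the continuous extension; note
  that \<open>lax_wendroff\<close> itself is not usable there, as division by zero yields zero.\<close>

definition lw_zero_step ::
  "real \<Rightarrow> real \<Rightarrow> real \<Rightarrow> real \<Rightarrow> real \<Rightarrow> (int \<Rightarrow> real^2) \<Rightarrow> real^2" where
  "lw_zero_step cf D K \<rho>a r W = Lim (at_right 0) (\<lambda>\<Delta>t. lax_wendroff cf D K \<rho>a \<Delta>t (\<Delta>t / r) W)"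

text \<open>Jacobian with respect to the \<open>j\<close>-th stencil argument, all arguments being \<open>w\<close>.\<close>

definition variation_coeff ::
  "real \<Rightarrow> real \<Rightarrow> real \<Rightarrow> real \<Rightarrow> real \<Rightarrow> int \<Rightarrow> real^2 \<Rightarrow> real^2^2" where
  "variation_coeff cf D K \<rho>a r j w =
     jacobian (\<lambda>z. lw_zero_step cf D K \<rho>a r ((\<lambda>_. w)(j := z))) (at w)"

definition first_variation ::
  "real \<Rightarrow> real \<Rightarrow> real \<Rightarrow> real \<Rightarrow> real \<Rightarrow> (real \<Rightarrow> real \<Rightarrow> real^2) \<Rightarrow> real \<Rightarrow> real \<Rightarrow>
    (real \<Rightarrow> real^2) \<Rightarrow> real \<Rightarrow> real^2" where
  "first_variation cf D K \<rho>a r u t \<Delta>x f x =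
     (\<Sum>j\<in>{-1, 0, 1}. variation_coeff cf D K \<rho>a r j (u t x) *v f (x + of_int j * \<Delta>x))"

text \<open>\<open>M(t - \<Delta>t, \<Delta>x) M(t - 2 \<Delta>t, \<Delta>x) \<cdots> M(t - n \<Delta>t, \<Delta>x)\<close>\<close>

primrec variation_product ::
  "real \<Rightarrow> real \<Rightarrow> real \<Rightarrow> real \<Rightarrow> real \<Rightarrow> (real \<Rightarrow> real \<Rightarrow> real^2) \<Rightarrow> real \<Rightarrow> real \<Rightarrow> nat \<Rightarrow>
    (real \<Rightarrow> real^2) \<Rightarrow> real \<Rightarrow> real^2" where
  "variation_product cf D K \<rho>a r u t \<Delta>t 0 = (\<lambda>f. f)"
| "variation_product cf D K \<rho>a r u t \<Delta>t (Suc n) =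
     (\<lambda>f. variation_product cf D K \<rho>a r u t \<Delta>t n
            (first_variation cf D K \<rho>a r u (t - real (Suc n) * \<Delta>t) (\<Delta>t / r) f))"

definition mesh :: "real \<Rightarrow> real \<Rightarrow> real \<Rightarrow> real \<Rightarrow> real set" where
  "mesh y \<Delta>x a b = {x\<in>{a..b}. \<exists>k::int. x = y + of_int k * \<Delta>x}"

text \<open>Each factor \<open>M\<close> needs \<open>u\<close> and one more mesh point on either side, so the product of
  \<open>n\<close> factors maps mesh functions on \<open>{0..L}\<close> to mesh functions on
  \<open>{n \<Delta>x..L - n \<Delta>x}\<close>; the norm of this map is bounded, for all meshes
  \<open>y + \<Delta>x \<int>\<close>. The weight \<open>\<Delta>x\<close> of the discrete norm cancels. Since \<open>M\<close> only
  uses neighbouring values, this also bounds the map between any two time slices of any cone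
  contained in the rectangle.\<close>

definition l2_stable ::
  "real \<Rightarrow> real \<Rightarrow> real \<Rightarrow> real \<Rightarrow> real \<Rightarrow> real \<Rightarrow> real \<Rightarrow> (real \<Rightarrow> real \<Rightarrow> real^2) \<Rightarrow> bool" where
  "l2_stable T L cf D K \<rho>a r u \<longleftrightarrow>
     (\<exists>\<kappa> :: real \<Rightarrow> real. \<forall>t\<in>{0..T}. \<forall>\<Delta>t>0. \<forall>n. real n * \<Delta>t \<le> t \<longrightarrow> (\<forall>y f.
        L2_set (\<lambda>x. norm (variation_product cf D K \<rho>a r u t \<Delta>t n f x))
            (mesh y (\<Delta>t / r) (real n * (\<Delta>t / r)) (L - real n * (\<Delta>t / r)))
          \<le> \<kappa> t * L2_set (\<lambda>x. norm (f x)) (mesh y (\<Delta>t / r) 0 L)))"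

end

(*
  Freezing the coefficients of a Lax-Wendroff step diagonalises it: the characteristic variables
  c Q f +- g, where Q is the reciprocal of the density and c^2 = K / rho_a, satisfy scalar
  Lax-Wendroff steps with Courant numbers nu = r (v +- c). Hyperbolicity means |v| < c, so
  2 r c <= 1 gives |nu| <= 1, and summation by parts shows that the energy grows by a factor
  1 + O(h) per step. This is the l2-stability of the first variation.

  For convergence, the error E of the scheme on the backward cone satisfies the linearised step up
  to O(h E + h^3), and the same holds for its difference quotient G, because the truncation error
  is smooth enough. The energy of (E, G) is therefore O(h^3), summed over mesh points, and as E is
  controlled pointwise by the energy this also closes the bootstrap for the nonlinear terms.
  The width of the cone shrinks to zero at the apex, where the energy only gives O(h^(3/2)); the
  order h^2 follows by comparing mean values of |E| over consecutive slices.

  That the order is not higher is seen on flows with constant density and velocity y(t), where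
  y' = -C y^2 and the scheme is a Taylor method with a computable error term.
*)
theory Submission
  imports Defs
begin

section \<open>Partial derivatives on the rectangle\<close>

text \<open>The difference quotient G has to be part of the energy because the last stage compares
  |E| at consecutive levels by the triangle inequality. In terms of E alone one step changes |E| by
  O(|E|), which is useless when iterated 1/h times; in terms of G it is O(h (|E| + |G|) + h^3). The
  price is that every residual must be estimated together with its difference between neighbouring
  points, which must gain another power of h. This requirement shapes the calculus of
  \<open>ord\<close>, \<open>approx\<close> and the perturbation relations, which carry both bounds
  at once. It also makes the friction law delicate: |V| is not differentiable at rest, and V |V| has
  just one derivative, which is Lipschitz. A bare |V| is tolerable because it always occurs with h
  times a difference of the unknowns, so that a spare factor h replaces the missing smoothness.
  Everything is confined to a backward cone, without boundary conditions: slices lose one point on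
  each side per step, and truncated data may be extended by zero because dropping points only lowers
  the energy.\<close>

lemma Ck_on_cong:
  assumes "Ck_on k S f" "\<And>z. z \<in> S \<Longrightarrow> g z = f z"
  shows "Ck_on k S g"
proof (cases k)
  case 0
  then show ?thesis
    using assms continuous_on_cong[of S S g f] by simp
next
  case (Suc m)
  then obtain ft fx where *: "\<forall>z\<in>S. (f has_derivative (\<lambda>(s, y). s *\<^sub>R ft z + y *\<^sub>R fx z)) (at z within S)"
    "Ck_on m S ft" "Ck_on m S fx"
    using assms(1) by auto
  have "\<forall>z\<in>S. (g has_derivative (\<lambda>(s, y). s *\<^sub>R ft z + y *\<^sub>R fx z)) (at z within S)"
    using *(1) assms(2) by (auto intro!: has_derivative_transform[of _ S g f])
  with * Suc show ?thesis by auto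
qed

lemma Ck_on_continuous: "Ck_on k S f \<Longrightarrow> continuous_on S f"
proof (cases k)
  case (Suc m)
  assume "Ck_on k S f"
  with Suc obtain f' where "\<And>z. z \<in> S \<Longrightarrow> (f has_derivative f' z) (at z within S)"
    using that[of "\<lambda>z. \<lambda>(s, y). s *\<^sub>R _ z + y *\<^sub>R _ z"] by auto
  then show ?thesis
    by (meson continuous_on_eq_continuous_within has_derivative_continuous)
qed simp

lemma Ck_on_linear:
  assumes "bounded_linear l"
  shows "Ck_on k S f \<Longrightarrow> Ck_on k S (\<lambda>z. l (f z))"
proof (induction k arbitrary: f)
  case 0
  then show ?case
    using assms by (auto intro: bounded_linear.continuous_on)
next
  case (Suc k)
  from Suc.prems obtain ft fx where
    d: "\<forall>z\<in>S. (f has_derivative (\<lambda>(s, y). s *\<^sub>R ft z + y *\<^sub>R fx z)) (at z within S)"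
    and c: "Ck_on k S ft" "Ck_on k S fx"
    by auto
  interpret l: bounded_linear l by fact
  have "\<forall>z\<in>S. ((\<lambda>z. l (f z)) has_derivative (\<lambda>(s, y). s *\<^sub>R l (ft z) + y *\<^sub>R l (fx z))) (at z within S)"
  proof
    fix z assume "z \<in> S"
    with d have "(f has_derivative (\<lambda>(s, y). s *\<^sub>R ft z + y *\<^sub>R fx z)) (at z within S)" by auto
    from l.has_derivative[OF this]
    show "((\<lambda>z. l (f z)) has_derivative (\<lambda>(s, y). s *\<^sub>R l (ft z) + y *\<^sub>R l (fx z))) (at z within S)"
      by (simp add: case_prod_unfold l.add l.scaleR)
  qed
  with Suc.IH[OF c(1)] Suc.IH[OF c(2)] show ?case
    unfolding Ck_on.simps by (intro exI[of _ "\<lambda>z. l (ft z)"] exI[of _ "\<lambda>z. l (fx z)"] conjI)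
qed

lemma vector_derivative_on_interval:
  assumes "(f has_vector_derivative f') (at x within {a..b::real})" "a < b" "x \<in> {a..b}"
  shows "vector_derivative f (at x within {a..b}) = f'"
  using assms by (intro vector_derivative_within) (auto simp: trivial_limit_within islimpt_Icc)

locale rectangle =
  fixes T L :: real
  assumes T_pos: "0 < T" and L_pos: "0 < L"
begin

abbreviation smooth :: "(real \<Rightarrow> real \<Rightarrow> 'a::real_normed_vector) \<Rightarrow> bool" where
  "smooth f \<equiv> Cinf_on ({0..T} \<times> {0..L}) (\<lambda>(t, x). f t x)"

text \<open>Composition with the embeddings of a line in either direction. Uniqueness of one-sided
  derivatives on nondegenerate intervals then identifies the witnesses hidden in
  \<open>Ck_on\<close> with \<open>dt\<close> and \<open>dx\<close>.\<close>

lemma has_partials: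
  fixes f :: "real \<Rightarrow> real \<Rightarrow> 'a::real_normed_vector"
  assumes "((\<lambda>(t, x). f t x) has_derivative (\<lambda>(s, y). s *\<^sub>R a + y *\<^sub>R b))
             (at (t, x) within {0..T} \<times> {0..L})"
    and "t \<in> {0..T}" "x \<in> {0..L}"
  shows "((\<lambda>s. f s x) has_vector_derivative a) (at t within {0..T})"
    "((\<lambda>y. f t y) has_vector_derivative b) (at x within {0..L})"
    "dt T f t x = a" "dx L f t x = b"
proof -
  have "((\<lambda>s. (\<lambda>(t, x). f t x) (s, x)) has_derivative (\<lambda>s. (\<lambda>(s, y). s *\<^sub>R a + y *\<^sub>R b) (s, 0))) (at t within {0..T})"
    by (rule has_derivative_in_compose[where f="\<lambda>s. (s, x)"])
       (use assms in \<open>auto intro!: derivative_eq_intros has_derivative_subset[OF assms(1)]\<close>)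
  then show 1: "((\<lambda>s. f s x) has_vector_derivative a) (at t within {0..T})"
    by (simp add: has_vector_derivative_def)
  have "((\<lambda>y. (\<lambda>(t, x). f t x) (t, y)) has_derivative (\<lambda>y. (\<lambda>(s, y). s *\<^sub>R a + y *\<^sub>R b) (0, y))) (at x within {0..L})"
    by (rule has_derivative_in_compose[where f="\<lambda>y. (t, y)"])
       (use assms in \<open>auto intro!: derivative_eq_intros has_derivative_subset[OF assms(1)]\<close>)
  then show 2: "((\<lambda>y. f t y) has_vector_derivative b) (at x within {0..L})"
    by (simp add: has_vector_derivative_def)
  show "dt T f t x = a" "dx L f t x = b"
    using vector_derivative_on_interval[OF 1] vector_derivative_on_interval[OF 2] assms(2,3) T_pos L_pos
    by (simp_all add: dt_def dx_def)
qed

lemma Ck_on_Suc_partials: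
  fixes f :: "real \<Rightarrow> real \<Rightarrow> 'a::real_normed_vector"
  assumes "Ck_on (Suc k) ({0..T} \<times> {0..L}) (\<lambda>(t, x). f t x)"
  shows "Ck_on k ({0..T} \<times> {0..L}) (\<lambda>(t, x). dt T f t x)" "Ck_on k ({0..T} \<times> {0..L}) (\<lambda>(t, x). dx L f t x)"
    "\<lbrakk>t \<in> {0..T}; x \<in> {0..L}\<rbrakk> \<Longrightarrow> ((\<lambda>s. f s x) has_vector_derivative dt T f t x) (at t within {0..T})"
    "\<lbrakk>t \<in> {0..T}; x \<in> {0..L}\<rbrakk> \<Longrightarrow> ((\<lambda>y. f t y) has_vector_derivative dx L f t x) (at x within {0..L})"
proof -
  from assms obtain ft fx where
    d: "\<And>z. z \<in> {0..T} \<times> {0..L} \<Longrightarrow> ((\<lambda>(t, x). f t x) has_derivative (\<lambda>(s, y). s *\<^sub>R ft z + y *\<^sub>R fx z)) (at z within {0..T} \<times> {0..L})"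
    and c: "Ck_on k ({0..T} \<times> {0..L}) ft" "Ck_on k ({0..T} \<times> {0..L}) fx"
    by auto
  have p: "((\<lambda>s. f s x) has_vector_derivative ft (t, x)) (at t within {0..T})"
    "((\<lambda>y. f t y) has_vector_derivative fx (t, x)) (at x within {0..L})"
    "dt T f t x = ft (t, x)" "dx L f t x = fx (t, x)" if "t \<in> {0..T}" "x \<in> {0..L}" for t x
    using has_partials[of f "ft (t, x)" "fx (t, x)" t x] d[of "(t, x)"] that by auto
  show "Ck_on k ({0..T} \<times> {0..L}) (\<lambda>(t, x). dt T f t x)"
    by (rule Ck_on_cong[OF c(1)]) (auto simp: p(3))
  show "Ck_on k ({0..T} \<times> {0..L}) (\<lambda>(t, x). dx L f t x)"
    by (rule Ck_on_cong[OF c(2)]) (auto simp: p(4))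
  show "\<lbrakk>t \<in> {0..T}; x \<in> {0..L}\<rbrakk> \<Longrightarrow> ((\<lambda>s. f s x) has_vector_derivative dt T f t x) (at t within {0..T})"
    "\<lbrakk>t \<in> {0..T}; x \<in> {0..L}\<rbrakk> \<Longrightarrow> ((\<lambda>y. f t y) has_vector_derivative dx L f t x) (at x within {0..L})"
    using p by auto
qed

lemma smooth_partials:
  fixes f :: "real \<Rightarrow> real \<Rightarrow> 'a::real_normed_vector"
  assumes "smooth f"
  shows smooth_dt: "smooth (dt T f)" and smooth_dx: "smooth (dx L f)"
    and smooth_has_dt: "\<lbrakk>t \<in> {0..T}; x \<in> {0..L}\<rbrakk> \<Longrightarrow> ((\<lambda>s. f s x) has_vector_derivative dt T f t x) (at t within {0..T})"
    and smooth_has_dx: "\<lbrakk>t \<in> {0..T}; x \<in> {0..L}\<rbrakk> \<Longrightarrow> ((\<lambda>y. f t y) has_vector_derivative dx L f t x) (at x within {0..L})"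
  using Ck_on_Suc_partials[of _ f] assms unfolding Cinf_on_def by blast+

lemma smooth_has_real_derivative:
  fixes f :: "real \<Rightarrow> real \<Rightarrow> real"
  assumes "smooth f" "t \<in> {0..T}" "x \<in> {0..L}"
  shows DERIV_dt: "((\<lambda>s. f s x) has_real_derivative dt T f t x) (at t within {0..T})"
    and DERIV_dx: "((\<lambda>y. f t y) has_real_derivative dx L f t x) (at x within {0..L})"
  using smooth_has_dt[of f] smooth_has_dx[of f] assms
  by (auto simp: has_real_derivative_iff_has_vector_derivative)

lemma smooth_nth:
  fixes u :: "real \<Rightarrow> real \<Rightarrow> real^'n"
  assumes "smooth u"
  shows "smooth (\<lambda>t x. u t x $ i)"
  using assms Ck_on_linear[OF bounded_linear_vec_nth, of _ _ "\<lambda>(t, x). u t x" i]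
  by (auto simp: Cinf_on_def case_prod_unfold)

lemma dt_dx_nth:
  fixes u :: "real \<Rightarrow> real \<Rightarrow> real^'n"
  assumes "smooth u" "t \<in> {0..T}" "x \<in> {0..L}"
  shows "dt T (\<lambda>t x. u t x $ i) t x = dt T u t x $ i" "dx L (\<lambda>t x. u t x $ i) t x = dx L u t x $ i"
proof -
  have "((\<lambda>s. u s x $ i) has_vector_derivative dt T u t x $ i) (at t within {0..T})"
    "((\<lambda>y. u t y $ i) has_vector_derivative dx L u t x $ i) (at x within {0..L})"
    using smooth_has_dt[OF assms] smooth_has_dx[OF assms]
      bounded_linear.has_vector_derivative[OF bounded_linear_vec_nth] by blast+
  then show "dt T (\<lambda>t x. u t x $ i) t x = dt T u t x $ i" "dx L (\<lambda>t x. u t x $ i) t x = dx L u t x $ i"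
    using assms T_pos L_pos by (auto simp: dt_def dx_def intro!: vector_derivative_on_interval)
qed

lemma smooth_bounded:
  fixes f :: "real \<Rightarrow> real \<Rightarrow> real"
  assumes "smooth f"
  obtains M where "0 \<le> M" "\<And>t x. \<lbrakk>t \<in> {0..T}; x \<in> {0..L}\<rbrakk> \<Longrightarrow> \<bar>f t x\<bar> \<le> M"
proof -
  have "continuous_on ({0..T} \<times> {0..L}) (\<lambda>(t, x). f t x)"
    using assms Ck_on_continuous unfolding Cinf_on_def by blast
  then have "compact ((\<lambda>(t, x). f t x) ` ({0..T} \<times> {0..L}))"
    by (intro compact_continuous_image compact_Times) auto
  then obtain M where "\<forall>y\<in>(\<lambda>(t, x). f t x) ` ({0..T} \<times> {0..L}). norm y \<le> M"
    using compact_imp_bounded bounded_iff by metis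
  then have "\<bar>f t x\<bar> \<le> max 0 M" if "t \<in> {0..T}" "x \<in> {0..L}" for t x
    using that by (force simp: le_max_iff_disj)
  then show ?thesis by (intro that[of "max 0 M"]) auto
qed

lemma smooth_lipschitz_x:
  fixes f :: "real \<Rightarrow> real \<Rightarrow> real"
  assumes "smooth f"
  obtains M where "0 \<le> M"
    "\<And>t x y. \<lbrakk>t \<in> {0..T}; x \<in> {0..L}; y \<in> {0..L}\<rbrakk> \<Longrightarrow> \<bar>f t y - f t x\<bar> \<le> M * \<bar>y - x\<bar>"
proof -
  obtain M where M: "0 \<le> M" "\<And>t x. \<lbrakk>t \<in> {0..T}; x \<in> {0..L}\<rbrakk> \<Longrightarrow> \<bar>dx L f t x\<bar> \<le> M"
    using smooth_bounded[OF smooth_dx[OF assms]] by blast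
  have "norm (f t y - f t x) \<le> M * norm (y - x)" if "t \<in> {0..T}" "x \<in> {0..L}" "y \<in> {0..L}" for t x y
    by (rule field_differentiable_bound[of "{0..L}" "f t" "dx L f t"])
       (use that M DERIV_dx[OF assms] in auto)
  then show ?thesis using M(1) that by simp
qed

lemma smooth_lipschitz_t:
  fixes f :: "real \<Rightarrow> real \<Rightarrow> real"
  assumes "smooth f"
  obtains M where "0 \<le> M"
    "\<And>t s x. \<lbrakk>t \<in> {0..T}; s \<in> {0..T}; x \<in> {0..L}\<rbrakk> \<Longrightarrow> \<bar>f s x - f t x\<bar> \<le> M * \<bar>s - t\<bar>"
proof -
  obtain M where M: "0 \<le> M" "\<And>t x. \<lbrakk>t \<in> {0..T}; x \<in> {0..L}\<rbrakk> \<Longrightarrow> \<bar>dt T f t x\<bar> \<le> M"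
    using smooth_bounded[OF smooth_dt[OF assms]] by blast
  have "norm (f s x - f t x) \<le> M * norm (s - t)" if "t \<in> {0..T}" "s \<in> {0..T}" "x \<in> {0..L}" for t s x
    by (rule field_differentiable_bound[of "{0..T}" "\<lambda>t. f t x" "\<lambda>t. dt T f t x"])
       (use that M DERIV_dt[OF assms] in auto)
  then show ?thesis using M(1) that by simp
qed

lemma smooth_nonzero_bound:
  fixes f :: "real \<Rightarrow> real \<Rightarrow> real"
  assumes "smooth f" "\<forall>t\<in>{0..T}. \<forall>x\<in>{0..L}. f t x \<noteq> 0"
  obtains \<delta> where "0 < \<delta>" "\<And>t x. \<lbrakk>t \<in> {0..T}; x \<in> {0..L}\<rbrakk> \<Longrightarrow> \<delta> \<le> \<bar>f t x\<bar>"
proof -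
  let ?R = "{0..T} \<times> {0..L}"
  have "continuous_on ?R (\<lambda>(t, x). f t x)"
    using assms Ck_on_continuous unfolding Cinf_on_def by blast
  then have "continuous_on ?R (\<lambda>z. \<bar>(\<lambda>(t, x). f t x) z\<bar>)"
    by (rule continuous_on_rabs)
  then have "\<exists>z\<in>?R. \<forall>w\<in>?R. \<bar>(\<lambda>(t, x). f t x) z\<bar> \<le> \<bar>(\<lambda>(t, x). f t x) w\<bar>"
    using T_pos L_pos by (intro continuous_attains_inf compact_Times) auto
  then obtain t0 x0 where "t0 \<in> {0..T}" "x0 \<in> {0..L}" "\<And>t x. \<lbrakk>t \<in> {0..T}; x \<in> {0..L}\<rbrakk> \<Longrightarrow> \<bar>f t0 x0\<bar> \<le> \<bar>f t x\<bar>"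
    by auto
  then show ?thesis using assms(2) that[of "\<bar>f t0 x0\<bar>"] by auto
qed

text \<open>The second difference over a small rectangle equals its area times either mixed
  derivative at some interior point, by two mean value theorems applied in either order; continuity
  then forces equality.\<close>

lemma mixed_partials:
  fixes f :: "real \<Rightarrow> real \<Rightarrow> real"
  assumes f: "smooth f" and "t \<in> {0..T}" "x \<in> {0..L}"
  shows "dt T (dx L f) t x = dx L (dt T f) t x"
proof (rule ccontr)
  define a where "a = (\<lambda>(t, x). dt T (dx L f) t x)"
  define b where "b = (\<lambda>(t, x). dx L (dt T f) t x)"
  let ?R = "{0..T} \<times> {0..L}"
  have ca: "continuous_on ?R a" and cb: "continuous_on ?R b"
    using smooth_dt[OF smooth_dx[OF f]] smooth_dx[OF smooth_dt[OF f]] Ck_on_continuous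
    unfolding Cinf_on_def a_def b_def by blast+
  assume "dt T (dx L f) t x \<noteq> dx L (dt T f) t x"
  then have "a (t, x) \<noteq> b (t, x)" by (simp add: a_def b_def)
  define e where "e = \<bar>a (t, x) - b (t, x)\<bar> / 2"
  have "0 < e" using \<open>a (t, x) \<noteq> b (t, x)\<close> by (simp add: e_def)
  have R: "(t, x) \<in> ?R" using assms by auto
  from ca R \<open>0 < e\<close> obtain d1 where d1: "0 < d1" "\<And>z. z \<in> ?R \<Longrightarrow> dist z (t, x) < d1 \<Longrightarrow> dist (a z) (a (t, x)) < e"
    unfolding continuous_on_iff by metis
  from cb R \<open>0 < e\<close> obtain d2 where d2: "0 < d2" "\<And>z. z \<in> ?R \<Longrightarrow> dist z (t, x) < d2 \<Longrightarrow> dist (b z) (b (t, x)) < e"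
    unfolding continuous_on_iff by metis
  \<comment> \<open>Points within \<open>d\<close> in both coordinates have distance at most
    \<open>2 * d\<close>, so a third leaves a strict inequality.\<close>
  define d where "d = min d1 d2 / 3"
  have "0 < d" using d1 d2 by (simp add: d_def)
  \<comment> \<open>Clipping to the large rectangle leaves nondegenerate intervals even at its
    boundary, because (t, x) itself lies in it.\<close>
  define t1 t2 x1 x2 where "t1 = max 0 (t - d)" and "t2 = min T (t + d)"
    and "x1 = max 0 (x - d)" and "x2 = min L (x + d)"
  have lt: "t1 < t2" "x1 < x2" using \<open>0 < d\<close> assms T_pos L_pos
    by (auto simp: t1_def t2_def x1_def x2_def)
  have sub: "{t1..t2} \<subseteq> {0..T}" "{x1..x2} \<subseteq> {0..L}"
    by (auto simp: t1_def t2_def x1_def x2_def)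
  have near: "dist (s, y) (t, x) < min d1 d2" "(s, y) \<in> ?R" if "s \<in> {t1..t2}" "y \<in> {x1..x2}" for s y
  proof -
    have "\<bar>s - t\<bar> \<le> d" "\<bar>y - x\<bar> \<le> d"
      using that assms \<open>0 < d\<close> by (auto simp: t1_def t2_def x1_def x2_def)
    then have "dist (s, y) (t, x) \<le> d + d"
      using sqrt_sum_squares_le_sum_abs[of "s - t" "y - x"] by (simp add: dist_Pair_Pair dist_real_def)
    also have "\<dots> < min d1 d2" using d1 d2 by (auto simp: d_def)
    finally show "dist (s, y) (t, x) < min d1 d2" .
    show "(s, y) \<in> ?R" using that sub by blast
  qed
  have in1: "s \<in> {0..T}" if "t1 \<le> s" "s \<le> t2" for s using that sub(1) by auto
  have in2: "y \<in> {0..L}" if "x1 \<le> y" "y \<le> x2" for y using that sub(2) by auto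
  have mvt: "\<exists>z\<in>{p<..<q}. g q - g p = g' z * (q - p)"
    if "p < q" "\<And>z. p \<le> z \<Longrightarrow> z \<le> q \<Longrightarrow> (g has_real_derivative g' z) (at z within {p..q})" for p q and g g' :: "real \<Rightarrow> real"
    using mvt_simple[OF that(1), of g "\<lambda>z. (*) (g' z)"] that(2) by (auto simp: has_field_derivative_def)
  note Dt = DERIV_subset[OF DERIV_dt sub(1)] and Dx = DERIV_subset[OF DERIV_dx sub(2)]
  let ?F = "f t2 x2 - f t2 x1 - f t1 x2 + f t1 x1"
  have "\<exists>s\<in>{t1<..<t2}. (f t2 x2 - f t2 x1) - (f t1 x2 - f t1 x1) = (dt T f s x2 - dt T f s x1) * (t2 - t1)"
    using lt by (intro mvt) (auto intro!: DERIV_diff Dt f in1 in2)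
  then obtain s where s: "s \<in> {t1<..<t2}" "?F = (dt T f s x2 - dt T f s x1) * (t2 - t1)" by (auto simp: algebra_simps)
  have "\<exists>y\<in>{x1<..<x2}. dt T f s x2 - dt T f s x1 = dx L (dt T f) s y * (x2 - x1)"
    using s lt by (intro mvt) (auto intro!: DERIV_diff Dx smooth_dt f in1 in2)
  then obtain y where y: "y \<in> {x1<..<x2}" "?F = b (s, y) * (x2 - x1) * (t2 - t1)" using s(2) by (auto simp: b_def)
  have "\<exists>y\<in>{x1<..<x2}. (f t2 x2 - f t1 x2) - (f t2 x1 - f t1 x1) = (dx L f t2 y - dx L f t1 y) * (x2 - x1)"
    using lt by (intro mvt) (auto intro!: DERIV_diff Dx f in1 in2)
  then obtain y' where y': "y' \<in> {x1<..<x2}" "?F = (dx L f t2 y' - dx L f t1 y') * (x2 - x1)" by (auto simp: algebra_simps)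
  have "\<exists>s\<in>{t1<..<t2}. dx L f t2 y' - dx L f t1 y' = dt T (dx L f) s y' * (t2 - t1)"
    using y' lt by (intro mvt) (auto intro!: DERIV_diff Dt smooth_dx f in1 in2)
  then obtain s' where s': "s' \<in> {t1<..<t2}" "?F = a (s', y') * (t2 - t1) * (x2 - x1)" using y'(2) by (auto simp: a_def)
  have "b (s, y) = a (s', y')" using y(2) s'(2) lt by simp
  moreover have "dist (b (s, y)) (b (t, x)) < e" using d2(2)[of "(s, y)"] near[of s y] s y by auto
  moreover have "dist (a (s', y')) (a (t, x)) < e" using d1(2)[of "(s', y')"] near[of s' y'] s' y' by auto
  ultimately show False by (auto simp: e_def dist_real_def abs_if split: if_splits)
qed

end

text \<open>At zero the difference quotient is |y|, which tends to zero. This single derivative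
  suffices for the second time derivative of the velocity, in which friction is differentiated
  once.\<close>

lemma DERIV_mult_abs: "((\<lambda>y::real. y * \<bar>y\<bar>) has_real_derivative 2 * \<bar>y\<bar>) (at y within S)"
proof -
  consider "y < 0" | "y = 0" | "0 < y" by linarith
  then have "((\<lambda>y::real. y * \<bar>y\<bar>) has_real_derivative 2 * \<bar>y\<bar>) (at y)"
  proof cases
    case 1
    show ?thesis
      by (rule has_field_derivative_transform_within_open[where S="{..<0}" and f="\<lambda>y. - (y * y)"])
         (use 1 in \<open>auto intro!: derivative_eq_intros\<close>)
  next
    case 2
    have "(abs \<longlongrightarrow> 0) (at (0::real))"
      using tendsto_rabs_zero[OF tendsto_ident_at] by simp
    then have "((\<lambda>y. (y * \<bar>y\<bar> - 0 * \<bar>0\<bar>) / (y - 0)) \<longlongrightarrow> 0) (at (0::real))"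
      by (rule Lim_transform_eventually) (auto simp: eventually_at_filter)
    with 2 show ?thesis by (simp add: has_field_derivative_iff)
  next
    case 3
    show ?thesis
      by (rule has_field_derivative_transform_within_open[where S="{0<..}" and f="\<lambda>y. y * y"])
         (use 3 in \<open>auto intro!: derivative_eq_intros\<close>)
  qed
  then show ?thesis by (rule has_field_derivative_at_within)
qed

context rectangle
begin

text \<open>Lets the flow equations be differentiated although they are known only on the rectangle:
  agreement there determines derivatives within it.\<close>

lemma dt_eqI:
  assumes "(g has_real_derivative d) (at t within {0..T})" "t \<in> {0..T}"
    and "\<And>s. s \<in> {0..T} \<Longrightarrow> f s x = g s"
  shows "dt T f t x = d"
proof -
  have "((\<lambda>s. f s x) has_derivative (\<lambda>s. s *\<^sub>R d)) (at t within {0..T})"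
    by (rule has_derivative_transform[OF assms(2,3)
          assms(1)[unfolded has_real_derivative_iff_has_vector_derivative has_vector_derivative_def]])
  then show ?thesis
    unfolding dt_def
    by (intro vector_derivative_on_interval[OF _ T_pos assms(2)]) (simp only: has_vector_derivative_def)
qed

lemma dx_eqI:
  assumes "(g has_real_derivative d) (at x within {0..L})" "x \<in> {0..L}"
    and "\<And>y. y \<in> {0..L} \<Longrightarrow> f t y = g y"
  shows "dx L f t x = d"
proof -
  have "((\<lambda>y. f t y) has_derivative (\<lambda>s. s *\<^sub>R d)) (at x within {0..L})"
    by (rule has_derivative_transform[OF assms(2,3)
          assms(1)[unfolded has_real_derivative_iff_has_vector_derivative has_vector_derivative_def]])
  then show ?thesis
    unfolding dx_def
    by (intro vector_derivative_on_interval[OF _ L_pos assms(2)]) (simp only: has_vector_derivative_def)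
qed

end

section \<open>Pipe flows\<close>

lemma A_matrix_times:
  "(A_matrix K \<rho>a w *v z) $ 1 = w $ 2 * z $ 1 + w $ 1 * z $ 2"
  "(A_matrix K \<rho>a w *v z) $ 2 = K / \<rho>a / w $ 1 * z $ 1 + w $ 2 * z $ 2"
  by (simp_all add: A_matrix_def matrix_vector_mult_def sum_2 vector_2)

text \<open>An eigenvector with vanishing first component would vanish by the first row, since
  \<open>w $ 1\<close> is not zero; so that component can be cancelled after elimination of the
  second one. The eigenvalues are velocity plus or minus sound speed.\<close>

lemma eigenvalue_A_matrix:
  assumes "eigenvalue_of (A_matrix K \<rho>a w) l" "w $ 1 \<noteq> 0"
  shows "(l - w $ 2)\<^sup>2 = K / \<rho>a"
proof -
  from assms(1) obtain z where z: "z \<noteq> 0" "A_matrix K \<rho>a w *v z = l *\<^sub>R z"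
    unfolding eigenvalue_of_def by blast
  have e: "(A_matrix K \<rho>a w *v z) $ i = l * z $ i" for i
    by (simp only: z(2) vector_scaleR_component real_scaleR_def)
  then have 1: "w $ 2 * z $ 1 + w $ 1 * z $ 2 = l * z $ 1"
    and 2: "K / \<rho>a / w $ 1 * z $ 1 + w $ 2 * z $ 2 = l * z $ 2"
    using e[of 1] e[of 2] by (simp_all only: A_matrix_times)
  have z1: "z $ 1 \<noteq> 0"
  proof
    assume "z $ 1 = 0"
    with 1 assms(2) have "z $ 2 = 0" by simp
    with \<open>z $ 1 = 0\<close> z(1) show False by (simp add: vec_eq_iff forall_2)
  qed
  have "K / \<rho>a / w $ 1 * w $ 1 = K / \<rho>a" using assms(2) by simp
  with 1 2 have "(l - w $ 2)\<^sup>2 * z $ 1 = K / \<rho>a * z $ 1" by algebra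
  with z1 show ?thesis by (rule mult_right_cancel[THEN iffD1])
qed

text \<open>The left-hand sides are the time derivatives of the two flow equations, the right-hand
  sides the second order brackets of the scheme. Division and modulus enter only through Q P = 1 and
  w^2 = V^2, so both are polynomial identities modulo two relations.\<close>

lemma second_time_derivatives_identity:
  fixes P V Q w Px Vx Pxx Vxx Pt Vt Ptx Vtx C c2 :: real
  assumes Pt: "Pt = - (P * Vx) - V * Px" and Vt: "Vt = - (V * Vx) - c2 * (Q * Px) - C * (V * w)"
    and Ptx: "Ptx = - (Px * Vx + Vxx * P) - (Vx * Px + Pxx * V)"
    and Vtx: "Vtx = - (Vx * Vx + Vxx * V) - c2 * (- (Q * Px * Q) * Px + Pxx * Q) - C * (2 * w * Vx)"
    and Q: "Q * P = 1" and w: "w * w = V * V"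
  shows "- (Pt * Vx + Vtx * P) - (Vt * Px + Ptx * V) =
    2 * P * Vx\<^sup>2 + 2 * P * V * Vxx + 4 * V * Vx * Px + 2 * C * w * P * Vx + C * V * w * Px + (c2 + V\<^sup>2) * Pxx"
   (is ?A)
   and "- (Vt * Vx + Vtx * V) - c2 * (- (Q * Pt * Q) * Px + Ptx * Q) - C * (2 * w * Vt) =
    2 * V * Vx\<^sup>2 + (c2 + V\<^sup>2) * Vxx + 5 * C * V * w * Vx + 2 * c2 * Q * Px * Vx - 2 * c2 * V * Q\<^sup>2 * Px\<^sup>2
      + 2 * c2 * V * Q * Pxx + 2 * C * c2 * w * Q * Px + 2 * C\<^sup>2 * V ^ 3" (is ?B)
proof -
  \<comment> \<open>Cancellation of \<open>P\<close> against \<open>Q\<close>, and of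
    \<open>w * w\<close>, in the nested products that \<open>algebra_simps\<close> produces.\<close>
  have l: "P * (a * (Q * z)) = a * z" "P * (a * (b * (Q * z))) = a * (b * z)" "P * (Q * z) = z" "w * (w * z) = V * (V * z)" for a b z
    using Q w by algebra+
  show ?A unfolding Pt Vt Ptx Vtx
    by (simp add: algebra_simps power2_eq_square power3_eq_cube l)
  show ?B unfolding Pt Vt Ptx Vtx
    by (simp add: algebra_simps power2_eq_square power3_eq_cube l w)
qed

locale pipe = rectangle +
  fixes cf D K \<rho>a :: real and u :: "real \<Rightarrow> real \<Rightarrow> real^2"
  assumes cf_pos: "0 < cf" and D_pos: "0 < D" and K_pos: "0 < K" and \<rho>a_pos: "0 < \<rho>a"
    and flow: "u \<in> pipe_flows T L cf D K \<rho>a"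
begin

definition P where "P t x = u t x $ 1"
definition V where "V t x = u t x $ 2"
definition C where "C = cf / (2 * D)"
definition c where "c = sqrt (K / \<rho>a)"

lemma C_pos: "0 < C" and c_pos: "0 < c" and c_sq: "c\<^sup>2 = K / \<rho>a"
  using cf_pos D_pos K_pos \<rho>a_pos by (auto simp: C_def c_def)

lemma smooth_u: "smooth u"
  using flow by (simp add: pipe_flows_def)

lemma smooth_P: "smooth P" and smooth_V: "smooth V"
  using smooth_nth[OF smooth_u] by (simp_all add: P_def[abs_def] V_def[abs_def])

lemma flow_properties:
  shows P_nonzero: "\<lbrakk>t \<in> {0..T}; x \<in> {0..L}\<rbrakk> \<Longrightarrow> P t x \<noteq> 0"
    and hyperbolic_u: "hyperbolic T L K \<rho>a u"
    and quasilinear_u: "quasilinear_form T L cf D K \<rho>a u"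
  using flow unfolding pipe_flows_def P_def by blast+

lemma V_less: "\<lbrakk>t \<in> {0..T}; x \<in> {0..L}\<rbrakk> \<Longrightarrow> \<bar>V t x\<bar> < c"
proof -
  assume tx: "t \<in> {0..T}" "x \<in> {0..L}"
  have "\<exists>l1 l2. l1 < 0 \<and> 0 < l2 \<and> eigenvalue_of (A_matrix K \<rho>a (u t x)) l1 \<and> eigenvalue_of (A_matrix K \<rho>a (u t x)) l2"
    using hyperbolic_u tx unfolding hyperbolic_def by simp
  then obtain l1 l2 where l: "l1 < 0" "0 < l2" "eigenvalue_of (A_matrix K \<rho>a (u t x)) l1"
    "eigenvalue_of (A_matrix K \<rho>a (u t x)) l2"
    by blast
  then have "(l1 - V t x)\<^sup>2 = c\<^sup>2" "(l2 - V t x)\<^sup>2 = c\<^sup>2"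
    using P_nonzero[OF tx] by (simp_all add: eigenvalue_A_matrix P_def V_def c_sq)
  then have "l1 - V t x = c \<or> l1 - V t x = - c" "l2 - V t x = c \<or> l2 - V t x = - c"
    by (simp_all add: power2_eq_iff)
  with l(1,2) c_pos show ?thesis by auto
qed

definition Q where "Q t x = inverse (P t x)"

lemma Q_P: "\<lbrakk>t \<in> {0..T}; x \<in> {0..L}\<rbrakk> \<Longrightarrow> Q t x * P t x = 1"
  using P_nonzero by (simp add: Q_def)

abbreviation (input) "Px \<equiv> dx L P"
abbreviation (input) "Vx \<equiv> dx L V"
abbreviation (input) "Pxx \<equiv> dx L (dx L P)"
abbreviation (input) "Vxx \<equiv> dx L (dx L V)"

lemma
  assumes "t \<in> {0..T}" "x \<in> {0..L}"
  shows P_t: "dt T P t x = - (P t x * Vx t x) - V t x * Px t x"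
    and V_t: "dt T V t x = - (V t x * Vx t x) - c\<^sup>2 * (Q t x * Px t x) - C * (V t x * \<bar>V t x\<bar>)"
proof -
  have "dt T u t x = - (A_matrix K \<rho>a (u t x) *v dx L u t x) + B_vector cf D (u t x)"
    using quasilinear_u assms unfolding quasilinear_form_def by simp
  then have "dt T u t x $ i = - (A_matrix K \<rho>a (u t x) *v dx L u t x) $ i + B_vector cf D (u t x) $ i" for i
    by (simp only: vector_add_component vector_uminus_component)
  note e = this[of 1] this[of 2]
  have d: "dt T P t x = dt T u t x $ 1" "dt T V t x = dt T u t x $ 2"
    "Px t x = dx L u t x $ 1" "Vx t x = dx L u t x $ 2"
    unfolding P_def[abs_def] V_def[abs_def] by (rule dt_dx_nth[OF smooth_u assms])+
  show "dt T P t x = - (P t x * Vx t x) - V t x * Px t x"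
    "dt T V t x = - (V t x * Vx t x) - c\<^sup>2 * (Q t x * Px t x) - C * (V t x * \<bar>V t x\<bar>)"
    unfolding d e A_matrix_times
    by (simp_all add: B_vector_def P_def V_def c_sq C_def Q_def inverse_eq_divide)
qed

lemma
  assumes "t \<in> {0..T}" "x \<in> {0..L}"
  shows DERIV_Q_t: "((\<lambda>s. Q s x) has_real_derivative - (Q t x * dt T P t x * Q t x)) (at t within {0..T})"
    and DERIV_Q_x: "((\<lambda>y. Q t y) has_real_derivative - (Q t x * dx L P t x * Q t x)) (at x within {0..L})"
  unfolding Q_def[abs_def]
  by (rule DERIV_inverse'[OF DERIV_dt[OF smooth_P assms] P_nonzero[OF assms]],
      rule DERIV_inverse'[OF DERIV_dx[OF smooth_P assms] P_nonzero[OF assms]])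

lemma
  assumes "t \<in> {0..T}" "x \<in> {0..L}"
  shows P_tx: "dx L (dt T P) t x = - (Px t x * Vx t x + Vxx t x * P t x) - (Vx t x * Px t x + Pxx t x * V t x)"
    and V_tx: "dx L (dt T V) t x = - (Vx t x * Vx t x + Vxx t x * V t x)
      - c\<^sup>2 * (- (Q t x * Px t x * Q t x) * Px t x + Pxx t x * Q t x) - C * (2 * \<bar>V t x\<bar> * Vx t x)"
proof -
  note d = DERIV_dx[OF smooth_P assms] DERIV_dx[OF smooth_V assms]
    DERIV_dx[OF smooth_dx[OF smooth_P] assms] DERIV_dx[OF smooth_dx[OF smooth_V] assms]
  note abs = DERIV_chain2[OF DERIV_mult_abs d(2)]
  have "((\<lambda>x. - (P t x * Vx t x) - V t x * Px t x) has_real_derivative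
      - (Px t x * Vx t x + Vxx t x * P t x) - (Vx t x * Px t x + Pxx t x * V t x)) (at x within {0..L})"
    by (intro DERIV_diff DERIV_minus DERIV_mult d)
  then show "dx L (dt T P) t x = - (Px t x * Vx t x + Vxx t x * P t x) - (Vx t x * Px t x + Pxx t x * V t x)"
    by (rule dx_eqI[OF _ assms(2)]) (rule P_t[OF assms(1)])
  have "((\<lambda>x. - (V t x * Vx t x) - c\<^sup>2 * (Q t x * Px t x) - C * (V t x * \<bar>V t x\<bar>)) has_real_derivative
      - (Vx t x * Vx t x + Vxx t x * V t x) - c\<^sup>2 * (- (Q t x * Px t x * Q t x) * Px t x + Pxx t x * Q t x)
      - C * (2 * \<bar>V t x\<bar> * Vx t x)) (at x within {0..L})"
    by (intro DERIV_diff DERIV_minus DERIV_mult DERIV_cmult d abs DERIV_Q_x assms)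
  then show "dx L (dt T V) t x = - (Vx t x * Vx t x + Vxx t x * V t x)
      - c\<^sup>2 * (- (Q t x * Px t x * Q t x) * Px t x + Pxx t x * Q t x) - C * (2 * \<bar>V t x\<bar> * Vx t x)"
    by (rule dx_eqI[OF _ assms(2)]) (rule V_t[OF assms(1)])
qed

text \<open>The flow equations are differentiated in time, mixed derivatives interchanged and first
  time derivatives eliminated. The outcome is the bracket that the scheme multiplies by half the
  squared time step, with derivatives in place of difference quotients.\<close>

lemma
  assumes "t \<in> {0..T}" "x \<in> {0..L}"
  shows P_tt: "dt T (dt T P) t x =
      2 * P t x * (Vx t x)\<^sup>2 + 2 * P t x * V t x * Vxx t x + 4 * V t x * Vx t x * Px t x
      + 2 * C * \<bar>V t x\<bar> * P t x * Vx t x + C * V t x * \<bar>V t x\<bar> * Px t x + (c\<^sup>2 + (V t x)\<^sup>2) * Pxx t x"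
    and V_tt: "dt T (dt T V) t x =
      2 * V t x * (Vx t x)\<^sup>2 + (c\<^sup>2 + (V t x)\<^sup>2) * Vxx t x + 5 * C * V t x * \<bar>V t x\<bar> * Vx t x
      + 2 * c\<^sup>2 * Q t x * Px t x * Vx t x - 2 * c\<^sup>2 * V t x * (Q t x)\<^sup>2 * (Px t x)\<^sup>2
      + 2 * c\<^sup>2 * V t x * Q t x * Pxx t x + 2 * C * c\<^sup>2 * \<bar>V t x\<bar> * Q t x * Px t x
      + 2 * C\<^sup>2 * (V t x) ^ 3"
proof -
  note d = DERIV_dt[OF smooth_P assms] DERIV_dt[OF smooth_V assms]
    DERIV_dt[OF smooth_dx[OF smooth_P] assms] DERIV_dt[OF smooth_dx[OF smooth_V] assms]
  note abs = DERIV_chain2[OF DERIV_mult_abs d(2)]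
  have "((\<lambda>t. - (P t x * Vx t x) - V t x * Px t x) has_real_derivative
      - (dt T P t x * Vx t x + dt T Vx t x * P t x) - (dt T V t x * Px t x + dt T Px t x * V t x)) (at t within {0..T})"
    by (intro DERIV_diff DERIV_minus DERIV_mult d)
  then have P: "dt T (dt T P) t x = - (dt T P t x * Vx t x + dx L (dt T V) t x * P t x)
      - (dt T V t x * Px t x + dx L (dt T P) t x * V t x)"
    unfolding mixed_partials[OF smooth_P assms] mixed_partials[OF smooth_V assms]
    by (rule dt_eqI[OF _ assms(1)]) (rule P_t[OF _ assms(2)])
  have "((\<lambda>t. - (V t x * Vx t x) - c\<^sup>2 * (Q t x * Px t x) - C * (V t x * \<bar>V t x\<bar>)) has_real_derivative
      - (dt T V t x * Vx t x + dt T Vx t x * V t x)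
      - c\<^sup>2 * (- (Q t x * dt T P t x * Q t x) * Px t x + dt T Px t x * Q t x)
      - C * (2 * \<bar>V t x\<bar> * dt T V t x)) (at t within {0..T})"
    by (intro DERIV_diff DERIV_minus DERIV_mult DERIV_cmult d abs DERIV_Q_t assms)
  then have V: "dt T (dt T V) t x = - (dt T V t x * Vx t x + dx L (dt T V) t x * V t x)
      - c\<^sup>2 * (- (Q t x * dt T P t x * Q t x) * Px t x + dx L (dt T P) t x * Q t x)
      - C * (2 * \<bar>V t x\<bar> * dt T V t x)"
    unfolding mixed_partials[OF smooth_P assms] mixed_partials[OF smooth_V assms]
    by (rule dt_eqI[OF _ assms(1)]) (rule V_t[OF _ assms(2)])
  note eqs = P_t[OF assms] V_t[OF assms] P_tx[OF assms] V_tx[OF assms] Q_P[OF assms] abs_mult_self_eq[of "V t x"]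
  show "dt T (dt T P) t x =
      2 * P t x * (Vx t x)\<^sup>2 + 2 * P t x * V t x * Vxx t x + 4 * V t x * Vx t x * Px t x
      + 2 * C * \<bar>V t x\<bar> * P t x * Vx t x + C * V t x * \<bar>V t x\<bar> * Px t x + (c\<^sup>2 + (V t x)\<^sup>2) * Pxx t x"
    unfolding P by (rule second_time_derivatives_identity(1)[OF eqs])
  show "dt T (dt T V) t x =
      2 * V t x * (Vx t x)\<^sup>2 + (c\<^sup>2 + (V t x)\<^sup>2) * Vxx t x + 5 * C * V t x * \<bar>V t x\<bar> * Vx t x
      + 2 * c\<^sup>2 * Q t x * Px t x * Vx t x - 2 * c\<^sup>2 * V t x * (Q t x)\<^sup>2 * (Px t x)\<^sup>2
      + 2 * c\<^sup>2 * V t x * Q t x * Pxx t x + 2 * C * c\<^sup>2 * \<bar>V t x\<bar> * Q t x * Px t x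
      + 2 * C\<^sup>2 * (V t x) ^ 3"
    unfolding V by (rule second_time_derivatives_identity(2)[OF eqs])
qed

end

section \<open>Orders of magnitude of grid functions\<close>

text \<open>\<open>ord \<omega> m q\<close> bounds not only a grid function by \<open>\<omega> h\<^sup>m\<close> but also its difference between
  neighbouring grid points by one more power of \<open>h\<close>, as for smooth functions sampled
  on the grid.\<close>

locale grid_orders =
  fixes I :: "'i set" and sh :: "'i \<Rightarrow> 'i" and h :: "'i \<Rightarrow> real" and H :: real
  assumes h_pos: "i \<in> I \<Longrightarrow> 0 < h i" and h_le: "i \<in> I \<Longrightarrow> h i \<le> H" and H_pos: "0 < H"
    and h_shift: "\<lbrakk>i \<in> I; sh i \<in> I\<rbrakk> \<Longrightarrow> h (sh i) = h i"
begin

definition ord :: "('i \<Rightarrow> real) \<Rightarrow> nat \<Rightarrow> ('i \<Rightarrow> real) \<Rightarrow> bool" where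
  "ord \<omega> m q \<longleftrightarrow> (\<exists>C\<ge>0. \<forall>i\<in>I. \<bar>q i\<bar> \<le> C * \<bar>\<omega> i\<bar> * h i ^ m \<and>
      (sh i \<in> I \<longrightarrow> \<bar>q (sh i) - q i\<bar> \<le> C * \<bar>\<omega> i\<bar> * h i ^ Suc m))"

abbreviation ord1 :: "nat \<Rightarrow> ('i \<Rightarrow> real) \<Rightarrow> bool" where
  "ord1 \<equiv> ord (\<lambda>_. 1)"

lemma ordI:
  assumes "0 \<le> C" "\<And>i. i \<in> I \<Longrightarrow> \<bar>q i\<bar> \<le> C * \<bar>\<omega> i\<bar> * h i ^ m"
    and "\<And>i. \<lbrakk>i \<in> I; sh i \<in> I\<rbrakk> \<Longrightarrow> \<bar>q (sh i) - q i\<bar> \<le> C * \<bar>\<omega> i\<bar> * h i ^ Suc m"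
  shows "ord \<omega> m q"
  using assms unfolding ord_def by blast

lemma ordI2:
  assumes "\<And>i. i \<in> I \<Longrightarrow> \<bar>q i\<bar> \<le> C * \<bar>\<omega> i\<bar> * h i ^ m"
    and "\<And>i. \<lbrakk>i \<in> I; sh i \<in> I\<rbrakk> \<Longrightarrow> \<bar>q (sh i) - q i\<bar> \<le> D * \<bar>\<omega> i\<bar> * h i ^ Suc m"
  shows "ord \<omega> m q"
proof (rule ordI[of "\<bar>C\<bar> + \<bar>D\<bar>"])
  fix i assume i: "i \<in> I"
  note p = h_pos[OF i]
  have "C * (\<bar>\<omega> i\<bar> * h i ^ m) \<le> (\<bar>C\<bar> + \<bar>D\<bar>) * (\<bar>\<omega> i\<bar> * h i ^ m)"
    using p by (intro mult_right_mono) auto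
  then show "\<bar>q i\<bar> \<le> (\<bar>C\<bar> + \<bar>D\<bar>) * \<bar>\<omega> i\<bar> * h i ^ m" using assms(1)[OF i] by (simp add: mult.assoc)
  assume s: "sh i \<in> I"
  have "D * (\<bar>\<omega> i\<bar> * h i ^ Suc m) \<le> (\<bar>C\<bar> + \<bar>D\<bar>) * (\<bar>\<omega> i\<bar> * h i ^ Suc m)"
    using p by (intro mult_right_mono) auto
  then show "\<bar>q (sh i) - q i\<bar> \<le> (\<bar>C\<bar> + \<bar>D\<bar>) * \<bar>\<omega> i\<bar> * h i ^ Suc m" using assms(2)[OF i s] by (simp add: mult.assoc)
qed simp

lemma ordE:
  assumes "ord \<omega> m q"
  obtains C where "0 \<le> C" "\<And>i. i \<in> I \<Longrightarrow> \<bar>q i\<bar> \<le> C * \<bar>\<omega> i\<bar> * h i ^ m"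
    and "\<And>i. \<lbrakk>i \<in> I; sh i \<in> I\<rbrakk> \<Longrightarrow> \<bar>q (sh i) - q i\<bar> \<le> C * \<bar>\<omega> i\<bar> * h i ^ Suc m"
  using assms unfolding ord_def by blast

lemma ord_cong: "\<lbrakk>ord \<omega> m p; \<And>i. i \<in> I \<Longrightarrow> q i = p i\<rbrakk> \<Longrightarrow> ord \<omega> m q"
  unfolding ord_def by simp

lemma ord_add:
  assumes "ord \<omega> m p" "ord \<omega> m q"
  shows "ord \<omega> m (\<lambda>i. p i + q i)"
proof -
  from assms(1) obtain C where C: "0 \<le> C" "\<And>i. i \<in> I \<Longrightarrow> \<bar>p i\<bar> \<le> C * \<bar>\<omega> i\<bar> * h i ^ m"
    "\<And>i. \<lbrakk>i \<in> I; sh i \<in> I\<rbrakk> \<Longrightarrow> \<bar>p (sh i) - p i\<bar> \<le> C * \<bar>\<omega> i\<bar> * h i ^ Suc m" by (rule ordE) blast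
  from assms(2) obtain D where D: "0 \<le> D" "\<And>i. i \<in> I \<Longrightarrow> \<bar>q i\<bar> \<le> D * \<bar>\<omega> i\<bar> * h i ^ m"
    "\<And>i. \<lbrakk>i \<in> I; sh i \<in> I\<rbrakk> \<Longrightarrow> \<bar>q (sh i) - q i\<bar> \<le> D * \<bar>\<omega> i\<bar> * h i ^ Suc m" by (rule ordE) blast
  show ?thesis
  proof (rule ordI[of "C + D"])
    fix i assume i: "i \<in> I"
    show "\<bar>p i + q i\<bar> \<le> (C + D) * \<bar>\<omega> i\<bar> * h i ^ m"
      using C(2)[OF i] D(2)[OF i] by (simp add: algebra_simps)
    assume s: "sh i \<in> I"
    show "\<bar>p (sh i) + q (sh i) - (p i + q i)\<bar> \<le> (C + D) * \<bar>\<omega> i\<bar> * h i ^ Suc m"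
      using C(3)[OF i s] D(3)[OF i s] by (simp add: distrib_right)
  qed (use C D in auto)
qed

lemma ord_const: "ord1 0 (\<lambda>_. c)"
  by (rule ordI[of "\<bar>c\<bar>"]) (auto dest: h_pos)

lemma ord_step: "ord1 1 h"
  by (rule ordI[of 1]) (auto dest: h_pos h_shift)

text \<open>Discrete product rule. The product of the two differences carries a surplus power of the
  step, which the common bound \<open>H\<close> absorbs. Only one factor has a weight, as otherwise
  the weight would be squared.\<close>

lemma ord_mult:
  assumes "ord1 m p" "ord \<omega> n q"
  shows "ord \<omega> (m + n) (\<lambda>i. p i * q i)"
proof -
  from assms(1) obtain C where C: "0 \<le> C" "\<And>i. i \<in> I \<Longrightarrow> \<bar>p i\<bar> \<le> C * \<bar>1\<bar> * h i ^ m"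
    "\<And>i. \<lbrakk>i \<in> I; sh i \<in> I\<rbrakk> \<Longrightarrow> \<bar>p (sh i) - p i\<bar> \<le> C * \<bar>1\<bar> * h i ^ Suc m" by (rule ordE) blast
  from assms(2) obtain D where D: "0 \<le> D" "\<And>i. i \<in> I \<Longrightarrow> \<bar>q i\<bar> \<le> D * \<bar>\<omega> i\<bar> * h i ^ n"
    "\<And>i. \<lbrakk>i \<in> I; sh i \<in> I\<rbrakk> \<Longrightarrow> \<bar>q (sh i) - q i\<bar> \<le> D * \<bar>\<omega> i\<bar> * h i ^ Suc n" by (rule ordE) blast
  show ?thesis
  proof (rule ordI2[where C = "C * D" and D = "C * D * (2 + H)"])
    fix i assume i: "i \<in> I"
    have "\<bar>p i\<bar> * \<bar>q i\<bar> \<le> (C * \<bar>1\<bar> * h i ^ m) * (D * \<bar>\<omega> i\<bar> * h i ^ n)"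
      using C(1) h_pos[OF i] by (intro mult_mono C D i) auto
    then show "\<bar>p i * q i\<bar> \<le> C * D * \<bar>\<omega> i\<bar> * h i ^ (m + n)"
      by (simp add: abs_mult power_add mult_ac)
    assume s: "sh i \<in> I"
    let ?w = "C * D * \<bar>\<omega> i\<bar> * h i ^ Suc (m + n)"
    have 1: "\<bar>p (sh i) - p i\<bar> * \<bar>q i\<bar> \<le> (C * \<bar>1\<bar> * h i ^ Suc m) * (D * \<bar>\<omega> i\<bar> * h i ^ n)"
      using C(1) h_pos[OF i] by (intro mult_mono C D i s) auto
    have 2: "\<bar>p i\<bar> * \<bar>q (sh i) - q i\<bar> \<le> (C * \<bar>1\<bar> * h i ^ m) * (D * \<bar>\<omega> i\<bar> * h i ^ Suc n)"
      using C(1) h_pos[OF i] by (intro mult_mono C D i s) auto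
    have 3: "\<bar>p (sh i) - p i\<bar> * \<bar>q (sh i) - q i\<bar> \<le> (C * \<bar>1\<bar> * h i ^ Suc m) * (D * \<bar>\<omega> i\<bar> * h i ^ Suc n)"
      using C(1) h_pos[OF i] by (intro mult_mono C D i s) auto
    have "0 \<le> ?w" using C(1) D(1) h_pos[OF i] by simp
    then have "?w * h i \<le> ?w * H" using h_le[OF i] by (intro mult_left_mono)
    have "p (sh i) * q (sh i) - p i * q i = (p (sh i) - p i) * q i + p i * (q (sh i) - q i) + (p (sh i) - p i) * (q (sh i) - q i)"
      by (simp add: algebra_simps)
    also have "\<bar>\<dots>\<bar> \<le> \<bar>p (sh i) - p i\<bar> * \<bar>q i\<bar> + \<bar>p i\<bar> * \<bar>q (sh i) - q i\<bar> + \<bar>p (sh i) - p i\<bar> * \<bar>q (sh i) - q i\<bar>"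
      by (intro order_trans[OF abs_triangle_ineq] add_mono) (auto simp: abs_mult)
    also have "\<dots> \<le> ?w + ?w + ?w * h i"
      using 1 2 3 by (simp add: power_add mult_ac)
    also have "\<dots> \<le> C * D * (2 + H) * \<bar>\<omega> i\<bar> * h i ^ Suc (m + n)"
      using \<open>?w * h i \<le> ?w * H\<close> by (simp add: algebra_simps)
    finally show "\<bar>p (sh i) * q (sh i) - p i * q i\<bar> \<le> C * D * (2 + H) * \<bar>\<omega> i\<bar> * h i ^ Suc (m + n)" .
  qed
qed

lemma ord_mult': "\<lbrakk>ord \<omega> m p; ord1 n q\<rbrakk> \<Longrightarrow> ord \<omega> (m + n) (\<lambda>i. p i * q i)"
  using ord_mult[of n q \<omega> m p] by (simp add: mult.commute add.commute)

lemma ord_cmult: "ord \<omega> m q \<Longrightarrow> ord \<omega> m (\<lambda>i. c * q i)"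
  using ord_mult[OF ord_const] by fastforce

lemma ord_minus: "ord \<omega> m q \<Longrightarrow> ord \<omega> m (\<lambda>i. - q i)"
  using ord_cmult[of \<omega> m q "-1"] by simp

lemma ord_diff: "\<lbrakk>ord \<omega> m p; ord \<omega> m q\<rbrakk> \<Longrightarrow> ord \<omega> m (\<lambda>i. p i - q i)"
  using ord_add[OF _ ord_minus, of \<omega> m p q] by simp

lemma ord_zero: "ord \<omega> m (\<lambda>_. 0)"
  by (rule ordI[of 0]) auto

lemma ord_mono:
  assumes "ord \<omega> m q" "n \<le> m"
  shows "ord \<omega> n q"
proof -
  from assms(1) obtain C where C: "0 \<le> C" "\<And>i. i \<in> I \<Longrightarrow> \<bar>q i\<bar> \<le> C * \<bar>\<omega> i\<bar> * h i ^ m"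
    "\<And>i. \<lbrakk>i \<in> I; sh i \<in> I\<rbrakk> \<Longrightarrow> \<bar>q (sh i) - q i\<bar> \<le> C * \<bar>\<omega> i\<bar> * h i ^ Suc m" by (rule ordE) blast
  have *: "C * \<bar>\<omega> i\<bar> * h i ^ k \<le> C * H ^ (m - n) * \<bar>\<omega> i\<bar> * h i ^ (k - (m - n))" if "i \<in> I" "m \<le> k" for i k
  proof -
    have "h i ^ k = h i ^ (m - n) * h i ^ (k - (m - n))"
      using that(2) by (simp flip: power_add)
    also have "\<dots> \<le> H ^ (m - n) * h i ^ (k - (m - n))"
      using h_pos[OF that(1)] h_le[OF that(1)] by (intro mult_right_mono power_mono) auto
    finally have "C * \<bar>\<omega> i\<bar> * h i ^ k \<le> C * \<bar>\<omega> i\<bar> * (H ^ (m - n) * h i ^ (k - (m - n)))"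
      using C(1) by (intro mult_left_mono) auto
    then show ?thesis by (simp add: mult_ac)
  qed
  show ?thesis
  proof (rule ordI[of "C * H ^ (m - n)"])
    fix i assume i: "i \<in> I"
    show "\<bar>q i\<bar> \<le> C * H ^ (m - n) * \<bar>\<omega> i\<bar> * h i ^ n"
      using order_trans[OF C(2)[OF i] *[OF i order_refl]] assms(2) by simp
    assume s: "sh i \<in> I"
    show "\<bar>q (sh i) - q i\<bar> \<le> C * H ^ (m - n) * \<bar>\<omega> i\<bar> * h i ^ Suc n"
      using order_trans[OF C(3)[OF i s] *[OF i, of "Suc m"]] assms(2) by (simp add: Suc_diff_le)
  qed (use C(1) H_pos in auto)
qed

lemma ord_abs:
  assumes "ord1 0 q"
  shows "ord1 0 (\<lambda>i. \<bar>q i\<bar>)"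
proof -
  from assms obtain C where C: "0 \<le> C" "\<And>i. i \<in> I \<Longrightarrow> \<bar>q i\<bar> \<le> C * \<bar>1\<bar> * h i ^ 0"
    "\<And>i. \<lbrakk>i \<in> I; sh i \<in> I\<rbrakk> \<Longrightarrow> \<bar>q (sh i) - q i\<bar> \<le> C * \<bar>1\<bar> * h i ^ Suc 0" by (rule ordE) blast
  show ?thesis
    using C abs_triangle_ineq3 order_trans by (intro ordI[of C]) fastforce+
qed

lemma ord_inverse:
  assumes q: "ord1 0 q" and \<delta>: "0 < \<delta>" "\<And>i. i \<in> I \<Longrightarrow> \<delta> \<le> \<bar>q i\<bar>"
  shows "ord1 0 (\<lambda>i. inverse (q i))"
proof -
  from q obtain C where C: "0 \<le> C" "\<And>i. i \<in> I \<Longrightarrow> \<bar>q i\<bar> \<le> C * \<bar>1\<bar> * h i ^ 0"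
    "\<And>i. \<lbrakk>i \<in> I; sh i \<in> I\<rbrakk> \<Longrightarrow> \<bar>q (sh i) - q i\<bar> \<le> C * \<bar>1\<bar> * h i ^ Suc 0" by (rule ordE) blast
  have inv: "\<bar>inverse (q i)\<bar> \<le> 1 / \<delta>" if "i \<in> I" for i
    using \<delta>(1) \<delta>(2)[OF that] by (auto simp: field_simps abs_inverse)
  show ?thesis
  proof (rule ordI2[where C = "1 / \<delta>" and D = "1 / \<delta> * C * (1 / \<delta>)"])
    fix i assume i: "i \<in> I"
    show "\<bar>inverse (q i)\<bar> \<le> 1 / \<delta> * \<bar>1\<bar> * h i ^ 0" using inv[OF i] by simp
    assume s: "sh i \<in> I"
    have "q i \<noteq> 0" "q (sh i) \<noteq> 0" using \<delta>(1) \<delta>(2)[OF s] \<delta>(2)[OF i] by auto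
    then have "inverse (q (sh i)) - inverse (q i) = - (inverse (q (sh i)) * (q (sh i) - q i) * inverse (q i))"
      by (simp add: division_ring_inverse_diff left_diff_distrib right_diff_distrib)
    also have "\<bar>\<dots>\<bar> = \<bar>inverse (q (sh i))\<bar> * \<bar>q (sh i) - q i\<bar> * \<bar>inverse (q i)\<bar>" by (simp add: abs_mult)
    also have "\<dots> \<le> 1 / \<delta> * (C * h i) * (1 / \<delta>)"
      using inv[OF i] inv[OF s] C(3)[OF i s] C(1) \<delta>(1) h_pos[OF i]
      by (intro mult_mono) auto
    finally show "\<bar>inverse (q (sh i)) - inverse (q i)\<bar> \<le> 1 / \<delta> * C * (1 / \<delta>) * \<bar>1\<bar> * h i ^ Suc 0"
      by (simp add: mult_ac)
  qed
qed

text \<open>Boundedness of both functions is included so that the relation is closed under products.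
  The truncation error can then be found by substitution into the formula of the scheme.\<close>

definition approx :: "nat \<Rightarrow> ('i \<Rightarrow> real) \<Rightarrow> ('i \<Rightarrow> real) \<Rightarrow> bool" where
  "approx m p q \<longleftrightarrow> ord1 0 p \<and> ord1 0 q \<and> ord1 m (\<lambda>i. p i - q i)"

lemma approx_refl: "ord1 0 p \<Longrightarrow> approx m p p"
  unfolding approx_def by (simp add: ord_zero)

lemma approx_add: "\<lbrakk>approx m p q; approx m p' q'\<rbrakk> \<Longrightarrow> approx m (\<lambda>i. p i + p' i) (\<lambda>i. q i + q' i)"
  unfolding approx_def using ord_add[of "\<lambda>_. 1" m "\<lambda>i. p i - q i" "\<lambda>i. p' i - q' i"]
  by (auto intro: ord_add simp: algebra_simps)

lemma approx_mult:
  assumes "approx m p q" "approx m p' q'"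
  shows "approx m (\<lambda>i. p i * p' i) (\<lambda>i. q i * q' i)"
proof -
  have o: "ord1 0 p" "ord1 0 q" "ord1 0 p'" "ord1 0 q'" "ord1 m (\<lambda>i. p i - q i)" "ord1 m (\<lambda>i. p' i - q' i)"
    using assms by (auto simp: approx_def)
  have "ord1 m (\<lambda>i. p i * (p' i - q' i) + (p i - q i) * q' i)"
    using ord_mult[OF o(1,6)] ord_mult'[OF o(5,4)] by (intro ord_add) auto
  then have "ord1 m (\<lambda>i. p i * p' i - q i * q' i)" by (simp add: algebra_simps)
  then show ?thesis using ord_mult[OF o(1,3)] ord_mult[OF o(2,4)] by (simp add: approx_def)
qed

lemma approx_const: "approx m (\<lambda>_. c) (\<lambda>_. c)"
  by (intro approx_refl ord_const)

lemma approx_minus: "approx m p q \<Longrightarrow> approx m (\<lambda>i. - p i) (\<lambda>i. - q i)"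
  using approx_mult[OF approx_const[of m "-1"], of p q] by simp

lemma approx_diff: "\<lbrakk>approx m p q; approx m p' q'\<rbrakk> \<Longrightarrow> approx m (\<lambda>i. p i - p' i) (\<lambda>i. q i - q' i)"
  using approx_add[OF _ approx_minus, of m p q p' q'] by simp

lemma approx_power: "approx m p q \<Longrightarrow> approx m (\<lambda>i. p i ^ k) (\<lambda>i. q i ^ k)"
proof (induction k)
  case 0
  then show ?case by (simp add: approx_const)
next
  case (Suc k)
  then show ?case using approx_mult[of m p q] by simp
qed

end

section \<open>The energy estimate\<close>

definition lw_scalar :: "(int \<Rightarrow> real) \<Rightarrow> (int \<Rightarrow> real) \<Rightarrow> int \<Rightarrow> real" where
  "lw_scalar \<nu> w j = w j - \<nu> j / 2 * (w (j + 1) - w (j - 1)) + (\<nu> j)\<^sup>2 / 2 * (w (j + 1) - 2 * w j + w (j - 1))"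

lemma lw_flux_identity:
  fixes x y z \<alpha> \<beta> \<gamma> :: real \<comment> \<open>neighbouring values of \<open>w\<close> and of \<open>\<nu>\<close>\<close>
  shows "(y - \<beta> / 2 * (z - x) + \<beta>\<^sup>2 / 2 * (z - 2 * y + x))\<^sup>2 =
    y\<^sup>2 - \<beta>\<^sup>2 * (1 - \<beta>\<^sup>2) / 4 * (z - 2 * y + x)\<^sup>2
    + ((- \<beta> * y * z + (\<beta>\<^sup>2 * z\<^sup>2 - \<gamma>\<^sup>2 * y\<^sup>2) / 2 - \<gamma> ^ 3 * (z - y)\<^sup>2 / 2)
       - (- \<alpha> * x * y + (\<alpha>\<^sup>2 * y\<^sup>2 - \<beta>\<^sup>2 * x\<^sup>2) / 2 - \<beta> ^ 3 * (y - x)\<^sup>2 / 2))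
    + ((\<beta> - \<alpha>) * x * y + y\<^sup>2 * (\<gamma>\<^sup>2 + \<alpha>\<^sup>2 - 2 * \<beta>\<^sup>2) / 2 + (\<gamma> ^ 3 - \<beta> ^ 3) * (z - y)\<^sup>2 / 2)"
  by (simp add: field_simps power2_eq_square power3_eq_cube)

lemma abs_diff_square_le:
  fixes a b :: real
  assumes "\<bar>a\<bar> \<le> 1" "\<bar>b\<bar> \<le> 1" "\<bar>a - b\<bar> \<le> \<delta>"
  shows "\<bar>a\<^sup>2 - b\<^sup>2\<bar> \<le> 2 * \<delta>" "\<bar>a ^ 3 - b ^ 3\<bar> \<le> 3 * \<delta>"
proof -
  have "\<bar>a + b\<bar> \<le> 2" using assms by linarith
  then have "\<bar>a - b\<bar> * \<bar>a + b\<bar> \<le> \<delta> * 2" using assms by (intro mult_mono) auto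
  then show "\<bar>a\<^sup>2 - b\<^sup>2\<bar> \<le> 2 * \<delta>"
    by (simp add: power2_eq_square square_diff_square_factored abs_mult mult.commute)
  have "\<bar>a * a\<bar> \<le> 1" "\<bar>a * b\<bar> \<le> 1" "\<bar>b * b\<bar> \<le> 1"
    using mult_le_one[OF assms(1) _ assms(1)] mult_le_one[OF assms(1) _ assms(2)] mult_le_one[OF assms(2) _ assms(2)]
    by (simp_all add: abs_mult)
  then have "\<bar>a * a + a * b + b * b\<bar> \<le> 3" by linarith
  then have "\<bar>a - b\<bar> * \<bar>a * a + a * b + b * b\<bar> \<le> \<delta> * 3" using assms by (intro mult_mono) auto
  then show "\<bar>a ^ 3 - b ^ 3\<bar> \<le> 3 * \<delta>"
    by (simp add: abs_mult[symmetric] power3_eq_cube algebra_simps)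
qed

lemma sum_telescope_int:
  fixes f :: "int \<Rightarrow> real"
  assumes "a \<le> b + 1"
  shows "(\<Sum>j\<in>{a..b}. f (j + 1) - f j) = f (b + 1) - f a"
proof -
  have "a - 1 \<le> b" using assms by simp
  then show ?thesis
  proof (induction b rule: int_ge_induct)
    case base
    then show ?case by simp
  next
    case (step b)
    then have "{a..b + 1} = insert (b + 1) {a..b}" by auto
    then show ?case using step by simp
  qed
qed

text \<open>In \<open>lw_flux_identity\<close> the squared second difference is dissipative for
  Courant numbers of modulus at most 1, the following bracket is an exact difference of fluxes, and
  the last one vanishes for constant \<open>\<nu>\<close>. Summation therefore leaves only terms
  proportional to the variation of \<open>\<nu>\<close>.\<close>

lemma lw_scalar_energy:
  assumes \<nu>: "\<And>j. \<bar>\<nu> j\<bar> \<le> 1" "\<And>j. \<bar>\<nu> (j + 1) - \<nu> j\<bar> \<le> \<delta>"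
    and w: "\<And>j. j \<notin> {a..b} \<Longrightarrow> w j = 0"
  shows "(\<Sum>j\<in>{a + 1..b - 1}. (lw_scalar \<nu> w j)\<^sup>2) \<le> (1 + 9 * \<delta>) * (\<Sum>j\<in>{a..b}. (w j)\<^sup>2)"
proof (cases "a \<le> b")
  case False
  then show ?thesis by simp
next
  case True
  have \<delta>: "0 \<le> \<delta>" using \<nu>(2)[of 0] by linarith
  define F where "F j = - \<nu> (j - 1) * w (j - 1) * w j + ((\<nu> (j - 1))\<^sup>2 * (w j)\<^sup>2 - (\<nu> j)\<^sup>2 * (w (j - 1))\<^sup>2) / 2
      - (\<nu> j) ^ 3 * (w j - w (j - 1))\<^sup>2 / 2" for j
  let ?E = "\<lambda>j. (w (j - 1))\<^sup>2 + (w j)\<^sup>2 * 6 + (w (j + 1))\<^sup>2 * 3"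
  \<comment> \<open>The weights collect 1/2 + 1/2 from the mixed product, 2 from the squares of
    \<open>\<nu>\<close> and 3 + 3 from the cubes; their total is the 9 of the statement.\<close>
  have point: "(lw_scalar \<nu> w j)\<^sup>2 \<le> (w j)\<^sup>2 + (F (j + 1) - F j) + \<delta> * ((w (j - 1))\<^sup>2 / 2 + (w j)\<^sup>2 * (11 / 2) + 3 * (w (j + 1))\<^sup>2)" for j
  proof -
    let ?x = "w (j - 1)" and ?y = "w j" and ?z = "w (j + 1)"
    let ?\<alpha> = "\<nu> (j - 1)" and ?\<beta> = "\<nu> j" and ?\<gamma> = "\<nu> (j + 1)"
    have d: "\<bar>?\<beta> - ?\<alpha>\<bar> \<le> \<delta>" "\<bar>?\<gamma> - ?\<beta>\<bar> \<le> \<delta>" "\<bar>?\<alpha> - ?\<beta>\<bar> \<le> \<delta>"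
      using \<nu>(2)[of "j - 1"] \<nu>(2)[of j] by auto
    have "0 \<le> ?\<beta>\<^sup>2 * (1 - ?\<beta>\<^sup>2) / 4 * (?z - 2 * ?y + ?x)\<^sup>2"
      using \<nu>(1)[of j] by (simp add: abs_square_le_1)
    moreover have "(?\<beta> - ?\<alpha>) * ?x * ?y \<le> \<delta> * ((?x\<^sup>2 + ?y\<^sup>2) / 2)"
    proof -
      have "(?\<beta> - ?\<alpha>) * (?x * ?y) \<le> \<bar>?\<beta> - ?\<alpha>\<bar> * \<bar>?x * ?y\<bar>" by (metis abs_ge_self abs_mult)
      also have "\<dots> \<le> \<delta> * ((?x\<^sup>2 + ?y\<^sup>2) / 2)"
      proof (intro mult_mono d \<delta>)
        show "\<bar>?x * ?y\<bar> \<le> (?x\<^sup>2 + ?y\<^sup>2) / 2"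
          using sum_squares_bound[of "\<bar>?x\<bar>" "\<bar>?y\<bar>"] by (simp add: abs_mult)
      qed simp
      finally show ?thesis by (simp add: mult.assoc)
    qed
    moreover have "?y\<^sup>2 * (?\<gamma>\<^sup>2 + ?\<alpha>\<^sup>2 - 2 * ?\<beta>\<^sup>2) / 2 \<le> \<delta> * (2 * ?y\<^sup>2)"
    proof -
      have "(?\<gamma>\<^sup>2 + ?\<alpha>\<^sup>2 - 2 * ?\<beta>\<^sup>2) / 2 \<le> 2 * \<delta>"
        using abs_le_D1[OF abs_diff_square_le(1)[OF \<nu>(1) \<nu>(1) d(2)]]
          abs_le_D1[OF abs_diff_square_le(1)[OF \<nu>(1) \<nu>(1) d(3)]] by simp
      then have "?y\<^sup>2 * ((?\<gamma>\<^sup>2 + ?\<alpha>\<^sup>2 - 2 * ?\<beta>\<^sup>2) / 2) \<le> ?y\<^sup>2 * (2 * \<delta>)" by (rule mult_left_mono) simp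
      then show ?thesis by (simp add: mult_ac)
    qed
    moreover have "(?\<gamma> ^ 3 - ?\<beta> ^ 3) * (?z - ?y)\<^sup>2 / 2 \<le> \<delta> * (3 * ?z\<^sup>2 + 3 * ?y\<^sup>2)"
    proof -
      have "?\<gamma> ^ 3 - ?\<beta> ^ 3 \<le> 3 * \<delta>" using abs_diff_square_le(2)[OF \<nu>(1) \<nu>(1) d(2)] by linarith
      then have "(?\<gamma> ^ 3 - ?\<beta> ^ 3) * ((?z - ?y)\<^sup>2 / 2) \<le> (3 * \<delta>) * ((?z - ?y)\<^sup>2 / 2)" by (rule mult_right_mono) simp
      also have "\<dots> \<le> (3 * \<delta>) * (?z\<^sup>2 + ?y\<^sup>2)"
      proof (rule mult_left_mono)
        have "0 \<le> (?z + ?y)\<^sup>2" by simp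
        then show "(?z - ?y)\<^sup>2 / 2 \<le> ?z\<^sup>2 + ?y\<^sup>2" by (simp add: power2_eq_square algebra_simps)
      qed (use \<delta> in simp)
      finally show ?thesis by (simp add: algebra_simps)
    qed
    moreover have "(lw_scalar \<nu> w j)\<^sup>2 = ?y\<^sup>2 - ?\<beta>\<^sup>2 * (1 - ?\<beta>\<^sup>2) / 4 * (?z - 2 * ?y + ?x)\<^sup>2
      + (F (j + 1) - F j)
      + ((?\<beta> - ?\<alpha>) * ?x * ?y + ?y\<^sup>2 * (?\<gamma>\<^sup>2 + ?\<alpha>\<^sup>2 - 2 * ?\<beta>\<^sup>2) / 2 + (?\<gamma> ^ 3 - ?\<beta> ^ 3) * (?z - ?y)\<^sup>2 / 2)"
      unfolding lw_scalar_def lw_flux_identity[of ?y ?\<beta> ?z ?x ?\<gamma> ?\<alpha>] by (simp add: F_def)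
    moreover have "\<delta> * (?x\<^sup>2 / 2 + ?y\<^sup>2 * (11 / 2) + 3 * ?z\<^sup>2) = \<delta> * ((?x\<^sup>2 + ?y\<^sup>2) / 2) + \<delta> * (2 * ?y\<^sup>2) + \<delta> * (3 * ?z\<^sup>2 + 3 * ?y\<^sup>2)"
      by (simp add: field_simps)
    ultimately show ?thesis by linarith
  qed
  \<comment> \<open>One point beyond the support is included on either side, so that the end fluxes
    \<open>F (b + 2)\<close> and \<open>F (a - 1)\<close> see only zeros of
    \<open>w\<close>.\<close>
  have "(\<Sum>j\<in>{a + 1..b - 1}. (lw_scalar \<nu> w j)\<^sup>2) \<le> (\<Sum>j\<in>{a - 1..b + 1}. (lw_scalar \<nu> w j)\<^sup>2)"
    by (rule sum_mono2) auto
  also have "\<dots> \<le> (\<Sum>j\<in>{a - 1..b + 1}. (w j)\<^sup>2 + (F (j + 1) - F j) + \<delta> * ((w (j - 1))\<^sup>2 / 2 + (w j)\<^sup>2 * (11 / 2) + 3 * (w (j + 1))\<^sup>2))"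
    by (intro sum_mono point)
  also have "\<dots> = (\<Sum>j\<in>{a - 1..b + 1}. (w j)\<^sup>2) + (F (b + 2) - F (a - 1))
      + \<delta> * ((\<Sum>j\<in>{a - 1..b + 1}. (w (j - 1))\<^sup>2) / 2 + (\<Sum>j\<in>{a - 1..b + 1}. (w j)\<^sup>2) * (11 / 2)
          + 3 * (\<Sum>j\<in>{a - 1..b + 1}. (w (j + 1))\<^sup>2))"
    using True
    by (simp add: sum.distrib sum_telescope_int add.commute[of 2] flip: sum_distrib_left sum_distrib_right sum_divide_distrib)
  also have "F (b + 2) - F (a - 1) = 0" by (simp add: F_def w)
  also have "(\<Sum>j\<in>{a - 1..b + 1}. (w j)\<^sup>2) = (\<Sum>j\<in>{a..b}. (w j)\<^sup>2)"
    by (rule sum.mono_neutral_right) (auto simp: w)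
  also have "(\<Sum>j\<in>{a - 1..b + 1}. (w (j - 1))\<^sup>2) = (\<Sum>j\<in>{a - 2..b}. (w j)\<^sup>2)"
    by (rule sum.reindex_bij_witness[where i="\<lambda>j. j + 1" and j="\<lambda>j. j - 1"]) auto
  also have "\<dots> = (\<Sum>j\<in>{a..b}. (w j)\<^sup>2)"
    by (rule sum.mono_neutral_right) (auto simp: w)
  also have "(\<Sum>j\<in>{a - 1..b + 1}. (w (j + 1))\<^sup>2) = (\<Sum>j\<in>{a..b + 2}. (w j)\<^sup>2)"
    by (rule sum.reindex_bij_witness[where i="\<lambda>j. j - 1" and j="\<lambda>j. j + 1"]) auto
  also have "\<dots> = (\<Sum>j\<in>{a..b}. (w j)\<^sup>2)"
    by (rule sum.mono_neutral_right) (auto simp: w)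
  also have "\<delta> * ((\<Sum>j\<in>{a..b}. (w j)\<^sup>2) / 2 + (\<Sum>j\<in>{a..b}. (w j)\<^sup>2) * (11 / 2) + 3 * (\<Sum>j\<in>{a..b}. (w j)\<^sup>2)) 
      = 9 * \<delta> * (\<Sum>j\<in>{a..b}. (w j)\<^sup>2)" by (simp add: algebra_simps)
  finally show ?thesis by (simp add: algebra_simps)
qed

section \<open>The linearised system and its characteristic variables\<close>

definition lw_lin_dens where
  "lw_lin_dens r k V P f g j = f j - r / 2 * (V j * (f (j + 1) - f (j - 1)) + P j * (g (j + 1) - g (j - 1)))
     + r\<^sup>2 / 2 * (((V j)\<^sup>2 + k) * (f (j + 1) - 2 * f j + f (j - 1)) + 2 * P j * V j * (g (j + 1) - 2 * g j + g (j - 1)))"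
  for r k :: real and V P f g :: "int \<Rightarrow> real"

definition lw_lin_vel where
  "lw_lin_vel r k V Q f g j = g j - r / 2 * (k * Q j * (f (j + 1) - f (j - 1)) + V j * (g (j + 1) - g (j - 1)))
     + r\<^sup>2 / 2 * (2 * k * V j * Q j * (f (j + 1) - 2 * f j + f (j - 1)) + ((V j)\<^sup>2 + k) * (g (j + 1) - 2 * g j + g (j - 1)))"
  for r k :: real and V Q f g :: "int \<Rightarrow> real"

text \<open>\<open>c Q f \<plusminus> g\<close> are the characteristic variables, belonging to the eigenvalues \<open>V \<plusminus> c\<close>.\<close>

definition energy :: "real \<Rightarrow> (int \<Rightarrow> real) \<Rightarrow> (int \<Rightarrow> real) \<Rightarrow> (int \<Rightarrow> real) \<Rightarrow> int \<Rightarrow> real" where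
  "energy c Q f g j = (c * Q j * f j)\<^sup>2 + (g j)\<^sup>2"

lemma energy_nonneg: "0 \<le> energy c Q f g j"
  by (simp add: energy_def)

lemma characteristic_step:
  fixes c r \<sigma> :: real
  assumes "Q j * P j = 1" "\<sigma>\<^sup>2 = 1" "\<nu> = r * (V j + \<sigma> * c)"
  shows "c * Q j * lw_lin_dens r (c\<^sup>2) V P f g j + \<sigma> * lw_lin_vel r (c\<^sup>2) V Q f g j =
    (c * Q j * f j + \<sigma> * g j)
    - \<nu> / 2 * ((c * Q j * f (j + 1) + \<sigma> * g (j + 1)) - (c * Q j * f (j - 1) + \<sigma> * g (j - 1)))
    + \<nu>\<^sup>2 / 2 * ((c * Q j * f (j + 1) + \<sigma> * g (j + 1)) - 2 * (c * Q j * f j + \<sigma> * g j) + (c * Q j * f (j - 1) + \<sigma> * g (j - 1)))"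
  using assms unfolding lw_lin_dens_def lw_lin_vel_def by algebra

text \<open>Young's inequality with weight h: the principal part may grow by the factor 1 + h only,
  so the perturbation pays 1/h. This is the origin of \<open>K / h\<close> in
  \<open>energy_growth\<close>.\<close>

lemma square_add_le:
  fixes x y h :: real
  assumes "0 < h"
  shows "(x + y)\<^sup>2 \<le> (1 + h) * x\<^sup>2 + (1 + 1 / h) * y\<^sup>2"
proof -
  have "0 \<le> (h * x - y)\<^sup>2 / h" using assms by simp
  also have "\<dots> = h * x\<^sup>2 - 2 * x * y + 1 / h * y\<^sup>2"
    using assms by (simp add: field_simps power2_eq_square)
  finally show ?thesis by (simp add: power2_eq_square algebra_simps)
qed

lemma square_add4_le: "(x + y + z + w)\<^sup>2 \<le> 4 * (x\<^sup>2 + y\<^sup>2 + z\<^sup>2 + w\<^sup>2)" for x y z w :: real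
proof -
  have "0 \<le> (x - y)\<^sup>2 + (x - z)\<^sup>2 + (x - w)\<^sup>2 + (y - z)\<^sup>2 + (y - w)\<^sup>2 + (z - w)\<^sup>2" by simp
  then show ?thesis by (simp add: power2_eq_square algebra_simps)
qed

lemma sum_shift_le:
  fixes e :: "int \<Rightarrow> real"
  assumes "\<And>j. 0 \<le> e j"
  shows "(\<Sum>j\<in>{a + 1..b - 1}. e (j + 1)) \<le> (\<Sum>j\<in>{a..b}. e j)" "(\<Sum>j\<in>{a + 1..b - 1}. e (j - 1)) \<le> (\<Sum>j\<in>{a..b}. e j)"
    "(\<Sum>j\<in>{a + 1..b - 1}. e j) \<le> (\<Sum>j\<in>{a..b}. e j)"
proof -
  have "(\<Sum>j\<in>{a + 1..b - 1}. e (j + 1)) = (\<Sum>j\<in>{a + 2..b}. e j)"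
    by (rule sum.reindex_bij_witness[where i="\<lambda>j. j - 1" and j="\<lambda>j. j + 1"]) auto
  also have "\<dots> \<le> (\<Sum>j\<in>{a..b}. e j)" by (rule sum_mono2) (use assms in auto)
  finally show "(\<Sum>j\<in>{a + 1..b - 1}. e (j + 1)) \<le> (\<Sum>j\<in>{a..b}. e j)" .
  have "(\<Sum>j\<in>{a + 1..b - 1}. e (j - 1)) = (\<Sum>j\<in>{a..b - 2}. e j)"
    by (rule sum.reindex_bij_witness[where i="\<lambda>j. j + 1" and j="\<lambda>j. j - 1"]) auto
  also have "\<dots> \<le> (\<Sum>j\<in>{a..b}. e j)" by (rule sum_mono2) (use assms in auto)
  finally show "(\<Sum>j\<in>{a + 1..b - 1}. e (j - 1)) \<le> (\<Sum>j\<in>{a..b}. e j)" .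
  show "(\<Sum>j\<in>{a + 1..b - 1}. e j) \<le> (\<Sum>j\<in>{a..b}. e j)" by (rule sum_mono2) (use assms in auto)
qed

definition coeffs_ok where
  "coeffs_ok c q q' B h a b P Q V \<longleftrightarrow>
     (\<forall>j\<in>{a..b}. Q j * P j = 1 \<and> q \<le> \<bar>c * Q j\<bar> \<and> \<bar>c * Q j\<bar> \<le> q' \<and> \<bar>V j\<bar> \<le> c) \<and>
     (\<forall>j\<in>{a..b - 1}. \<bar>V (j + 1) - V j\<bar> \<le> B * h \<and> \<bar>Q (j + 1) - Q j\<bar> \<le> B * h)"
  for c q q' B h :: real and a b :: int and P Q V :: "int \<Rightarrow> real"

text \<open>In the step at j the neighbouring values occur as c Q_j f_(j+1), whereas the
  characteristic variable there contains Q_(j+1). The mismatch is O(h) relative to f; together with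
  the residuals it forms the perturbation \<open>\<rho>\<close> of a scalar step.\<close>

lemma characteristic_energy:
  fixes c r q q' B h H \<sigma> :: real
  assumes c: "0 < c" and r: "0 < r" "2 * r * c \<le> 1" and q: "0 < q" and B: "0 \<le> B" and h: "0 < h" "h \<le> H"
    and ok: "coeffs_ok c q q' B h a b P Q V" and \<sigma>: "\<sigma> = 1 \<or> \<sigma> = -1"
    and f': "\<And>j. j \<in> {a + 1..b - 1} \<Longrightarrow> f' j = lw_lin_dens r (c\<^sup>2) V P f g j + R j"
    and g': "\<And>j. j \<in> {a + 1..b - 1} \<Longrightarrow> g' j = lw_lin_vel r (c\<^sup>2) V Q f g j + S j"
  shows "(\<Sum>j\<in>{a + 1..b - 1}. (c * Q j * f' j + \<sigma> * g' j)\<^sup>2) \<le>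
    (1 + h) * (1 + 9 * (r * B * h)) * (\<Sum>j\<in>{a..b}. (c * Q j * f j + \<sigma> * g j)\<^sup>2)
    + (1 + 1 / h) * (8 * (c * B * h / q)\<^sup>2 * (\<Sum>j\<in>{a..b}. energy c Q f g j)
        + 4 * (q'\<^sup>2 + 1) * (\<Sum>j\<in>{a + 1..b - 1}. (R j)\<^sup>2 + (S j)\<^sup>2))"
proof (cases "a \<le> b")
  case False
  then show ?thesis by simp
next
  case True
  \<comment> \<open>The scalar estimate asks for bounds on \<open>\<nu>\<close> at all integers;
    clamping the index extends the coefficients by their boundary values without enlarging
    increments.\<close>
  define cl where "cl j = max a (min b j)" for j
  define \<nu> where "\<nu> j = r * (V (cl j) + \<sigma> * c)" for j
  define w where "w j = (if j \<in> {a..b} then c * Q j * f j + \<sigma> * g j else 0)" for j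
  have coef: "Q j * P j = 1" "q \<le> \<bar>c * Q j\<bar>" "\<bar>c * Q j\<bar> \<le> q'" "\<bar>V j\<bar> \<le> c" if "j \<in> {a..b}" for j
    using ok that by (auto simp: coeffs_ok_def)
  have dV: "\<bar>V (j + 1) - V j\<bar> \<le> B * h" and dQ: "\<bar>Q (j + 1) - Q j\<bar> \<le> B * h" if "a \<le> j" "j < b" for j
    using ok that by (auto simp: coeffs_ok_def)
  have cl: "cl j \<in> {a..b}" for j using True by (auto simp: cl_def)
  have \<nu>1: "\<bar>\<nu> j\<bar> \<le> 1" for j
  proof -
    have "\<bar>V (cl j) + \<sigma> * c\<bar> \<le> 2 * c" using abs_le_D1[OF coef(4)[OF cl[of j]]] abs_le_D2[OF coef(4)[OF cl[of j]]] \<sigma> c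
      by (auto simp: abs_le_iff)
    then have "r * \<bar>V (cl j) + \<sigma> * c\<bar> \<le> r * (2 * c)" using r by (intro mult_left_mono) auto
    also have "\<dots> \<le> 1" using r(2) by (simp add: mult_ac)
    finally show ?thesis using r(1) by (simp add: \<nu>_def abs_mult)
  qed
  have \<nu>2: "\<bar>\<nu> (j + 1) - \<nu> j\<bar> \<le> r * B * h" for j
  proof -
    have "\<bar>V (cl (j + 1)) - V (cl j)\<bar> \<le> B * h"
    proof (cases "a \<le> j \<and> j < b")
      case True
      then have "cl (j + 1) = j + 1" "cl j = j" by (auto simp: cl_def)
      then show ?thesis using dV[of j] True by simp
    next
      case out: False
      then have "cl (j + 1) = cl j" using True by (auto simp: cl_def)
      then show ?thesis using B h by simp
    qed
    then have "r * \<bar>V (cl (j + 1)) - V (cl j)\<bar> \<le> r * (B * h)" using r by (intro mult_left_mono) auto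
    then show ?thesis using r(1) by (simp add: \<nu>_def abs_mult mult.assoc flip: right_diff_distrib)
  qed
  define \<rho> where "\<rho> j = ((\<nu> j)\<^sup>2 / 2 - \<nu> j / 2) * (c * (Q j - Q (j + 1))) * f (j + 1)
    + ((\<nu> j)\<^sup>2 / 2 + \<nu> j / 2) * (c * (Q j - Q (j - 1))) * f (j - 1) + c * Q j * R j + \<sigma> * S j" for j
  let ?I = "{a + 1..b - 1}"
  let ?e = "energy c Q f g"
  have step: "c * Q j * f' j + \<sigma> * g' j = lw_scalar \<nu> w j + \<rho> j" if j: "j \<in> ?I" for j
  proof -
    have "cl j = j" "j \<in> {a..b}" using j by (auto simp: cl_def)
    then have "c * Q j * lw_lin_dens r (c\<^sup>2) V P f g j + \<sigma> * lw_lin_vel r (c\<^sup>2) V Q f g j =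
      (c * Q j * f j + \<sigma> * g j)
      - \<nu> j / 2 * ((c * Q j * f (j + 1) + \<sigma> * g (j + 1)) - (c * Q j * f (j - 1) + \<sigma> * g (j - 1)))
      + (\<nu> j)\<^sup>2 / 2 * ((c * Q j * f (j + 1) + \<sigma> * g (j + 1)) - 2 * (c * Q j * f j + \<sigma> * g j) + (c * Q j * f (j - 1) + \<sigma> * g (j - 1)))"
      using \<sigma> by (intro characteristic_step coef(1)) (auto simp: \<nu>_def)
    moreover have "w (j + 1) = c * Q (j + 1) * f (j + 1) + \<sigma> * g (j + 1)"
      "w (j - 1) = c * Q (j - 1) * f (j - 1) + \<sigma> * g (j - 1)" "w j = c * Q j * f j + \<sigma> * g j"
      using j by (auto simp: w_def)
    ultimately show ?thesis
      unfolding f'[OF j] g'[OF j] lw_scalar_def \<rho>_def by (simp add: algebra_simps)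
  qed
  have f_le: "(f j)\<^sup>2 \<le> ?e j / q\<^sup>2" if "j \<in> {a..b}" for j
  proof -
    have "q\<^sup>2 \<le> (c * Q j)\<^sup>2" using coef(2)[OF that] q by (simp add: abs_le_square_iff[symmetric])
    then have "q\<^sup>2 * (f j)\<^sup>2 \<le> (c * Q j)\<^sup>2 * (f j)\<^sup>2" by (intro mult_right_mono) auto
    also have "\<dots> \<le> ?e j" by (simp add: energy_def power_mult_distrib)
    finally show ?thesis using q by (simp add: pos_le_divide_eq mult.commute)
  qed
  \<comment> \<open>The 4 counts the summands of \<open>\<rho>\<close>; adding the sums over left
    and right neighbours later turns it into 8.\<close>
  have \<rho>_le: "(\<rho> j)\<^sup>2 \<le> 4 * (c * B * h / q)\<^sup>2 * (?e (j + 1) + ?e (j - 1)) + 4 * (q'\<^sup>2 + 1) * ((R j)\<^sup>2 + (S j)\<^sup>2)"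
    if j: "j \<in> ?I" for j
  proof -
    have nb: "\<bar>(\<nu> j)\<^sup>2 / 2 + s * (\<nu> j / 2)\<bar> \<le> 1" if "\<bar>s\<bar> = 1" for s
    proof -
      have "(\<nu> j)\<^sup>2 \<le> 1" using \<nu>1[of j] by (simp add: abs_square_le_1)
      moreover have "\<bar>s * (\<nu> j / 2)\<bar> \<le> 1 / 2" using \<nu>1[of j] that by (simp add: abs_mult)
      moreover have "0 \<le> (\<nu> j)\<^sup>2" by simp
      ultimately show ?thesis by linarith
    qed
    have sq: "(k * (c * d) * y)\<^sup>2 \<le> (c * B * h / q)\<^sup>2 * ?e i"
      if "\<bar>k\<bar> \<le> 1" "\<bar>d\<bar> \<le> B * h" "y\<^sup>2 \<le> ?e i / q\<^sup>2" for k d y i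
    proof -
      have "\<bar>k\<bar> * (c * \<bar>d\<bar>) \<le> 1 * (c * (B * h))" using that c by (intro mult_mono mult_left_mono) auto
      then have "\<bar>k * (c * d)\<bar> \<le> \<bar>c * B * h\<bar>" using c B h by (simp add: abs_mult mult.assoc)
      then have "(k * (c * d))\<^sup>2 \<le> (c * B * h)\<^sup>2" by (simp only: abs_le_square_iff)
      then have "(k * (c * d))\<^sup>2 * y\<^sup>2 \<le> (c * B * h)\<^sup>2 * (?e i / q\<^sup>2)"
        using that(3) by (intro mult_mono) auto
      then show ?thesis by (simp only: power_mult_distrib[of _ y] power_divide times_divide_eq_right times_divide_eq_left)
    qed
    have "(\<rho> j)\<^sup>2 \<le> 4 * ((((\<nu> j)\<^sup>2 / 2 - \<nu> j / 2) * (c * (Q j - Q (j + 1))) * f (j + 1))\<^sup>2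
        + (((\<nu> j)\<^sup>2 / 2 + \<nu> j / 2) * (c * (Q j - Q (j - 1))) * f (j - 1))\<^sup>2 + (c * Q j * R j)\<^sup>2 + (\<sigma> * S j)\<^sup>2)"
      unfolding \<rho>_def by (rule square_add4_le)
    moreover have "(((\<nu> j)\<^sup>2 / 2 - \<nu> j / 2) * (c * (Q j - Q (j + 1))) * f (j + 1))\<^sup>2 \<le> (c * B * h / q)\<^sup>2 * ?e (j + 1)"
      using nb[of "-1"] dQ[of j] f_le[of "j + 1"] j by (intro sq) (auto simp: abs_minus_commute)
    moreover have "(((\<nu> j)\<^sup>2 / 2 + \<nu> j / 2) * (c * (Q j - Q (j - 1))) * f (j - 1))\<^sup>2 \<le> (c * B * h / q)\<^sup>2 * ?e (j - 1)"
      using nb[of 1] dQ[of "j - 1"] f_le[of "j - 1"] j by (intro sq) auto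
    moreover have "(c * Q j * R j)\<^sup>2 \<le> q'\<^sup>2 * (R j)\<^sup>2"
    proof -
      have "(c * Q j)\<^sup>2 \<le> q'\<^sup>2"
        using coef(3)[of j] j by (subst abs_le_square_iff[symmetric]) auto
      then show ?thesis by (simp only: power_mult_distrib[of _ "R j"]) (rule mult_right_mono, auto)
    qed
    moreover have "(\<sigma> * S j)\<^sup>2 = (S j)\<^sup>2" using \<sigma> by auto
    moreover have "0 \<le> q'\<^sup>2 * (S j)\<^sup>2" by simp
    moreover have "0 \<le> (R j)\<^sup>2" by simp
    ultimately show ?thesis unfolding distrib_left distrib_right mult_1 mult_1_right mult.assoc by linarith
  qed
  have "(\<Sum>j\<in>?I. (c * Q j * f' j + \<sigma> * g' j)\<^sup>2) = (\<Sum>j\<in>?I. (lw_scalar \<nu> w j + \<rho> j)\<^sup>2)"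
    by (simp add: step)
  also have "\<dots> \<le> (\<Sum>j\<in>?I. (1 + h) * (lw_scalar \<nu> w j)\<^sup>2 + (1 + 1 / h) * (\<rho> j)\<^sup>2)"
    by (intro sum_mono square_add_le h)
  also have "\<dots> = (1 + h) * (\<Sum>j\<in>?I. (lw_scalar \<nu> w j)\<^sup>2) + (1 + 1 / h) * (\<Sum>j\<in>?I. (\<rho> j)\<^sup>2)"
    by (simp only: sum.distrib sum_distrib_left)
  also have "\<dots> \<le> (1 + h) * ((1 + 9 * (r * B * h)) * (\<Sum>j\<in>{a..b}. (w j)\<^sup>2))
      + (1 + 1 / h) * (\<Sum>j\<in>?I. 4 * (c * B * h / q)\<^sup>2 * (?e (j + 1) + ?e (j - 1)) + 4 * (q'\<^sup>2 + 1) * ((R j)\<^sup>2 + (S j)\<^sup>2))"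
    using h by (intro add_mono mult_left_mono sum_mono \<rho>_le lw_scalar_energy \<nu>1 \<nu>2) (auto simp: w_def)
  also have "(\<Sum>j\<in>{a..b}. (w j)\<^sup>2) = (\<Sum>j\<in>{a..b}. (c * Q j * f j + \<sigma> * g j)\<^sup>2)"
    by (rule sum.cong) (auto simp: w_def)
  also have "(\<Sum>j\<in>?I. 4 * (c * B * h / q)\<^sup>2 * (?e (j + 1) + ?e (j - 1)) + 4 * (q'\<^sup>2 + 1) * ((R j)\<^sup>2 + (S j)\<^sup>2))
      = 4 * (c * B * h / q)\<^sup>2 * ((\<Sum>j\<in>?I. ?e (j + 1)) + (\<Sum>j\<in>?I. ?e (j - 1))) + 4 * (q'\<^sup>2 + 1) * (\<Sum>j\<in>?I. (R j)\<^sup>2 + (S j)\<^sup>2)"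
    by (simp only: sum.distrib sum_distrib_left[symmetric])
  also have "(1 + h) * ((1 + 9 * (r * B * h)) * (\<Sum>j\<in>{a..b}. (c * Q j * f j + \<sigma> * g j)\<^sup>2))
      + (1 + 1 / h) * (4 * (c * B * h / q)\<^sup>2 * ((\<Sum>j\<in>?I. ?e (j + 1)) + (\<Sum>j\<in>?I. ?e (j - 1))) + 4 * (q'\<^sup>2 + 1) * (\<Sum>j\<in>?I. (R j)\<^sup>2 + (S j)\<^sup>2))
      \<le> (1 + h) * ((1 + 9 * (r * B * h)) * (\<Sum>j\<in>{a..b}. (c * Q j * f j + \<sigma> * g j)\<^sup>2))
      + (1 + 1 / h) * (4 * (c * B * h / q)\<^sup>2 * ((\<Sum>j\<in>{a..b}. ?e j) + (\<Sum>j\<in>{a..b}. ?e j)) + 4 * (q'\<^sup>2 + 1) * (\<Sum>j\<in>?I. (R j)\<^sup>2 + (S j)\<^sup>2))"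
    using h by (intro add_left_mono mult_left_mono add_right_mono add_mono sum_shift_le energy_nonneg) auto
  finally show ?thesis by (simp add: mult.assoc)
qed

text \<open>One \<open>K\<close> serves all step sizes, windows and data. \<open>Q'\<close> is the
  reciprocal density at the new time level, by which the new energy is measured; \<open>R\<close>
  and \<open>S\<close> are residuals of the linearised step.\<close>

definition energy_growth where
  "energy_growth c r q q' B H K \<longleftrightarrow>
     (\<forall>h a b P Q Q' V f g f' g' R S. 0 < h \<longrightarrow> h \<le> H \<longrightarrow> coeffs_ok c q q' B h a b P Q V \<longrightarrow>
        (\<forall>j\<in>{a + 1..b - 1}. \<bar>Q' j - Q j\<bar> \<le> B * h \<and>
           f' j = lw_lin_dens r (c\<^sup>2) V P f g j + R j \<and> g' j = lw_lin_vel r (c\<^sup>2) V Q f g j + S j) \<longrightarrow>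
        (\<Sum>j\<in>{a + 1..b - 1}. energy c Q' f' g' j) \<le>
          (1 + K * h) * (\<Sum>j\<in>{a..b}. energy c Q f g j) + K / h * (\<Sum>j\<in>{a + 1..b - 1}. (R j)\<^sup>2 + (S j)\<^sup>2))"

lemma energy_growthD:
  assumes "energy_growth c r q q' B H K" "0 < h" "h \<le> H" "coeffs_ok c q q' B h a b P Q V"
    and "\<And>j. j \<in> {a + 1..b - 1} \<Longrightarrow> \<bar>Q' j - Q j\<bar> \<le> B * h"
    and "\<And>j. j \<in> {a + 1..b - 1} \<Longrightarrow> f' j = lw_lin_dens r (c\<^sup>2) V P f g j + R j"
    and "\<And>j. j \<in> {a + 1..b - 1} \<Longrightarrow> g' j = lw_lin_vel r (c\<^sup>2) V Q f g j + S j"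
  shows "(\<Sum>j\<in>{a + 1..b - 1}. energy c Q' f' g' j) \<le>
        (1 + K * h) * (\<Sum>j\<in>{a..b}. energy c Q f g j) + K / h * (\<Sum>j\<in>{a + 1..b - 1}. (R j)\<^sup>2 + (S j)\<^sup>2)"
  using assms(1)[unfolded energy_growth_def, rule_format, OF assms(2-4), of Q' f' f g R g' S] assms(5-7) by blast

text \<open>The estimates for both characteristic families add up to twice the energy by the
  parallelogram identity. Passing from \<open>Q\<close> to \<open>Q'\<close> costs another factor 1
  + O(h).\<close>

lemma energy_step:
  fixes c r q q' B H :: real
  assumes c: "0 < c" and r: "0 < r" "2 * r * c \<le> 1" and q: "0 < q" and B: "0 \<le> B" and H: "0 < H"
  shows "\<exists>K\<ge>0. energy_growth c r q q' B H K"
proof -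
  \<comment> \<open>\<open>A\<close> is the growth rate with \<open>Q\<close> kept fixed: the
    product (1 + h) (1 + 9 r B h) and the mismatch of neighbouring \<open>Q\<close>.
    \<open>G\<close> is the price of the residuals, and \<open>b\<close> comes from (1 + c B h /
    q)^2 \<le> 1 + b h in the change to \<open>Q'\<close>.\<close>
  define A where "A = 1 + 9 * r * B + 9 * r * B * H + 8 * (c * B / q)\<^sup>2 * (1 + H)"
  define G where "G = 4 * (q'\<^sup>2 + 1) * (1 + H)"
  define b where "b = 2 * (c * B / q) + (c * B / q)\<^sup>2 * H"
  have pos: "0 \<le> A" "0 \<le> G" "0 \<le> b"
    using c r q B H by (simp_all add: A_def G_def b_def)
  define K where "K = (A + b + A * b * H) + (1 + b * H) * G"
  have "0 \<le> K" using pos H by (simp add: K_def)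
  have main: "(\<Sum>j\<in>{a + 1..b' - 1}. energy c Q' f' g' j) \<le>
        (1 + K * h) * (\<Sum>j\<in>{a..b'}. energy c Q f g j) + K / h * (\<Sum>j\<in>{a + 1..b' - 1}. (R j)\<^sup>2 + (S j)\<^sup>2)"
    if h: "0 < h" "h \<le> H" and ok: "coeffs_ok c q q' B h a b' P Q V"
      and dQ: "\<And>j. j \<in> {a + 1..b' - 1} \<Longrightarrow> \<bar>Q' j - Q j\<bar> \<le> B * h"
      and f': "\<And>j. j \<in> {a + 1..b' - 1} \<Longrightarrow> f' j = lw_lin_dens r (c\<^sup>2) V P f g j + R j"
      and g': "\<And>j. j \<in> {a + 1..b' - 1} \<Longrightarrow> g' j = lw_lin_vel r (c\<^sup>2) V Q f g j + S j"
    for h a b' P Q Q' V f g f' g' R S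
  proof -
    let ?I = "{a + 1..b' - 1}"
    define E where "E = (\<Sum>j\<in>{a..b'}. energy c Q f g j)"
    define N where "N = (\<Sum>j\<in>?I. (R j)\<^sup>2 + (S j)\<^sup>2)"
    define X where "X = (\<Sum>j\<in>?I. energy c Q f' g' j)"
    have E0: "0 \<le> E" and N0: "0 \<le> N" and X0: "0 \<le> X"
      by (auto simp: E_def N_def X_def intro!: sum_nonneg energy_nonneg)
    have par: "(c * Q j * x + 1 * y)\<^sup>2 + (c * Q j * x + (-1) * y)\<^sup>2 = 2 * ((c * Q j * x)\<^sup>2 + y\<^sup>2)" for j x y
      by (simp add: power2_eq_square algebra_simps)
    have two: "(\<Sum>j\<in>J. (c * Q j * x j + 1 * y j)\<^sup>2) + (\<Sum>j\<in>J. (c * Q j * x j + (-1) * y j)\<^sup>2) = 2 * (\<Sum>j\<in>J. energy c Q x y j)" for x y J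
      unfolding sum.distrib[symmetric] par by (simp add: energy_def sum_distrib_left)
    note ce = characteristic_energy[OF c r q B h ok _ f' g']
    define \<alpha> where "\<alpha> = (1 + h) * (1 + 9 * (r * B * h))"
    define Z where "Z = (1 + 1 / h) * (8 * (c * B * h / q)\<^sup>2 * E + 4 * (q'\<^sup>2 + 1) * N)"
    note ce' = ce[folded E_def N_def, folded Z_def, folded \<alpha>_def]
    let ?E = "\<lambda>\<sigma>. \<Sum>j\<in>{a..b'}. (c * Q j * f j + \<sigma> * g j)\<^sup>2"
    have "2 * X \<le> (\<alpha> * ?E 1 + Z) + (\<alpha> * ?E (-1) + Z)"
      unfolding X_def two[symmetric] by (intro add_mono ce') simp_all
    also have "\<dots> = \<alpha> * (?E 1 + ?E (-1)) + 2 * Z" by (simp only: distrib_left mult_2 ac_simps)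
    also have "?E 1 + ?E (-1) = 2 * E" unfolding E_def by (rule two)
    finally have "X \<le> \<alpha> * E + Z" by linarith
    also have "\<dots> = ((1 + h) * (1 + 9 * (r * B * h)) + (1 + 1 / h) * (8 * (c * B * h / q)\<^sup>2)) * E + (1 + 1 / h) * (4 * (q'\<^sup>2 + 1)) * N"
      by (simp add: \<alpha>_def Z_def distrib_left distrib_right mult.assoc)
    also have "\<dots> \<le> (1 + A * h) * E + G / h * N"
    proof (rule add_mono[OF mult_right_mono[OF _ E0] mult_right_mono[OF _ N0]])
      have "(c * B * h / q)\<^sup>2 = (c * B / q)\<^sup>2 * h\<^sup>2" by (simp add: power_mult_distrib power_divide)
      then have "(1 + 1 / h) * (8 * (c * B * h / q)\<^sup>2) = 8 * (c * B / q)\<^sup>2 * ((1 + 1 / h) * h\<^sup>2)"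
        by (simp only: ac_simps)
      also have "(1 + 1 / h) * h\<^sup>2 = (1 + h) * h" using h(1) by (simp add: field_simps power2_eq_square)
      also have "8 * (c * B / q)\<^sup>2 * ((1 + h) * h) \<le> 8 * (c * B / q)\<^sup>2 * ((1 + H) * h)"
        using h by (intro mult_left_mono mult_right_mono) auto
      finally have 1: "(1 + 1 / h) * (8 * (c * B * h / q)\<^sup>2) \<le> 8 * (c * B / q)\<^sup>2 * (1 + H) * h" by (simp add: mult.assoc)
      have "9 * r * B * h * h \<le> 9 * r * B * H * h"
        using h r B by (intro mult_right_mono mult_left_mono) auto
      then have "(1 + h) * (1 + 9 * (r * B * h)) \<le> 1 + (1 + 9 * r * B + 9 * r * B * H) * h"
        by (simp add: algebra_simps)
      with 1 show "(1 + h) * (1 + 9 * (r * B * h)) + (1 + 1 / h) * (8 * (c * B * h / q)\<^sup>2) \<le> 1 + A * h"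
        unfolding A_def by (simp add: distrib_right)
      have "(1 + 1 / h) = (1 + h) / h" using h(1) by (simp add: field_simps)
      also have "\<dots> \<le> (1 + H) / h" using h by (intro divide_right_mono) auto
      finally have "(1 + 1 / h) * (4 * (q'\<^sup>2 + 1)) \<le> (1 + H) / h * (4 * (q'\<^sup>2 + 1))" by (intro mult_right_mono) auto
      then show "(1 + 1 / h) * (4 * (q'\<^sup>2 + 1)) \<le> G / h" by (simp add: G_def mult_ac)
    qed
    finally have X_le: "X \<le> (1 + A * h) * E + G / h * N" .
    have "(\<Sum>j\<in>?I. energy c Q' f' g' j) \<le> (\<Sum>j\<in>?I. (1 + b * h) * energy c Q f' g' j)"
    proof (rule sum_mono)
      fix j assume j: "j \<in> ?I"
      then have cQ: "q \<le> \<bar>c * Q j\<bar>" using ok by (auto simp: coeffs_ok_def)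
      have "\<bar>c * Q' j\<bar> \<le> \<bar>c * Q j\<bar> + c * (B * h)"
      proof -
        have "c * \<bar>Q' j - Q j\<bar> \<le> c * (B * h)" using dQ[OF j] c by (intro mult_left_mono) auto
        moreover have "\<bar>c * Q' j\<bar> \<le> \<bar>c * Q j\<bar> + c * \<bar>Q' j - Q j\<bar>"
          using mult_left_mono[of "\<bar>Q' j\<bar>" "\<bar>Q j\<bar> + \<bar>Q' j - Q j\<bar>" c] c by (simp add: abs_mult distrib_left)
        ultimately show ?thesis by linarith
      qed
      \<comment> \<open>The absolute change of the weight becomes a relative one through the lower
        bound \<open>q\<close>.\<close>
      also have "c * (B * h) \<le> c * (B * h) * (\<bar>c * Q j\<bar> / q)"
        using mult_left_mono[of 1 "\<bar>c * Q j\<bar> / q" "c * (B * h)"] cQ q c B h by simp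
      finally have "\<bar>c * Q' j\<bar> \<le> (1 + c * B / q * h) * \<bar>c * Q j\<bar>" by (simp add: algebra_simps)
      then have "\<bar>c * Q' j\<bar>\<^sup>2 \<le> ((1 + c * B / q * h) * \<bar>c * Q j\<bar>)\<^sup>2" by (intro power_mono) auto
      also have "\<dots> = (1 + c * B / q * h)\<^sup>2 * (c * Q j)\<^sup>2" by (simp only: power_mult_distrib power2_abs)
      also have "\<dots> \<le> (1 + b * h) * (c * Q j)\<^sup>2"
      proof (rule mult_right_mono)
        have "(c * B / q)\<^sup>2 * h * h \<le> (c * B / q)\<^sup>2 * H * h" using h by (intro mult_right_mono mult_left_mono) auto
        then show "(1 + c * B / q * h)\<^sup>2 \<le> 1 + b * h" unfolding b_def by (simp add: power2_eq_square algebra_simps)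
      qed simp
      finally have 1: "(c * Q' j)\<^sup>2 \<le> (1 + b * h) * (c * Q j)\<^sup>2" by (simp only: power2_abs)
      have "(c * Q' j)\<^sup>2 * (f' j)\<^sup>2 \<le> (1 + b * h) * (c * Q j)\<^sup>2 * (f' j)\<^sup>2" using 1 by (rule mult_right_mono) simp
      moreover have "1 * (g' j)\<^sup>2 \<le> (1 + b * h) * (g' j)\<^sup>2" using pos h by (intro mult_right_mono) auto
      ultimately show "energy c Q' f' g' j \<le> (1 + b * h) * energy c Q f' g' j"
        unfolding energy_def power_mult_distrib[of "c * _"] by (simp add: distrib_left mult.assoc)
    qed
    also have "\<dots> = (1 + b * h) * X" by (simp add: X_def sum_distrib_left)
    also have "\<dots> \<le> (1 + b * h) * ((1 + A * h) * E + G / h * N)"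
      using pos h by (intro mult_left_mono X_le) auto
    also have "\<dots> = (1 + b * h) * (1 + A * h) * E + (1 + b * h) * G / h * N" by (simp add: algebra_simps)
    also have "\<dots> \<le> (1 + K * h) * E + K / h * N"
    proof (rule add_mono[OF mult_right_mono[OF _ E0] mult_right_mono[OF _ N0]])
      have "A * b * h * h \<le> A * b * H * h" using pos h by (intro mult_right_mono mult_left_mono) auto
      moreover have "0 \<le> (1 + b * H) * G * h" using pos h H by simp
      ultimately show "(1 + b * h) * (1 + A * h) \<le> 1 + K * h"
        unfolding K_def by (simp add: algebra_simps)
      have "b * h \<le> b * H" using pos h by (intro mult_left_mono) auto
      then have "(1 + b * h) * G \<le> (1 + b * H) * G" using pos by (intro mult_right_mono) auto
      also have "\<dots> \<le> K" using pos H by (simp add: K_def)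
      finally show "(1 + b * h) * G / h \<le> K / h" using h by (intro divide_right_mono) auto
    qed
    finally show ?thesis by (simp add: E_def N_def)
  qed
  show ?thesis
    unfolding energy_growth_def by (intro exI[of _ K] conjI allI impI \<open>0 \<le> K\<close> main) auto
qed

section \<open>Taylor expansion and truncation error\<close>

lemma taylor_quadratic:
  fixes F :: "real \<Rightarrow> real"
  assumes "convex S" "w \<in> S" "z \<in> S"
    and "\<And>y. y \<in> S \<Longrightarrow> (F has_real_derivative F' y) (at y within S)"
    and "\<And>y. y \<in> S \<Longrightarrow> (F' has_real_derivative F'' y) (at y within S)"
    and "\<And>y. y \<in> S \<Longrightarrow> (F'' has_real_derivative F''' y) (at y within S)"
    and "\<And>y. y \<in> S \<Longrightarrow> \<bar>F''' y\<bar> \<le> M"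
  shows "\<bar>F z - F w - (z - w) * F' w - (z - w)\<^sup>2 / 2 * F'' w\<bar> \<le> M * \<bar>z - w\<bar> ^ 3"
proof -
  define f where "f i = (if i = 0 then F else if i = 1 then F' else if i = 2 then F'' else F''')" for i :: nat
  have 1: "norm (f 0 z - (\<Sum>i\<le>2. f i w * (z - w) ^ i / fact i)) \<le> M * norm (z - w) ^ Suc 2 / fact 2"
  proof (rule field_Taylor[OF assms(1)])
    show "(f i has_field_derivative f (Suc i) x) (at x within S)" if "x \<in> S" "i \<le> 2" for i x
    proof -
      from that(2) consider "i = 0" | "i = 1" | "i = 2" by linarith
      then show ?thesis using assms(4-6) that(1) by cases (simp_all add: f_def)
    qed
  qed (use assms in \<open>auto simp: f_def\<close>)
  have 2: "f 0 z - (\<Sum>i\<le>2. f i w * (z - w) ^ i / fact i)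
      = F z - F w - (z - w) * F' w - (z - w)\<^sup>2 / 2 * F'' w"
    by (simp add: f_def numeral_2_eq_2)
  have 3: "M * norm (z - w) ^ Suc 2 / fact 2 \<le> M * \<bar>z - w\<bar> ^ 3"
  proof -
    have "0 \<le> M" using assms(7)[OF assms(2)] by linarith
    then have "0 \<le> M * \<bar>z - w\<bar> ^ 3" by simp
    then show ?thesis by (simp add: eval_nat_numeral)
  qed
  show ?thesis using order_trans[OF 1 3] unfolding 2 real_norm_def .
qed

section \<open>Taylor remainders and their increments\<close>

context rectangle
begin

definition rest_x where
  "rest_x f t x y = f t y - f t x - (y - x) * dx L f t x - (y - x)\<^sup>2 / 2 * dx L (dx L f) t x"

definition rest_t where
  "rest_t f t s x = f s x - f t x - (s - t) * dt T f t x - (s - t)\<^sup>2 / 2 * dt T (dt T f) t x"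

text \<open>For the second bound Taylor's formula is applied to the increment f (y + d) - f y, whose
  third derivative is at most a multiple of d because that of f is Lipschitz. This gives the extra
  power of the mesh width required by \<open>ord\<close>.\<close>

lemma rest_x_bounds:
  fixes f :: "real \<Rightarrow> real \<Rightarrow> real"
  assumes f: "smooth f"
  obtains M where "0 \<le> M"
    "\<And>t x y. \<lbrakk>t \<in> {0..T}; x \<in> {0..L}; y \<in> {0..L}\<rbrakk> \<Longrightarrow> \<bar>rest_x f t x y\<bar> \<le> M * \<bar>y - x\<bar> ^ 3"
    "\<And>t x y d. \<lbrakk>t \<in> {0..T}; 0 \<le> d; x \<in> {0..L - d}; y \<in> {0..L - d}\<rbrakk>
       \<Longrightarrow> \<bar>rest_x f t (x + d) (y + d) - rest_x f t x y\<bar> \<le> M * d * \<bar>y - x\<bar> ^ 3"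
proof -
  let ?f1 = "dx L f" and ?f2 = "dx L (dx L f)" and ?f3 = "dx L (dx L (dx L f))"
  note s = f smooth_dx[OF f] smooth_dx[OF smooth_dx[OF f]] smooth_dx[OF smooth_dx[OF smooth_dx[OF f]]]
  note d = DERIV_dx[OF s(1)] DERIV_dx[OF s(2)] DERIV_dx[OF s(3)]
  obtain M1 where M1: "0 \<le> M1" "\<And>t x. \<lbrakk>t \<in> {0..T}; x \<in> {0..L}\<rbrakk> \<Longrightarrow> \<bar>?f3 t x\<bar> \<le> M1"
    using smooth_bounded[OF s(4)] by blast
  obtain M2 where M2: "0 \<le> M2"
    "\<And>t x y. \<lbrakk>t \<in> {0..T}; x \<in> {0..L}; y \<in> {0..L}\<rbrakk> \<Longrightarrow> \<bar>?f3 t y - ?f3 t x\<bar> \<le> M2 * \<bar>y - x\<bar>"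
    using smooth_lipschitz_x[OF s(4)] by blast
  have sh: "((\<lambda>y. g t (y + e)) has_real_derivative g' t (y + e)) (at y within {0..L - e})"
    if "\<And>y. y \<in> {0..L} \<Longrightarrow> (g t has_real_derivative g' t y) (at y within {0..L})" "0 \<le> e" "y \<in> {0..L - e}"
    for g g' :: "real \<Rightarrow> real \<Rightarrow> real" and t e y
  proof -
    have "(g t has_real_derivative g' t (y + e)) (at (y + e) within (\<lambda>y. y + e) ` {0..L - e})"
      by (rule DERIV_subset[OF that(1)]) (use that in auto)
    moreover have "((\<lambda>y. y + e) has_real_derivative 1) (at y within {0..L - e})"
      by (auto intro!: derivative_eq_intros)
    ultimately show ?thesis using DERIV_image_chain[of "g t" "g' t (y + e)" "\<lambda>y. y + e" y "{0..L - e}" 1]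
      by (simp add: o_def)
  qed
  show ?thesis
  proof (rule that[of "M1 + M2"])
    fix t x y assume *: "t \<in> {0..T}" "x \<in> {0..L}" "y \<in> {0..L}"
    have "\<bar>rest_x f t x y\<bar> \<le> M1 * \<bar>y - x\<bar> ^ 3"
      unfolding rest_x_def
      by (rule taylor_quadratic[of "{0..L}" x y "f t" "?f1 t" "?f2 t" "?f3 t"]) (use * M1 in \<open>auto intro: d\<close>)
    also have "\<dots> \<le> (M1 + M2) * \<bar>y - x\<bar> ^ 3" using M2(1) by (intro mult_right_mono) auto
    finally show "\<bar>rest_x f t x y\<bar> \<le> (M1 + M2) * \<bar>y - x\<bar> ^ 3" .
  next
    fix t x y e assume *: "t \<in> {0..T}" "0 \<le> e" "x \<in> {0..L - e}" "y \<in> {0..L - e}"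
    have e: "((\<lambda>y. g t (y + e) - g t y) has_real_derivative g' t (y + e) - g' t y) (at y within {0..L - e})"
      if "\<And>y. y \<in> {0..L} \<Longrightarrow> (g t has_real_derivative g' t y) (at y within {0..L})" "y \<in> {0..L - e}"
      for g g' :: "real \<Rightarrow> real \<Rightarrow> real" and y
      by (rule DERIV_diff[OF sh[of g t g' e y, OF that(1)] DERIV_subset[OF that(1)]]) (use that * in auto)
    have "\<bar>(f t (y + e) - f t y) - (f t (x + e) - f t x) - (y - x) * (?f1 t (x + e) - ?f1 t x)
        - (y - x)\<^sup>2 / 2 * (?f2 t (x + e) - ?f2 t x)\<bar> \<le> (M2 * e) * \<bar>y - x\<bar> ^ 3"
    proof (rule taylor_quadratic[where S="{0..L - e}" and F="\<lambda>y. f t (y + e) - f t y"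
          and F'="\<lambda>y. ?f1 t (y + e) - ?f1 t y" and F''="\<lambda>y. ?f2 t (y + e) - ?f2 t y"
          and F'''="\<lambda>y. ?f3 t (y + e) - ?f3 t y"])
      show "\<bar>?f3 t (y + e) - ?f3 t y\<bar> \<le> M2 * e" if "y \<in> {0..L - e}" for y
        using M2(2)[of t y "y + e"] that * by auto
    qed (rule * e[OF d(1)] e[OF d(2)] e[OF d(3)] convex_real_interval | assumption)+
    also have "(f t (y + e) - f t y) - (f t (x + e) - f t x) - (y - x) * (?f1 t (x + e) - ?f1 t x)
        - (y - x)\<^sup>2 / 2 * (?f2 t (x + e) - ?f2 t x) = rest_x f t (x + e) (y + e) - rest_x f t x y"
      by (simp add: rest_x_def right_diff_distrib)
    also have "M2 * e * \<bar>y - x\<bar> ^ 3 \<le> (M1 + M2) * e * \<bar>y - x\<bar> ^ 3"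
      using M1(1) *(2) by (intro mult_right_mono) auto
    finally show "\<bar>rest_x f t (x + e) (y + e) - rest_x f t x y\<bar> \<le> (M1 + M2) * e * \<bar>y - x\<bar> ^ 3" .
  qed (use M1 M2 in auto)
qed

text \<open>The second bound expands the spatial increment f t y - f t x in time; its third time
  derivative is at most a multiple of |y - x|.\<close>

lemma rest_t_bounds:
  fixes f :: "real \<Rightarrow> real \<Rightarrow> real"
  assumes f: "smooth f"
  obtains M where "0 \<le> M"
    "\<And>t s x. \<lbrakk>t \<in> {0..T}; s \<in> {0..T}; x \<in> {0..L}\<rbrakk> \<Longrightarrow> \<bar>rest_t f t s x\<bar> \<le> M * \<bar>s - t\<bar> ^ 3"
    "\<And>t s x y. \<lbrakk>t \<in> {0..T}; s \<in> {0..T}; x \<in> {0..L}; y \<in> {0..L}\<rbrakk>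
       \<Longrightarrow> \<bar>rest_t f t s y - rest_t f t s x\<bar> \<le> M * \<bar>y - x\<bar> * \<bar>s - t\<bar> ^ 3"
proof -
  let ?f1 = "dt T f" and ?f2 = "dt T (dt T f)" and ?f3 = "dt T (dt T (dt T f))"
  note s = f smooth_dt[OF f] smooth_dt[OF smooth_dt[OF f]] smooth_dt[OF smooth_dt[OF smooth_dt[OF f]]]
  note d = DERIV_dt[OF s(1)] DERIV_dt[OF s(2)] DERIV_dt[OF s(3)]
  obtain M1 where M1: "0 \<le> M1" "\<And>t x. \<lbrakk>t \<in> {0..T}; x \<in> {0..L}\<rbrakk> \<Longrightarrow> \<bar>?f3 t x\<bar> \<le> M1"
    using smooth_bounded[OF s(4)] by blast
  obtain M2 where M2: "0 \<le> M2"
    "\<And>t x y. \<lbrakk>t \<in> {0..T}; x \<in> {0..L}; y \<in> {0..L}\<rbrakk> \<Longrightarrow> \<bar>?f3 t y - ?f3 t x\<bar> \<le> M2 * \<bar>y - x\<bar>"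
    using smooth_lipschitz_x[OF s(4)] by blast
  show ?thesis
  proof (rule that[of "M1 + M2"])
    fix t s x assume *: "t \<in> {0..T}" "s \<in> {0..T}" "x \<in> {0..L}"
    have "\<bar>rest_t f t s x\<bar> \<le> M1 * \<bar>s - t\<bar> ^ 3"
      unfolding rest_t_def
      by (rule taylor_quadratic[of "{0..T}" t s "\<lambda>t. f t x" "\<lambda>t. ?f1 t x" "\<lambda>t. ?f2 t x" "\<lambda>t. ?f3 t x"]) (use * M1 in \<open>auto intro: d\<close>)
    also have "\<dots> \<le> (M1 + M2) * \<bar>s - t\<bar> ^ 3" using M2(1) by (intro mult_right_mono) auto
    finally show "\<bar>rest_t f t s x\<bar> \<le> (M1 + M2) * \<bar>s - t\<bar> ^ 3" .
  next
    fix t s x y assume *: "t \<in> {0..T}" "s \<in> {0..T}" "x \<in> {0..L}" "y \<in> {0..L}"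
    have "\<bar>(f s y - f s x) - (f t y - f t x) - (s - t) * (?f1 t y - ?f1 t x)
        - (s - t)\<^sup>2 / 2 * (?f2 t y - ?f2 t x)\<bar> \<le> (M2 * \<bar>y - x\<bar>) * \<bar>s - t\<bar> ^ 3"
      by (rule taylor_quadratic[where S="{0..T}" and F="\<lambda>t. f t y - f t x"
          and F'="\<lambda>t. ?f1 t y - ?f1 t x" and F''="\<lambda>t. ?f2 t y - ?f2 t x"
          and F'''="\<lambda>t. ?f3 t y - ?f3 t x"]) 
        ((rule convex_real_interval * DERIV_diff d M2(2) | assumption)+)
    also have "(f s y - f s x) - (f t y - f t x) - (s - t) * (?f1 t y - ?f1 t x)
        - (s - t)\<^sup>2 / 2 * (?f2 t y - ?f2 t x) = rest_t f t s y - rest_t f t s x"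
      by (simp add: rest_t_def right_diff_distrib)
    also have "M2 * \<bar>y - x\<bar> * \<bar>s - t\<bar> ^ 3 \<le> (M1 + M2) * \<bar>y - x\<bar> * \<bar>s - t\<bar> ^ 3"
      using M1(1) by (intro mult_right_mono) auto
    finally show "\<bar>rest_t f t s y - rest_t f t s x\<bar> \<le> (M1 + M2) * \<bar>y - x\<bar> * \<bar>s - t\<bar> ^ 3" .
  qed (use M1 M2 in auto)
qed

end

text \<open>The scheme in the scaled differences \<open>a = \<Delta>t D\<^sub>0\<close> and \<open>s = \<Delta>t\<^sup>2 D\<^sub>2\<close>, which are
  combinations of the stencil values with coefficients depending on \<open>r\<close> only;
  \<open>k = K / \<rho>\<^sub>a\<close>, \<open>w = \<bar>V\<bar>\<close> and \<open>Q = 1 / P\<close>.\<close>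

definition lw_dens :: "real \<Rightarrow> real \<Rightarrow> real \<Rightarrow> real \<Rightarrow> real \<Rightarrow> real \<Rightarrow> real \<Rightarrow> real \<Rightarrow> real \<Rightarrow> real \<Rightarrow> real" where
  "lw_dens k C h P V w aP aV sP sV =
     P - P * aV - V * aP + P * aV\<^sup>2 + P * V * sV + 2 * V * aV * aP + (k + V\<^sup>2) * sP / 2
     + h * (C * w * P * aV + C / 2 * V * w * aP)"

definition lw_vel :: "real \<Rightarrow> real \<Rightarrow> real \<Rightarrow> real \<Rightarrow> real \<Rightarrow> real \<Rightarrow> real \<Rightarrow> real \<Rightarrow> real \<Rightarrow> real \<Rightarrow> real" where
  "lw_vel k C h Q V w aP aV sP sV =
     V - V * aV - k * Q * aP - h * (C * V * w) + V * aV\<^sup>2 + (k + V\<^sup>2) * sV / 2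
     + 5 / 2 * h * (C * V * w * aV) + k * Q * aP * aV - k * V * Q\<^sup>2 * aP\<^sup>2 + k * V * Q * sP
     + h * (C * k * w * Q * aP) + h\<^sup>2 * (C\<^sup>2 * V ^ 3)"

definition diff1 :: "real \<Rightarrow> (int \<Rightarrow> real) \<Rightarrow> real" where
  "diff1 r f = r * (f 1 - f (-1)) / 2"

definition diff2 :: "real \<Rightarrow> (int \<Rightarrow> real) \<Rightarrow> real" where
  "diff2 r f = r\<^sup>2 * (f 1 - 2 * f 0 + f (-1))"

lemma lax_wendroff_nth:
  assumes "h \<noteq> 0" "r \<noteq> 0"
  shows "lax_wendroff cf D K \<rho>a h (h / r) W $ 1 =
      lw_dens (K / \<rho>a) (cf / (2 * D)) h (W 0 $ 1) (W 0 $ 2) \<bar>W 0 $ 2\<bar>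
        (diff1 r (\<lambda>j. W j $ 1)) (diff1 r (\<lambda>j. W j $ 2)) (diff2 r (\<lambda>j. W j $ 1)) (diff2 r (\<lambda>j. W j $ 2))" (is ?P)
    and "lax_wendroff cf D K \<rho>a h (h / r) W $ 2 =
      lw_vel (K / \<rho>a) (cf / (2 * D)) h (inverse (W 0 $ 1)) (W 0 $ 2) \<bar>W 0 $ 2\<bar>
        (diff1 r (\<lambda>j. W j $ 1)) (diff1 r (\<lambda>j. W j $ 2)) (diff2 r (\<lambda>j. W j $ 1)) (diff2 r (\<lambda>j. W j $ 2))" (is ?V)
proof -
  have d: "D0 (h / r) f = diff1 r f / h" "D2 (h / r) f = diff2 r f / h\<^sup>2" for f
    using assms by (simp_all add: D0_def D2_def diff1_def diff2_def power_divide)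
  have i: "K / (\<rho>a * P) = K / \<rho>a * inverse P" "2 * K / (\<rho>a * P) = 2 * (K / \<rho>a) * inverse P"
    "2 * K * V / (\<rho>a * P) = 2 * (K / \<rho>a) * V * inverse P"
    "2 * C * K * V / (\<rho>a * P) = 2 * C * (K / \<rho>a) * V * inverse P" for P V C
    by (simp_all add: inverse_eq_divide power_divide)
  show ?P
    unfolding lax_wendroff_def Let_def vector_2 d lw_dens_def
    using assms(1) by (simp add: field_simps power2_eq_square)
  define k Q where "k = K / \<rho>a" and "Q = inverse (W 0 $ 1)"
  show ?V
    unfolding lax_wendroff_def Let_def vector_2 d lw_vel_def i power_inverse[symmetric] k_def[symmetric] Q_def[symmetric]
    using assms(1) by (simp add: field_simps power2_eq_square)
qed

section \<open>Truncation error of the scheme\<close>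

locale pipe_grid = pipe +
  fixes r :: real
  assumes r_pos: "0 < r"
begin

abbreviation (input) tm :: "real \<times> real \<times> real \<Rightarrow> real" where "tm \<equiv> fst"
abbreviation (input) ps :: "real \<times> real \<times> real \<Rightarrow> real" where "ps i \<equiv> fst (snd i)"
abbreviation (input) st :: "real \<times> real \<times> real \<Rightarrow> real" where "st i \<equiv> snd (snd i)"

text \<open>Triples (time, position, time step) whose three-point stencil lies in the rectangle. All
  step sizes are indexed at once, so that a constant in \<open>ord\<close> is automatically uniform
  in the step.\<close>

definition cells :: "(real \<times> real \<times> real) set" where
  "cells = {i. 0 < st i \<and> tm i \<in> {0..T} \<and> 0 \<le> ps i - st i / r \<and> ps i + st i / r \<le> L}"

definition next_cell :: "real \<times> real \<times> real \<Rightarrow> real \<times> real \<times> real" where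
  "next_cell i = (tm i, ps i + st i / r, st i)"

lemma cells_D:
  assumes "i \<in> cells"
  shows "0 < st i" "tm i \<in> {0..T}" "0 < st i / r" "ps i \<in> {0..L}" "ps i + st i / r \<in> {0..L}"
    "ps i - st i / r \<in> {0..L}" "st i \<le> r * L"
proof -
  have d: "0 < st i / r"
    using assms r_pos by (simp add: cells_def)
  show *: "0 < st i" "tm i \<in> {0..T}" "0 < st i / r" "ps i \<in> {0..L}" "ps i + st i / r \<in> {0..L}"
    "ps i - st i / r \<in> {0..L}"
    using assms d unfolding cells_def by auto
  have "st i / r \<le> L" using * by auto
  then show "st i \<le> r * L" using r_pos by (simp add: pos_divide_le_eq mult.commute)
qed

sublocale grid_orders cells next_cell st "r * L"
  by unfold_locales (auto simp: next_cell_def r_pos L_pos dest: cells_D(1,7))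

lemma ord_smooth:
  assumes "smooth f"
  shows "ord1 0 (\<lambda>i. f (tm i) (ps i))"
proof -
  obtain M where M: "0 \<le> M" "\<And>t x. \<lbrakk>t \<in> {0..T}; x \<in> {0..L}\<rbrakk> \<Longrightarrow> \<bar>f t x\<bar> \<le> M"
    using smooth_bounded[OF assms] by blast
  obtain N where N: "0 \<le> N"
    "\<And>t x y. \<lbrakk>t \<in> {0..T}; x \<in> {0..L}; y \<in> {0..L}\<rbrakk> \<Longrightarrow> \<bar>f t y - f t x\<bar> \<le> N * \<bar>y - x\<bar>"
    using smooth_lipschitz_x[OF assms] by blast
  show ?thesis
  proof (rule ordI2[where C=M and D="N / r"])
    fix i assume i: "i \<in> cells"
    show "\<bar>f (tm i) (ps i)\<bar> \<le> M * \<bar>1\<bar> * st i ^ 0" using M(2) cells_D[OF i] by simp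
    show "\<bar>f (tm (next_cell i)) (ps (next_cell i)) - f (tm i) (ps i)\<bar> \<le> N / r * \<bar>1\<bar> * st i ^ Suc 0"
      using N(2)[OF cells_D(2,4,5)[OF i]] cells_D(3)[OF i] by (simp add: next_cell_def abs_of_pos del: abs_divide)
  qed
qed

definition A where "A f i = diff1 r (\<lambda>j. f (tm i) (ps i + of_int j * (st i / r)))"
definition S where "S f i = diff2 r (\<lambda>j. f (tm i) (ps i + of_int j * (st i / r)))"

lemma ord_rest:
  assumes "smooth f"
  shows "ord1 3 (\<lambda>i. rest_x f (tm i) (ps i) (ps i + st i / r))" "ord1 3 (\<lambda>i. rest_x f (tm i) (ps i) (ps i - st i / r))"
proof -
  obtain M where M: "0 \<le> M"
    "\<And>t x y. \<lbrakk>t \<in> {0..T}; x \<in> {0..L}; y \<in> {0..L}\<rbrakk> \<Longrightarrow> \<bar>rest_x f t x y\<bar> \<le> M * \<bar>y - x\<bar> ^ 3"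
    "\<And>t x y d. \<lbrakk>t \<in> {0..T}; 0 \<le> d; x \<in> {0..L - d}; y \<in> {0..L - d}\<rbrakk>
       \<Longrightarrow> \<bar>rest_x f t (x + d) (y + d) - rest_x f t x y\<bar> \<le> M * d * \<bar>y - x\<bar> ^ 3"
    using rest_x_bounds[OF assms] by blast
  have *: "\<bar>\<sigma> * (st i / r)\<bar> ^ 3 = st i ^ 3 / r ^ 3" if "i \<in> cells" "\<bar>\<sigma>\<bar> = 1" for i \<sigma>
    unfolding abs_mult that(2) abs_of_pos[OF cells_D(3)[OF that(1)]] by (simp add: power_divide)
  have "ord1 3 (\<lambda>i. rest_x f (tm i) (ps i) (ps i + \<sigma> * (st i / r)))" if "\<sigma> = 1 \<or> \<sigma> = -1" for \<sigma>
  proof (rule ordI2[where C="M / r ^ 3" and D="M / r ^ 4"])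
    fix i assume i: "i \<in> cells"
    then show "\<bar>rest_x f (tm i) (ps i) (ps i + \<sigma> * (st i / r))\<bar> \<le> M / r ^ 3 * \<bar>1\<bar> * st i ^ 3"
      using M(2)[of "tm i" "ps i" "ps i + \<sigma> * (st i / r)"] that cells_D[OF i] *[OF i, of \<sigma>] by auto
    assume "next_cell i \<in> cells"
    note j = cells_D[OF this, unfolded next_cell_def, simplified]
    have "\<bar>rest_x f (tm i) (ps i + st i / r) (ps i + \<sigma> * (st i / r) + st i / r) - rest_x f (tm i) (ps i) (ps i + \<sigma> * (st i / r))\<bar>
        \<le> M * (st i / r) * \<bar>ps i + \<sigma> * (st i / r) - ps i\<bar> ^ 3"
      using j cells_D[OF i] that by (intro M(3)) auto
    also have "\<dots> = M * (st i / r) * (st i ^ 3 / r ^ 3)"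
      using *[OF i, of \<sigma>] that by auto
    also have "\<dots> = M / r ^ 4 * \<bar>1\<bar> * st i ^ Suc 3"
      by (simp add: eval_nat_numeral)
    finally show "\<bar>rest_x f (tm (next_cell i)) (ps (next_cell i)) (ps (next_cell i) + \<sigma> * (st (next_cell i) / r))
        - rest_x f (tm i) (ps i) (ps i + \<sigma> * (st i / r))\<bar> \<le> M / r ^ 4 * \<bar>1\<bar> * st i ^ Suc 3"
      by (simp add: next_cell_def add.commute add.left_commute)
  qed
  from this[of 1] this[of "-1"] show "ord1 3 (\<lambda>i. rest_x f (tm i) (ps i) (ps i + st i / r))"
    "ord1 3 (\<lambda>i. rest_x f (tm i) (ps i) (ps i - st i / r))" by simp_all
qed

lemma approx_smooth: "smooth f \<Longrightarrow> approx m (\<lambda>i. f (tm i) (ps i)) (\<lambda>i. f (tm i) (ps i))"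
  by (intro approx_refl ord_smooth)

lemma approx_step: "approx m st st"
  by (intro approx_refl ord_mono[OF ord_step]) simp

lemma approxI:
  assumes "ord1 m (\<lambda>i. p i - q i)" "ord1 0 q"
  shows "approx m p q"
  using assms ord_add[OF ord_mono[OF assms(1), of 0] assms(2)] by (simp add: approx_def)

text \<open>By parity the quadratic Taylor polynomials at the two neighbours cancel except for the
  derivative sought, and only cubic remainders are left. For \<open>S\<close> this is one order
  below the true h^4, but h^3 is all that is required.\<close>

lemma approx_differences:
  assumes f: "smooth f"
  shows "approx 3 (A f) (\<lambda>i. st i * dx L f (tm i) (ps i))"
    and "approx 3 (S f) (\<lambda>i. (st i)\<^sup>2 * dx L (dx L f) (tm i) (ps i))"
proof -
  let ?p = "\<lambda>i. rest_x f (tm i) (ps i) (ps i + st i / r)" and ?m = "\<lambda>i. rest_x f (tm i) (ps i) (ps i - st i / r)"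
  note o = ord_rest[OF f]
  have "ord1 3 (\<lambda>i. r / 2 * (?p i - ?m i))" by (intro ord_cmult ord_diff o)
  moreover have "A f i - st i * dx L f (tm i) (ps i) = r / 2 * (?p i - ?m i)" for i
    using r_pos by (simp add: A_def diff1_def rest_x_def right_diff_distrib left_diff_distrib distrib_left distrib_right add_divide_distrib diff_divide_distrib)
  ultimately have 1: "ord1 3 (\<lambda>i. A f i - st i * dx L f (tm i) (ps i))" by (simp only:)
  have "ord1 3 (\<lambda>i. r\<^sup>2 * (?p i + ?m i))" by (intro ord_cmult ord_add o)
  moreover have "S f i - (st i)\<^sup>2 * dx L (dx L f) (tm i) (ps i) = r\<^sup>2 * (?p i + ?m i)" for i
    using r_pos by (simp add: S_def diff2_def rest_x_def field_simps power2_eq_square)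
  ultimately have 2: "ord1 3 (\<lambda>i. S f i - (st i)\<^sup>2 * dx L (dx L f) (tm i) (ps i))" by (simp only:)
  have "ord1 0 (\<lambda>i. st i * dx L f (tm i) (ps i))"
    by (rule ord_mono[OF ord_mult[OF ord_step ord_smooth[OF smooth_dx[OF f]]]]) simp
  with 1 show "approx 3 (A f) (\<lambda>i. st i * dx L f (tm i) (ps i))"
    by (rule approxI)
  have "ord1 0 (\<lambda>i. st i * (st i * dx L (dx L f) (tm i) (ps i)))"
    by (rule ord_mono[OF ord_mult[OF ord_step ord_mult[OF ord_step ord_smooth[OF smooth_dx[OF smooth_dx[OF f]]]]]]) simp
  then show "approx 3 (S f) (\<lambda>i. (st i)\<^sup>2 * dx L (dx L f) (tm i) (ps i))"
    using 2 by (intro approxI) (simp_all only: power2_eq_square mult.assoc)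
qed

lemma ord_Q: "ord1 0 (\<lambda>i. Q (tm i) (ps i))"
proof -
  obtain \<delta> where \<delta>: "0 < \<delta>" "\<And>t x. \<lbrakk>t \<in> {0..T}; x \<in> {0..L}\<rbrakk> \<Longrightarrow> \<delta> \<le> \<bar>P t x\<bar>"
    using smooth_nonzero_bound[OF smooth_P] P_nonzero by blast
  show ?thesis
    unfolding Q_def
    by (rule ord_inverse[OF ord_smooth[OF smooth_P] \<delta>(1)]) (rule \<delta>(2)[OF cells_D(2,4)])
qed

definition lw_u where
  "lw_u k i = lax_wendroff cf D K \<rho>a (st i) (st i / r) (\<lambda>j. u (tm i) (ps i + of_int j * (st i / r))) $ k"

lemma lw_u_eq:
  assumes "i \<in> cells"
  shows "lw_u 1 i = lw_dens (c\<^sup>2) C (st i) (P (tm i) (ps i)) (V (tm i) (ps i)) \<bar>V (tm i) (ps i)\<bar> (A P i) (A V i) (S P i) (S V i)"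
    "lw_u 2 i = lw_vel (c\<^sup>2) C (st i) (Q (tm i) (ps i)) (V (tm i) (ps i)) \<bar>V (tm i) (ps i)\<bar> (A P i) (A V i) (S P i) (S V i)"
  using cells_D(1)[OF assms] r_pos
  by (simp_all add: lw_u_def lax_wendroff_nth c_sq C_def P_def V_def Q_def A_def S_def)

text \<open>As \<open>approx\<close> is compatible with the operations of the scheme, scaled
  differences may be replaced by scaled derivatives at a cost of h^3. What remains is the quadratic
  Taylor polynomial in time, by \<open>P_t\<close>, \<open>P_tt\<close>, \<open>V_t\<close> and
  \<open>V_tt\<close>.\<close>

lemma ord_truncation:
  shows "ord1 3 (\<lambda>i. lw_u 1 i - (P (tm i) (ps i) + st i * dt T P (tm i) (ps i) + (st i)\<^sup>2 / 2 * dt T (dt T P) (tm i) (ps i)))"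
    and "ord1 3 (\<lambda>i. lw_u 2 i - (V (tm i) (ps i) + st i * dt T V (tm i) (ps i) + (st i)\<^sup>2 / 2 * dt T (dt T V) (tm i) (ps i)))"
proof -
  note prims = approx_smooth[OF smooth_P] approx_smooth[OF smooth_V] approx_refl[OF ord_abs[OF ord_smooth[OF smooth_V]]]
    approx_refl[OF ord_Q] approx_differences[OF smooth_P] approx_differences[OF smooth_V] approx_step
  let ?P = "\<lambda>i. P (tm i) (ps i)" and ?V = "\<lambda>i. V (tm i) (ps i)" and ?Q = "\<lambda>i. Q (tm i) (ps i)"
  let ?aP = "\<lambda>i. st i * dx L P (tm i) (ps i)" and ?aV = "\<lambda>i. st i * dx L V (tm i) (ps i)"
  let ?sP = "\<lambda>i. (st i)\<^sup>2 * dx L (dx L P) (tm i) (ps i)" and ?sV = "\<lambda>i. (st i)\<^sup>2 * dx L (dx L V) (tm i) (ps i)"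
  have "approx 3 (\<lambda>i. lw_dens (c\<^sup>2) C (st i) (?P i) (?V i) \<bar>?V i\<bar> (A P i) (A V i) (S P i) (S V i))
      (\<lambda>i. lw_dens (c\<^sup>2) C (st i) (?P i) (?V i) \<bar>?V i\<bar> (?aP i) (?aV i) (?sP i) (?sV i))"
    unfolding lw_dens_def divide_inverse by (intro approx_add approx_diff approx_mult approx_power approx_const prims)
  then show "ord1 3 (\<lambda>i. lw_u 1 i - (P (tm i) (ps i) + st i * dt T P (tm i) (ps i) + (st i)\<^sup>2 / 2 * dt T (dt T P) (tm i) (ps i)))"
    unfolding approx_def
    by (elim conjE, elim ord_cong)
       (use cells_D(2,4) in \<open>simp add: lw_u_eq P_t P_tt lw_dens_def algebra_simps power2_eq_square\<close>)
  have "approx 3 (\<lambda>i. lw_vel (c\<^sup>2) C (st i) (?Q i) (?V i) \<bar>?V i\<bar> (A P i) (A V i) (S P i) (S V i))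
      (\<lambda>i. lw_vel (c\<^sup>2) C (st i) (?Q i) (?V i) \<bar>?V i\<bar> (?aP i) (?aV i) (?sP i) (?sV i))"
    unfolding lw_vel_def divide_inverse by (intro approx_add approx_diff approx_mult approx_power approx_const prims)
  then show "ord1 3 (\<lambda>i. lw_u 2 i - (V (tm i) (ps i) + st i * dt T V (tm i) (ps i) + (st i)\<^sup>2 / 2 * dt T (dt T V) (tm i) (ps i)))"
    unfolding approx_def
    by (elim conjE, elim ord_cong)
       (use cells_D(2,4) in \<open>simp add: lw_u_eq V_t V_tt lw_vel_def algebra_simps power2_eq_square\<close>)
qed

lemma ord_drop:
  assumes "ord \<omega> m (\<lambda>i. a i - (b i + d i))" "ord \<omega> m d"
  shows "ord \<omega> m (\<lambda>i. a i - b i)"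
  using ord_add[OF assms] by simp

lemma consistent_u: "consistent T L cf D K \<rho>a r u"
proof -
  have P2: "ord1 2 (\<lambda>i. lw_u 1 i - (P (tm i) (ps i) + st i * dt T P (tm i) (ps i)))"
  proof -
    have "ord1 2 (\<lambda>i. (st i)\<^sup>2 / 2 * dt T (dt T P) (tm i) (ps i))"
      using ord_mult[OF ord_step ord_mult[OF ord_step ord_cmult[OF ord_smooth[OF smooth_dt[OF smooth_dt[OF smooth_P]]], of "1/2"]]]
      by (simp add: power2_eq_square mult.assoc numeral_2_eq_2)
    from ord_drop[OF ord_mono[OF ord_truncation(1)] this] show ?thesis by simp
  qed
  have V2: "ord1 2 (\<lambda>i. lw_u 2 i - (V (tm i) (ps i) + st i * dt T V (tm i) (ps i)))"
  proof -
    have "ord1 2 (\<lambda>i. (st i)\<^sup>2 / 2 * dt T (dt T V) (tm i) (ps i))"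
      using ord_mult[OF ord_step ord_mult[OF ord_step ord_cmult[OF ord_smooth[OF smooth_dt[OF smooth_dt[OF smooth_V]]], of "1/2"]]]
      by (simp add: power2_eq_square mult.assoc numeral_2_eq_2)
    from ord_drop[OF ord_mono[OF ord_truncation(2)] this] show ?thesis by simp
  qed
  from P2 obtain C1 where C1: "\<And>i. i \<in> cells \<Longrightarrow> \<bar>lw_u 1 i - (P (tm i) (ps i) + st i * dt T P (tm i) (ps i))\<bar> \<le> C1 * \<bar>1\<bar> * st i ^ 2"
    by (rule ordE) blast
  from V2 obtain C2 where C2: "\<And>i. i \<in> cells \<Longrightarrow> \<bar>lw_u 2 i - (V (tm i) (ps i) + st i * dt T V (tm i) (ps i))\<bar> \<le> C2 * \<bar>1\<bar> * st i ^ 2"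
    by (rule ordE) blast
  show ?thesis
    unfolding consistent_def
  proof (intro exI[of _ "C1 + C2"] ballI allI impI)
    fix t x h assume t: "t \<in> {0..T}" and h: "0 < h" and x: "x - h / r \<in> {0..L} \<and> x + h / r \<in> {0..L}"
    then have i: "(t, x, h) \<in> cells" by (simp add: cells_def)
    have xL: "x \<in> {0..L}" using cells_D(4)[OF i] by simp
    let ?e = "lax_wendroff cf D K \<rho>a h (h / r) (\<lambda>j. u t (x + of_int j * (h / r)))
        - (u t x + h *\<^sub>R (- (A_matrix K \<rho>a (u t x) *v dx L u t x) + B_vector cf D (u t x)))"
    have "- (A_matrix K \<rho>a (u t x) *v dx L u t x) + B_vector cf D (u t x) = dt T u t x"
      using quasilinear_u t xL unfolding quasilinear_form_def by simp
    then have e: "?e $ k = lw_u k (t, x, h) - (u t x $ k + h * dt T u t x $ k)" for k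
      by (simp add: lw_u_def)
    have "dt T u t x $ 1 = dt T P t x" "dt T u t x $ 2 = dt T V t x"
      unfolding P_def[abs_def] V_def[abs_def] by (rule dt_dx_nth(1)[OF smooth_u t xL, symmetric])+
    then have "\<bar>?e $ 1\<bar> \<le> C1 * h\<^sup>2" "\<bar>?e $ 2\<bar> \<le> C2 * h\<^sup>2"
      unfolding e using C1[OF i] C2[OF i] by (simp_all add: P_def V_def)
    moreover have "norm ?e \<le> \<bar>?e $ 1\<bar> + \<bar>?e $ 2\<bar>"
      using norm_le_l1_cart[of ?e] by (simp add: sum_2)
    ultimately show "norm ?e \<le> (C1 + C2) * h\<^sup>2" by (simp add: distrib_right)
  qed
qed

end

section \<open>The first variation\<close>

lemma has_derivative_vector_2:
  fixes f :: "'a::real_normed_vector \<Rightarrow> real^2"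
  assumes "((\<lambda>z. f z $ 1) has_derivative f1) F" "((\<lambda>z. f z $ 2) has_derivative f2) F"
  shows "(f has_derivative (\<lambda>d. vector [f1 d, f2 d])) F"
proof -
  have e: "(vector [a, b] :: real^2) = a *\<^sub>R axis 1 1 + b *\<^sub>R axis 2 1" for a b :: real
    by (simp add: vec_eq_iff forall_2 axis_def vector_2)
  have f: "f z = (f z $ 1) *\<^sub>R axis 1 1 + (f z $ 2) *\<^sub>R axis 2 1" for z
    unfolding e[symmetric] by (simp add: vec_eq_iff forall_2 vector_2)
  show ?thesis
    unfolding e using has_derivative_add[OF has_derivative_scaleR_left[OF assms(1)] has_derivative_scaleR_left[OF assms(2)], of "axis 1 1 :: real^2" "axis 2 1"]
    by (simp only: f[symmetric])
qed

lemma jacobian_apply: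
  fixes f :: "real^'n \<Rightarrow> real^'m"
  assumes "(f has_derivative f') (at x)"
  shows "jacobian f (at x) *v d = f' d"
proof -
  have "(f has_derivative (\<lambda>h. jacobian f (at x) *v h)) (at x)"
    using assms jacobian_works[of f "at x"] unfolding differentiable_def by blast
  then show ?thesis using has_derivative_unique[OF assms] by metis
qed

text \<open>For fixed r the scaled differences do not depend on the step, so the scheme is
  polynomial in it and the limit is the value at zero. All friction terms carry a factor of the
  step, hence the zeros in place of the friction constant and the modulus.\<close>

lemma lw_zero_step_nth:
  assumes "0 < r"
  shows "lw_zero_step cf D K \<rho>a r W $ 1 =
      lw_dens (K / \<rho>a) 0 0 (W 0 $ 1) (W 0 $ 2) 0
        (diff1 r (\<lambda>j. W j $ 1)) (diff1 r (\<lambda>j. W j $ 2)) (diff2 r (\<lambda>j. W j $ 1)) (diff2 r (\<lambda>j. W j $ 2))" (is "_ = ?P 0")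
    and "lw_zero_step cf D K \<rho>a r W $ 2 =
      lw_vel (K / \<rho>a) 0 0 (inverse (W 0 $ 1)) (W 0 $ 2) 0
        (diff1 r (\<lambda>j. W j $ 1)) (diff1 r (\<lambda>j. W j $ 2)) (diff2 r (\<lambda>j. W j $ 1)) (diff2 r (\<lambda>j. W j $ 2))" (is "_ = ?V 0")
proof -
  let ?L = "vector [?P 0, ?V 0] :: real^2"
  have ev: "\<forall>\<^sub>F h in at_right 0. h \<noteq> (0::real)" by (simp add: eventually_at_filter)
  have "((\<lambda>h. lax_wendroff cf D K \<rho>a h (h / r) W $ 1) \<longlongrightarrow> ?P 0) (at_right 0)"
  proof (rule Lim_transform_eventually)
    let ?f = "\<lambda>h. lw_dens (K / \<rho>a) (cf / (2 * D)) h (W 0 $ 1) (W 0 $ 2) \<bar>W 0 $ 2\<bar>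
        (diff1 r (\<lambda>j. W j $ 1)) (diff1 r (\<lambda>j. W j $ 2)) (diff2 r (\<lambda>j. W j $ 1)) (diff2 r (\<lambda>j. W j $ 2))"
    have "isCont ?f 0" unfolding lw_dens_def by (intro continuous_intros)
    then have "(?f \<longlongrightarrow> ?f 0) (at_right 0)" using continuous_at_imp_continuous_at_within continuous_within by blast
    then show "(?f \<longlongrightarrow> ?P 0) (at_right 0)" by (simp add: lw_dens_def)
    show "\<forall>\<^sub>F h in at_right 0. ?f h = lax_wendroff cf D K \<rho>a h (h / r) W $ 1"
      by (rule eventually_mono[OF ev]) (use assms in \<open>simp add: lax_wendroff_nth\<close>)
  qed
  moreover have "((\<lambda>h. lax_wendroff cf D K \<rho>a h (h / r) W $ 2) \<longlongrightarrow> ?V 0) (at_right 0)"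
  proof (rule Lim_transform_eventually)
    let ?f = "\<lambda>h. lw_vel (K / \<rho>a) (cf / (2 * D)) h (inverse (W 0 $ 1)) (W 0 $ 2) \<bar>W 0 $ 2\<bar>
        (diff1 r (\<lambda>j. W j $ 1)) (diff1 r (\<lambda>j. W j $ 2)) (diff2 r (\<lambda>j. W j $ 1)) (diff2 r (\<lambda>j. W j $ 2))"
    have "isCont ?f 0" unfolding lw_vel_def by (intro continuous_intros)
    then have "(?f \<longlongrightarrow> ?f 0) (at_right 0)" using continuous_at_imp_continuous_at_within continuous_within by blast
    then show "(?f \<longlongrightarrow> ?V 0) (at_right 0)" by (simp add: lw_vel_def)
    show "\<forall>\<^sub>F h in at_right 0. ?f h = lax_wendroff cf D K \<rho>a h (h / r) W $ 2"
      by (rule eventually_mono[OF ev]) (use assms in \<open>simp add: lax_wendroff_nth\<close>)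
  qed
  ultimately have "\<forall>i. ((\<lambda>h. lax_wendroff cf D K \<rho>a h (h / r) W $ i) \<longlongrightarrow> ?L $ i) (at_right 0)"
    by (simp add: forall_2 vector_2)
  then have "((\<lambda>h. lax_wendroff cf D K \<rho>a h (h / r) W) \<longlongrightarrow> ?L) (at_right 0)"
    by (intro vec_tendstoI) blast
  then have "lw_zero_step cf D K \<rho>a r W = ?L"
    unfolding lw_zero_step_def by (intro tendsto_Lim) auto
  then show "lw_zero_step cf D K \<rho>a r W $ 1 = ?P 0" "lw_zero_step cf D K \<rho>a r W $ 2 = ?V 0"
    by (simp_all add: vector_2)
qed

text \<open>At a constant stencil all differences vanish, so neither the variation of coefficients
  nor products of differences contribute. The Jacobians are I - r^2 A^2 at the centre and -\<sigma>
  (r/2) A + (r^2/2) A^2 at the neighbours, with A the matrix of the system.\<close>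

lemma variation_coeff_times:
  fixes w d :: "real^2" and K \<rho>a r :: real
  assumes r: "0 < r" and w: "w $ 1 \<noteq> 0"
  defines "k \<equiv> K / \<rho>a" and "Q \<equiv> inverse (w $ 1)" and "P \<equiv> w $ 1" and "V \<equiv> w $ 2"
  shows "variation_coeff cf D K \<rho>a r 0 w *v d = vector
      [d $ 1 - r\<^sup>2 * ((V\<^sup>2 + k) * d $ 1 + 2 * P * V * d $ 2),
       d $ 2 - r\<^sup>2 * (2 * k * V * Q * d $ 1 + (V\<^sup>2 + k) * d $ 2)]"
    and "\<sigma> = 1 \<or> \<sigma> = -1 \<Longrightarrow> variation_coeff cf D K \<rho>a r \<sigma> w *v d = vector
      [- (of_int \<sigma> * r / 2 * (V * d $ 1 + P * d $ 2)) + r\<^sup>2 / 2 * ((V\<^sup>2 + k) * d $ 1 + 2 * P * V * d $ 2),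
       - (of_int \<sigma> * r / 2 * (k * Q * d $ 1 + V * d $ 2)) + r\<^sup>2 / 2 * (2 * k * V * Q * d $ 1 + (V\<^sup>2 + k) * d $ 2)]"
proof -
  note nth = bounded_linear.has_derivative[OF bounded_linear_vec_nth has_derivative_ident]
  let ?F = "\<lambda>j z. lw_zero_step cf D K \<rho>a r ((\<lambda>_. w)(j := z))"
  note defs = lw_zero_step_nth[OF r] diff1_def diff2_def lw_dens_def lw_vel_def
  have "((\<lambda>z. ?F 0 z $ 1) has_derivative (\<lambda>d. d $ 1 - r\<^sup>2 * ((V\<^sup>2 + k) * d $ 1 + 2 * P * V * d $ 2))) (at w)"
    unfolding defs P_def V_def k_def[symmetric]
    by (auto intro!: derivative_eq_intros nth simp: fun_eq_iff field_simps power2_eq_square)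
  moreover have "((\<lambda>z. ?F 0 z $ 2) has_derivative (\<lambda>d. d $ 2 - r\<^sup>2 * (2 * k * V * Q * d $ 1 + (V\<^sup>2 + k) * d $ 2))) (at w)"
    unfolding defs Q_def V_def k_def[symmetric]
    using w by (auto intro!: derivative_eq_intros nth simp: fun_eq_iff field_simps power2_eq_square)
  ultimately show "variation_coeff cf D K \<rho>a r 0 w *v d = vector
      [d $ 1 - r\<^sup>2 * ((V\<^sup>2 + k) * d $ 1 + 2 * P * V * d $ 2),
       d $ 2 - r\<^sup>2 * (2 * k * V * Q * d $ 1 + (V\<^sup>2 + k) * d $ 2)]"
    unfolding variation_coeff_def by (rule jacobian_apply[OF has_derivative_vector_2])
  assume \<sigma>: "\<sigma> = 1 \<or> \<sigma> = -1"
  have W: "((\<lambda>_. w)(\<sigma> := z)) 0 = w" for z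
    using \<sigma> by auto
  have d: "diff1 r (\<lambda>j. ((\<lambda>_. w)(\<sigma> := z)) j $ i) = of_int \<sigma> * r / 2 * (z $ i - w $ i)"
    "diff2 r (\<lambda>j. ((\<lambda>_. w)(\<sigma> := z)) j $ i) = r\<^sup>2 * (z $ i - w $ i)" for z i
    using \<sigma> by (elim disjE; simp add: diff1_def diff2_def right_diff_distrib left_diff_distrib diff_divide_distrib)+
  \<comment> \<open>As a function of a neighbouring argument alone, each component is an exact
    quadratic polynomial in z - w, of which only the linear part matters.\<close>
  have quadratic: "((\<lambda>z. A + B1 * (z $ 1 - w $ 1) + B2 * (z $ 2 - w $ 2)
        + A11 * (z $ 1 - w $ 1)\<^sup>2 + A12 * (z $ 1 - w $ 1) * (z $ 2 - w $ 2) + A22 * (z $ 2 - w $ 2)\<^sup>2)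
      has_derivative (\<lambda>d. B1 * d $ 1 + B2 * d $ 2)) (at w)" for A B1 B2 A11 A12 A22 :: real
    by (auto intro!: derivative_eq_intros nth)
  define m where "m = of_int \<sigma> * r / 2"
  have "((\<lambda>z. ?F \<sigma> z $ 1) has_derivative (\<lambda>d. - (of_int \<sigma> * r / 2 * (V * d $ 1 + P * d $ 2)) + r\<^sup>2 / 2 * ((V\<^sup>2 + k) * d $ 1 + 2 * P * V * d $ 2))) (at w)"
  proof (rule has_derivative_eq_rhs)
    show "((\<lambda>z. ?F \<sigma> z $ 1) has_derivative (\<lambda>d. ((k + V\<^sup>2) * r\<^sup>2 / 2 - V * m) * d $ 1 + (P * V * r\<^sup>2 - P * m) * d $ 2)) (at w)"
      using quadratic[of P "(k + V\<^sup>2) * r\<^sup>2 / 2 - V * m" "P * V * r\<^sup>2 - P * m" 0 "2 * V * m * m" "P * m * m"]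
      unfolding lw_zero_step_nth[OF r] d W lw_dens_def k_def[symmetric] m_def[symmetric]
      by (simp add: P_def V_def algebra_simps power2_eq_square)
  qed (simp add: fun_eq_iff m_def algebra_simps)
  moreover have "((\<lambda>z. ?F \<sigma> z $ 2) has_derivative (\<lambda>d. - (of_int \<sigma> * r / 2 * (k * Q * d $ 1 + V * d $ 2)) + r\<^sup>2 / 2 * (2 * k * V * Q * d $ 1 + (V\<^sup>2 + k) * d $ 2))) (at w)"
  proof (rule has_derivative_eq_rhs)
    show "((\<lambda>z. ?F \<sigma> z $ 2) has_derivative (\<lambda>d. (k * V * Q * r\<^sup>2 - k * Q * m) * d $ 1 + ((k + V\<^sup>2) * r\<^sup>2 / 2 - V * m) * d $ 2)) (at w)"
      using quadratic[of V "k * V * Q * r\<^sup>2 - k * Q * m" "(k + V\<^sup>2) * r\<^sup>2 / 2 - V * m" "- (k * V * Q * Q * m * m)" "k * Q * m * m" "V * m * m"]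
      unfolding lw_zero_step_nth[OF r] d W lw_vel_def k_def[symmetric] m_def[symmetric] Q_def[symmetric]
      by (simp add: V_def algebra_simps power2_eq_square)
  qed (simp add: fun_eq_iff m_def algebra_simps)
  ultimately show "variation_coeff cf D K \<rho>a r \<sigma> w *v d = vector
      [- (of_int \<sigma> * r / 2 * (V * d $ 1 + P * d $ 2)) + r\<^sup>2 / 2 * ((V\<^sup>2 + k) * d $ 1 + 2 * P * V * d $ 2),
       - (of_int \<sigma> * r / 2 * (k * Q * d $ 1 + V * d $ 2)) + r\<^sup>2 / 2 * (2 * k * V * Q * d $ 1 + (V\<^sup>2 + k) * d $ 2)]"
    unfolding variation_coeff_def by (rule jacobian_apply[OF has_derivative_vector_2])
qed

section \<open>Stability\<close>

lemma norm_square_2: "(norm z)\<^sup>2 = (z $ 1)\<^sup>2 + (z $ 2)\<^sup>2" for z :: "real^2"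
  by (simp add: norm_vec_def L2_set_def sum_2)

lemma mesh_eq_image:
  assumes "0 < d"
  shows "mesh y d (real n * d) (L - real n * d) =
    (\<lambda>j. y + of_int j * d) ` {\<lceil>- y / d\<rceil> + int n..\<lfloor>(L - y) / d\<rfloor> - int n}"
proof -
  have "y + of_int j * d \<in> {real n * d..L - real n * d} \<longleftrightarrow> j \<in> {\<lceil>- y / d\<rceil> + int n..\<lfloor>(L - y) / d\<rfloor> - int n}" for j
  proof -
    have "\<lceil>- y / d\<rceil> + int n \<le> j \<longleftrightarrow> - y / d \<le> of_int (j - int n)"
      by (simp flip: ceiling_le_iff) linarith
    also have "\<dots> \<longleftrightarrow> real n * d \<le> y + of_int j * d"
      by (subst pos_divide_le_eq[OF assms]) (auto simp: algebra_simps)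
    finally have 1: "\<lceil>- y / d\<rceil> + int n \<le> j \<longleftrightarrow> real n * d \<le> y + of_int j * d" .
    have "j \<le> \<lfloor>(L - y) / d\<rfloor> - int n \<longleftrightarrow> of_int (j + int n) \<le> (L - y) / d"
      by (simp flip: le_floor_iff) linarith
    also have "\<dots> \<longleftrightarrow> y + of_int j * d \<le> L - real n * d"
      using assms by (auto simp: pos_le_divide_eq algebra_simps)
    finally show ?thesis using 1 by auto
  qed
  then show ?thesis unfolding mesh_def image_def by blast
qed

section \<open>Uniform constants and iteration of the energy estimate\<close>

context pipe_grid
begin

text \<open>All constants of \<open>coeffs_ok\<close> by compactness. The spatial Lipschitz bound
  contains the factor r so that neighbours at distance h / r differ by at most B h.\<close>

lemma uniform_bounds:
  obtains q q' B where "0 < q" "0 \<le> B"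
    "\<And>t x. \<lbrakk>t \<in> {0..T}; x \<in> {0..L}\<rbrakk> \<Longrightarrow> q \<le> \<bar>c * Q t x\<bar> \<and> \<bar>c * Q t x\<bar> \<le> q'"
    "\<And>t x y. \<lbrakk>t \<in> {0..T}; x \<in> {0..L}; y \<in> {0..L}\<rbrakk> \<Longrightarrow>
       \<bar>V t y - V t x\<bar> \<le> B * (r * \<bar>y - x\<bar>) \<and> \<bar>Q t y - Q t x\<bar> \<le> B * (r * \<bar>y - x\<bar>)"
    "\<And>t s x. \<lbrakk>t \<in> {0..T}; s \<in> {0..T}; x \<in> {0..L}\<rbrakk> \<Longrightarrow> \<bar>Q s x - Q t x\<bar> \<le> B * \<bar>s - t\<bar>"
proof -
  obtain \<delta> where \<delta>: "0 < \<delta>" "\<And>t x. \<lbrakk>t \<in> {0..T}; x \<in> {0..L}\<rbrakk> \<Longrightarrow> \<delta> \<le> \<bar>P t x\<bar>"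
    using smooth_nonzero_bound[OF smooth_P] P_nonzero by blast
  obtain M where M: "0 \<le> M" "\<And>t x. \<lbrakk>t \<in> {0..T}; x \<in> {0..L}\<rbrakk> \<Longrightarrow> \<bar>P t x\<bar> \<le> M"
    by (rule smooth_bounded[OF smooth_P]) (rule that)
  obtain N1 where N1: "0 \<le> N1"
    "\<And>t x y. \<lbrakk>t \<in> {0..T}; x \<in> {0..L}; y \<in> {0..L}\<rbrakk> \<Longrightarrow> \<bar>V t y - V t x\<bar> \<le> N1 * \<bar>y - x\<bar>"
    by (rule smooth_lipschitz_x[OF smooth_V]) (rule that)
  obtain N2 where N2: "0 \<le> N2"
    "\<And>t x y. \<lbrakk>t \<in> {0..T}; x \<in> {0..L}; y \<in> {0..L}\<rbrakk> \<Longrightarrow> \<bar>P t y - P t x\<bar> \<le> N2 * \<bar>y - x\<bar>"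
    by (rule smooth_lipschitz_x[OF smooth_P]) (rule that)
  obtain N3 where N3: "0 \<le> N3"
    "\<And>t s x. \<lbrakk>t \<in> {0..T}; s \<in> {0..T}; x \<in> {0..L}\<rbrakk> \<Longrightarrow> \<bar>P s x - P t x\<bar> \<le> N3 * \<bar>s - t\<bar>"
    by (rule smooth_lipschitz_t[OF smooth_P]) (rule that)
  have Q_le: "\<bar>Q t x\<bar> \<le> 1 / \<delta>" if "t \<in> {0..T}" "x \<in> {0..L}" for t x
    using \<delta>(1) \<delta>(2)[OF that] by (simp add: Q_def abs_inverse inverse_eq_divide frac_le)
  have Q_diff: "\<bar>Q s y - Q t x\<bar> \<le> (1 / \<delta>) * (1 / \<delta>) * \<bar>P s y - P t x\<bar>"
    if "t \<in> {0..T}" "s \<in> {0..T}" "x \<in> {0..L}" "y \<in> {0..L}" for t s x y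
  proof -
    have "Q s y - Q t x = Q s y * Q t x * (P t x - P s y)"
      using Q_P[OF that(1,3)] Q_P[OF that(2,4)] by algebra
    then have "\<bar>Q s y - Q t x\<bar> = \<bar>Q s y\<bar> * \<bar>Q t x\<bar> * \<bar>P s y - P t x\<bar>" by (simp add: abs_mult abs_minus_commute)
    also have "\<dots> \<le> (1 / \<delta>) * (1 / \<delta>) * \<bar>P s y - P t x\<bar>"
      using \<delta>(1) by (intro mult_right_mono mult_mono Q_le that) auto
    finally show ?thesis .
  qed
  define B where "B = N1 / r + (1 / \<delta>) * (1 / \<delta>) * N2 / r + (1 / \<delta>) * (1 / \<delta>) * N3"
  have nn: "0 \<le> N1 / r" "0 \<le> (1 / \<delta>) * (1 / \<delta>) * N2 / r" "0 \<le> (1 / \<delta>) * (1 / \<delta>) * N3"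
    using N1 N2 N3 \<delta>(1) r_pos by auto
  show ?thesis
  \<comment> \<open>The bound \<open>M\<close> might be zero, hence the 1 added in the
    denominator.\<close>
  proof (rule that[of "c / (M + 1)" B "c / \<delta>"])
    show "0 < c / (M + 1)" "0 \<le> B" using c_pos M(1) nn by (auto simp: B_def)
    fix t x assume *: "t \<in> {0..T}" "x \<in> {0..L}"
    have "1 = \<bar>Q t x\<bar> * \<bar>P t x\<bar>" using Q_P[OF *] by (simp flip: abs_mult)
    also have "\<dots> \<le> \<bar>Q t x\<bar> * (M + 1)" using M(2)[OF *] by (intro mult_left_mono) auto
    finally have "1 / (M + 1) \<le> \<bar>Q t x\<bar>" using M(1) by (simp add: pos_divide_le_eq)
    then have "c * (1 / (M + 1)) \<le> c * \<bar>Q t x\<bar>" using c_pos by (intro mult_left_mono) auto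
    moreover have "c * \<bar>Q t x\<bar> \<le> c * (1 / \<delta>)" using c_pos Q_le[OF *] by (intro mult_left_mono) auto
    ultimately show "c / (M + 1) \<le> \<bar>c * Q t x\<bar> \<and> \<bar>c * Q t x\<bar> \<le> c / \<delta>"
      using c_pos by (simp add: abs_mult)
  next
    fix t x y assume *: "t \<in> {0..T}" "x \<in> {0..L}" "y \<in> {0..L}"
    have b: "N1 / r \<le> B" "(1 / \<delta>) * (1 / \<delta>) * N2 / r \<le> B"
      using nn unfolding B_def by linarith+
    have "N1 / r * (r * \<bar>y - x\<bar>) \<le> B * (r * \<bar>y - x\<bar>)"
      "(1 / \<delta>) * (1 / \<delta>) * N2 / r * (r * \<bar>y - x\<bar>) \<le> B * (r * \<bar>y - x\<bar>)"
      by (rule mult_right_mono[OF b(1)], use r_pos in simp, rule mult_right_mono[OF b(2)], use r_pos in simp)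
    moreover have "N1 / r * (r * \<bar>y - x\<bar>) = N1 * \<bar>y - x\<bar>"
      "(1 / \<delta>) * (1 / \<delta>) * N2 / r * (r * \<bar>y - x\<bar>) = (1 / \<delta>) * (1 / \<delta>) * (N2 * \<bar>y - x\<bar>)"
      using r_pos by simp_all
    moreover have "(1 / \<delta>) * (1 / \<delta>) * \<bar>P t y - P t x\<bar> \<le> (1 / \<delta>) * (1 / \<delta>) * (N2 * \<bar>y - x\<bar>)"
      using N2(2)[OF *] by (intro mult_left_mono) auto
    ultimately show "\<bar>V t y - V t x\<bar> \<le> B * (r * \<bar>y - x\<bar>) \<and> \<bar>Q t y - Q t x\<bar> \<le> B * (r * \<bar>y - x\<bar>)"
      using N1(2)[OF *] Q_diff[OF *(1,1,2,3)] by linarith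
  next
    fix t s x assume *: "t \<in> {0..T}" "s \<in> {0..T}" "x \<in> {0..L}"
    have "\<bar>Q s x - Q t x\<bar> \<le> (1 / \<delta>) * (1 / \<delta>) * \<bar>P s x - P t x\<bar>" by (rule Q_diff[OF *(1,2,3,3)])
    also have "\<dots> \<le> (1 / \<delta>) * (1 / \<delta>) * (N3 * \<bar>s - t\<bar>)"
      using N3(2)[OF *] by (intro mult_left_mono) auto
    also have "\<dots> \<le> B * \<bar>s - t\<bar>"
      using mult_right_mono[of "(1 / \<delta>) * (1 / \<delta>) * N3" B "\<bar>s - t\<bar>"] nn by (simp add: B_def mult.assoc)
    finally show "\<bar>Q s x - Q t x\<bar> \<le> B * \<bar>s - t\<bar>" .
  qed
qed

text \<open>The mesh width is \<open>\<Delta>x = h / r\<close>.\<close>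

definition gr :: "real \<Rightarrow> real \<Rightarrow> (real \<Rightarrow> 'a) \<Rightarrow> int \<Rightarrow> 'a" where
  "gr y h f j = f (y + of_int j * (h / r))"

lemma gr_shift: "f (y + of_int j * (h / r) + of_int k * (h / r)) = gr y h f (j + k)"
  by (simp add: gr_def distrib_right add.assoc add_divide_distrib)

lemma coeffs_grid:
  assumes q: "\<And>t x. \<lbrakk>t \<in> {0..T}; x \<in> {0..L}\<rbrakk> \<Longrightarrow> q \<le> \<bar>c * Q t x\<bar> \<and> \<bar>c * Q t x\<bar> \<le> q'"
    and B: "\<And>t x y. \<lbrakk>t \<in> {0..T}; x \<in> {0..L}; y \<in> {0..L}\<rbrakk> \<Longrightarrow>
       \<bar>V t y - V t x\<bar> \<le> B * (r * \<bar>y - x\<bar>) \<and> \<bar>Q t y - Q t x\<bar> \<le> B * (r * \<bar>y - x\<bar>)"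
    and t: "t \<in> {0..T}" and h: "0 < h" and x: "\<And>j. j \<in> {a..b} \<Longrightarrow> y + of_int j * (h / r) \<in> {0..L}"
  shows "coeffs_ok c q q' B h a b (gr y h (P t)) (gr y h (Q t)) (gr y h (V t))"
  unfolding coeffs_ok_def
proof (intro conjI ballI)
  fix j assume j: "j \<in> {a..b}"
  show "gr y h (Q t) j * gr y h (P t) j = 1" unfolding gr_def by (rule Q_P[OF t x[OF j]])
  show "q \<le> \<bar>c * gr y h (Q t) j\<bar>" "\<bar>c * gr y h (Q t) j\<bar> \<le> q'" "\<bar>gr y h (V t) j\<bar> \<le> c"
    unfolding gr_def using q[OF t x[OF j]] V_less[OF t x[OF j]] by auto
next
  fix j assume j: "j \<in> {a..b - 1}"
  then have "y + of_int j * (h / r) \<in> {0..L}" "y + of_int (j + 1) * (h / r) \<in> {0..L}"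
    using x[of j] x[of "j + 1"] by simp_all
  note lip = B[OF t this]
  have e: "y + of_int (j + 1) * (h / r) - (y + of_int j * (h / r)) = h / r"
    by (simp add: algebra_simps add_divide_distrib)
  have "r * \<bar>h / r\<bar> = h" using h r_pos by simp
  note lip = lip[unfolded e this]
  then show "\<bar>gr y h (V t) (j + 1) - gr y h (V t) j\<bar> \<le> B * h"
    "\<bar>gr y h (Q t) (j + 1) - gr y h (Q t) j\<bar> \<le> B * h"
    unfolding gr_def by blast+
qed

text \<open>Makes \<open>energy_growth\<close> applicable to the first variation, with zero
  residual.\<close>

lemma first_variation_grid:
  fixes f :: "real \<Rightarrow> real^2"
  assumes "P t (y + of_int j * (h / r)) \<noteq> 0"
  shows "gr y h (first_variation cf D K \<rho>a r u t (h / r) f) j $ 1 =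
      lw_lin_dens r (c\<^sup>2) (gr y h (V t)) (gr y h (P t)) (\<lambda>j. gr y h f j $ 1) (\<lambda>j. gr y h f j $ 2) j"
    and "gr y h (first_variation cf D K \<rho>a r u t (h / r) f) j $ 2 =
      lw_lin_vel r (c\<^sup>2) (gr y h (V t)) (gr y h (Q t)) (\<lambda>j. gr y h f j $ 1) (\<lambda>j. gr y h f j $ 2) j"
proof -
  let ?w = "u t (y + of_int j * (h / r))"
  have w: "?w $ 1 \<noteq> 0" using assms by (simp add: P_def)
  define k qj where "k = K / \<rho>a" and "qj = inverse (?w $ 1)"
  have *: "gr y h (first_variation cf D K \<rho>a r u t (h / r) f) j =
      variation_coeff cf D K \<rho>a r (-1) ?w *v gr y h f (j - 1) + variation_coeff cf D K \<rho>a r 0 ?w *v gr y h f j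
      + variation_coeff cf D K \<rho>a r 1 ?w *v gr y h f (j + 1)"
    using gr_shift[of f y j h "-1"] gr_shift[of f y j h 0] gr_shift[of f y j h 1]
    by (simp add: gr_def first_variation_def)
  have PQV: "gr y h (P t) j = ?w $ 1" "gr y h (Q t) j = inverse (?w $ 1)" "gr y h (V t) j = ?w $ 2"
    by (simp_all add: gr_def P_def Q_def V_def)
  note vc = variation_coeff_times(1)[OF r_pos w] variation_coeff_times(2)[OF r_pos w disjI1[OF refl]]
    variation_coeff_times(2)[OF r_pos w disjI2[OF refl]]
  show "gr y h (first_variation cf D K \<rho>a r u t (h / r) f) j $ 1 =
      lw_lin_dens r (c\<^sup>2) (gr y h (V t)) (gr y h (P t)) (\<lambda>j. gr y h f j $ 1) (\<lambda>j. gr y h f j $ 2) j"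
    unfolding * vc vector_add_component vector_2 lw_lin_dens_def PQV c_sq k_def[symmetric] qj_def[symmetric]
    by (simp add: field_simps power2_eq_square)
  show "gr y h (first_variation cf D K \<rho>a r u t (h / r) f) j $ 2 =
      lw_lin_vel r (c\<^sup>2) (gr y h (V t)) (gr y h (Q t)) (\<lambda>j. gr y h f j $ 1) (\<lambda>j. gr y h f j $ 2) j"
    unfolding * vc vector_add_component vector_2 lw_lin_vel_def PQV c_sq k_def[symmetric] qj_def[symmetric]
    by (simp add: field_simps power2_eq_square)
qed

abbreviation (input) "en t y h F \<equiv> energy c (gr y h (Q t)) (\<lambda>j. gr y h F j $ 1) (\<lambda>j. gr y h F j $ 2)"

lemma l2_stable_u:
  assumes cfl: "2 * r * c \<le> 1"
  shows "l2_stable T L cf D K \<rho>a r u"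
proof -
  obtain q q' B where q: "0 < q" and B: "0 \<le> B"
    and qq': "\<And>t x. \<lbrakk>t \<in> {0..T}; x \<in> {0..L}\<rbrakk> \<Longrightarrow> q \<le> \<bar>c * Q t x\<bar> \<and> \<bar>c * Q t x\<bar> \<le> q'"
    and lip: "\<And>t x y. \<lbrakk>t \<in> {0..T}; x \<in> {0..L}; y \<in> {0..L}\<rbrakk> \<Longrightarrow>
       \<bar>V t y - V t x\<bar> \<le> B * (r * \<bar>y - x\<bar>) \<and> \<bar>Q t y - Q t x\<bar> \<le> B * (r * \<bar>y - x\<bar>)"
    and lip_t: "\<And>t s x. \<lbrakk>t \<in> {0..T}; s \<in> {0..T}; x \<in> {0..L}\<rbrakk> \<Longrightarrow> \<bar>Q s x - Q t x\<bar> \<le> B * \<bar>s - t\<bar>"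
    by (rule uniform_bounds) (rule that)
  obtain M where M: "0 \<le> M" and growth: "energy_growth c r q q' B T M"
    using energy_step[OF c_pos r_pos cfl q B T_pos] by blast
  note step = energy_growthD[OF growth]
  let ?M = "\<lambda>t h. first_variation cf D K \<rho>a r u t (h / r)"
  let ?W = "\<lambda>t h. variation_product cf D K \<rho>a r u t h"
  \<comment> \<open>The factor that acts first on \<open>f\<close> belongs to the earliest time, so
    the induction peels it off. It costs one point at either end of the window; hence
    \<open>a\<close>, \<open>b\<close> and \<open>f\<close> are arbitrary.\<close>
  have iter: "(\<Sum>j\<in>{a + int n..b - int n}. en t y h (?W t h n f) j) \<le> (1 + M * h) ^ n * (\<Sum>j\<in>{a..b}. en (t - real n * h) y h f j)"
    if t: "t \<in> {0..T}" and h: "0 < h" and n: "real n * h \<le> t" and x: "\<And>j. j \<in> {a..b} \<Longrightarrow> y + of_int j * (h / r) \<in> {0..L}"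
    for t h n a b y f
    using n x
  proof (induction n arbitrary: f a b)
    case 0
    then show ?case by simp
  next
    case (Suc n)
    define s where "s = t - real (Suc n) * h"
    have n: "real n * h \<le> t" using Suc.prems(1) h by (simp add: algebra_simps)
    have nh: "0 \<le> real n * h" using h by simp
    have Suc_h: "real (Suc n) * h = real n * h + h" by (simp add: algebra_simps)
    have tT: "0 \<le> t" "t \<le> T" using t by auto
    have "0 \<le> s" "s \<le> T" "0 \<le> s + h" "s + h \<le> T" and s_eq: "s + h = t - real n * h"
      using Suc.prems(1) tT h n nh Suc_h unfolding s_def by linarith+
    then have s: "s \<in> {0..T}" "s + h \<in> {0..T}" "s + h = t - real n * h" by simp_all
    have hT: "h \<le> T" using Suc.prems(1) tT nh Suc_h by linarith
    have in_L: "y + of_int j * (h / r) \<in> {0..L}" if "j \<in> {a + 1..b - 1}" for j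
      using Suc.prems(2)[of j] that by auto
    have "(\<Sum>j\<in>{(a + 1) + int n..(b - 1) - int n}. en t y h (?W t h n (?M s h f)) j)
        \<le> (1 + M * h) ^ n * (\<Sum>j\<in>{a + 1..b - 1}. en (t - real n * h) y h (?M s h f) j)"
      by (rule Suc.IH[OF n in_L])
    also have "\<dots> \<le> (1 + M * h) ^ n * ((1 + M * h) * (\<Sum>j\<in>{a..b}. en s y h f j) + M / h * (\<Sum>j\<in>{a + 1..b - 1}. 0\<^sup>2 + 0\<^sup>2))"
    proof (rule mult_left_mono[OF step])
      show "coeffs_ok c q q' B h a b (gr y h (P s)) (gr y h (Q s)) (gr y h (V s))"
        by (rule coeffs_grid[OF qq' lip s(1) h Suc.prems(2)])
      fix j assume j: "j \<in> {a + 1..b - 1}"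
      show "\<bar>gr y h (Q (t - real n * h)) j - gr y h (Q s) j\<bar> \<le> B * h"
        using lip_t[OF s(1,2) in_L[OF j]] h by (simp add: gr_def s(3)[symmetric])
      show "gr y h (?M s h f) j $ 1 = lw_lin_dens r (c\<^sup>2) (gr y h (V s)) (gr y h (P s)) (\<lambda>j. gr y h f j $ 1) (\<lambda>j. gr y h f j $ 2) j + 0"
        "gr y h (?M s h f) j $ 2 = lw_lin_vel r (c\<^sup>2) (gr y h (V s)) (gr y h (Q s)) (\<lambda>j. gr y h f j $ 1) (\<lambda>j. gr y h f j $ 2) j + 0"
        using first_variation_grid[OF P_nonzero[OF s(1) in_L[OF j]]] by simp_all
    qed (use h hT M in auto)
    finally show ?case by (simp add: s_def algebra_simps)
  qed
  \<comment> \<open>The outer factors compare the Euclidean norm with the energy in both directions,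
    the middle one bounds (1 + M h)^n for n h \<le> T. The root is due to the energy being a
    square.\<close>
  define \<kappa> where "\<kappa> = sqrt ((1 + 1 / q\<^sup>2) * exp (M * T) * (1 + q'\<^sup>2))"
  show ?thesis
    unfolding l2_stable_def
  proof (intro exI[of _ "\<lambda>_. \<kappa>"] ballI allI impI)
    fix t h n y f assume t: "t \<in> {0..T}" and h: "0 < h" and n: "real n * h \<le> t"
    let ?d = "h / r"
    let ?a = "\<lceil>- y / ?d\<rceil>" and ?b = "\<lfloor>(L - y) / ?d\<rfloor>"
    have d: "0 < ?d" using h r_pos by simp
    have m0: "mesh y ?d 0 L = (\<lambda>j. y + of_int j * ?d) ` {?a..?b}"
      using mesh_eq_image[OF d, of y 0 L] by simp
    have x: "y + of_int j * ?d \<in> {0..L}" if "j \<in> {?a..?b}" for j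
    proof -
      have "y + of_int j * ?d \<in> mesh y ?d 0 L" unfolding m0 using that by blast
      then show ?thesis unfolding mesh_def by blast
    qed
    have inj: "inj_on (\<lambda>j. y + of_int j * ?d) J" for J
      using h r_pos by (auto simp: inj_on_def)
    have L2: "(L2_set (\<lambda>x. norm (F x)) ((\<lambda>j. y + of_int j * ?d) ` J)) = sqrt (\<Sum>j\<in>J. (norm (gr y h F j))\<^sup>2)"
      for F :: "real \<Rightarrow> real^2" and J
      unfolding L2_set_def sum.reindex[OF inj] o_def gr_def ..
    have upper: "en s y h F j \<le> (1 + q'\<^sup>2) * (norm (gr y h F j))\<^sup>2"
      and lower: "(norm (gr y h F j))\<^sup>2 \<le> (1 + 1 / q\<^sup>2) * en s y h F j"
      if "j \<in> {?a..?b}" "s \<in> {0..T}" for F :: "real \<Rightarrow> real^2" and j s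
    proof -
      let ?k = "(c * gr y h (Q s) j)\<^sup>2"
      have k: "q\<^sup>2 \<le> ?k" "?k \<le> q'\<^sup>2"
        using power_mono[of q "\<bar>c * gr y h (Q s) j\<bar>" 2] power_mono[of "\<bar>c * gr y h (Q s) j\<bar>" q' 2]
          qq'[OF that(2) x[OF that(1)]] q
        by (simp_all only: gr_def power2_abs abs_ge_zero less_imp_le)
      have "?k * (gr y h F j $ 1)\<^sup>2 \<le> q'\<^sup>2 * (gr y h F j $ 1)\<^sup>2" using k by (intro mult_right_mono) auto
      moreover have "0 \<le> q'\<^sup>2 * (gr y h F j $ 2)\<^sup>2" "0 \<le> (gr y h F j $ 1)\<^sup>2" by simp_all
      ultimately show "en s y h F j \<le> (1 + q'\<^sup>2) * (norm (gr y h F j))\<^sup>2"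
        unfolding energy_def norm_square_2 power_mult_distrib[of _ "gr y h F j $ 1"] distrib_left distrib_right mult_1 by linarith
      have "(gr y h F j $ 1)\<^sup>2 = 1 / q\<^sup>2 * (q\<^sup>2 * (gr y h F j $ 1)\<^sup>2)" using q by simp
      also have "\<dots> \<le> 1 / q\<^sup>2 * (?k * (gr y h F j $ 1)\<^sup>2)" using k by (intro mult_left_mono mult_right_mono) auto
      finally have "(gr y h F j $ 1)\<^sup>2 \<le> 1 / q\<^sup>2 * (?k * (gr y h F j $ 1)\<^sup>2)" .
      moreover have "0 \<le> 1 / q\<^sup>2 * (gr y h F j $ 2)\<^sup>2" "0 \<le> ?k * (gr y h F j $ 1)\<^sup>2" by simp_all
      ultimately show "(norm (gr y h F j))\<^sup>2 \<le> (1 + 1 / q\<^sup>2) * en s y h F j"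
        unfolding energy_def norm_square_2 power_mult_distrib[of _ "gr y h F j $ 1"] distrib_left distrib_right mult_1 by linarith
    qed
    let ?J = "{?a + int n..?b - int n}"
    have tn: "t - real n * h \<in> {0..T}"
    proof -
      have "0 \<le> real n * h" using h by simp
      then show ?thesis using n t by auto
    qed
    have "(\<Sum>j\<in>?J. (norm (gr y h (?W t h n f) j))\<^sup>2) \<le> (\<Sum>j\<in>?J. (1 + 1 / q\<^sup>2) * en t y h (?W t h n f) j)"
      by (intro sum_mono lower[OF _ t]) auto
    also have "\<dots> = (1 + 1 / q\<^sup>2) * (\<Sum>j\<in>?J. en t y h (?W t h n f) j)" by (simp only: sum_distrib_left)
    also have "\<dots> \<le> (1 + 1 / q\<^sup>2) * (exp (M * T) * (\<Sum>j\<in>{?a..?b}. en (t - real n * h) y h f j))"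
    proof (rule mult_left_mono)
      have "(1 + M * h) ^ n \<le> exp (M * h) ^ n" using M h by (intro power_mono exp_ge_add_one_self) auto
      also have "\<dots> = exp (real n * (M * h))" by (rule exp_of_nat_mult[symmetric])
      also have "\<dots> = exp (M * (real n * h))" by (simp only: mult.left_commute)
      also have "\<dots> \<le> exp (M * T)"
        unfolding exp_le_cancel_iff by (rule mult_left_mono[OF _ M]) (use n t in simp)
      finally have "(1 + M * h) ^ n * (\<Sum>j\<in>{?a..?b}. en (t - real n * h) y h f j) \<le> exp (M * T) * (\<Sum>j\<in>{?a..?b}. en (t - real n * h) y h f j)"
        by (rule mult_right_mono) (intro sum_nonneg energy_nonneg)
      then show "(\<Sum>j\<in>?J. en t y h (?W t h n f) j) \<le> exp (M * T) * (\<Sum>j\<in>{?a..?b}. en (t - real n * h) y h f j)"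
        using iter[OF t h n x] by (rule order_trans[rotated])
    qed simp
    also have "\<dots> \<le> (1 + 1 / q\<^sup>2) * (exp (M * T) * (\<Sum>j\<in>{?a..?b}. (1 + q'\<^sup>2) * (norm (gr y h f j))\<^sup>2))"
      by (intro mult_left_mono sum_mono upper tn) auto
    also have "\<dots> = ((1 + 1 / q\<^sup>2) * exp (M * T) * (1 + q'\<^sup>2)) * (\<Sum>j\<in>{?a..?b}. (norm (gr y h f j))\<^sup>2)"
      by (simp only: sum_distrib_left[symmetric] mult.assoc)
    finally have "sqrt (\<Sum>j\<in>?J. (norm (gr y h (?W t h n f) j))\<^sup>2) \<le> \<kappa> * sqrt (\<Sum>j\<in>{?a..?b}. (norm (gr y h f j))\<^sup>2)"
      unfolding \<kappa>_def real_sqrt_mult[symmetric] by (rule real_sqrt_le_mono)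
    then show "L2_set (\<lambda>x. norm (?W t h n f x)) (mesh y ?d (real n * ?d) (L - real n * ?d)) \<le> \<kappa> * L2_set (\<lambda>x. norm (f x)) (mesh y ?d 0 L)"
      unfolding mesh_eq_image[OF d] m0 L2 .
  qed
qed

end

section \<open>Perturbation of the nonlinear scheme\<close>

text \<open>Mixed second difference of the friction law, for the control of difference quotients.
  First e moves to e' at the base a', then the increments at the bases a' and a are compared; the
  latter works because the derivative 2 |y| is Lipschitz.\<close>

lemma mult_abs_second_difference:
  fixes a a' e e' :: real
  shows "\<bar>((a' + e') * \<bar>a' + e'\<bar> - a' * \<bar>a'\<bar>) - ((a + e) * \<bar>a + e\<bar> - a * \<bar>a\<bar>)\<bar>
    \<le> 2 * (\<bar>a'\<bar> + \<bar>e\<bar> + \<bar>e'\<bar>) * \<bar>e' - e\<bar> + 2 * \<bar>a' - a\<bar> * \<bar>e\<bar>"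
proof -
  have lip: "\<bar>x * \<bar>x\<bar> - y * \<bar>y\<bar>\<bar> \<le> 2 * m * \<bar>x - y\<bar>" if "\<bar>x\<bar> \<le> m" "\<bar>y\<bar> \<le> m" for x y m :: real
  proof -
    have "norm (x * \<bar>x\<bar> - y * \<bar>y\<bar>) \<le> (2 * m) * norm (x - y)"
      by (rule field_differentiable_bound[of "{-m..m}" "\<lambda>y. y * \<bar>y\<bar>" "\<lambda>y. 2 * \<bar>y\<bar>"])
         (use that in \<open>auto intro: DERIV_mult_abs\<close>)
    then show ?thesis by simp
  qed
  have 1: "\<bar>(a' + e') * \<bar>a' + e'\<bar> - (a' + e) * \<bar>a' + e\<bar>\<bar> \<le> 2 * (\<bar>a'\<bar> + \<bar>e\<bar> + \<bar>e'\<bar>) * \<bar>(a' + e') - (a' + e)\<bar>"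
    by (rule lip) auto
  have 2: "\<bar>((a' + e) * \<bar>a' + e\<bar> - (a + e) * \<bar>a + e\<bar>) - (a' * \<bar>a'\<bar> - a * \<bar>a\<bar>)\<bar> \<le> 2 * \<bar>a' - a\<bar> * \<bar>e\<bar>"
  proof -
    let ?g = "\<lambda>s. (a' + s) * \<bar>a' + s\<bar> - (a + s) * \<bar>a + s\<bar>"
    have chain: "((\<lambda>s. (a + s) * \<bar>a + s\<bar>) has_real_derivative 2 * \<bar>a + s\<bar> * 1) (at s)" for a s :: real
      by (rule DERIV_chain2[where f="\<lambda>y. y * \<bar>y\<bar>" and g="\<lambda>s. a + s"], rule DERIV_mult_abs)
         (auto intro!: derivative_eq_intros)
    have "norm (?g e - ?g 0) \<le> (2 * \<bar>a' - a\<bar>) * norm (e - 0)"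
    proof (rule field_differentiable_bound[of UNIV ?g "\<lambda>s. 2 * \<bar>a' + s\<bar> - 2 * \<bar>a + s\<bar>"])
      fix s
      show "(?g has_field_derivative 2 * \<bar>a' + s\<bar> - 2 * \<bar>a + s\<bar>) (at s within UNIV)"
        using DERIV_diff[OF chain[of a' s] chain[of a s]] by simp
      show "norm (2 * \<bar>a' + s\<bar> - 2 * \<bar>a + s\<bar>) \<le> 2 * \<bar>a' - a\<bar>"
        unfolding right_diff_distrib[symmetric] abs_mult real_norm_def abs_numeral
        using abs_triangle_ineq3[of "a' + s" "a + s"] by simp
    qed auto
    then show ?thesis by simp
  qed
  have eq: "(p - z) + ((z - x) - (q - y)) = (p - q) - (x - y)" for p q x y z :: real by simp
  show ?thesis
    using order_trans[OF abs_triangle_ineq add_mono[OF 1 2]] unfolding eq add_diff_cancel_left .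
qed

section \<open>Perturbation calculus for grid functions\<close>

context grid_orders
begin

text \<open>Two bounds on the same error: one by the weight, including neighbouring differences, and
  an absolute one by the step. The absolute one reflects the bootstrap hypothesis and claims nothing
  about differences.\<close>

definition small :: "('i \<Rightarrow> real) \<Rightarrow> ('i \<Rightarrow> real) \<Rightarrow> bool" where
  "small \<omega> p \<longleftrightarrow> ord \<omega> 0 p \<and> (\<exists>C\<ge>0. \<forall>i\<in>I. \<bar>p i\<bar> \<le> C * h i)"

lemma smallI: "\<lbrakk>ord \<omega> 0 p; 0 \<le> C; \<And>i. i \<in> I \<Longrightarrow> \<bar>p i\<bar> \<le> C * h i\<rbrakk> \<Longrightarrow> small \<omega> p"
  unfolding small_def by blast

lemma smallE:
  assumes "small \<omega> p"
  obtains C where "0 \<le> C" "\<And>i. i \<in> I \<Longrightarrow> \<bar>p i\<bar> \<le> C * h i"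
  using assms unfolding small_def by blast

lemma small_ord: "small \<omega> p \<Longrightarrow> ord \<omega> 0 p"
  by (simp add: small_def)

lemma small_zero: "small \<omega> (\<lambda>_. 0)"
  by (rule smallI[of _ _ 0]) (simp_all add: ord_zero)

lemma small_add:
  assumes "small \<omega> p" "small \<omega> q"
  shows "small \<omega> (\<lambda>i. p i + q i)"
proof -
  obtain C where C: "0 \<le> C" "\<And>i. i \<in> I \<Longrightarrow> \<bar>p i\<bar> \<le> C * h i" by (rule smallE[OF assms(1)]) (rule that)
  obtain D where D: "0 \<le> D" "\<And>i. i \<in> I \<Longrightarrow> \<bar>q i\<bar> \<le> D * h i" by (rule smallE[OF assms(2)]) (rule that)
  show ?thesis
  proof (rule smallI[of _ _ "C + D"])
    show "\<bar>p i + q i\<bar> \<le> (C + D) * h i" if "i \<in> I" for i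
      using C(2)[OF that] D(2)[OF that] by (simp add: distrib_right)
  qed (use C D assms in \<open>auto intro: ord_add small_ord\<close>)
qed

lemma small_mult:
  assumes "ord1 0 q" "small \<omega> p"
  shows "small \<omega> (\<lambda>i. q i * p i)"
proof -
  from assms(1) obtain C where C: "0 \<le> C" "\<And>i. i \<in> I \<Longrightarrow> \<bar>q i\<bar> \<le> C * \<bar>1\<bar> * h i ^ 0" by (rule ordE) blast
  obtain D where D: "0 \<le> D" "\<And>i. i \<in> I \<Longrightarrow> \<bar>p i\<bar> \<le> D * h i" by (rule smallE[OF assms(2)]) (rule that)
  show ?thesis
  proof (rule smallI[of _ _ "C * D"])
    show "ord \<omega> 0 (\<lambda>i. q i * p i)" using ord_mult[OF assms(1) small_ord[OF assms(2)]] by simp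
    show "\<bar>q i * p i\<bar> \<le> C * D * h i" if "i \<in> I" for i
    proof -
      have "\<bar>q i\<bar> * \<bar>p i\<bar> \<le> C * (D * h i)" using C(1) C(2)[OF that] D(2)[OF that] by (intro mult_mono) auto
      then show ?thesis by (simp add: abs_mult mult.assoc)
    qed
  qed (use C D in auto)
qed

lemma small_minus: "small \<omega> p \<Longrightarrow> small \<omega> (\<lambda>i. - p i)"
  using small_mult[OF ord_const[of "-1"], of \<omega> p] by simp

lemma small_ord1:
  assumes "small \<omega> p"
  shows "ord1 0 p"
proof -
  obtain C where C: "0 \<le> C" "\<And>i. i \<in> I \<Longrightarrow> \<bar>p i\<bar> \<le> C * h i" by (rule smallE[OF assms]) (rule that)
  show ?thesis
  proof (rule ordI2[where C="C * H" and D="2 * C"])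
    fix i assume i: "i \<in> I"
    have "C * h i \<le> C * H" using C(1) h_le[OF i] by (intro mult_left_mono)
    then show "\<bar>p i\<bar> \<le> C * H * \<bar>1\<bar> * h i ^ 0" using C(2)[OF i] by simp
    assume s: "sh i \<in> I"
    have "\<bar>p (sh i)\<bar> \<le> C * h i" "\<bar>p i\<bar> \<le> C * h i" using C(2)[OF i] C(2)[OF s] h_shift[OF i s] by auto
    then show "\<bar>p (sh i) - p i\<bar> \<le> 2 * C * \<bar>1\<bar> * h i ^ Suc 0" by simp
  qed
qed

text \<open>One factor takes the absolute bound and the other the weighted one, so a quadratic error
  term becomes linear in the weight with a gain of h.\<close>

lemma small_mult_small:
  assumes p: "small \<omega> p" and q: "small \<omega> q"
  shows "ord \<omega> 1 (\<lambda>i. p i * q i)"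
proof -
  obtain C where C: "0 \<le> C" "\<And>i. i \<in> I \<Longrightarrow> \<bar>p i\<bar> \<le> C * h i" by (rule smallE[OF p]) (rule that)
  obtain D where D: "0 \<le> D" "\<And>i. i \<in> I \<Longrightarrow> \<bar>q i\<bar> \<le> D * h i" by (rule smallE[OF q]) (rule that)
  from small_ord[OF p] obtain C' where C': "0 \<le> C'"
    "\<And>i. \<lbrakk>i \<in> I; sh i \<in> I\<rbrakk> \<Longrightarrow> \<bar>p (sh i) - p i\<bar> \<le> C' * \<bar>\<omega> i\<bar> * h i ^ Suc 0" by (rule ordE) blast
  from small_ord[OF q] obtain D' where D': "0 \<le> D'" "\<And>i. i \<in> I \<Longrightarrow> \<bar>q i\<bar> \<le> D' * \<bar>\<omega> i\<bar> * h i ^ 0"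
    "\<And>i. \<lbrakk>i \<in> I; sh i \<in> I\<rbrakk> \<Longrightarrow> \<bar>q (sh i) - q i\<bar> \<le> D' * \<bar>\<omega> i\<bar> * h i ^ Suc 0" by (rule ordE) blast
  show ?thesis
  proof (rule ordI2[where C="C * D'" and D="C * D' + C' * D"])
    fix i assume i: "i \<in> I"
    have "\<bar>p i\<bar> * \<bar>q i\<bar> \<le> (C * h i) * (D' * \<bar>\<omega> i\<bar>)"
      using C C'(1) D'(2)[OF i] h_pos[OF i] by (intro mult_mono C i) auto
    then show "\<bar>p i * q i\<bar> \<le> C * D' * \<bar>\<omega> i\<bar> * h i ^ 1" by (simp add: abs_mult mult_ac)
    assume s: "sh i \<in> I"
    have 1: "\<bar>p i\<bar> * \<bar>q (sh i) - q i\<bar> \<le> (C * h i) * (D' * \<bar>\<omega> i\<bar> * h i)"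
      using C D'(3)[OF i s] h_pos[OF i] by (intro mult_mono C i) auto
    have 2: "\<bar>p (sh i) - p i\<bar> * \<bar>q (sh i)\<bar> \<le> (C' * \<bar>\<omega> i\<bar> * h i) * (D * h i)"
      using C' D(2)[OF s] C'(2)[OF i s] h_shift[OF i s] h_pos[OF i] by (intro mult_mono) auto
    have "p (sh i) * q (sh i) - p i * q i = p i * (q (sh i) - q i) + (p (sh i) - p i) * q (sh i)"
      by (simp add: algebra_simps)
    then have "\<bar>p (sh i) * q (sh i) - p i * q i\<bar> \<le> \<bar>p i\<bar> * \<bar>q (sh i) - q i\<bar> + \<bar>p (sh i) - p i\<bar> * \<bar>q (sh i)\<bar>"
      by (metis abs_mult abs_triangle_ineq)
    also have "\<dots> \<le> (C * h i) * (D' * \<bar>\<omega> i\<bar> * h i) + (C' * \<bar>\<omega> i\<bar> * h i) * (D * h i)"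
      using 1 2 by (rule add_mono)
    also have "\<dots> = (C * D' + C' * D) * \<bar>\<omega> i\<bar> * h i ^ Suc 1"
      by (simp add: algebra_simps)
    finally show "\<bar>p (sh i) * q (sh i) - p i * q i\<bar> \<le> (C * D' + C' * D) * \<bar>\<omega> i\<bar> * h i ^ Suc 1" .
  qed
qed

text \<open>Perturbations \<open>p'\<close> of \<open>p\<close>: by a small amount for \<open>p = O(1)\<close> (\<open>pert0\<close>) and \<open>p = O(h)\<close>
  (\<open>pert1\<close>), and by an amount of order \<open>\<omega> h\<close> (\<open>pertN\<close>), which the energy estimate absorbs.\<close>

definition pert0 where "pert0 \<omega> p' p \<longleftrightarrow> ord1 0 p \<and> small \<omega> (\<lambda>i. p' i - p i)"
definition pert1 where "pert1 \<omega> p' p \<longleftrightarrow> ord1 1 p \<and> small \<omega> (\<lambda>i. p' i - p i)"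
definition pertN where "pertN \<omega> p' p \<longleftrightarrow> ord1 0 p \<and> ord \<omega> 1 (\<lambda>i. p' i - p i)"

lemma pert1_pert0: "pert1 \<omega> p' p \<Longrightarrow> pert0 \<omega> p' p"
  unfolding pert0_def pert1_def using ord_mono by blast

lemma pert0_refl: "ord1 0 p \<Longrightarrow> pert0 \<omega> p p"
  unfolding pert0_def by (simp add: small_zero)

lemma pert0_const: "pert0 \<omega> (\<lambda>_. c) (\<lambda>_. c)"
  by (intro pert0_refl ord_const)

lemma pert0_add: "\<lbrakk>pert0 \<omega> p' p; pert0 \<omega> q' q\<rbrakk> \<Longrightarrow> pert0 \<omega> (\<lambda>i. p' i + q' i) (\<lambda>i. p i + q i)"
  unfolding pert0_def using ord_add[of "\<lambda>_. 1" 0 p q] small_add[of \<omega> "\<lambda>i. p' i - p i" "\<lambda>i. q' i - q i"]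
  by (simp add: algebra_simps)

lemma pertN_add: "\<lbrakk>pertN \<omega> p' p; pertN \<omega> q' q\<rbrakk> \<Longrightarrow> pertN \<omega> (\<lambda>i. p' i + q' i) (\<lambda>i. p i + q i)"
  unfolding pertN_def using ord_add[of "\<lambda>_. 1" 0 p q] ord_add[of \<omega> 1 "\<lambda>i. p' i - p i" "\<lambda>i. q' i - q i"]
  by (simp add: algebra_simps)

lemma pert0_mult:
  assumes "pert0 \<omega> p' p" "pert0 \<omega> q' q"
  shows "pert0 \<omega> (\<lambda>i. p' i * q' i) (\<lambda>i. p i * q i)"
proof -
  have o: "ord1 0 p" "ord1 0 q" "small \<omega> (\<lambda>i. p' i - p i)" "small \<omega> (\<lambda>i. q' i - q i)"
    using assms by (auto simp: pert0_def)
  have "small \<omega> (\<lambda>i. q i * (p' i - p i) + p i * (q' i - q i) + (p' i - p i) * (q' i - q i))"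
    by (intro small_add small_mult o small_ord1[OF o(3)])
  moreover have "q i * (p' i - p i) + p i * (q' i - q i) + (p' i - p i) * (q' i - q i) = p' i * q' i - p i * q i" for i
    by (simp add: algebra_simps)
  ultimately have "small \<omega> (\<lambda>i. p' i * q' i - p i * q i)" by (simp only:)
  then show ?thesis using ord_mult[OF o(1,2)] by (simp add: pert0_def)
qed

lemma pert0_power: "pert0 \<omega> p' p \<Longrightarrow> pert0 \<omega> (\<lambda>i. p' i ^ k) (\<lambda>i. p i ^ k)"
proof (induction k)
  case 0
  then show ?case by (simp add: pert0_const)
next
  case (Suc k)
  then show ?case using pert0_mult[of \<omega> p' p] by simp
qed

text \<open>The change p (q' - q) has the order of the weight without a factor h, so it belongs to
  the linearised step and is split off. The rest gains h because q is O(h), or because both factors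
  are perturbed.\<close>

lemma linear_perturbation:
  assumes "pert0 \<omega> p' p" "pert1 \<omega> q' q"
  shows "ord \<omega> 1 (\<lambda>i. p' i * q' i - p i * q i - p i * (q' i - q i))"
proof -
  have o: "small \<omega> (\<lambda>i. p' i - p i)" "ord1 1 q" "small \<omega> (\<lambda>i. q' i - q i)"
    using assms by (auto simp: pert0_def pert1_def)
  have "ord \<omega> 1 (\<lambda>i. q i * (p' i - p i) + (p' i - p i) * (q' i - q i))"
    using ord_add[OF _ small_mult_small[OF o(1,3)]] ord_mult[OF o(2) small_ord[OF o(1)]] by simp
  moreover have "q i * (p' i - p i) + (p' i - p i) * (q' i - q i) = p' i * q' i - p i * q i - p i * (q' i - q i)" for i
    by (simp add: algebra_simps)
  ultimately show ?thesis by (simp only:)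
qed

lemma pert1_mult: 
  assumes "pert0 \<omega> p' p" "pert1 \<omega> q' q"
  shows "pert1 \<omega> (\<lambda>i. p' i * q' i) (\<lambda>i. p i * q i)"
  using pert0_mult[OF assms(1) pert1_pert0[OF assms(2)]] ord_mult[of 0 p "\<lambda>_. 1" 1 q] assms
  by (simp add: pert0_def pert1_def)

lemma pertN_mult:
  assumes "pert1 \<omega> p' p" "pert1 \<omega> q' q"
  shows "pertN \<omega> (\<lambda>i. p' i * q' i) (\<lambda>i. p i * q i)"
proof -
  have o: "ord1 1 p" "ord1 1 q" "small \<omega> (\<lambda>i. p' i - p i)" "small \<omega> (\<lambda>i. q' i - q i)"
    using assms by (auto simp: pert1_def)
  have "ord \<omega> 1 (\<lambda>i. q i * (p' i - p i) + p i * (q' i - q i) + (p' i - p i) * (q' i - q i))"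
    using ord_mult[OF o(2) small_ord[OF o(3)]] ord_mult[OF o(1) small_ord[OF o(4)]]
    by (intro ord_add[OF ord_add small_mult_small[OF o(3,4)]]) simp_all
  moreover have "q i * (p' i - p i) + p i * (q' i - q i) + (p' i - p i) * (q' i - q i) = p' i * q' i - p i * q i" for i
    by (simp add: algebra_simps)
  ultimately have "ord \<omega> 1 (\<lambda>i. p' i * q' i - p i * q i)" by (simp only:)
  then show ?thesis using ord_mono[OF ord_mult[OF o(1,2)], of 0] by (simp add: pertN_def)
qed

lemma pertN_step:
  assumes "pert0 \<omega> q' q"
  shows "pertN \<omega> (\<lambda>i. h i * q' i) (\<lambda>i. h i * q i)"
proof -
  have o: "ord1 0 q" "small \<omega> (\<lambda>i. q' i - q i)" using assms by (auto simp: pert0_def)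
  have "ord \<omega> 1 (\<lambda>i. h i * q' i - h i * q i)"
    using ord_mult[OF ord_step small_ord[OF o(2)]] by (simp add: right_diff_distrib)
  then show ?thesis using ord_mono[OF ord_mult[OF ord_step o(1)], of 0] by (simp add: pertN_def)
qed

lemma pert0_step: "pert0 \<omega> h h"
  by (intro pert0_refl ord_mono[OF ord_step]) simp

text \<open>The change of |v| has no better neighbouring difference than its own size, as the
  modulus is not differentiable. Its size at both points is enough here: q' is O(h), which supplies
  the power of h missing in the difference bound.\<close>

lemma pertN_abs:
  assumes v: "ord1 0 v" and d: "0 \<le> C" "\<And>i. i \<in> I \<Longrightarrow> \<bar>v' i - v i\<bar> \<le> C * \<bar>\<omega> i\<bar>"
    "\<And>i. \<lbrakk>i \<in> I; sh i \<in> I\<rbrakk> \<Longrightarrow> \<bar>v' (sh i) - v (sh i)\<bar> \<le> C * \<bar>\<omega> i\<bar>"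
    and q: "pert1 \<omega> q' q"
  shows "pertN \<omega> (\<lambda>i. h i * (\<bar>v' i\<bar> * q' i)) (\<lambda>i. h i * (\<bar>v i\<bar> * q i))"
proof -
  let ?d = "\<lambda>i. \<bar>v' i\<bar> - \<bar>v i\<bar>"
  have o: "ord1 1 q" "small \<omega> (\<lambda>i. q' i - q i)" using q by (auto simp: pert1_def)
  from o(1) obtain D1 where D1: "0 \<le> D1" "\<And>i. i \<in> I \<Longrightarrow> \<bar>q i\<bar> \<le> D1 * \<bar>1\<bar> * h i ^ 1" by (rule ordE) blast
  obtain D2 where D2: "0 \<le> D2" "\<And>i. i \<in> I \<Longrightarrow> \<bar>q' i - q i\<bar> \<le> D2 * h i" by (rule smallE[OF o(2)]) (rule that)
  have q': "\<bar>q' i\<bar> \<le> (D1 + D2) * h i" if "i \<in> I" for i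
    using D1(2)[OF that] D2(2)[OF that] by (simp add: distrib_right)
  have dd: "\<bar>?d i\<bar> \<le> C * \<bar>\<omega> i\<bar>" if "i \<in> I" for i
    using d(2)[OF that] by linarith
  have ds: "\<bar>?d (sh i)\<bar> \<le> C * \<bar>\<omega> i\<bar>" if "i \<in> I" "sh i \<in> I" for i
    using d(3)[OF that] by linarith
  have "ord \<omega> 1 (\<lambda>i. h i * (?d i * q' i))"
  proof (rule ordI2[where C="C * (D1 + D2) * H" and D="2 * (C * (D1 + D2))"])
    fix i assume i: "i \<in> I"
    have *: "\<bar>h i * (x * y)\<bar> \<le> C * (D1 + D2) * \<bar>\<omega> i\<bar> * h i * h i"
      if "\<bar>x\<bar> \<le> C * \<bar>\<omega> i\<bar>" "\<bar>y\<bar> \<le> (D1 + D2) * h i" for x y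
    proof -
      have "\<bar>x\<bar> * \<bar>y\<bar> \<le> (C * \<bar>\<omega> i\<bar>) * ((D1 + D2) * h i)" using that d(1) by (intro mult_mono) auto
      then have "h i * (\<bar>x\<bar> * \<bar>y\<bar>) \<le> h i * ((C * \<bar>\<omega> i\<bar>) * ((D1 + D2) * h i))"
        using h_pos[OF i] by (intro mult_left_mono) auto
      then show ?thesis using h_pos[OF i] by (simp add: abs_mult mult_ac)
    qed
    have 1: "\<bar>h i * (?d i * q' i)\<bar> \<le> C * (D1 + D2) * \<bar>\<omega> i\<bar> * h i * h i" by (rule *[OF dd q']) (rule i)+
    also have "\<dots> \<le> C * (D1 + D2) * \<bar>\<omega> i\<bar> * h i * H"
      using h_le[OF i] h_pos[OF i] d(1) D1(1) D2(1) by (intro mult_left_mono) auto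
    finally show "\<bar>h i * (?d i * q' i)\<bar> \<le> C * (D1 + D2) * H * \<bar>\<omega> i\<bar> * h i ^ 1" by (simp add: mult_ac)
    assume s: "sh i \<in> I"
    have "\<bar>h i * (?d (sh i) * q' (sh i))\<bar> \<le> C * (D1 + D2) * \<bar>\<omega> i\<bar> * h i * h i"
      using ds[OF i s] q'[OF s] h_shift[OF i s] by (intro *) auto
    then have "\<bar>h i * (?d (sh i) * q' (sh i)) - h i * (?d i * q' i)\<bar> \<le> 2 * (C * (D1 + D2) * \<bar>\<omega> i\<bar> * h i * h i)"
      using 1 by linarith
    then show "\<bar>h (sh i) * (?d (sh i) * q' (sh i)) - h i * (?d i * q' i)\<bar> \<le> 2 * (C * (D1 + D2)) * \<bar>\<omega> i\<bar> * h i ^ Suc 1"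
      unfolding h_shift[OF i s] by (simp add: mult_ac)
  qed
  moreover have "ord \<omega> 1 (\<lambda>i. h i * (\<bar>v i\<bar> * (q' i - q i)))"
    using ord_mult[OF ord_step ord_mult[OF ord_abs[OF v] small_ord[OF o(2)]]] by simp
  ultimately have "ord \<omega> 1 (\<lambda>i. h i * (?d i * q' i) + h i * (\<bar>v i\<bar> * (q' i - q i)))" by (rule ord_add)
  moreover have "h i * (?d i * q' i) + h i * (\<bar>v i\<bar> * (q' i - q i)) = h i * (\<bar>v' i\<bar> * q' i) - h i * (\<bar>v i\<bar> * q i)" for i
    by (simp add: algebra_simps)
  ultimately have "ord \<omega> 1 (\<lambda>i. h i * (\<bar>v' i\<bar> * q' i) - h i * (\<bar>v i\<bar> * q i))" by (simp only:)
  moreover have "ord1 (1 + (0 + 1)) (\<lambda>i. h i * (\<bar>v i\<bar> * q i))" by (intro ord_mult ord_step ord_abs v o)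
  ultimately show ?thesis using ord_mono[of _ "1 + (0 + 1)" _ 0] by (auto simp: pertN_def)
qed

lemma pert0_inverse:
  assumes p: "pert0 \<omega> p' p" and \<delta>: "0 < \<delta>" "\<And>i. i \<in> I \<Longrightarrow> \<delta> \<le> \<bar>p i\<bar>" "\<And>i. i \<in> I \<Longrightarrow> \<delta> \<le> \<bar>p' i\<bar>"
  shows "pert0 \<omega> (\<lambda>i. inverse (p' i)) (\<lambda>i. inverse (p i))"
proof -
  have o: "ord1 0 p" "small \<omega> (\<lambda>i. p' i - p i)" using p by (auto simp: pert0_def)
  have p': "ord1 0 p'" using ord_add[OF o(1) small_ord1[OF o(2)]] by simp
  have i: "ord1 0 (\<lambda>i. inverse (p' i))" "ord1 0 (\<lambda>i. inverse (p i))"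
    by (rule ord_inverse[OF p' \<delta>(1,3)], assumption, rule ord_inverse[OF o(1) \<delta>(1,2)])
  have "small \<omega> (\<lambda>i. - (inverse (p' i) * (inverse (p i) * (p' i - p i))))"
    by (intro small_minus small_mult i o)
  moreover have "- (inverse (p' i) * (inverse (p i) * (p' i - p i))) = inverse (p' i) - inverse (p i)" if "i \<in> I" for i
  proof -
    have "p i * inverse (p i) = 1" "p' i * inverse (p' i) = 1" using \<delta>(1) \<delta>(2,3)[OF that] by auto
    then show ?thesis by algebra
  qed
  ultimately have "small \<omega> (\<lambda>i. inverse (p' i) - inverse (p i))"
    unfolding small_def ord_def by simp
  then show ?thesis using i by (simp add: pert0_def)
qed

text \<open>The source term h C V |V| contains no difference that could supply a further power of h,
  so \<open>pertN_abs\<close> does not apply. Instead the Lipschitz derivative of V |V| controls the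
  neighbouring difference.\<close>

lemma pert0_mult_abs:
  assumes "pert0 \<omega> v' v"
  shows "pert0 \<omega> (\<lambda>i. v' i * \<bar>v' i\<bar>) (\<lambda>i. v i * \<bar>v i\<bar>)"
proof -
  let ?e = "\<lambda>i. v' i - v i"
  have v: "ord1 0 v" and e: "small \<omega> ?e" using assms by (auto simp: pert0_def)
  from v obtain A where A: "0 \<le> A" "\<And>i. i \<in> I \<Longrightarrow> \<bar>v i\<bar> \<le> A * \<bar>1\<bar> * h i ^ 0"
    "\<And>i. \<lbrakk>i \<in> I; sh i \<in> I\<rbrakk> \<Longrightarrow> \<bar>v (sh i) - v i\<bar> \<le> A * \<bar>1\<bar> * h i ^ Suc 0" by (rule ordE) blast
  obtain C where C: "0 \<le> C" "\<And>i. i \<in> I \<Longrightarrow> \<bar>?e i\<bar> \<le> C * h i" by (rule smallE[OF e]) (rule that)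
  from small_ord[OF e] obtain D where D: "0 \<le> D" "\<And>i. i \<in> I \<Longrightarrow> \<bar>?e i\<bar> \<le> D * \<bar>\<omega> i\<bar> * h i ^ 0"
    "\<And>i. \<lbrakk>i \<in> I; sh i \<in> I\<rbrakk> \<Longrightarrow> \<bar>?e (sh i) - ?e i\<bar> \<le> D * \<bar>\<omega> i\<bar> * h i ^ Suc 0" by (rule ordE) blast
  have eH: "\<bar>?e i\<bar> \<le> C * H" if "i \<in> I" for i
    using C(2)[OF that] mult_left_mono[OF h_le[OF that] C(1)] by linarith
  \<comment> \<open>Dominates twice the sum of |v| and of the errors at both points, which is the
    coefficient in \<open>mult_abs_second_difference\<close>.\<close>
  define M where "M = 2 * (A + 2 * (C * H))"
  have M: "0 \<le> M" using A(1) C(1) H_pos by (simp add: M_def)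
  have diff: "\<bar>v' i * \<bar>v' i\<bar> - v i * \<bar>v i\<bar>\<bar> \<le> M * \<bar>?e i\<bar>" if "i \<in> I" for i
  proof -
    have "\<bar>v' i * \<bar>v' i\<bar> - v i * \<bar>v i\<bar>\<bar> \<le> 2 * (\<bar>v i\<bar> + \<bar>?e i\<bar>) * \<bar>?e i\<bar>"
      using mult_abs_second_difference[of "v i" "?e i" "v i" 0] by simp
    also have "\<dots> \<le> M * \<bar>?e i\<bar>"
    proof (rule mult_right_mono)
      have "0 \<le> C * H" using C(1) H_pos by simp
      moreover have "\<bar>v i\<bar> \<le> A" using A(2)[OF that] by simp
      ultimately show "2 * (\<bar>v i\<bar> + \<bar>?e i\<bar>) \<le> M" using eH[OF that] unfolding M_def by (simp add: algebra_simps)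
    qed simp
    finally show ?thesis .
  qed
  have "small \<omega> (\<lambda>i. v' i * \<bar>v' i\<bar> - v i * \<bar>v i\<bar>)"
  proof (rule smallI[where C="M * C"])
    show "\<bar>v' i * \<bar>v' i\<bar> - v i * \<bar>v i\<bar>\<bar> \<le> M * C * h i" if "i \<in> I" for i
      using diff[OF that] mult_left_mono[OF C(2)[OF that] M] by (simp add: mult.assoc)
    show "ord \<omega> 0 (\<lambda>i. v' i * \<bar>v' i\<bar> - v i * \<bar>v i\<bar>)"
    proof (rule ordI2[where C="M * D" and D="M * D + 2 * A * D"])
      fix i assume i: "i \<in> I"
      show "\<bar>v' i * \<bar>v' i\<bar> - v i * \<bar>v i\<bar>\<bar> \<le> M * D * \<bar>\<omega> i\<bar> * h i ^ 0"
        using diff[OF i] mult_left_mono[OF D(2)[OF i] M] by (simp add: mult.assoc)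
      assume s: "sh i \<in> I"
      have "\<bar>(v' (sh i) * \<bar>v' (sh i)\<bar> - v (sh i) * \<bar>v (sh i)\<bar>) - (v' i * \<bar>v' i\<bar> - v i * \<bar>v i\<bar>)\<bar>
          \<le> 2 * (\<bar>v (sh i)\<bar> + \<bar>?e i\<bar> + \<bar>?e (sh i)\<bar>) * \<bar>?e (sh i) - ?e i\<bar> + 2 * \<bar>v (sh i) - v i\<bar> * \<bar>?e i\<bar>"
        using mult_abs_second_difference[of "v (sh i)" "?e (sh i)" "v i" "?e i"] by simp
      also have "\<dots> \<le> M * (D * \<bar>\<omega> i\<bar> * h i) + 2 * (A * h i) * (D * \<bar>\<omega> i\<bar>)"
      proof (rule add_mono; rule mult_mono)
        have "\<bar>v (sh i)\<bar> \<le> A" using A(2)[OF s] by simp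
        then show "2 * (\<bar>v (sh i)\<bar> + \<bar>?e i\<bar> + \<bar>?e (sh i)\<bar>) \<le> M"
          using eH[OF i] eH[OF s] unfolding M_def by (simp add: algebra_simps)
        show "\<bar>?e (sh i) - ?e i\<bar> \<le> D * \<bar>\<omega> i\<bar> * h i" using D(3)[OF i s] by simp
        show "2 * \<bar>v (sh i) - v i\<bar> \<le> 2 * (A * h i)" using A(3)[OF i s] by simp
        show "\<bar>?e i\<bar> \<le> D * \<bar>\<omega> i\<bar>" using D(2)[OF i] by simp
      qed (use M A(1) h_pos[OF i] in simp_all)
      also have "\<dots> = (M * D + 2 * A * D) * \<bar>\<omega> i\<bar> * h i ^ Suc 0" by (simp add: algebra_simps)
      finally show "\<bar>(v' (sh i) * \<bar>v' (sh i)\<bar> - v (sh i) * \<bar>v (sh i)\<bar>) - (v' i * \<bar>v' i\<bar> - v i * \<bar>v i\<bar>)\<bar>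
          \<le> (M * D + 2 * A * D) * \<bar>\<omega> i\<bar> * h i ^ Suc 0" .
    qed
  qed (use M C in auto)
  then show ?thesis
    using ord_mult[OF v ord_abs[OF v]] by (simp add: pert0_def)
qed

text \<open>Terms linear in one difference keep a principal part and go through
  \<open>linear_perturbation\<close>. Terms with two differences or with a factor h, friction
  included, are absorbed entirely.\<close>

lemma lw_dens_linearised:
  assumes P: "pert0 \<omega> P' P" and V: "pert0 \<omega> V' V"
    and a: "pert1 \<omega> aP' aP" "pert1 \<omega> aV' aV" and s: "pert1 \<omega> sP' sP" "pert1 \<omega> sV' sV"
    and d: "0 \<le> C" "\<And>i. i \<in> I \<Longrightarrow> \<bar>V' i - V i\<bar> \<le> C * \<bar>\<omega> i\<bar>"
      "\<And>i. \<lbrakk>i \<in> I; sh i \<in> I\<rbrakk> \<Longrightarrow> \<bar>V' (sh i) - V (sh i)\<bar> \<le> C * \<bar>\<omega> i\<bar>"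
  shows "ord \<omega> 1 (\<lambda>i. lw_dens k K (h i) (P' i) (V' i) \<bar>V' i\<bar> (aP' i) (aV' i) (sP' i) (sV' i)
      - lw_dens k K (h i) (P i) (V i) \<bar>V i\<bar> (aP i) (aV i) (sP i) (sV i)
      - ((P' i - P i) - V i * (aP' i - aP i) - P i * (aV' i - aV i)
         + ((V i)\<^sup>2 + k) / 2 * (sP' i - sP i) + P i * V i * (sV' i - sV i)))"
proof -
  have v: "ord1 0 V" using V by (simp add: pert0_def)
  have "pert0 \<omega> (\<lambda>i. ((V' i)\<^sup>2 + k) * (1 / 2)) (\<lambda>i. ((V i)\<^sup>2 + k) * (1 / 2))"
    by (intro pert0_mult pert0_add pert0_power pert0_const V)
  then have half: "pert0 \<omega> (\<lambda>i. ((V' i)\<^sup>2 + k) / 2) (\<lambda>i. ((V i)\<^sup>2 + k) / 2)" by simp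
  note lin = linear_perturbation[OF V a(1)] linear_perturbation[OF P a(2)] linear_perturbation[OF half s(1)]
    linear_perturbation[OF pert0_mult[OF P V] s(2)]
  \<comment> \<open>Each summand is arranged as a product of two O(h) quantities or as
    \<open>h i\<close> times a factor, the shapes for which \<open>pertN\<close> is
    available.\<close>
  have "pertN \<omega> (\<lambda>i. (P' i * aV' i) * aV' i + 2 * V' i * aV' i * aP' i + h i * (\<bar>V' i\<bar> * (K * P' i * aV' i))
        + h i * (K / 2 * (V' i * \<bar>V' i\<bar>) * aP' i))
      (\<lambda>i. (P i * aV i) * aV i + 2 * V i * aV i * aP i + h i * (\<bar>V i\<bar> * (K * P i * aV i))
        + h i * (K / 2 * (V i * \<bar>V i\<bar>) * aP i))"
    by (intro pertN_add pertN_mult pert1_mult pert0_mult pert0_const P V a pertN_step pertN_abs[OF v d]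
        pert0_mult_abs pert1_pert0[OF a(1)])
  then have N: "ord \<omega> 1 (\<lambda>i. ((P' i * aV' i) * aV' i + 2 * V' i * aV' i * aP' i + h i * (\<bar>V' i\<bar> * (K * P' i * aV' i))
        + h i * (K / 2 * (V' i * \<bar>V' i\<bar>) * aP' i))
      - ((P i * aV i) * aV i + 2 * V i * aV i * aP i + h i * (\<bar>V i\<bar> * (K * P i * aV i))
        + h i * (K / 2 * (V i * \<bar>V i\<bar>) * aP i)))"
    by (simp add: pertN_def)
  show ?thesis
    by (rule ord_cong[OF ord_add[OF ord_add[OF ord_diff[OF ord_diff[OF N lin(1)] lin(2)] lin(3)] lin(4)]])
       (simp add: lw_dens_def algebra_simps power2_eq_square add_divide_distrib diff_divide_distrib)
qed

lemma lw_vel_linearised: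
  assumes Q: "pert0 \<omega> Q' Q" and V: "pert0 \<omega> V' V"
    and a: "pert1 \<omega> aP' aP" "pert1 \<omega> aV' aV" and s: "pert1 \<omega> sP' sP" "pert1 \<omega> sV' sV"
    and d: "0 \<le> C" "\<And>i. i \<in> I \<Longrightarrow> \<bar>V' i - V i\<bar> \<le> C * \<bar>\<omega> i\<bar>"
      "\<And>i. \<lbrakk>i \<in> I; sh i \<in> I\<rbrakk> \<Longrightarrow> \<bar>V' (sh i) - V (sh i)\<bar> \<le> C * \<bar>\<omega> i\<bar>"
  shows "ord \<omega> 1 (\<lambda>i. lw_vel k K (h i) (Q' i) (V' i) \<bar>V' i\<bar> (aP' i) (aV' i) (sP' i) (sV' i)
      - lw_vel k K (h i) (Q i) (V i) \<bar>V i\<bar> (aP i) (aV i) (sP i) (sV i)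
      - ((V' i - V i) - k * Q i * (aP' i - aP i) - V i * (aV' i - aV i)
         + k * V i * Q i * (sP' i - sP i) + ((V i)\<^sup>2 + k) / 2 * (sV' i - sV i)))"
proof -
  have v: "ord1 0 V" using V by (simp add: pert0_def)
  have "pert0 \<omega> (\<lambda>i. ((V' i)\<^sup>2 + k) * (1 / 2)) (\<lambda>i. ((V i)\<^sup>2 + k) * (1 / 2))"
    by (intro pert0_mult pert0_add pert0_power pert0_const V)
  then have half: "pert0 \<omega> (\<lambda>i. ((V' i)\<^sup>2 + k) / 2) (\<lambda>i. ((V i)\<^sup>2 + k) / 2)" by simp
  have kQ: "pert0 \<omega> (\<lambda>i. k * Q' i) (\<lambda>i. k * Q i)" "pert0 \<omega> (\<lambda>i. k * V' i * Q' i) (\<lambda>i. k * V i * Q i)"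
    by (intro pert0_mult pert0_const Q V)+
  note lin = linear_perturbation[OF kQ(1) a(1)] linear_perturbation[OF V a(2)] linear_perturbation[OF kQ(2) s(1)]
    linear_perturbation[OF half s(2)]
  have "pertN \<omega> (\<lambda>i. h i * ((- K) * (V' i * \<bar>V' i\<bar>)) + (V' i * aV' i) * aV' i
        + h i * (5 / 2 * K * (V' i * \<bar>V' i\<bar>) * aV' i) + k * Q' i * aP' i * aV' i
        + ((- k) * V' i * Q' i * Q' i * aP' i) * aP' i + h i * (\<bar>V' i\<bar> * (K * k * Q' i * aP' i))
        + h i * (h i * (K\<^sup>2 * V' i ^ 3)))
      (\<lambda>i. h i * ((- K) * (V i * \<bar>V i\<bar>)) + (V i * aV i) * aV i
        + h i * (5 / 2 * K * (V i * \<bar>V i\<bar>) * aV i) + k * Q i * aP i * aV i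
        + ((- k) * V i * Q i * Q i * aP i) * aP i + h i * (\<bar>V i\<bar> * (K * k * Q i * aP i))
        + h i * (h i * (K\<^sup>2 * V i ^ 3)))"
    by (intro pertN_add pertN_mult pert1_mult pert0_mult pert0_const Q V a pertN_step pertN_abs[OF v d]
        pert0_mult_abs pert0_step pert0_power pert1_pert0[OF a(2)])
  then have N: "ord \<omega> 1 (\<lambda>i. (h i * ((- K) * (V' i * \<bar>V' i\<bar>)) + (V' i * aV' i) * aV' i
        + h i * (5 / 2 * K * (V' i * \<bar>V' i\<bar>) * aV' i) + k * Q' i * aP' i * aV' i
        + ((- k) * V' i * Q' i * Q' i * aP' i) * aP' i + h i * (\<bar>V' i\<bar> * (K * k * Q' i * aP' i))
        + h i * (h i * (K\<^sup>2 * V' i ^ 3)))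
      - (h i * ((- K) * (V i * \<bar>V i\<bar>)) + (V i * aV i) * aV i
        + h i * (5 / 2 * K * (V i * \<bar>V i\<bar>) * aV i) + k * Q i * aP i * aV i
        + ((- k) * V i * Q i * Q i * aP i) * aP i + h i * (\<bar>V i\<bar> * (K * k * Q i * aP i))
        + h i * (h i * (K\<^sup>2 * V i ^ 3))))"
    by (simp add: pertN_def)
  show ?thesis
    by (rule ord_cong[OF ord_add[OF ord_add[OF ord_diff[OF ord_diff[OF N lin(1)] lin(2)] lin(3)] lin(4)]])
       (simp add: lw_vel_def algebra_simps power2_eq_square power3_eq_cube add_divide_distrib diff_divide_distrib)
qed

end

section \<open>The error on the cone\<close>

context pipe_grid
begin

lemma ord_A: "smooth f \<Longrightarrow> ord1 1 (A f)" and ord_S: "smooth f \<Longrightarrow> ord1 1 (S f)"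
proof -
  assume f: "smooth f"
  have 1: "ord1 1 (\<lambda>i. st i * dx L f (tm i) (ps i))"
    using ord_mult[OF ord_step ord_smooth[OF smooth_dx[OF f]]] by simp
  have 2: "ord1 1 (\<lambda>i. (st i)\<^sup>2 * dx L (dx L f) (tm i) (ps i))"
    using ord_mono[OF ord_mult[OF ord_step ord_mult[OF ord_step ord_smooth[OF smooth_dx[OF smooth_dx[OF f]]]]], of 1]
    by (simp add: power2_eq_square mult.assoc)
  have d: "ord1 3 (\<lambda>i. A f i - st i * dx L f (tm i) (ps i))"
    "ord1 3 (\<lambda>i. S f i - (st i)\<^sup>2 * dx L (dx L f) (tm i) (ps i))"
    using approx_differences[OF f] by (simp_all add: approx_def)
  show "ord1 1 (A f)" using ord_add[OF ord_mono[OF d(1), of 1] 1] by simp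
  show "ord1 1 (S f)" using ord_add[OF ord_mono[OF d(2), of 1] 2] by simp
qed

end

text \<open>From \<open>n0\<close> on, the step is at most half the lower bound
  \<open>\<delta>\<close> of the density. While the error is at most one step, the numerical density
  thus stays above \<open>\<delta> / 2\<close> in modulus and its reciprocal is harmless.\<close>

locale pipe_cone = pipe_grid +
  fixes t0 x0 \<delta> :: real and n0 :: nat
  assumes cone: "(t0, x0) \<in> cone_points T L r"
    and \<delta>_pos: "0 < \<delta>" and \<delta>_le: "\<lbrakk>t \<in> {0..T}; x \<in> {0..L}\<rbrakk> \<Longrightarrow> \<delta> \<le> \<bar>P t x\<bar>"
    and n0_pos: "0 < n0" and n0: "t0 / real n0 \<le> \<delta> / 2"
begin

definition stp :: "nat \<Rightarrow> real" where "stp n = t0 / real n"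
definition pos :: "nat \<Rightarrow> int \<Rightarrow> real" where "pos n j = x0 + of_int j * (stp n / r)"
text \<open>Half-width, in mesh points, of the cone slice at level k; the apex is level n.\<close>

definition wd :: "nat \<Rightarrow> nat \<Rightarrow> int" where "wd n k = int n - int k"
definition U :: "nat \<Rightarrow> nat \<Rightarrow> int \<Rightarrow> real^2" where
  "U n k j = lw_solution cf D K \<rho>a r (u 0) (stp n) k (pos n j)"

definition pn where "pn n k = gr x0 (stp n) (P (real k * stp n))"
definition vn where "vn n k = gr x0 (stp n) (V (real k * stp n))"
definition qn where "qn n k = gr x0 (stp n) (Q (real k * stp n))"

definition E1 where "E1 n k j = U n k j $ 1 - pn n k j"
definition E2 where "E2 n k j = U n k j $ 2 - vn n k j"

text \<open>Forward difference quotient, with r / stp n = 1 / \<Delta>x. It is zero where the right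
  neighbour leaves the slice, so sums over a slice may include the last point.\<close>

definition Gd :: "(nat \<Rightarrow> nat \<Rightarrow> int \<Rightarrow> real) \<Rightarrow> nat \<Rightarrow> nat \<Rightarrow> int \<Rightarrow> real" where
  "Gd E n k j = (if - wd n k \<le> j \<and> j < wd n k then r / stp n * (E n k (j + 1) - E n k j) else 0)"

definition mag :: "nat \<Rightarrow> nat \<Rightarrow> int \<Rightarrow> real" where
  "mag n k j = \<bar>E1 n k j\<bar> + \<bar>E2 n k j\<bar> + \<bar>Gd E1 n k j\<bar> + \<bar>Gd E2 n k j\<bar>"

text \<open>Serves as the weight of \<open>err.ord\<close>. Three neighbouring points are combined
  because a difference between i and its successor has to be bounded by the weight at i
  alone.\<close>

definition eb :: "nat \<Rightarrow> nat \<Rightarrow> int \<Rightarrow> real" where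
  "eb n k j = mag n k (j - 1) + mag n k j + mag n k (j + 1)"

text \<open>As long as the error is at most one step, nonlinear error terms are dominated by
  linear ones; the energy bound then shows that this persists.\<close>

definition good :: "nat \<Rightarrow> nat \<Rightarrow> bool" where
  "good n k \<longleftrightarrow> n0 \<le> n \<and> k < n \<and> (\<forall>l. \<bar>l\<bar> \<le> wd n k \<longrightarrow> \<bar>E1 n k l\<bar> \<le> stp n \<and> \<bar>E2 n k l\<bar> \<le> stp n)"

text \<open>Triples (n, k, j) of refinement, level and point. All refinements are indexed together
  for constants uniform in n; strict inequality keeps the whole stencil in the slice.\<close>

definition inds :: "(nat \<times> nat \<times> int) set" where
  "inds = {i. good (fst i) (fst (snd i)) \<and> \<bar>snd (snd i)\<bar> < wd (fst i) (fst (snd i))}"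

definition nxt :: "nat \<times> nat \<times> int \<Rightarrow> nat \<times> nat \<times> int" where
  "nxt i = (fst i, fst (snd i), snd (snd i) + 1)"

abbreviation (input) lift :: "(nat \<Rightarrow> nat \<Rightarrow> int \<Rightarrow> real) \<Rightarrow> nat \<times> nat \<times> int \<Rightarrow> real" where
  "lift f \<equiv> \<lambda>i. f (fst i) (fst (snd i)) (snd (snd i))"

definition cell :: "nat \<times> nat \<times> int \<Rightarrow> real \<times> real \<times> real" where
  "cell i = (real (fst (snd i)) * stp (fst i), pos (fst i) (snd (snd i)), stp (fst i))"

lemma t0_pos: "0 < t0" and t0_le: "t0 \<le> T"
proof -
  show "0 < t0" using cone by (simp add: cone_points_def)
  then have "(t0, x0) \<in> cone r t0 x0" by (simp add: cone_def)
  then show "t0 \<le> T" using cone by (auto simp: cone_points_def)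
qed

lemma stp_pos: "0 < n \<Longrightarrow> 0 < stp n"
  using t0_pos by (simp add: stp_def)

lemma stp_n: "0 < n \<Longrightarrow> real n * stp n = t0"
  by (simp add: stp_def)

lemma stp_le: "0 < n \<Longrightarrow> stp n \<le> t0"
  using t0_pos by (simp add: stp_def divide_le_eq)

lemma stp_le_\<delta>: "n0 \<le> n \<Longrightarrow> stp n \<le> \<delta> / 2"
proof -
  assume "n0 \<le> n"
  then have "stp n \<le> stp n0" using n0_pos t0_pos unfolding stp_def by (intro divide_left_mono) auto
  then show ?thesis using n0 unfolding stp_def by linarith
qed

lemma time_eq:
  assumes "0 < n"
  shows "t0 - real k * stp n = of_int (wd n k) * stp n"
  unfolding wd_def of_int_diff of_int_of_nat_eq left_diff_distrib stp_n[OF assms] ..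

lemma cone_point:
  assumes "0 < n" "k \<le> n" "\<bar>j\<bar> \<le> wd n k"
  shows "real k * stp n \<in> {0..T}" "pos n j \<in> {0..L}"
proof -
  have h: "0 < stp n" by (rule stp_pos[OF assms(1)])
  have "r * (pos n j - x0) = of_int j * stp n" using r_pos by (simp add: pos_def)
  then have "\<bar>r * (pos n j - x0)\<bar> = of_int \<bar>j\<bar> * stp n" using h by (simp add: abs_mult)
  also have "\<dots> \<le> of_int (wd n k) * stp n" using assms(3) h by (intro mult_right_mono) auto
  finally have le: "\<bar>r * (pos n j - x0)\<bar> \<le> t0 - real k * stp n" using time_eq[OF assms(1), of k] by simp
  then have "real k * stp n \<le> t0" by linarith
  with le h have "(real k * stp n, pos n j) \<in> cone r t0 x0" by (simp add: cone_def)
  then show "real k * stp n \<in> {0..T}" "pos n j \<in> {0..L}" using cone by (auto simp: cone_points_def)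
qed

lemma pn_eq: "pn n k j = P (real k * stp n) (pos n j)"
  and vn_eq: "vn n k j = V (real k * stp n) (pos n j)"
  and qn_eq: "qn n k j = Q (real k * stp n) (pos n j)"
  by (simp_all add: pn_def vn_def qn_def gr_def pos_def)

lemma inds_D:
  assumes "i \<in> inds"
  shows "0 < fst i" "n0 \<le> fst i" "fst (snd i) < fst i" "\<bar>snd (snd i)\<bar> < wd (fst i) (fst (snd i))"
    "good (fst i) (fst (snd i))"
  using assms by (auto simp: inds_def good_def)

lemma cell_in:
  assumes "i \<in> inds"
  shows "cell i \<in> cells"
proof -
  note i = inds_D[OF assms]
  have "pos (fst i) (snd (snd i)) - stp (fst i) / r = pos (fst i) (snd (snd i) - 1)"
    "pos (fst i) (snd (snd i)) + stp (fst i) / r = pos (fst i) (snd (snd i) + 1)"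
    by (simp_all add: pos_def algebra_simps add_divide_distrib diff_divide_distrib)
  moreover have "pos (fst i) (snd (snd i) - 1) \<in> {0..L}" "pos (fst i) (snd (snd i) + 1) \<in> {0..L}"
    using i by (intro cone_point(2)[of _ "fst (snd i)"]; linarith)+
  moreover have "real (fst (snd i)) * stp (fst i) \<in> {0..T}"
    using i by (intro cone_point(1)[of _ _ "snd (snd i)"]) auto
  ultimately show ?thesis using stp_pos[OF i(1)] by (simp add: cells_def cell_def)
qed

lemma cell_nxt: "cell (nxt i) = next_cell (cell i)"
  by (simp add: cell_def nxt_def next_cell_def pos_def algebra_simps add_divide_distrib)

sublocale err: grid_orders inds nxt "\<lambda>i. stp (fst i)" t0
  by unfold_locales (auto simp: nxt_def t0_pos intro: stp_pos stp_le dest: inds_D(1))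

lemma transfer_ord:
  assumes "ord1 m q"
  shows "err.ord1 m (\<lambda>i. q (cell i))"
proof -
  from assms obtain C where C: "0 \<le> C" "\<And>i. i \<in> cells \<Longrightarrow> \<bar>q i\<bar> \<le> C * \<bar>1\<bar> * st i ^ m"
    "\<And>i. \<lbrakk>i \<in> cells; next_cell i \<in> cells\<rbrakk> \<Longrightarrow> \<bar>q (next_cell i) - q i\<bar> \<le> C * \<bar>1\<bar> * st i ^ Suc m" by (rule ordE) blast
  have st: "st (cell i) = stp (fst i)" for i by (simp add: cell_def)
  show ?thesis
  proof (rule err.ordI[OF C(1)])
    fix i assume i: "i \<in> inds"
    show "\<bar>q (cell i)\<bar> \<le> C * \<bar>1\<bar> * stp (fst i) ^ m" using C(2)[OF cell_in[OF i]] by (simp add: st)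
    assume s: "nxt i \<in> inds"
    show "\<bar>q (cell (nxt i)) - q (cell i)\<bar> \<le> C * \<bar>1\<bar> * stp (fst i) ^ Suc m"
      using C(3)[OF cell_in[OF i]] cell_in[OF s] by (simp add: cell_nxt st)
  qed
qed

lemma ord_grid: "err.ord1 0 (lift pn)" "err.ord1 0 (lift vn)" "err.ord1 0 (lift qn)"
  using transfer_ord[OF ord_smooth[OF smooth_P]] transfer_ord[OF ord_smooth[OF smooth_V]] transfer_ord[OF ord_Q]
  by (simp_all add: pn_eq vn_eq qn_eq cell_def)

lemma mag_nonneg: "0 \<le> mag n k j" and eb_nonneg: "0 \<le> eb n k j"
  by (simp_all add: mag_def eb_def)

lemma E_bounds:
  assumes "E = E1 \<or> E = E2" "l \<in> {-1, 0, 1}"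
  shows "\<bar>E n k (j + l)\<bar> \<le> eb n k j" "\<bar>Gd E n k (j + l)\<bar> \<le> eb n k j"
  using assms mag_nonneg[of n k "j - 1"] mag_nonneg[of n k j] mag_nonneg[of n k "j + 1"]
  by (auto simp: eb_def mag_def)

lemma E_diff:
  assumes "- wd n k \<le> j" "j < wd n k" "0 < n"
  shows "E n k (j + 1) - E n k j = stp n / r * Gd E n k j"
  using assms stp_pos[OF assms(3)] r_pos by (simp add: Gd_def)

definition a1 where "a1 E n k j = r / 2 * (E n k (j + 1) - E n k (j - 1))" for E :: "nat \<Rightarrow> nat \<Rightarrow> int \<Rightarrow> real"
definition s1 where "s1 E n k j = r\<^sup>2 * (E n k (j + 1) - 2 * E n k j + E n k (j - 1))" for E :: "nat \<Rightarrow> nat \<Rightarrow> int \<Rightarrow> real"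

lemma a1_G:
  assumes "- wd n k < j" "j < wd n k" "0 < n"
  shows "a1 E n k j = stp n / 2 * (Gd E n k j + Gd E n k (j - 1))"
    and "s1 E n k j = r * stp n * (Gd E n k j - Gd E n k (j - 1))"
proof -
  have "E n k (j + 1) = E n k j + stp n / r * Gd E n k j" "E n k (j - 1) = E n k j - stp n / r * Gd E n k (j - 1)"
    using E_diff[of n k j E] E_diff[of n k "j - 1" E] assms by auto
  then have "E n k (j + 1) - E n k (j - 1) = stp n / r * (Gd E n k j + Gd E n k (j - 1))"
    "E n k (j + 1) - 2 * E n k j + E n k (j - 1) = stp n / r * (Gd E n k j - Gd E n k (j - 1))"
    by (simp_all add: algebra_simps)
  then show "a1 E n k j = stp n / 2 * (Gd E n k j + Gd E n k (j - 1))"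
    "s1 E n k j = r * stp n * (Gd E n k j - Gd E n k (j - 1))"
    using r_pos by (simp_all add: a1_def s1_def power2_eq_square)
qed

text \<open>Differences of the error are rewritten through \<open>Gd\<close>, which gains a factor
  of the step. The versions at j - 1 are used where a value at j + 1 has to be bounded by the weight
  at j.\<close>

lemma a1_s1_le:
  assumes "- wd n k < j" "j < wd n k" "0 < n" and E: "E = E1 \<or> E = E2"
  shows "\<bar>a1 E n k j\<bar> \<le> stp n * eb n k j" "\<bar>s1 E n k j\<bar> \<le> 2 * r * (stp n * eb n k j)"
    "\<bar>a1 E n k j\<bar> \<le> stp n * eb n k (j - 1)" "\<bar>s1 E n k j\<bar> \<le> 2 * r * (stp n * eb n k (j - 1))"
proof -
  have h: "0 < stp n" by (rule stp_pos[OF assms(3)])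
  have *: "\<bar>a1 E n k j\<bar> \<le> stp n * b" "\<bar>s1 E n k j\<bar> \<le> 2 * r * (stp n * b)"
    if "\<bar>Gd E n k j\<bar> \<le> b" "\<bar>Gd E n k (j - 1)\<bar> \<le> b" for b
  proof -
    have "\<bar>(Gd E n k j + Gd E n k (j - 1)) / 2\<bar> \<le> b" "\<bar>Gd E n k j - Gd E n k (j - 1)\<bar> \<le> 2 * b"
      using that by (auto simp: abs_le_iff)
    then have "stp n * \<bar>(Gd E n k j + Gd E n k (j - 1)) / 2\<bar> \<le> stp n * b"
      "(r * stp n) * \<bar>Gd E n k j - Gd E n k (j - 1)\<bar> \<le> (r * stp n) * (2 * b)"
      using h r_pos by (intro mult_left_mono; simp)+
    then show "\<bar>a1 E n k j\<bar> \<le> stp n * b" "\<bar>s1 E n k j\<bar> \<le> 2 * r * (stp n * b)"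
      unfolding a1_G[OF assms(1-3)] using h r_pos by (simp_all add: abs_mult mult_ac)
  qed
  have b0: "\<bar>Gd E n k j\<bar> \<le> eb n k j" "\<bar>Gd E n k (j - 1)\<bar> \<le> eb n k j"
    using E_bounds(2)[OF E, of 0 n k j] E_bounds(2)[OF E, of "-1" n k j] by simp_all
  have b1: "\<bar>Gd E n k j\<bar> \<le> eb n k (j - 1)" "\<bar>Gd E n k (j - 1)\<bar> \<le> eb n k (j - 1)"
    using E_bounds(2)[OF E, of 1 n k "j - 1"] E_bounds(2)[OF E, of 0 n k "j - 1"] by simp_all
  show "\<bar>a1 E n k j\<bar> \<le> stp n * eb n k j" "\<bar>s1 E n k j\<bar> \<le> 2 * r * (stp n * eb n k j)"
    "\<bar>a1 E n k j\<bar> \<le> stp n * eb n k (j - 1)" "\<bar>s1 E n k j\<bar> \<le> 2 * r * (stp n * eb n k (j - 1))"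
    using *[OF b0] *[OF b1] by auto
qed

text \<open>Absolute bounds come from \<open>good\<close>, weighted ones from \<open>Gd\<close>. For
  \<open>a1\<close> and \<open>s1\<close> the neighbouring differences are estimated by the sizes,
  which already contain the step.\<close>

lemma small_E:
  assumes E: "E = E1 \<or> E = E2"
  shows "err.small (lift eb) (lift E)" "err.small (lift eb) (lift (a1 E))" "err.small (lift eb) (lift (s1 E))"
proof -
  have Eh: "\<bar>E n k l\<bar> \<le> stp n" if "good n k" "\<bar>l\<bar> \<le> wd n k" for n k l
    using that E by (auto simp: good_def)
  show "err.small (lift eb) (lift E)"
  proof (rule err.smallI[where C=1])
    fix i assume i: "i \<in> inds"
    show "\<bar>lift E i\<bar> \<le> 1 * stp (fst i)" using Eh[OF inds_D(5)[OF i]] inds_D(4)[OF i] by simp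
  next
    show "err.ord (lift eb) 0 (lift E)"
    proof (rule err.ordI2[where C=1 and D="1 / r"])
      fix i assume i: "i \<in> inds"
      note d = inds_D[OF i]
      show "\<bar>lift E i\<bar> \<le> 1 * \<bar>lift eb i\<bar> * stp (fst i) ^ 0"
        using E_bounds(1)[OF E, of 0 "fst i" "fst (snd i)" "snd (snd i)"] by simp
      have "\<bar>stp (fst i) / r * Gd E (fst i) (fst (snd i)) (snd (snd i))\<bar> \<le> stp (fst i) / r * lift eb i"
        using E_bounds(2)[OF E, of 0 "fst i" "fst (snd i)" "snd (snd i)"] stp_pos[OF d(1)] r_pos
        unfolding abs_mult by (intro mult_mono) auto
      then show "\<bar>lift E (nxt i) - lift E i\<bar> \<le> 1 / r * \<bar>lift eb i\<bar> * stp (fst i) ^ Suc 0"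
        using E_diff[of "fst i" "fst (snd i)" "snd (snd i)" E] d eb_nonneg by (simp add: nxt_def mult_ac)
    qed
  qed simp
  show "err.small (lift eb) (lift (a1 E))"
  proof (rule err.smallI[where C=r])
    fix i assume i: "i \<in> inds"
    note d = inds_D[OF i]
    have "\<bar>E (fst i) (fst (snd i)) (snd (snd i) + 1)\<bar> \<le> stp (fst i)" "\<bar>E (fst i) (fst (snd i)) (snd (snd i) - 1)\<bar> \<le> stp (fst i)"
      using d(4) by (intro Eh[OF d(5)]; linarith)+
    then have "\<bar>(E (fst i) (fst (snd i)) (snd (snd i) + 1) - E (fst i) (fst (snd i)) (snd (snd i) - 1)) / 2\<bar> \<le> stp (fst i)"
      by (auto simp: abs_le_iff)
    then have "r * \<bar>(E (fst i) (fst (snd i)) (snd (snd i) + 1) - E (fst i) (fst (snd i)) (snd (snd i) - 1)) / 2\<bar> \<le> r * stp (fst i)"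
      using r_pos by (intro mult_left_mono) auto
    then show "\<bar>lift (a1 E) i\<bar> \<le> r * stp (fst i)" using r_pos by (simp add: a1_def abs_mult)
  next
    show "err.ord (lift eb) 0 (lift (a1 E))"
    proof (rule err.ordI2[where C=t0 and D=2])
      fix i assume i: "i \<in> inds"
      note d = inds_D[OF i]
      have "\<bar>lift (a1 E) i\<bar> \<le> stp (fst i) * lift eb i" using d by (intro a1_s1_le E) auto
      also have "\<dots> \<le> t0 * lift eb i" using stp_le[OF d(1)] eb_nonneg by (intro mult_right_mono)
      finally show "\<bar>lift (a1 E) i\<bar> \<le> t0 * \<bar>lift eb i\<bar> * stp (fst i) ^ 0" using eb_nonneg by simp
      assume "nxt i \<in> inds"
      note s = inds_D[OF this, unfolded nxt_def, simplified]
      have "\<bar>lift (a1 E) i\<bar> \<le> stp (fst i) * lift eb i" using d by (intro a1_s1_le E) auto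
      moreover have "\<bar>a1 E (fst i) (fst (snd i)) (snd (snd i) + 1)\<bar> \<le> stp (fst i) * lift eb i"
        using a1_s1_le(3)[of "fst i" "fst (snd i)" "snd (snd i) + 1" E] d(1) s E by auto
      ultimately show "\<bar>lift (a1 E) (nxt i) - lift (a1 E) i\<bar> \<le> 2 * \<bar>lift eb i\<bar> * stp (fst i) ^ Suc 0"
        using eb_nonneg by (simp add: nxt_def mult.commute)
    qed
  qed (use r_pos in simp)
  show "err.small (lift eb) (lift (s1 E))"
  proof (rule err.smallI[where C="4 * r\<^sup>2"])
    fix i assume i: "i \<in> inds"
    note d = inds_D[OF i]
    let ?E = "E (fst i) (fst (snd i))" and ?j = "snd (snd i)"
    have "\<bar>?E (?j + 1)\<bar> \<le> stp (fst i)" "\<bar>?E (?j - 1)\<bar> \<le> stp (fst i)" "\<bar>?E ?j\<bar> \<le> stp (fst i)"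
      using d(4) by (intro Eh[OF d(5)]; linarith)+
    then have "\<bar>?E (?j + 1) - 2 * ?E ?j + ?E (?j - 1)\<bar> \<le> 4 * stp (fst i)" by linarith
    then have "r\<^sup>2 * \<bar>?E (?j + 1) - 2 * ?E ?j + ?E (?j - 1)\<bar> \<le> r\<^sup>2 * (4 * stp (fst i))"
      by (intro mult_left_mono) auto
    then show "\<bar>lift (s1 E) i\<bar> \<le> 4 * r\<^sup>2 * stp (fst i)" by (simp add: s1_def abs_mult mult_ac)
  next
    show "err.ord (lift eb) 0 (lift (s1 E))"
    proof (rule err.ordI2[where C="2 * r * t0" and D="4 * r"])
      fix i assume i: "i \<in> inds"
      note d = inds_D[OF i]
      have 1: "\<bar>lift (s1 E) i\<bar> \<le> 2 * r * (stp (fst i) * lift eb i)" using d by (intro a1_s1_le E) auto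
      also have "\<dots> \<le> 2 * r * (t0 * lift eb i)" using stp_le[OF d(1)] eb_nonneg r_pos by (intro mult_left_mono mult_right_mono) auto
      finally show "\<bar>lift (s1 E) i\<bar> \<le> 2 * r * t0 * \<bar>lift eb i\<bar> * stp (fst i) ^ 0" using eb_nonneg by (simp add: mult.assoc)
      assume "nxt i \<in> inds"
      note s = inds_D[OF this, unfolded nxt_def, simplified]
      have "\<bar>s1 E (fst i) (fst (snd i)) (snd (snd i) + 1)\<bar> \<le> 2 * r * (stp (fst i) * lift eb i)"
        using a1_s1_le(4)[of "fst i" "fst (snd i)" "snd (snd i) + 1" E] d(1) s E by auto
      with 1 have "\<bar>lift (s1 E) (nxt i) - lift (s1 E) i\<bar> \<le> 4 * (r * (stp (fst i) * lift eb i))"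
        unfolding nxt_def by simp
      then show "\<bar>lift (s1 E) (nxt i) - lift (s1 E) i\<bar> \<le> 4 * r * \<bar>lift eb i\<bar> * stp (fst i) ^ Suc 0"
        using eb_nonneg by (simp add: mult_ac)
    qed
  qed simp
qed

end

lemma abs_residual_le:
  fixes h w :: real
  assumes "\<bar>a\<bar> \<le> C * \<bar>w\<bar> * x" "\<bar>b\<bar> \<le> D * \<bar>1\<bar> * y" "0 \<le> w" "0 \<le> C" "0 \<le> D" "0 \<le> x" "0 \<le> y"
  shows "\<bar>a + b\<bar> \<le> (C + D) * (x * w + y)"
proof -
  have "0 \<le> D * (x * w)" "0 \<le> C * y" using assms by auto
  then show ?thesis using assms(1,2,3) by (simp add: algebra_simps abs_le_iff)
qed

section \<open>Residual of the linearised error equation\<close>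

context pipe_cone
begin

lemma U_Suc: "U n (Suc k) j = lax_wendroff cf D K \<rho>a (stp n) (stp n / r) (\<lambda>l. U n k (j + l))"
proof -
  have "pos n j + of_int l * (stp n / r) = pos n (j + l)" for l
    by (simp add: pos_def algebra_simps add_divide_distrib)
  then show ?thesis by (simp add: U_def)
qed

definition Lin1 where
  "Lin1 n k j = E1 n k j - vn n k j * a1 E1 n k j - pn n k j * a1 E2 n k j
     + ((vn n k j)\<^sup>2 + c\<^sup>2) / 2 * s1 E1 n k j + pn n k j * vn n k j * s1 E2 n k j"

definition Lin2 where
  "Lin2 n k j = E2 n k j - c\<^sup>2 * qn n k j * a1 E1 n k j - vn n k j * a1 E2 n k j
     + c\<^sup>2 * vn n k j * qn n k j * s1 E1 n k j + ((vn n k j)\<^sup>2 + c\<^sup>2) / 2 * s1 E2 n k j"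

lemma Lin_eq:
  "Lin1 n k j = lw_lin_dens r (c\<^sup>2) (vn n k) (pn n k) (E1 n k) (E2 n k) j"
  "Lin2 n k j = lw_lin_vel r (c\<^sup>2) (vn n k) (qn n k) (E1 n k) (E2 n k) j"
  by (simp_all add: Lin1_def Lin2_def lw_lin_dens_def lw_lin_vel_def a1_def s1_def field_simps)

definition Rm1 where "Rm1 n k j = E1 n (Suc k) j - Lin1 n k j"
definition Rm2 where "Rm2 n k j = E2 n (Suc k) j - Lin2 n k j"

lemma ord_rest_t:
  assumes f: "smooth f"
  shows "err.ord1 3 (\<lambda>i. rest_t f (tm (cell i)) (tm (cell i) + stp (fst i)) (ps (cell i)))"
proof -
  obtain M where M: "0 \<le> M"
    "\<And>t s x. \<lbrakk>t \<in> {0..T}; s \<in> {0..T}; x \<in> {0..L}\<rbrakk> \<Longrightarrow> \<bar>rest_t f t s x\<bar> \<le> M * \<bar>s - t\<bar> ^ 3"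
    "\<And>t s x y. \<lbrakk>t \<in> {0..T}; s \<in> {0..T}; x \<in> {0..L}; y \<in> {0..L}\<rbrakk>
       \<Longrightarrow> \<bar>rest_t f t s y - rest_t f t s x\<bar> \<le> M * \<bar>y - x\<bar> * \<bar>s - t\<bar> ^ 3"
    by (rule rest_t_bounds[OF f]) (rule that)
  have tt: "tm (cell i) + stp (fst i) \<in> {0..T}" if "i \<in> inds" for i
  proof -
    note i = inds_D[OF that]
    have "real (Suc (fst (snd i))) * stp (fst i) \<in> {0..T}"
      using i by (intro cone_point(1)[of _ _ 0]) (auto simp: wd_def)
    moreover have "tm (cell i) + stp (fst i) = real (Suc (fst (snd i))) * stp (fst i)"
      by (simp add: cell_def algebra_simps)
    ultimately show ?thesis by simp
  qed
  show ?thesis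
  proof (rule err.ordI2[where C=M and D="M / r"])
    fix i assume i: "i \<in> inds"
    note h = stp_pos[OF inds_D(1)[OF i]]
    note ci = cells_D(2,4)[OF cell_in[OF i]]
    show "\<bar>rest_t f (tm (cell i)) (tm (cell i) + stp (fst i)) (ps (cell i))\<bar> \<le> M * \<bar>1\<bar> * stp (fst i) ^ 3"
      using M(2)[OF ci(1) tt[OF i] ci(2)] h by simp
    assume s: "nxt i \<in> inds"
    note cs = cells_D(2,4)[OF cell_in[OF s]]
    have e: "tm (cell (nxt i)) = tm (cell i)" "ps (cell (nxt i)) = ps (cell i) + stp (fst i) / r" "fst (nxt i) = fst i"
      unfolding cell_nxt by (simp_all add: next_cell_def nxt_def cell_def)
    have "\<bar>rest_t f (tm (cell i)) (tm (cell i) + stp (fst i)) (ps (cell (nxt i))) - rest_t f (tm (cell i)) (tm (cell i) + stp (fst i)) (ps (cell i))\<bar>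
        \<le> M * \<bar>ps (cell (nxt i)) - ps (cell i)\<bar> * \<bar>tm (cell i) + stp (fst i) - tm (cell i)\<bar> ^ 3"
      by (rule M(3)[OF ci(1) tt[OF i] ci(2) cs(2)])
    also have "\<dots> = M * (stp (fst i) / r) * stp (fst i) ^ 3"
      using h r_pos unfolding e by simp
    finally show "\<bar>rest_t f (tm (cell (nxt i))) (tm (cell (nxt i)) + stp (fst (nxt i))) (ps (cell (nxt i)))
        - rest_t f (tm (cell i)) (tm (cell i) + stp (fst i)) (ps (cell i))\<bar> \<le> M / r * \<bar>1\<bar> * stp (fst i) ^ Suc 3"
      unfolding e(1,3) by (simp add: power3_eq_cube power4_eq_xxxx mult_ac)
  qed
qed

text \<open>The new error is the scheme at U minus the scheme at u, plus the scheme at u minus the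
  next exact value. Without its linear part the former gives N; the latter gives T, a truncation
  error minus a Taylor remainder in time.\<close>

lemma residual_split:
  obtains N1 N2 T1 T2 where "err.ord (lift eb) 1 N1" "err.ord (lift eb) 1 N2" "err.ord1 3 T1" "err.ord1 3 T2"
    "\<And>i. i \<in> inds \<Longrightarrow> lift Rm1 i = N1 i + T1 i" "\<And>i. i \<in> inds \<Longrightarrow> lift Rm2 i = N2 i + T2 i"
proof -
  let ?U = "\<lambda>l i. U (fst i) (fst (snd i)) (snd (snd i) + l)"
  let ?aP = "\<lambda>i. diff1 r (\<lambda>l. ?U l i $ 1)" and ?aV = "\<lambda>i. diff1 r (\<lambda>l. ?U l i $ 2)"
  let ?sP = "\<lambda>i. diff2 r (\<lambda>l. ?U l i $ 1)" and ?sV = "\<lambda>i. diff2 r (\<lambda>l. ?U l i $ 2)"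
  have A: "A P (cell i) = diff1 r (\<lambda>l. pn (fst i) (fst (snd i)) (snd (snd i) + l))"
    "A V (cell i) = diff1 r (\<lambda>l. vn (fst i) (fst (snd i)) (snd (snd i) + l))"
    "S P (cell i) = diff2 r (\<lambda>l. pn (fst i) (fst (snd i)) (snd (snd i) + l))"
    "S V (cell i) = diff2 r (\<lambda>l. vn (fst i) (fst (snd i)) (snd (snd i) + l))" for i
    by (simp_all add: A_def S_def pn_eq vn_eq cell_def pos_def algebra_simps add_divide_distrib)
  have d: "?aP i - A P (cell i) = lift (a1 E1) i" "?aV i - A V (cell i) = lift (a1 E2) i"
    "?sP i - S P (cell i) = lift (s1 E1) i" "?sV i - S V (cell i) = lift (s1 E2) i" for i
    unfolding A by (simp_all add: diff1_def diff2_def a1_def s1_def E1_def E2_def algebra_simps diff_divide_distrib)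
  have P: "err.pert0 (lift eb) (\<lambda>i. ?U 0 i $ 1) (lift pn)"
    using ord_grid(1) small_E(1)[of E1] by (simp add: err.pert0_def E1_def)
  have V: "err.pert0 (lift eb) (\<lambda>i. ?U 0 i $ 2) (lift vn)"
    using ord_grid(2) small_E(1)[of E2] by (simp add: err.pert0_def E2_def)
  have aP: "err.pert1 (lift eb) ?aP (\<lambda>i. A P (cell i))" "err.pert1 (lift eb) ?aV (\<lambda>i. A V (cell i))"
    "err.pert1 (lift eb) ?sP (\<lambda>i. S P (cell i))" "err.pert1 (lift eb) ?sV (\<lambda>i. S V (cell i))"
    unfolding err.pert1_def d
    using small_E(2,3)[of E1] small_E(2,3)[of E2] transfer_ord[OF ord_A[OF smooth_P]] transfer_ord[OF ord_A[OF smooth_V]]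
      transfer_ord[OF ord_S[OF smooth_P]] transfer_ord[OF ord_S[OF smooth_V]] by auto
  have p_le: "\<delta> \<le> \<bar>lift pn i\<bar>" if "i \<in> inds" for i
    using \<delta>_le[OF cells_D(2,4)[OF cell_in[OF that]]] by (simp add: pn_eq cell_def)
  have Q: "err.pert0 (lift eb) (\<lambda>i. inverse (?U 0 i $ 1)) (lift qn)"
  proof -
    have "err.pert0 (lift eb) (\<lambda>i. inverse (?U 0 i $ 1)) (\<lambda>i. inverse (lift pn i))"
    proof (rule err.pert0_inverse[OF P, of "\<delta> / 2"])
      fix i assume i: "i \<in> inds"
      show "\<delta> / 2 \<le> \<bar>lift pn i\<bar>" using p_le[OF i] \<delta>_pos by linarith
      have "\<bar>lift E1 i\<bar> \<le> stp (fst i)" using inds_D(4,5)[OF i] by (auto simp: good_def)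
      then have "\<bar>lift E1 i\<bar> \<le> \<delta> / 2" using stp_le_\<delta>[OF inds_D(2)[OF i]] by linarith
      then show "\<delta> / 2 \<le> \<bar>?U 0 i $ 1\<bar>" using p_le[OF i] unfolding E1_def by (auto simp: abs_le_iff abs_if split: if_splits)
    qed (use \<delta>_pos in simp)
    then show ?thesis by (simp add: qn_eq pn_eq Q_def)
  qed
  have e2: "\<bar>?U 0 i $ 2 - lift vn i\<bar> \<le> 1 * \<bar>lift eb i\<bar>" for i
    using E_bounds(1)[of E2 0 "fst i" "fst (snd i)" "snd (snd i)"] by (simp add: E2_def)
  have e2n: "\<bar>?U 0 (nxt i) $ 2 - lift vn (nxt i)\<bar> \<le> 1 * \<bar>lift eb i\<bar>" for i
    using E_bounds(1)[of E2 1 "fst i" "fst (snd i)" "snd (snd i)"] by (simp add: E2_def nxt_def)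
  note N1 = err.lw_dens_linearised[OF P V aP zero_le_one e2 e2n, of "c\<^sup>2" C]
  note N2 = err.lw_vel_linearised[OF Q V aP zero_le_one e2 e2n, of "c\<^sup>2" C]
  note T1 = err.ord_diff[OF transfer_ord[OF ord_truncation(1)] ord_rest_t[OF smooth_P]]
  note T2 = err.ord_diff[OF transfer_ord[OF ord_truncation(2)] ord_rest_t[OF smooth_V]]
  show ?thesis
  proof (rule that[OF N1 N2 T1 T2])
    fix i assume i: "i \<in> inds"
    let ?n = "fst i" and ?k = "fst (snd i)" and ?j = "snd (snd i)"
    have h: "stp ?n \<noteq> 0" using stp_pos[OF inds_D(1)[OF i]] by simp
    have u: "lw_u 1 (cell i) = lw_dens (c\<^sup>2) C (stp ?n) (pn ?n ?k ?j) (vn ?n ?k ?j) \<bar>vn ?n ?k ?j\<bar> (A P (cell i)) (A V (cell i)) (S P (cell i)) (S V (cell i))"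
      "lw_u 2 (cell i) = lw_vel (c\<^sup>2) C (stp ?n) (qn ?n ?k ?j) (vn ?n ?k ?j) \<bar>vn ?n ?k ?j\<bar> (A P (cell i)) (A V (cell i)) (S P (cell i)) (S V (cell i))"
      unfolding lw_u_eq[OF cell_in[OF i]] by (simp_all add: cell_def pn_eq vn_eq qn_eq)
    have U: "U ?n (Suc ?k) ?j $ 1 = lw_dens (c\<^sup>2) C (stp ?n) (?U 0 i $ 1) (?U 0 i $ 2) \<bar>?U 0 i $ 2\<bar> (?aP i) (?aV i) (?sP i) (?sV i)"
      "U ?n (Suc ?k) ?j $ 2 = lw_vel (c\<^sup>2) C (stp ?n) (inverse (?U 0 i $ 1)) (?U 0 i $ 2) \<bar>?U 0 i $ 2\<bar> (?aP i) (?aV i) (?sP i) (?sV i)"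
      unfolding U_Suc lax_wendroff_nth[OF h less_imp_neq[OF r_pos, symmetric]] c_sq C_def by simp_all
    have tS: "real (Suc ?k) * stp ?n = tm (cell i) + stp ?n" by (simp add: cell_def algebra_simps)
    have next_exact: "pn ?n (Suc ?k) ?j = P (tm (cell i)) (ps (cell i)) + st (cell i) * dt T P (tm (cell i)) (ps (cell i))
        + (st (cell i))\<^sup>2 / 2 * dt T (dt T P) (tm (cell i)) (ps (cell i)) + rest_t P (tm (cell i)) (tm (cell i) + stp ?n) (ps (cell i))"
      "vn ?n (Suc ?k) ?j = V (tm (cell i)) (ps (cell i)) + st (cell i) * dt T V (tm (cell i)) (ps (cell i))
        + (st (cell i))\<^sup>2 / 2 * dt T (dt T V) (tm (cell i)) (ps (cell i)) + rest_t V (tm (cell i)) (tm (cell i) + stp ?n) (ps (cell i))"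
      unfolding pn_eq vn_eq tS rest_t_def by (simp_all add: cell_def)
    show "lift Rm1 i = lw_dens (c\<^sup>2) C (stp ?n) (?U 0 i $ 1) (?U 0 i $ 2) \<bar>?U 0 i $ 2\<bar> (?aP i) (?aV i) (?sP i) (?sV i)
      - lw_dens (c\<^sup>2) C (stp ?n) (lift pn i) (lift vn i) \<bar>lift vn i\<bar> (A P (cell i)) (A V (cell i)) (S P (cell i)) (S V (cell i))
      - ((?U 0 i $ 1 - lift pn i) - lift vn i * (?aP i - A P (cell i)) - lift pn i * (?aV i - A V (cell i))
         + ((lift vn i)\<^sup>2 + c\<^sup>2) / 2 * (?sP i - S P (cell i)) + lift pn i * lift vn i * (?sV i - S V (cell i)))
      + (lw_u 1 (cell i) - (P (tm (cell i)) (ps (cell i)) + st (cell i) * dt T P (tm (cell i)) (ps (cell i)) + (st (cell i))\<^sup>2 / 2 * dt T (dt T P) (tm (cell i)) (ps (cell i)))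
         - rest_t P (tm (cell i)) (tm (cell i) + stp ?n) (ps (cell i)))"
      unfolding Rm1_def E1_def[of _ "Suc _"] U next_exact u d Lin1_def by (simp add: E1_def)
    show "lift Rm2 i = lw_vel (c\<^sup>2) C (stp ?n) (inverse (?U 0 i $ 1)) (?U 0 i $ 2) \<bar>?U 0 i $ 2\<bar> (?aP i) (?aV i) (?sP i) (?sV i)
      - lw_vel (c\<^sup>2) C (stp ?n) (lift qn i) (lift vn i) \<bar>lift vn i\<bar> (A P (cell i)) (A V (cell i)) (S P (cell i)) (S V (cell i))
      - ((?U 0 i $ 2 - lift vn i) - c\<^sup>2 * lift qn i * (?aP i - A P (cell i)) - lift vn i * (?aV i - A V (cell i))
         + c\<^sup>2 * lift vn i * lift qn i * (?sP i - S P (cell i)) + ((lift vn i)\<^sup>2 + c\<^sup>2) / 2 * (?sV i - S V (cell i)))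
      + (lw_u 2 (cell i) - (V (tm (cell i)) (ps (cell i)) + st (cell i) * dt T V (tm (cell i)) (ps (cell i)) + (st (cell i))\<^sup>2 / 2 * dt T (dt T V) (tm (cell i)) (ps (cell i)))
         - rest_t V (tm (cell i)) (tm (cell i) + stp ?n) (ps (cell i)))"
      unfolding Rm2_def E2_def[of _ "Suc _"] U next_exact u d Lin2_def by (simp add: E2_def)
  qed
qed

text \<open>The bound on differences has one more power of the step; divided by the mesh width it
  becomes a residual bound for the difference quotient.\<close>

definition res_bound :: "real \<Rightarrow> bool" where
  "res_bound M \<longleftrightarrow> (\<forall>n k j. good n k \<longrightarrow> \<bar>j\<bar> < wd n k \<longrightarrow>
     \<bar>Rm1 n k j\<bar> \<le> M * (stp n * eb n k j + stp n ^ 3) \<and> \<bar>Rm2 n k j\<bar> \<le> M * (stp n * eb n k j + stp n ^ 3) \<and>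
     (\<bar>j + 1\<bar> < wd n k \<longrightarrow>
       \<bar>Rm1 n k (j + 1) - Rm1 n k j\<bar> \<le> M * stp n * (stp n * eb n k j + stp n ^ 3) \<and>
       \<bar>Rm2 n k (j + 1) - Rm2 n k j\<bar> \<le> M * stp n * (stp n * eb n k j + stp n ^ 3)))"

lemma residual_bound:
  obtains M where "0 \<le> M" "res_bound M"
proof -
  have one: "\<exists>M\<ge>0. \<forall>i\<in>inds. \<bar>lift R i\<bar> \<le> M * (stp (fst i) * lift eb i + stp (fst i) ^ 3) \<and>
      (nxt i \<in> inds \<longrightarrow> \<bar>lift R (nxt i) - lift R i\<bar> \<le> M * stp (fst i) * (stp (fst i) * lift eb i + stp (fst i) ^ 3))"
    if N: "err.ord (lift eb) 1 N" and T: "err.ord1 3 T" and R: "\<And>i. i \<in> inds \<Longrightarrow> lift R i = N i + T i" for R N T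
  proof -
    from N obtain M1 where M1: "0 \<le> M1" "\<And>i. i \<in> inds \<Longrightarrow> \<bar>N i\<bar> \<le> M1 * \<bar>lift eb i\<bar> * stp (fst i) ^ 1"
      "\<And>i. \<lbrakk>i \<in> inds; nxt i \<in> inds\<rbrakk> \<Longrightarrow> \<bar>N (nxt i) - N i\<bar> \<le> M1 * \<bar>lift eb i\<bar> * stp (fst i) ^ Suc 1" by (rule err.ordE) blast
    from T obtain M2 where M2: "0 \<le> M2" "\<And>i. i \<in> inds \<Longrightarrow> \<bar>T i\<bar> \<le> M2 * \<bar>1\<bar> * stp (fst i) ^ 3"
      "\<And>i. \<lbrakk>i \<in> inds; nxt i \<in> inds\<rbrakk> \<Longrightarrow> \<bar>T (nxt i) - T i\<bar> \<le> M2 * \<bar>1\<bar> * stp (fst i) ^ Suc 3" by (rule err.ordE) blast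
    show ?thesis
    proof (intro exI[of _ "M1 + M2"] conjI ballI impI)
      show "0 \<le> M1 + M2" using M1 M2 by simp
      fix i assume i: "i \<in> inds"
      have h: "0 < stp (fst i)" by (rule stp_pos[OF inds_D(1)[OF i]])
      show "\<bar>lift R i\<bar> \<le> (M1 + M2) * (stp (fst i) * lift eb i + stp (fst i) ^ 3)"
        unfolding R[OF i] using abs_residual_le[OF M1(2)[OF i] M2(2)[OF i] eb_nonneg M1(1) M2(1)] h by simp
      assume s: "nxt i \<in> inds"
      have "\<bar>(N (nxt i) - N i) + (T (nxt i) - T i)\<bar> \<le> (M1 + M2) * (stp (fst i) ^ Suc 1 * lift eb i + stp (fst i) ^ Suc 3)"
        using h by (intro abs_residual_le[OF M1(3)[OF i s] M2(3)[OF i s] eb_nonneg M1(1) M2(1)]) auto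
      also have "\<dots> = (M1 + M2) * stp (fst i) * (stp (fst i) * lift eb i + stp (fst i) ^ 3)"
        by (simp add: algebra_simps power3_eq_cube power4_eq_xxxx)
      also have "(N (nxt i) - N i) + (T (nxt i) - T i) = lift R (nxt i) - lift R i"
        using R[OF i] R[OF s] by simp
      finally show "\<bar>lift R (nxt i) - lift R i\<bar> \<le> (M1 + M2) * stp (fst i) * (stp (fst i) * lift eb i + stp (fst i) ^ 3)" .
    qed
  qed
  obtain N1 N2 T1 T2 where s: "err.ord (lift eb) 1 N1" "err.ord (lift eb) 1 N2" "err.ord1 3 T1" "err.ord1 3 T2"
    "\<And>i. i \<in> inds \<Longrightarrow> lift Rm1 i = N1 i + T1 i" "\<And>i. i \<in> inds \<Longrightarrow> lift Rm2 i = N2 i + T2 i"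
    by (rule residual_split) (rule that)
  obtain M1 where M1: "0 \<le> M1" "\<And>i. i \<in> inds \<Longrightarrow> \<bar>lift Rm1 i\<bar> \<le> M1 * (stp (fst i) * lift eb i + stp (fst i) ^ 3) \<and>
      (nxt i \<in> inds \<longrightarrow> \<bar>lift Rm1 (nxt i) - lift Rm1 i\<bar> \<le> M1 * stp (fst i) * (stp (fst i) * lift eb i + stp (fst i) ^ 3))"
    using one[OF s(1,3,5)] by blast
  obtain M2 where M2: "0 \<le> M2" "\<And>i. i \<in> inds \<Longrightarrow> \<bar>lift Rm2 i\<bar> \<le> M2 * (stp (fst i) * lift eb i + stp (fst i) ^ 3) \<and>
      (nxt i \<in> inds \<longrightarrow> \<bar>lift Rm2 (nxt i) - lift Rm2 i\<bar> \<le> M2 * stp (fst i) * (stp (fst i) * lift eb i + stp (fst i) ^ 3))"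
    using one[OF s(2,4,6)] by blast
  have "res_bound (M1 + M2)"
    unfolding res_bound_def
  proof (intro allI impI conjI)
    fix n k j assume g: "good n k" and j: "\<bar>j\<bar> < wd n k"
    then have i: "(n, k, j) \<in> inds" by (simp add: inds_def)
    have h: "0 < stp n" using stp_pos[OF inds_D(1)[OF i]] by simp
    let ?b = "stp n * eb n k j + stp n ^ 3"
    have b: "0 \<le> ?b" using h eb_nonneg[of n k j] by simp
    have le: "M1 * ?b \<le> (M1 + M2) * ?b" "M2 * ?b \<le> (M1 + M2) * ?b"
      "M1 * stp n * ?b \<le> (M1 + M2) * stp n * ?b" "M2 * stp n * ?b \<le> (M1 + M2) * stp n * ?b"
      using M1(1) M2(1) b h by (auto intro!: mult_right_mono)
    show "\<bar>Rm1 n k j\<bar> \<le> (M1 + M2) * ?b" using M1(2)[OF i] le(1) by simp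
    show "\<bar>Rm2 n k j\<bar> \<le> (M1 + M2) * ?b" using M2(2)[OF i] le(2) by simp
    assume "\<bar>j + 1\<bar> < wd n k"
    then have s: "nxt (n, k, j) \<in> inds" using g by (simp add: inds_def nxt_def)
    show "\<bar>Rm1 n k (j + 1) - Rm1 n k j\<bar> \<le> (M1 + M2) * stp n * ?b" using M1(2)[OF i] s le(3) by (simp add: nxt_def)
    show "\<bar>Rm2 n k (j + 1) - Rm2 n k j\<bar> \<le> (M1 + M2) * stp n * ?b" using M2(2)[OF i] s le(4) by (simp add: nxt_def)
  qed
  then show ?thesis using M1(1) M2(1) that[of "M1 + M2"] by simp
qed

end

section \<open>Residual for the difference quotient of the error\<close>

context pipe_cone
begin

lemma difference_quotient_commutes:
  assumes "- wd n k < j" "j + 1 < wd n k"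
  shows "r / stp n * (a1 E n k (j + 1) - a1 E n k j) = a1 (Gd E) n k j"
    and "r / stp n * (s1 E n k (j + 1) - s1 E n k j) = s1 (Gd E) n k j"
proof -
  have G: "Gd E n k (j + 1) = r / stp n * (E n k (j + 2) - E n k (j + 1))" "Gd E n k j = r / stp n * (E n k (j + 1) - E n k j)"
    "Gd E n k (j - 1) = r / stp n * (E n k j - E n k (j - 1))"
    using assms by (simp_all add: Gd_def add.assoc)
  show "r / stp n * (a1 E n k (j + 1) - a1 E n k j) = a1 (Gd E) n k j"
    "r / stp n * (s1 E n k (j + 1) - s1 E n k j) = s1 (Gd E) n k j"
    unfolding a1_def s1_def G by (simp_all add: add.assoc algebra_simps)
qed

definition leibniz :: "(nat \<Rightarrow> nat \<Rightarrow> int \<Rightarrow> real) \<Rightarrow> (nat \<Rightarrow> nat \<Rightarrow> int \<Rightarrow> real) \<Rightarrow> (nat \<Rightarrow> nat \<Rightarrow> int \<Rightarrow> real) \<Rightarrow> bool" where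
  "leibniz p X Y \<longleftrightarrow> (\<exists>M\<ge>0. \<forall>n k j. good n k \<longrightarrow> - wd n k < j \<longrightarrow> j + 1 < wd n k \<longrightarrow>
     \<bar>r / stp n * (p n k (j + 1) * X n k (j + 1) - p n k j * X n k j) - p n k j * Y n k j\<bar> \<le> M * (stp n * eb n k j))"

text \<open>Discrete product rule: Y is the difference quotient of X, so its contribution cancels
  and the commutator (p_(j+1) - p_j) X_(j+1) / \<Delta>x is left. Both factors are O(h), and X is
  moreover bounded by the error.\<close>

lemma leibnizI:
  assumes p: "err.ord1 0 (lift p)" and CA: "0 \<le> CA"
    and A: "\<And>n k j. \<lbrakk>0 < n; - wd n k < j; j < wd n k\<rbrakk> \<Longrightarrow> \<bar>X n k j\<bar> \<le> CA * (stp n * eb n k (j - 1))"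
    and B: "\<And>n k j. \<lbrakk>- wd n k < j; j + 1 < wd n k\<rbrakk> \<Longrightarrow> r / stp n * (X n k (j + 1) - X n k j) = Y n k j"
  shows "leibniz p X Y"
proof -
  from p obtain M where M: "0 \<le> M" "\<And>i. \<lbrakk>i \<in> inds; nxt i \<in> inds\<rbrakk> \<Longrightarrow> \<bar>lift p (nxt i) - lift p i\<bar> \<le> M * \<bar>1\<bar> * stp (fst i) ^ Suc 0"
    by (rule err.ordE) blast
  show ?thesis
    unfolding leibniz_def
  proof (intro exI[of _ "r * M * CA"] conjI allI impI)
    show "0 \<le> r * M * CA" using M CA r_pos by simp
    fix n k j assume g: "good n k" and j: "- wd n k < j" "j + 1 < wd n k"
    have n: "0 < n" using g by (auto simp: good_def)
    have h: "0 < stp n" by (rule stp_pos[OF n])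
    have "(n, k, j) \<in> inds" "nxt (n, k, j) \<in> inds" using g j by (auto simp: inds_def nxt_def)
    from M(2)[OF this] have dp: "\<bar>p n k (j + 1) - p n k j\<bar> \<le> M * stp n" by (simp add: nxt_def)
    have "r / stp n * (p n k (j + 1) * X n k (j + 1) - p n k j * X n k j) - p n k j * Y n k j
        = r / stp n * ((p n k (j + 1) - p n k j) * X n k (j + 1))"
      unfolding B[OF j, symmetric] by (simp add: algebra_simps)
    moreover have "\<bar>r / stp n * ((p n k (j + 1) - p n k j) * X n k (j + 1))\<bar> \<le> r / stp n * ((M * stp n) * (CA * (stp n * eb n k j)))"
      using dp A[OF n, of k "j + 1"] j h r_pos M(1) unfolding abs_mult by (intro mult_mono) auto
    moreover have "r / stp n * ((M * stp n) * (CA * (stp n * eb n k j))) = r * M * CA * (stp n * eb n k j)"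
      using h by simp
    ultimately show "\<bar>r / stp n * (p n k (j + 1) * X n k (j + 1) - p n k j * X n k j) - p n k j * Y n k j\<bar> \<le> r * M * CA * (stp n * eb n k j)"
      by simp
  qed
qed

lemma leibniz_a1: "\<lbrakk>err.ord1 0 (lift p); E = E1 \<or> E = E2\<rbrakk> \<Longrightarrow> leibniz p (a1 E) (a1 (Gd E))"
  using a1_s1_le(3) difference_quotient_commutes(1) by (intro leibnizI[of p 1]) auto

lemma leibniz_s1: "\<lbrakk>err.ord1 0 (lift p); E = E1 \<or> E = E2\<rbrakk> \<Longrightarrow> leibniz p (s1 E) (s1 (Gd E))"
  using a1_s1_le(4) difference_quotient_commutes(2) r_pos by (intro leibnizI[of p "2 * r"]) auto

text \<open>The signs follow \<open>Lin1\<close> and \<open>Lin2\<close>, so that both components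
  are instances: the difference quotient of a residual and four commutators.\<close>

lemma leibniz_combination:
  assumes l: "leibniz p1 A1 B1" "leibniz p2 A2 B2" "leibniz p3 A3 B3" "leibniz p4 A4 B4"
    and m: "0 \<le> M" "\<And>n k j. \<lbrakk>good n k; - wd n k < j; j + 1 < wd n k\<rbrakk> \<Longrightarrow>
       \<bar>r / stp n * (R n k (j + 1) - R n k j)\<bar> \<le> M * (stp n * eb n k j + stp n ^ 3)"
    and G: "\<And>n k j. \<lbrakk>good n k; - wd n k < j; j + 1 < wd n k\<rbrakk> \<Longrightarrow> G n k j =
       r / stp n * (R n k (j + 1) - R n k j)
       - (r / stp n * (p1 n k (j + 1) * A1 n k (j + 1) - p1 n k j * A1 n k j) - p1 n k j * B1 n k j)
       - (r / stp n * (p2 n k (j + 1) * A2 n k (j + 1) - p2 n k j * A2 n k j) - p2 n k j * B2 n k j)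
       + (r / stp n * (p3 n k (j + 1) * A3 n k (j + 1) - p3 n k j * A3 n k j) - p3 n k j * B3 n k j)
       + (r / stp n * (p4 n k (j + 1) * A4 n k (j + 1) - p4 n k j * A4 n k j) - p4 n k j * B4 n k j)"
  obtains M' where "0 \<le> M'" "\<And>n k j. \<lbrakk>good n k; - wd n k < j; j + 1 < wd n k\<rbrakk> \<Longrightarrow>
       \<bar>G n k j\<bar> \<le> M' * (stp n * eb n k j + stp n ^ 3)"
proof -
  have E: "\<exists>M\<ge>0. \<forall>n k j. good n k \<longrightarrow> - wd n k < j \<longrightarrow> j + 1 < wd n k \<longrightarrow>
     \<bar>r / stp n * (p n k (j + 1) * A n k (j + 1) - p n k j * A n k j) - p n k j * B n k j\<bar> \<le> M * (stp n * eb n k j + stp n ^ 3)"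
    if "leibniz p A B" for p A B
  proof -
    from that obtain M where M: "0 \<le> M" "\<And>n k j. \<lbrakk>good n k; - wd n k < j; j + 1 < wd n k\<rbrakk> \<Longrightarrow>
      \<bar>r / stp n * (p n k (j + 1) * A n k (j + 1) - p n k j * A n k j) - p n k j * B n k j\<bar> \<le> M * (stp n * eb n k j)"
      unfolding leibniz_def by blast
    show ?thesis
    proof (intro exI[of _ M] conjI allI impI)
      fix n k j assume a: "good n k" "- wd n k < j" "j + 1 < wd n k"
      have "0 < stp n" using a(1) by (auto simp: good_def intro: stp_pos)
      then have le: "M * (stp n * eb n k j) \<le> M * (stp n * eb n k j + stp n ^ 3)" using M(1) by (intro mult_left_mono) auto
      show "\<bar>r / stp n * (p n k (j + 1) * A n k (j + 1) - p n k j * A n k j) - p n k j * B n k j\<bar> \<le> M * (stp n * eb n k j + stp n ^ 3)"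
        by (rule order_trans[OF M(2)[OF a] le])
    qed (rule M(1))
  qed
  obtain M1 where M1: "0 \<le> M1" "\<And>n k j. \<lbrakk>good n k; - wd n k < j; j + 1 < wd n k\<rbrakk> \<Longrightarrow>
     \<bar>r / stp n * (p1 n k (j + 1) * A1 n k (j + 1) - p1 n k j * A1 n k j) - p1 n k j * B1 n k j\<bar> \<le> M1 * (stp n * eb n k j + stp n ^ 3)"
    using E[OF l(1)] by blast
  obtain M2 where M2: "0 \<le> M2" "\<And>n k j. \<lbrakk>good n k; - wd n k < j; j + 1 < wd n k\<rbrakk> \<Longrightarrow>
     \<bar>r / stp n * (p2 n k (j + 1) * A2 n k (j + 1) - p2 n k j * A2 n k j) - p2 n k j * B2 n k j\<bar> \<le> M2 * (stp n * eb n k j + stp n ^ 3)"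
    using E[OF l(2)] by blast
  obtain M3 where M3: "0 \<le> M3" "\<And>n k j. \<lbrakk>good n k; - wd n k < j; j + 1 < wd n k\<rbrakk> \<Longrightarrow>
     \<bar>r / stp n * (p3 n k (j + 1) * A3 n k (j + 1) - p3 n k j * A3 n k j) - p3 n k j * B3 n k j\<bar> \<le> M3 * (stp n * eb n k j + stp n ^ 3)"
    using E[OF l(3)] by blast
  obtain M4 where M4: "0 \<le> M4" "\<And>n k j. \<lbrakk>good n k; - wd n k < j; j + 1 < wd n k\<rbrakk> \<Longrightarrow>
     \<bar>r / stp n * (p4 n k (j + 1) * A4 n k (j + 1) - p4 n k j * A4 n k j) - p4 n k j * B4 n k j\<bar> \<le> M4 * (stp n * eb n k j + stp n ^ 3)"
    using E[OF l(4)] by blast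
  have tri: "\<bar>x - a - b + c' + d\<bar> \<le> X + A + B + C' + D" if "\<bar>x\<bar> \<le> X" "\<bar>a\<bar> \<le> A" "\<bar>b\<bar> \<le> B" "\<bar>c'\<bar> \<le> C'" "\<bar>d\<bar> \<le> D"
    for x a b c' d X A B C' D :: real
    using that by linarith
  show ?thesis
  proof (rule that[of "M + M1 + M2 + M3 + M4"])
    fix n k j assume a: "good n k" "- wd n k < j" "j + 1 < wd n k"
    show "\<bar>G n k j\<bar> \<le> (M + M1 + M2 + M3 + M4) * (stp n * eb n k j + stp n ^ 3)"
      unfolding G[OF a] distrib_right[of _ _ "stp n * eb n k j + stp n ^ 3"]
      by (rule tri[OF m(2)[OF a] M1(2)[OF a] M2(2)[OF a] M3(2)[OF a] M4(2)[OF a]])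
  qed (use m(1) M1(1) M2(1) M3(1) M4(1) in simp)
qed

definition RG1 where
  "RG1 n k j = Gd E1 n (Suc k) j - lw_lin_dens r (c\<^sup>2) (vn n k) (pn n k) (Gd E1 n k) (Gd E2 n k) j"
definition RG2 where
  "RG2 n k j = Gd E2 n (Suc k) j - lw_lin_vel r (c\<^sup>2) (vn n k) (qn n k) (Gd E1 n k) (Gd E2 n k) j"

lemma ord_coefficients:
  "err.ord1 0 (lift (\<lambda>n k j. ((vn n k j)\<^sup>2 + c\<^sup>2) / 2))" "err.ord1 0 (lift (\<lambda>n k j. pn n k j * vn n k j))"
  "err.ord1 0 (lift (\<lambda>n k j. c\<^sup>2 * qn n k j))" "err.ord1 0 (lift (\<lambda>n k j. c\<^sup>2 * vn n k j * qn n k j))"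
proof -
  let ?v2 = "\<lambda>n k j. ((vn n k j)\<^sup>2 + c\<^sup>2) / 2" and ?pv = "\<lambda>n k j. pn n k j * vn n k j"
  let ?cq = "\<lambda>n k j. c\<^sup>2 * qn n k j" and ?cvq = "\<lambda>n k j. c\<^sup>2 * vn n k j * qn n k j"
  have "err.ord1 0 (\<lambda>i. (1/2) * (lift vn i * lift vn i + c\<^sup>2))"
    using err.ord_mult[OF ord_grid(2) ord_grid(2)] by (intro err.ord_cmult err.ord_add err.ord_const) simp
  then show "err.ord1 0 (lift ?v2)" by (simp add: power2_eq_square)
  show "err.ord1 0 (lift ?pv)" using err.ord_mult[OF ord_grid(1,2)] by simp
  show "err.ord1 0 (lift ?cq)" by (intro err.ord_cmult ord_grid)
  have "err.ord1 0 (\<lambda>i. c\<^sup>2 * (lift vn i * lift qn i))"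
    using err.ord_mult[OF ord_grid(2,3)] by (intro err.ord_cmult) simp
  then show "err.ord1 0 (lift ?cvq)" by (simp add: mult.assoc)
qed

text \<open>The difference quotient commutes with \<open>a1\<close> and \<open>s1\<close> and
  therefore obeys the same linearised step. Only the multiplication by variable coefficients leaves
  commutators.\<close>

lemma derivative_residual_bound:
  obtains M where "0 \<le> M" "\<And>n k j. \<lbrakk>good n k; - wd n k < j; j + 1 < wd n k\<rbrakk> \<Longrightarrow>
       \<bar>RG1 n k j\<bar> \<le> M * (stp n * eb n k j + stp n ^ 3) \<and> \<bar>RG2 n k j\<bar> \<le> M * (stp n * eb n k j + stp n ^ 3)"
proof -
  obtain M where M: "0 \<le> M" "res_bound M" by (rule residual_bound) (rule that)
  let ?v2 = "\<lambda>n k j. ((vn n k j)\<^sup>2 + c\<^sup>2) / 2" and ?pv = "\<lambda>n k j. pn n k j * vn n k j"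
  let ?cq = "\<lambda>n k j. c\<^sup>2 * qn n k j" and ?cvq = "\<lambda>n k j. c\<^sup>2 * vn n k j * qn n k j"
  note o = ord_coefficients
  have res: "\<bar>r / stp n * (Rm1 n k (j + 1) - Rm1 n k j)\<bar> \<le> r * M * (stp n * eb n k j + stp n ^ 3)"
    "\<bar>r / stp n * (Rm2 n k (j + 1) - Rm2 n k j)\<bar> \<le> r * M * (stp n * eb n k j + stp n ^ 3)"
    if g: "good n k" and j: "- wd n k < j" "j + 1 < wd n k" for n k j
  proof -
    have h: "0 < stp n" using g by (auto simp: good_def intro: stp_pos)
    have sc: "\<bar>r / stp n * x\<bar> \<le> r * M * y" if "\<bar>x\<bar> \<le> M * stp n * y" for x y
    proof -
      have "r / stp n * \<bar>x\<bar> \<le> r / stp n * (M * stp n * y)" using that h r_pos by (intro mult_left_mono) auto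
      then show ?thesis using h r_pos by (simp add: abs_mult)
    qed
    have "\<bar>j\<bar> < wd n k" "\<bar>j + 1\<bar> < wd n k" using j by auto
    with M(2) g have d: "\<bar>Rm1 n k (j + 1) - Rm1 n k j\<bar> \<le> M * stp n * (stp n * eb n k j + stp n ^ 3)"
      "\<bar>Rm2 n k (j + 1) - Rm2 n k j\<bar> \<le> M * stp n * (stp n * eb n k j + stp n ^ 3)"
      by (auto simp: res_bound_def)
    show "\<bar>r / stp n * (Rm1 n k (j + 1) - Rm1 n k j)\<bar> \<le> r * M * (stp n * eb n k j + stp n ^ 3)"
      "\<bar>r / stp n * (Rm2 n k (j + 1) - Rm2 n k j)\<bar> \<le> r * M * (stp n * eb n k j + stp n ^ 3)"
      by (rule sc[OF d(1)] sc[OF d(2)])+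
  qed
  have rM: "0 \<le> r * M" using M r_pos by simp
  have Gd_Suc: "Gd E n (Suc k) j = r / stp n * (E n (Suc k) (j + 1) - E n (Suc k) j)"
    "Gd E n k j = r / stp n * (E n k (j + 1) - E n k j)"
    if "- wd n k < j" "j + 1 < wd n k" for E n k j
    using that by (auto simp: Gd_def wd_def)
  have G1: "RG1 n k j = r / stp n * (Rm1 n k (j + 1) - Rm1 n k j)
       - (r / stp n * (vn n k (j + 1) * a1 E1 n k (j + 1) - vn n k j * a1 E1 n k j) - vn n k j * a1 (Gd E1) n k j)
       - (r / stp n * (pn n k (j + 1) * a1 E2 n k (j + 1) - pn n k j * a1 E2 n k j) - pn n k j * a1 (Gd E2) n k j)
       + (r / stp n * (?v2 n k (j + 1) * s1 E1 n k (j + 1) - ?v2 n k j * s1 E1 n k j) - ?v2 n k j * s1 (Gd E1) n k j)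
       + (r / stp n * (?pv n k (j + 1) * s1 E2 n k (j + 1) - ?pv n k j * s1 E2 n k j) - ?pv n k j * s1 (Gd E2) n k j)"
    if j: "- wd n k < j" "j + 1 < wd n k" for n k j
  proof -
    have L: "lw_lin_dens r (c\<^sup>2) (vn n k) (pn n k) (Gd E1 n k) (Gd E2 n k) j = Gd E1 n k j - vn n k j * a1 (Gd E1) n k j
       - pn n k j * a1 (Gd E2) n k j + ?v2 n k j * s1 (Gd E1) n k j + ?pv n k j * s1 (Gd E2) n k j"
      unfolding lw_lin_dens_def a1_def s1_def by (simp add: field_simps)
    have E: "E1 n (Suc k) i = Rm1 n k i + (E1 n k i - vn n k i * a1 E1 n k i - pn n k i * a1 E2 n k i
       + ?v2 n k i * s1 E1 n k i + ?pv n k i * s1 E2 n k i)" for i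
      unfolding Rm1_def Lin1_def by simp
    have alg: "d * ((R' + (x' - a' - b' + e' + f')) - (R + (x - a - b + e + f))) - (d * (x' - x) - A - B + X + Y)
      = d * (R' - R) - (d * (a' - a) - A) - (d * (b' - b) - B) + (d * (e' - e) - X) + (d * (f' - f) - Y)"
      for d R' x' a' b' e' f' R x a b e f A B X Y :: real by (simp add: algebra_simps)
    show ?thesis
      unfolding RG1_def L Gd_Suc(1)[OF j] unfolding Gd_Suc(2)[OF j, of E1] E by (rule alg)
  qed
  have G2: "RG2 n k j = r / stp n * (Rm2 n k (j + 1) - Rm2 n k j)
       - (r / stp n * (?cq n k (j + 1) * a1 E1 n k (j + 1) - ?cq n k j * a1 E1 n k j) - ?cq n k j * a1 (Gd E1) n k j)
       - (r / stp n * (vn n k (j + 1) * a1 E2 n k (j + 1) - vn n k j * a1 E2 n k j) - vn n k j * a1 (Gd E2) n k j)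
       + (r / stp n * (?cvq n k (j + 1) * s1 E1 n k (j + 1) - ?cvq n k j * s1 E1 n k j) - ?cvq n k j * s1 (Gd E1) n k j)
       + (r / stp n * (?v2 n k (j + 1) * s1 E2 n k (j + 1) - ?v2 n k j * s1 E2 n k j) - ?v2 n k j * s1 (Gd E2) n k j)"
    if j: "- wd n k < j" "j + 1 < wd n k" for n k j
  proof -
    have L: "lw_lin_vel r (c\<^sup>2) (vn n k) (qn n k) (Gd E1 n k) (Gd E2 n k) j = Gd E2 n k j - ?cq n k j * a1 (Gd E1) n k j
       - vn n k j * a1 (Gd E2) n k j + ?cvq n k j * s1 (Gd E1) n k j + ?v2 n k j * s1 (Gd E2) n k j"
      unfolding lw_lin_vel_def a1_def s1_def by (simp add: field_simps)
    have E: "E2 n (Suc k) i = Rm2 n k i + (E2 n k i - ?cq n k i * a1 E1 n k i - vn n k i * a1 E2 n k i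
       + ?cvq n k i * s1 E1 n k i + ?v2 n k i * s1 E2 n k i)" for i
      unfolding Rm2_def Lin2_def by simp
    have alg: "d * ((R' + (x' - a' - b' + e' + f')) - (R + (x - a - b + e + f))) - (d * (x' - x) - A - B + X + Y)
      = d * (R' - R) - (d * (a' - a) - A) - (d * (b' - b) - B) + (d * (e' - e) - X) + (d * (f' - f) - Y)"
      for d R' x' a' b' e' f' R x a b e f A B X Y :: real by (simp add: algebra_simps)
    show ?thesis
      unfolding RG2_def L Gd_Suc(1)[OF j] unfolding Gd_Suc(2)[OF j, of E2] E by (rule alg)
  qed
  have e: "E1 = E1 \<or> E1 = E2" "E2 = E1 \<or> E2 = E2" by simp_all
  obtain M1 where M1: "0 \<le> M1" "\<And>n k j. \<lbrakk>good n k; - wd n k < j; j + 1 < wd n k\<rbrakk> \<Longrightarrow>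
       \<bar>RG1 n k j\<bar> \<le> M1 * (stp n * eb n k j + stp n ^ 3)"
    by (rule leibniz_combination[OF leibniz_a1[OF ord_grid(2) e(1)] leibniz_a1[OF ord_grid(1) e(2)]
          leibniz_s1[OF o(1) e(1)] leibniz_s1[OF o(2) e(2)] rM res(1) G1]) (assumption | rule that)+
  obtain M2 where M2: "0 \<le> M2" "\<And>n k j. \<lbrakk>good n k; - wd n k < j; j + 1 < wd n k\<rbrakk> \<Longrightarrow>
       \<bar>RG2 n k j\<bar> \<le> M2 * (stp n * eb n k j + stp n ^ 3)"
    by (rule leibniz_combination[OF leibniz_a1[OF o(3) e(1)] leibniz_a1[OF ord_grid(2) e(2)]
          leibniz_s1[OF o(4) e(1)] leibniz_s1[OF o(1) e(2)] rM res(2) G2]) (assumption | rule that)+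
  show ?thesis
  proof (rule that[of "M1 + M2"])
    show "0 \<le> M1 + M2" using M1 M2 by simp
    fix n k j assume a: "good n k" "- wd n k < j" "j + 1 < wd n k"
    have "0 < stp n" using a by (auto simp: good_def intro: stp_pos)
    then have "0 \<le> stp n * eb n k j + stp n ^ 3" using eb_nonneg[of n k j] by simp
    then have "0 \<le> M1 * (stp n * eb n k j + stp n ^ 3)" "0 \<le> M2 * (stp n * eb n k j + stp n ^ 3)"
      using M1(1) M2(1) by (auto intro: mult_nonneg_nonneg)
    then show "\<bar>RG1 n k j\<bar> \<le> (M1 + M2) * (stp n * eb n k j + stp n ^ 3) \<and> \<bar>RG2 n k j\<bar> \<le> (M1 + M2) * (stp n * eb n k j + stp n ^ 3)"
      using M1(2)[OF a] M2(2)[OF a] unfolding distrib_right[of M1 M2] by linarith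
  qed
qed

end

section \<open>Energy inequality and bootstrap\<close>

locale pipe_cone_bounds = pipe_cone +
  fixes q q' B :: real
  assumes cfl: "2 * r * c \<le> 1" and q_pos: "0 < q" and B_nonneg: "0 \<le> B"
    and Q_bounds: "\<And>t x. \<lbrakk>t \<in> {0..T}; x \<in> {0..L}\<rbrakk> \<Longrightarrow> q \<le> \<bar>c * Q t x\<bar> \<and> \<bar>c * Q t x\<bar> \<le> q'"
    and lipschitz_x: "\<And>t x y. \<lbrakk>t \<in> {0..T}; x \<in> {0..L}; y \<in> {0..L}\<rbrakk> \<Longrightarrow>
       \<bar>V t y - V t x\<bar> \<le> B * (r * \<bar>y - x\<bar>) \<and> \<bar>Q t y - Q t x\<bar> \<le> B * (r * \<bar>y - x\<bar>)"
    and lipschitz_t: "\<And>t s x. \<lbrakk>t \<in> {0..T}; s \<in> {0..T}; x \<in> {0..L}\<rbrakk> \<Longrightarrow> \<bar>Q s x - Q t x\<bar> \<le> B * \<bar>s - t\<bar>"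
begin

text \<open>The sums are not weighted by the mesh width: as a slice has O(1/h) points, h^3 is what
  errors of size h^2 produce. The second sum is one point shorter because difference quotients need
  a right neighbour.\<close>

definition F where
  "F n k = (\<Sum>j\<in>{- wd n k..wd n k}. energy c (qn n k) (E1 n k) (E2 n k) j)
     + (\<Sum>j\<in>{- wd n k..wd n k - 1}. energy c (qn n k) (Gd E1 n k) (Gd E2 n k) j)"

definition Cq where "Cq = 1 + 1 / q\<^sup>2"

lemma F_nonneg: "0 \<le> F n k"
  unfolding F_def by (intro add_nonneg_nonneg sum_nonneg energy_nonneg)

lemma Cq_pos: "0 < Cq"
  by (simp add: Cq_def add_pos_nonneg)

lemma energy_lower:
  assumes "0 < n" "k \<le> n" "\<bar>j\<bar> \<le> wd n k"
  shows "(f j)\<^sup>2 + (g j)\<^sup>2 \<le> Cq * energy c (qn n k) f g j"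
proof -
  have "q \<le> \<bar>c * qn n k j\<bar>" using Q_bounds[OF cone_point[OF assms]] by (simp add: qn_eq)
  then have "q\<^sup>2 \<le> (c * qn n k j)\<^sup>2" using q_pos by (simp flip: abs_le_square_iff)
  then have "q\<^sup>2 * (f j)\<^sup>2 \<le> (c * qn n k j)\<^sup>2 * (f j)\<^sup>2" by (intro mult_right_mono) auto
  then have "(f j)\<^sup>2 \<le> (c * qn n k j * f j)\<^sup>2 / q\<^sup>2"
    using q_pos by (simp add: pos_le_divide_eq power_mult_distrib mult.commute)
  moreover have "0 \<le> (c * qn n k j * f j)\<^sup>2" "0 \<le> (g j)\<^sup>2 / q\<^sup>2" by simp_all
  moreover have "Cq * energy c (qn n k) f g j = (c * qn n k j * f j)\<^sup>2 + (c * qn n k j * f j)\<^sup>2 / q\<^sup>2 + (g j)\<^sup>2 + (g j)\<^sup>2 / q\<^sup>2"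
    unfolding energy_def Cq_def distrib_left distrib_right by simp
  ultimately show ?thesis by linarith
qed

lemma sum_mag:
  assumes n: "0 < n" "k \<le> n"
  shows "(\<Sum>j\<in>{- wd n k..wd n k}. (mag n k j)\<^sup>2) \<le> 4 * Cq * F n k"
proof -
  let ?w = "wd n k" and ?X = "\<lambda>j. energy c (qn n k) (E1 n k) (E2 n k) j" and ?Y = "\<lambda>j. energy c (qn n k) (Gd E1 n k) (Gd E2 n k) j"
  have w: "0 \<le> ?w" using n by (simp add: wd_def)
  have "(mag n k j)\<^sup>2 \<le> 4 * Cq * (?X j + ?Y j)" if j: "j \<in> {- ?w..?w}" for j
  proof -
    have j': "\<bar>j\<bar> \<le> ?w" using j by auto
    have "(mag n k j)\<^sup>2 \<le> 4 * (((E1 n k j)\<^sup>2 + (E2 n k j)\<^sup>2) + ((Gd E1 n k j)\<^sup>2 + (Gd E2 n k j)\<^sup>2))"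
      using square_add4_le[of "\<bar>E1 n k j\<bar>" "\<bar>E2 n k j\<bar>" "\<bar>Gd E1 n k j\<bar>" "\<bar>Gd E2 n k j\<bar>"] by (simp add: mag_def add.assoc)
    also have "\<dots> \<le> 4 * (Cq * ?X j + Cq * ?Y j)"
      by (intro mult_left_mono add_mono energy_lower[OF n j']) simp
    also have "\<dots> = 4 * Cq * (?X j + ?Y j)" by (simp only: distrib_left mult.assoc)
    finally show ?thesis .
  qed
  then have "(\<Sum>j\<in>{- ?w..?w}. (mag n k j)\<^sup>2) \<le> (\<Sum>j\<in>{- ?w..?w}. 4 * Cq * (?X j + ?Y j))" by (rule sum_mono)
  also have "\<dots> = 4 * Cq * ((\<Sum>j\<in>{- ?w..?w}. ?X j) + (\<Sum>j\<in>{- ?w..?w}. ?Y j))"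
    by (simp only: sum_distrib_left[symmetric] sum.distrib)
  also have "(\<Sum>j\<in>{- ?w..?w}. ?Y j) = (\<Sum>j\<in>{- ?w..?w - 1}. ?Y j)"
    by (rule sum.mono_neutral_right) (auto simp: energy_def Gd_def)
  finally show ?thesis by (simp only: F_def)
qed

lemma sum_eb:
  assumes n: "0 < n" "k \<le> n"
  shows "(\<Sum>j\<in>{- wd n k + 1..wd n k - 1}. (eb n k j)\<^sup>2) \<le> 36 * Cq * F n k"
proof -
  let ?w = "wd n k" and ?m = "\<lambda>j. (mag n k j)\<^sup>2"
  \<comment> \<open>The 36 arises as 3 from squaring a sum of three terms, 3 from the shifted sums
    and 4 from \<open>sum_mag\<close>.\<close>
  have "(eb n k j)\<^sup>2 \<le> 3 * (?m (j - 1) + ?m j + ?m (j + 1))" for j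
  proof -
    have "0 \<le> (mag n k (j - 1) - mag n k j)\<^sup>2 + (mag n k (j - 1) - mag n k (j + 1))\<^sup>2 + (mag n k j - mag n k (j + 1))\<^sup>2" by simp
    then show ?thesis by (simp add: eb_def power2_eq_square algebra_simps)
  qed
  then have "(\<Sum>j\<in>{- ?w + 1..?w - 1}. (eb n k j)\<^sup>2) \<le> (\<Sum>j\<in>{- ?w + 1..?w - 1}. 3 * (?m (j - 1) + ?m j + ?m (j + 1)))"
    by (rule sum_mono)
  also have "\<dots> = 3 * ((\<Sum>j\<in>{- ?w + 1..?w - 1}. ?m (j - 1)) + (\<Sum>j\<in>{- ?w + 1..?w - 1}. ?m j) + (\<Sum>j\<in>{- ?w + 1..?w - 1}. ?m (j + 1)))"
    by (simp only: sum_distrib_left[symmetric] sum.distrib)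
  also have "\<dots> \<le> 3 * ((\<Sum>j\<in>{- ?w..?w}. ?m j) + (\<Sum>j\<in>{- ?w..?w}. ?m j) + (\<Sum>j\<in>{- ?w..?w}. ?m j))"
    by (intro mult_left_mono add_mono sum_shift_le) auto
  also have "\<dots> \<le> 36 * Cq * F n k" using sum_mag[OF n] by simp
  finally show ?thesis .
qed

text \<open>At most 2 n points contribute h^6 each from the truncation error, and n h = t0 turns
  this into h^5. One factor \<open>stp n\<close> stands in front to cancel the 1/h of
  \<open>energy_growth\<close>.\<close>

lemma residual_sum:
  assumes n: "0 < n" "k \<le> n" and M: "0 \<le> M" and J: "J \<subseteq> {- wd n k + 1..wd n k - 1}"
    and R: "\<And>j. j \<in> J \<Longrightarrow> \<bar>R j\<bar> \<le> M * (stp n * eb n k j + stp n ^ 3) \<and> \<bar>R' j\<bar> \<le> M * (stp n * eb n k j + stp n ^ 3)"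
  shows "(\<Sum>j\<in>J. (R j)\<^sup>2 + (R' j)\<^sup>2) \<le> stp n * (144 * M\<^sup>2 * Cq * (stp n * F n k) + 8 * M\<^sup>2 * t0 * stp n ^ 4)"
proof -
  let ?h = "stp n" and ?e = "eb n k" and ?W = "{- wd n k + 1..wd n k - 1}"
  have h: "0 < ?h" by (rule stp_pos[OF n(1)])
  have pt: "(R j)\<^sup>2 + (R' j)\<^sup>2 \<le> 4 * M\<^sup>2 * (?h\<^sup>2 * (?e j)\<^sup>2 + ?h ^ 6)" if "j \<in> J" for j
  proof -
    let ?b = "M * (?h * ?e j + ?h ^ 3)"
    have b: "0 \<le> ?b" using M h eb_nonneg[of n k j] by simp
    have "(R j)\<^sup>2 \<le> ?b\<^sup>2" "(R' j)\<^sup>2 \<le> ?b\<^sup>2" using R[OF that] b by (simp_all flip: abs_le_square_iff)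
    moreover have "?b\<^sup>2 \<le> M\<^sup>2 * (2 * (?h\<^sup>2 * (?e j)\<^sup>2 + ?h ^ 6))"
    proof -
      have "0 \<le> (?h * ?e j - ?h ^ 3)\<^sup>2" by simp
      moreover have "(?h ^ 3)\<^sup>2 = ?h ^ 6" by (simp flip: power_mult)
      ultimately have "(?h * ?e j + ?h ^ 3)\<^sup>2 \<le> 2 * (?h\<^sup>2 * (?e j)\<^sup>2 + ?h ^ 6)"
        by (simp only: power2_sum power2_diff power_mult_distrib) simp
      then show ?thesis unfolding power_mult_distrib[of M] by (intro mult_left_mono) auto
    qed
    ultimately have "(R j)\<^sup>2 + (R' j)\<^sup>2 \<le> 2 * (M\<^sup>2 * (2 * (?h\<^sup>2 * (?e j)\<^sup>2 + ?h ^ 6)))" by linarith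
    then show ?thesis by (simp add: algebra_simps)
  qed
  have "(\<Sum>j\<in>J. (R j)\<^sup>2 + (R' j)\<^sup>2) \<le> (\<Sum>j\<in>J. 4 * M\<^sup>2 * (?h\<^sup>2 * (?e j)\<^sup>2 + ?h ^ 6))" by (rule sum_mono[OF pt])
  also have "\<dots> \<le> (\<Sum>j\<in>?W. 4 * M\<^sup>2 * (?h\<^sup>2 * (?e j)\<^sup>2 + ?h ^ 6))"
    using J by (intro sum_mono2) (auto intro!: mult_nonneg_nonneg)
  also have "\<dots> = 4 * M\<^sup>2 * (?h\<^sup>2 * (\<Sum>j\<in>?W. (?e j)\<^sup>2) + of_nat (card ?W) * ?h ^ 6)"
    by (simp only: sum_distrib_left[symmetric] sum.distrib sum_constant)
  also have "\<dots> \<le> 4 * M\<^sup>2 * (?h\<^sup>2 * (36 * Cq * F n k) + (2 * real n) * ?h ^ 6)"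
  proof (intro mult_left_mono add_mono mult_right_mono sum_eb n)
    have "card ?W \<le> 2 * n" by (auto simp: wd_def)
    then show "real (card ?W) \<le> 2 * real n" by (metis of_nat_le_iff of_nat_mult of_nat_numeral)
  qed (use h in auto)
  also have "\<dots> = ?h * (144 * M\<^sup>2 * Cq * (?h * F n k) + 8 * M\<^sup>2 * (real n * ?h) * ?h ^ 4)"
    by (simp add: power2_eq_square eval_nat_numeral algebra_simps)
  also have "real n * ?h = t0" by (rule stp_n[OF n(1)])
  finally show ?thesis .
qed

lemma energy_inequality:
  obtains \<kappa> where "0 \<le> \<kappa>" "\<And>n k. good n k \<Longrightarrow> F n (Suc k) \<le> (1 + \<kappa> * stp n) * F n k + \<kappa> * stp n ^ 4"
proof -
  obtain \<kappa> where \<kappa>: "0 \<le> \<kappa>" "energy_growth c r q q' B t0 \<kappa>"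
    using energy_step[OF c_pos r_pos cfl q_pos B_nonneg t0_pos] by blast
  obtain M1 where M1: "0 \<le> M1" "res_bound M1" by (rule residual_bound) (rule that)
  obtain M2 where M2: "0 \<le> M2" "\<And>n k j. \<lbrakk>good n k; - wd n k < j; j + 1 < wd n k\<rbrakk> \<Longrightarrow>
       \<bar>RG1 n k j\<bar> \<le> M2 * (stp n * eb n k j + stp n ^ 3) \<and> \<bar>RG2 n k j\<bar> \<le> M2 * (stp n * eb n k j + stp n ^ 3)"
    by (rule derivative_residual_bound) (rule that)
  \<comment> \<open>The residual sums of both pairs are included: their part proportional to F joins
    the growth rate, the rest is the source of order h^4.\<close>
  define \<kappa>' where "\<kappa>' = \<kappa> * (1 + 144 * (M1\<^sup>2 + M2\<^sup>2) * Cq + 8 * (M1\<^sup>2 + M2\<^sup>2) * t0)"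
  have Z: "0 \<le> 144 * (M1\<^sup>2 + M2\<^sup>2) * Cq" "0 \<le> 8 * (M1\<^sup>2 + M2\<^sup>2) * t0" using Cq_pos t0_pos by simp_all
  have "F n (Suc k) \<le> (1 + \<kappa>' * stp n) * F n k + \<kappa>' * stp n ^ 4" if g: "good n k" for n k
  proof -
    let ?h = "stp n" and ?w = "wd n k"
    have n: "0 < n" "k \<le> n" and kn: "k < n" using g by (auto simp: good_def)
    have h: "0 < ?h" by (rule stp_pos[OF n(1)])
    have wS: "wd n (Suc k) = ?w - 1" by (simp add: wd_def)
    have w: "1 \<le> ?w" using kn by (simp add: wd_def)
    have ok: "coeffs_ok c q q' B ?h a b (pn n k) (qn n k) (vn n k)" if "- ?w \<le> a" "b \<le> ?w" for a b
      unfolding pn_def qn_def vn_def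
    proof (rule coeffs_grid[OF Q_bounds lipschitz_x _ h])
      show "real k * ?h \<in> {0..T}" using w by (intro cone_point(1)[OF n, of 0]) simp
      show "x0 + of_int j * (?h / r) \<in> {0..L}" if "j \<in> {a..b}" for j
        using cone_point(2)[OF n, of j] that \<open>- ?w \<le> a\<close> \<open>b \<le> ?w\<close> by (auto simp: pos_def)
    qed auto
    have dq: "\<bar>qn n (Suc k) j - qn n k j\<bar> \<le> B * ?h" if "\<bar>j\<bar> < ?w" for j
    proof -
      have c: "real k * ?h \<in> {0..T}" "real (Suc k) * ?h \<in> {0..T}" "pos n j \<in> {0..L}"
        using that by (intro cone_point(1)[OF n, of j]; linarith)
          (use that kn wS in \<open>intro cone_point(1)[OF n(1), of "Suc k" j] cone_point(2)[OF n, of j]; linarith\<close>)+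
      have "\<bar>real (Suc k) * ?h - real k * ?h\<bar> = ?h" using h by (simp add: algebra_simps)
      then show ?thesis using lipschitz_t[OF c] by (simp add: qn_eq)
    qed
    have e1: "(\<Sum>j\<in>{- ?w + 1..?w - 1}. energy c (qn n (Suc k)) (E1 n (Suc k)) (E2 n (Suc k)) j) \<le>
        (1 + \<kappa> * ?h) * (\<Sum>j\<in>{- ?w..?w}. energy c (qn n k) (E1 n k) (E2 n k) j) + \<kappa> / ?h * (\<Sum>j\<in>{- ?w + 1..?w - 1}. (Rm1 n k j)\<^sup>2 + (Rm2 n k j)\<^sup>2)"
      by (rule energy_growthD[OF \<kappa>(2) h stp_le[OF n(1)] ok])
         (auto intro: dq simp: Rm1_def Rm2_def Lin_eq)
    \<comment> \<open>For difference quotients the window -w..w-1 loses one point on each side and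
      becomes exactly the corresponding window of the next level.\<close>
    have e2: "(\<Sum>j\<in>{- ?w + 1..(?w - 1) - 1}. energy c (qn n (Suc k)) (Gd E1 n (Suc k)) (Gd E2 n (Suc k)) j) \<le>
        (1 + \<kappa> * ?h) * (\<Sum>j\<in>{- ?w..?w - 1}. energy c (qn n k) (Gd E1 n k) (Gd E2 n k) j) + \<kappa> / ?h * (\<Sum>j\<in>{- ?w + 1..(?w - 1) - 1}. (RG1 n k j)\<^sup>2 + (RG2 n k j)\<^sup>2)"
      by (rule energy_growthD[OF \<kappa>(2) h stp_le[OF n(1)] ok])
         (auto intro: dq simp: RG1_def RG2_def)
    have s1: "(\<Sum>j\<in>{- ?w + 1..?w - 1}. (Rm1 n k j)\<^sup>2 + (Rm2 n k j)\<^sup>2) \<le> ?h * (144 * M1\<^sup>2 * Cq * (?h * F n k) + 8 * M1\<^sup>2 * t0 * ?h ^ 4)"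
      using M1 g by (intro residual_sum[OF n M1(1)]) (auto simp: res_bound_def)
    have s2: "(\<Sum>j\<in>{- ?w + 1..(?w - 1) - 1}. (RG1 n k j)\<^sup>2 + (RG2 n k j)\<^sup>2) \<le> ?h * (144 * M2\<^sup>2 * Cq * (?h * F n k) + 8 * M2\<^sup>2 * t0 * ?h ^ 4)"
    proof (rule residual_sum[OF n M2(1)])
      fix j assume "j \<in> {- ?w + 1..(?w - 1) - 1}"
      then show "\<bar>RG1 n k j\<bar> \<le> M2 * (?h * eb n k j + ?h ^ 3) \<and> \<bar>RG2 n k j\<bar> \<le> M2 * (?h * eb n k j + ?h ^ 3)"
        by (intro M2(2)[OF g]) auto
    qed auto
    have cancel: "\<kappa> / ?h * x \<le> \<kappa> * y" if "x \<le> ?h * y" for x y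
    proof -
      have "\<kappa> / ?h * x \<le> \<kappa> / ?h * (?h * y)" using that \<kappa>(1) h by (intro mult_left_mono) auto
      then show ?thesis using h by simp
    qed
    have "F n (Suc k) = (\<Sum>j\<in>{- ?w + 1..?w - 1}. energy c (qn n (Suc k)) (E1 n (Suc k)) (E2 n (Suc k)) j)
      + (\<Sum>j\<in>{- ?w + 1..(?w - 1) - 1}. energy c (qn n (Suc k)) (Gd E1 n (Suc k)) (Gd E2 n (Suc k)) j)"
      unfolding F_def wS by simp
    also have "\<dots> \<le> (1 + \<kappa> * ?h) * F n k + (\<kappa> * (144 * M1\<^sup>2 * Cq * (?h * F n k) + 8 * M1\<^sup>2 * t0 * ?h ^ 4)
       + \<kappa> * (144 * M2\<^sup>2 * Cq * (?h * F n k) + 8 * M2\<^sup>2 * t0 * ?h ^ 4))"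
      using e1 e2 cancel[OF s1] cancel[OF s2] unfolding F_def[of n k] distrib_left[of "1 + \<kappa> * ?h"] by linarith
    also have "\<dots> = F n k + \<kappa> * (1 + 144 * (M1\<^sup>2 + M2\<^sup>2) * Cq) * (?h * F n k) + \<kappa> * (8 * (M1\<^sup>2 + M2\<^sup>2) * t0) * ?h ^ 4"
      by (simp add: algebra_simps)
    also have "\<dots> \<le> F n k + \<kappa>' * (?h * F n k) + \<kappa>' * ?h ^ 4"
    proof -
      have "\<kappa> * (1 + 144 * (M1\<^sup>2 + M2\<^sup>2) * Cq) \<le> \<kappa>'" "\<kappa> * (8 * (M1\<^sup>2 + M2\<^sup>2) * t0) \<le> \<kappa>'"
        unfolding \<kappa>'_def by (rule mult_left_mono[OF _ \<kappa>(1)], use Z in linarith)+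
      then show ?thesis using h F_nonneg[of n k] by (intro add_mono mult_right_mono order_refl) auto
    qed
    finally show ?thesis by (simp add: algebra_simps)
  qed
  moreover have "0 \<le> \<kappa>'" using Z \<kappa>(1) unfolding \<kappa>'_def by (intro mult_nonneg_nonneg) linarith+
  ultimately show ?thesis using that by blast
qed

lemma error_0: "\<bar>j\<bar> \<le> wd n 0 \<Longrightarrow> E1 n 0 j = 0" "\<bar>j\<bar> \<le> wd n 0 \<Longrightarrow> E2 n 0 j = 0"
  by (simp_all add: E1_def E2_def U_def pn_eq vn_eq P_def V_def)

lemma F_0: "F n 0 = 0"
proof -
  have "Gd E n 0 j = 0" if "E = E1 \<or> E = E2" "j \<in> {- wd n 0..wd n 0 - 1}" for E j
    using that by (auto simp: Gd_def error_0)
  then show ?thesis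
    unfolding F_def energy_def by (simp add: error_0 abs_le_iff)
qed

text \<open>Discrete Gronwall inequality with continuation: the bound at level k yields
  \<open>good\<close> there, which permits the step to level k + 1. This closes because energy h^3
  bounds the errors by a multiple of h^(3/2), which is below one step for large n.\<close>

lemma energy_bound:
  obtains C n1 where "0 \<le> C" "n0 \<le> n1" "\<And>n k. \<lbrakk>n1 \<le> n; k \<le> n\<rbrakk> \<Longrightarrow> F n k \<le> C * stp n ^ 3"
    and "\<And>n k. \<lbrakk>n1 \<le> n; k < n\<rbrakk> \<Longrightarrow> good n k"
proof -
  obtain \<kappa> where \<kappa>: "0 \<le> \<kappa>" "\<And>n k. good n k \<Longrightarrow> F n (Suc k) \<le> (1 + \<kappa> * stp n) * F n k + \<kappa> * stp n ^ 4"
    by (rule energy_inequality) (rule that)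
  define C where "C = exp (\<kappa> * t0) * \<kappa> * t0"
  have C: "0 \<le> C" using \<kappa> t0_pos by (simp add: C_def)
  \<comment> \<open>For n at least \<open>n1\<close> the bound Cq C h^3 on the squared error is at
    most h^2, as \<open>good\<close> demands.\<close>
  obtain n1 :: nat where n1: "n0 \<le> n1" "Cq * C * t0 \<le> real n1"
  proof
    show "n0 \<le> max n0 (nat \<lceil>Cq * C * t0\<rceil>)" by simp
    show "Cq * C * t0 \<le> real (max n0 (nat \<lceil>Cq * C * t0\<rceil>))" by linarith
  qed
  have good: "good n k" if n: "n1 \<le> n" "k < n" and F: "F n k \<le> C * stp n ^ 3" for n k
    unfolding good_def
  proof (intro conjI allI impI)
    have n0n: "0 < n" "k \<le> n" using n by auto
    show "n0 \<le> n" using n n1 by simp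
    show "k < n" by fact
    fix l assume l: "\<bar>l\<bar> \<le> wd n k"
    have h: "0 < stp n" by (rule stp_pos[OF n0n(1)])
    have "Cq * C * t0 \<le> real n" using n1 n(1) by linarith
    then have small: "Cq * C * stp n \<le> 1" using n0n by (simp add: stp_def pos_divide_le_eq)
    have "(E1 n k l)\<^sup>2 + (E2 n k l)\<^sup>2 \<le> Cq * energy c (qn n k) (E1 n k) (E2 n k) l" by (rule energy_lower[OF n0n l])
    also have "\<dots> \<le> Cq * F n k"
    proof (rule mult_left_mono)
      have "energy c (qn n k) (E1 n k) (E2 n k) l \<le> (\<Sum>j\<in>{- wd n k..wd n k}. energy c (qn n k) (E1 n k) (E2 n k) j)"
        using l by (intro member_le_sum energy_nonneg) auto
      also have "\<dots> \<le> F n k" unfolding F_def by (simp add: sum_nonneg energy_nonneg)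
      finally show "energy c (qn n k) (E1 n k) (E2 n k) l \<le> F n k" .
    qed (use Cq_pos in simp)
    also have "\<dots> \<le> Cq * (C * stp n ^ 3)" using F Cq_pos by (intro mult_left_mono) auto
    also have "\<dots> = Cq * C * stp n * (stp n)\<^sup>2" by (simp add: power2_eq_square power3_eq_cube)
    also have "\<dots> \<le> 1 * (stp n)\<^sup>2" using small by (intro mult_right_mono) auto
    finally have le: "(E1 n k l)\<^sup>2 + (E2 n k l)\<^sup>2 \<le> (stp n)\<^sup>2" by simp
    have "0 \<le> (E1 n k l)\<^sup>2" "0 \<le> (E2 n k l)\<^sup>2" by simp_all
    with le have "(E1 n k l)\<^sup>2 \<le> (stp n)\<^sup>2" "(E2 n k l)\<^sup>2 \<le> (stp n)\<^sup>2" by linarith+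
    then show "\<bar>E1 n k l\<bar> \<le> stp n" "\<bar>E2 n k l\<bar> \<le> stp n" using h by (simp_all add: abs_le_square_iff[symmetric])
  qed
  \<comment> \<open>The factor \<open>real k * stp n\<close> accounts for one source term per step.
    The second conjunct has a constant independent of k, for which \<open>n1\<close> was
    chosen.\<close>
  have F_le: "F n k \<le> exp (\<kappa> * (real k * stp n)) * \<kappa> * (real k * stp n) * stp n ^ 3 \<and> F n k \<le> C * stp n ^ 3"
    if n: "n1 \<le> n" "k \<le> n" for n k
    using n(2)
  proof (induction k)
    case 0
    show ?case using C n1(1) n0_pos n(1) stp_pos[of n] by (simp add: F_0)
  next
    case (Suc k)
    have n0n: "0 < n" using n n1 n0_pos by simp
    note h = stp_pos[OF n0n]
    have IH: "F n k \<le> exp (\<kappa> * (real k * stp n)) * \<kappa> * (real k * stp n) * stp n ^ 3" "F n k \<le> C * stp n ^ 3"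
      using Suc by auto
    let ?e = "\<lambda>k. exp (\<kappa> * (real k * stp n))"
    have eS: "(1 + \<kappa> * stp n) * ?e k \<le> ?e (Suc k)"
    proof -
      have "(1 + \<kappa> * stp n) * ?e k \<le> exp (\<kappa> * stp n) * ?e k" by (intro mult_right_mono exp_ge_add_one_self) simp
      also have "\<dots> = ?e (Suc k)" by (simp add: exp_add[symmetric] algebra_simps)
      finally show ?thesis .
    qed
    have e1: "1 \<le> ?e (Suc k)" using \<kappa> h by simp
    have "F n (Suc k) \<le> (1 + \<kappa> * stp n) * F n k + \<kappa> * stp n ^ 4"
      by (rule \<kappa>(2)[OF good[OF n(1) _ IH(2)]]) (use Suc in simp)
    also have "\<dots> \<le> (1 + \<kappa> * stp n) * (?e k * \<kappa> * (real k * stp n) * stp n ^ 3) + \<kappa> * stp n ^ 4"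
      using IH(1) \<kappa> h by (intro add_mono mult_left_mono order_refl) auto
    also have "\<dots> = ((1 + \<kappa> * stp n) * ?e k) * (\<kappa> * (real k * stp n) * stp n ^ 3) + 1 * (\<kappa> * stp n ^ 4)"
      by (simp add: mult_ac)
    also have "\<dots> \<le> ?e (Suc k) * (\<kappa> * (real k * stp n) * stp n ^ 3) + ?e (Suc k) * (\<kappa> * stp n ^ 4)"
      using eS e1 \<kappa> h by (intro add_mono mult_right_mono) auto
    also have "\<dots> = ?e (Suc k) * \<kappa> * (real (Suc k) * stp n) * stp n ^ 3"
      by (simp add: distrib_left distrib_right power3_eq_cube power4_eq_xxxx)
    finally have 1: "F n (Suc k) \<le> ?e (Suc k) * \<kappa> * (real (Suc k) * stp n) * stp n ^ 3" .
    have "real (Suc k) * stp n \<le> real n * stp n" using Suc.prems h by (intro mult_right_mono) auto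
    then have le: "real (Suc k) * stp n \<le> t0" using stp_n[OF n0n] by simp
    have "?e (Suc k) * \<kappa> * (real (Suc k) * stp n) * stp n ^ 3 \<le> exp (\<kappa> * t0) * \<kappa> * t0 * stp n ^ 3"
      using le \<kappa> h t0_pos by (intro mult_mono mult_right_mono) (auto intro!: mult_left_mono mult_nonneg_nonneg)
    with 1 show ?case unfolding C_def by linarith
  qed
  show ?thesis
  proof (rule that[OF C n1(1)])
    show "F n k \<le> C * stp n ^ 3" if "n1 \<le> n" "k \<le> n" for n k using F_le[OF that] by simp
    then show "good n k" if "n1 \<le> n" "k < n" for n k using good[OF that] that by simp
  qed
qed

end

section \<open>Pointwise bound at the apex\<close>

lemma sum_le_sqrt:
  fixes f :: "'a \<Rightarrow> real"
  assumes "finite I" "real (card I) \<le> 3 * m" "(\<Sum>i\<in>I. (f i)\<^sup>2) \<le> A * h ^ 3" "0 < h" "0 \<le> A"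
  shows "(\<Sum>i\<in>I. f i) \<le> sqrt (3 * A) * (h * sqrt h) * sqrt m"
proof (rule order_trans[OF real_le_rsqrt])
  show "(\<Sum>i\<in>I. f i)\<^sup>2 \<le> A * h ^ 3 * (3 * m)"
    using sum_squared_le_sum_of_squares[of f I] assms
      mult_mono[OF assms(3,2)] by (simp add: sum_nonneg)
  have "A * h ^ 3 * (3 * m) = 3 * A * (h\<^sup>2 * h) * m" by (simp add: power2_eq_square power3_eq_cube)
  then show "sqrt (A * h ^ 3 * (3 * m)) \<le> sqrt (3 * A) * (h * sqrt h) * sqrt m"
    using assms(4) by (simp only: real_sqrt_mult real_sqrt_power) simp
qed

lemma oscillation_le:
  fixes e :: "int \<Rightarrow> real"
  assumes "i \<in> {a..b}" "j \<in> {a..b}"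
  shows "e j \<le> e i + (\<Sum>l\<in>{a..b - 1}. \<bar>e (l + 1) - e l\<bar>)"
proof -
  have *: "\<bar>e y - e x\<bar> \<le> (\<Sum>l\<in>{a..b - 1}. \<bar>e (l + 1) - e l\<bar>)" if "x \<le> y" "a \<le> x" "y \<le> b" for x y
  proof -
    have "e y - e x = (\<Sum>l\<in>{x..y - 1}. e (l + 1) - e l)" using sum_telescope_int[of x "y - 1" e] that by simp
    then have "\<bar>e y - e x\<bar> \<le> (\<Sum>l\<in>{x..y - 1}. \<bar>e (l + 1) - e l\<bar>)" by simp
    also have "\<dots> \<le> (\<Sum>l\<in>{a..b - 1}. \<bar>e (l + 1) - e l\<bar>)" using that by (intro sum_mono2) auto
    finally show ?thesis .
  qed
  consider "i \<le> j" | "j \<le> i" by linarith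
  then show ?thesis
  proof cases
    case 1
    then show ?thesis using *[of i j] assms by (auto simp: abs_le_iff)
  next
    case 2
    then show ?thesis using *[of j i] assms by (auto simp: abs_le_iff)
  qed
qed

text \<open>At the apex of the cone the energy bound \<open>O(h\<^sup>3)\<close> controls the error only by \<open>h\<^sup>3\<^sup>/\<^sup>2\<close>.
  The mean of the error over a time slice of \<open>2 m + 1\<close> points grows by \<open>O(h\<^sup>5\<^sup>/\<^sup>2 / \<surd>m)\<close> per step
  only, including the loss of the two outer points, and these bounds add up to \<open>O(h\<^sup>2)\<close>.\<close>

lemma mean_shrink:
  fixes e :: "int \<Rightarrow> real"
  assumes m: "1 \<le> m" and D: "\<And>j. j \<in> {- m..m} \<Longrightarrow> e j \<le> e m + D \<and> e j \<le> e (- m) + D"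
  shows "(\<Sum>j\<in>{- m + 1..m - 1}. e j) / (2 * of_int m - 1) \<le> (\<Sum>j\<in>{- m..m}. e j) / (2 * of_int m + 1) + 2 * D / (2 * of_int m + 1)"
proof -
  let ?I = "{- m + 1..m - 1}"
  define X where "X = (\<Sum>j\<in>?I. e j)"
  define S where "S = (\<Sum>j\<in>{- m..m}. e j)"
  define M :: real where "M = of_int m"
  have M: "1 \<le> M" using m by (simp add: M_def)
  have card: "real (card ?I) = 2 * M - 1" using m by (simp add: M_def)
  have "{- m..m} = insert m (insert (- m) ?I)" using m by auto
  then have S: "S = X + e m + e (- m)" using m by (simp add: S_def X_def)
  \<comment> \<open>Each inner value exceeds each of the two dropped ones by at most
    \<open>D\<close>; adding both bounds compares the inner mean with the mean of the dropped
    values.\<close>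
  have "X \<le> real (card ?I) * (e m + D)" "X \<le> real (card ?I) * (e (- m) + D)"
    unfolding X_def by (rule sum_bounded_above, use D in force)+
  then have "2 * X \<le> (2 * M - 1) * (S - X + 2 * D)" unfolding card S by (simp add: algebra_simps)
  then have "X * (2 * M + 1) \<le> (S + 2 * D) * (2 * M - 1)" by (simp add: algebra_simps)
  then have "X / (2 * M - 1) \<le> (S + 2 * D) / (2 * M + 1)" using M by (simp add: frac_le_eq divide_simps mult.commute)
  then show ?thesis by (simp add: X_def S_def M_def add_divide_distrib)
qed

text \<open>Bounds the sum of 1 / sqrt m over all slices by a telescoping sum. The value m = 1, next
  to the apex, is included.\<close>

lemma inverse_sqrt_le: "1 \<le> m \<Longrightarrow> 1 / sqrt m \<le> 2 * (sqrt m - sqrt (m - 1))"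
proof -
  assume m: "1 \<le> m"
  have "(sqrt m - sqrt (m - 1)) * (sqrt m + sqrt (m - 1)) = 1"
    using m by (simp add: algebra_simps)
  moreover have "(sqrt m - sqrt (m - 1)) * (sqrt m + sqrt (m - 1)) \<le> (sqrt m - sqrt (m - 1)) * (2 * sqrt m)"
    by (intro mult_left_mono) auto
  ultimately show ?thesis using m by (simp add: divide_le_eq mult_ac)
qed

context pipe_cone_bounds
begin

definition ee where "ee n k j = \<bar>E1 n k j\<bar> + \<bar>E2 n k j\<bar>"

lemma bounded_coefficient:
  assumes "err.ord1 0 (lift p)"
  obtains b where "0 \<le> b" "\<And>n k j. \<lbrakk>good n k; \<bar>j\<bar> < wd n k\<rbrakk> \<Longrightarrow> \<bar>p n k j\<bar> \<le> b"
proof -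
  from assms obtain b where b: "0 \<le> b" "\<And>i. i \<in> inds \<Longrightarrow> \<bar>lift p i\<bar> \<le> b * \<bar>1\<bar> * stp (fst i) ^ 0" by (rule err.ordE) blast
  show ?thesis
  proof (rule that[OF b(1)])
    fix n k j assume "good n k" "\<bar>j\<bar> < wd n k"
    then have "(n, k, j) \<in> inds" by (simp add: inds_def)
    from b(2)[OF this] show "\<bar>p n k j\<bar> \<le> b" by simp
  qed
qed

text \<open>By \<open>a1_s1_le\<close> the transport terms are O(h) times nearby errors and
  difference quotients, so the triangle inequality is affordable. This is where \<open>Gd\<close>
  pays off.\<close>

lemma one_step:
  obtains M where "0 \<le> M" "\<And>n k j. \<lbrakk>good n k; \<bar>j\<bar> < wd n k\<rbrakk> \<Longrightarrow> ee n (Suc k) j \<le> ee n k j + M * (stp n * eb n k j + stp n ^ 3)"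
proof -
  obtain M where M: "0 \<le> M" "res_bound M" by (rule residual_bound) (rule that)
  obtain b1 where b1: "0 \<le> b1" "\<And>n k j. \<lbrakk>good n k; \<bar>j\<bar> < wd n k\<rbrakk> \<Longrightarrow> \<bar>vn n k j\<bar> \<le> b1" by (rule bounded_coefficient[OF ord_grid(2)]) (rule that)
  obtain b2 where b2: "0 \<le> b2" "\<And>n k j. \<lbrakk>good n k; \<bar>j\<bar> < wd n k\<rbrakk> \<Longrightarrow> \<bar>pn n k j\<bar> \<le> b2" by (rule bounded_coefficient[OF ord_grid(1)]) (rule that)
  obtain b3 where b3: "0 \<le> b3" "\<And>n k j. \<lbrakk>good n k; \<bar>j\<bar> < wd n k\<rbrakk> \<Longrightarrow> \<bar>((vn n k j)\<^sup>2 + c\<^sup>2) / 2\<bar> \<le> b3" by (rule bounded_coefficient[OF ord_coefficients(1)]) (rule that)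
  obtain b4 where b4: "0 \<le> b4" "\<And>n k j. \<lbrakk>good n k; \<bar>j\<bar> < wd n k\<rbrakk> \<Longrightarrow> \<bar>pn n k j * vn n k j\<bar> \<le> b4" by (rule bounded_coefficient[OF ord_coefficients(2)]) (rule that)
  obtain b5 where b5: "0 \<le> b5" "\<And>n k j. \<lbrakk>good n k; \<bar>j\<bar> < wd n k\<rbrakk> \<Longrightarrow> \<bar>c\<^sup>2 * qn n k j\<bar> \<le> b5" by (rule bounded_coefficient[OF ord_coefficients(3)]) (rule that)
  obtain b6 where b6: "0 \<le> b6" "\<And>n k j. \<lbrakk>good n k; \<bar>j\<bar> < wd n k\<rbrakk> \<Longrightarrow> \<bar>c\<^sup>2 * vn n k j * qn n k j\<bar> \<le> b6" by (rule bounded_coefficient[OF ord_coefficients(4)]) (rule that)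
  define M' where "M' = 2 * M + (2 * b1 + b2 + b5 + 2 * r * (2 * b3 + b4 + b6))"
  have "0 \<le> 2 * r * (2 * b3 + b4 + b6)" using b3 b4 b6 r_pos by (intro mult_nonneg_nonneg) auto
  then have M'0: "0 \<le> 2 * b1 + b2 + b5 + 2 * r * (2 * b3 + b4 + b6)" using b1 b2 b5 by linarith
  show ?thesis
  proof (rule that[of M'])
    show "0 \<le> M'" using M M'0 by (simp add: M'_def)
    fix n k j assume g: "good n k" and j: "\<bar>j\<bar> < wd n k"
    have n: "0 < n" using g by (auto simp: good_def)
    note h = stp_pos[OF n]
    define w where "w = stp n * eb n k j"
    have w: "0 \<le> w" using h eb_nonneg by (simp add: w_def)
    have j': "- wd n k < j" "j < wd n k" using j by auto
    have e: "E1 = E1 \<or> E1 = E2" "E2 = E1 \<or> E2 = E2" by simp_all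
    note d = a1_s1_le(1,2)[OF j' n e(1), folded w_def] a1_s1_le(1,2)[OF j' n e(2), folded w_def]
    have pr: "\<bar>x * y\<bar> \<le> b * z" if "\<bar>x\<bar> \<le> b" "\<bar>y\<bar> \<le> z" for x y b z :: real
      using that unfolding abs_mult by (intro mult_mono) auto
    note p = pr[OF b1(2)[OF g j] d(1)] pr[OF b2(2)[OF g j] d(3)] pr[OF b3(2)[OF g j] d(2)] pr[OF b4(2)[OF g j] d(4)]
      pr[OF b5(2)[OF g j] d(1)] pr[OF b1(2)[OF g j] d(3)] pr[OF b6(2)[OF g j] d(2)] pr[OF b3(2)[OF g j] d(4)]
    have R: "\<bar>Rm1 n k j\<bar> \<le> M * (w + stp n ^ 3)" "\<bar>Rm2 n k j\<bar> \<le> M * (w + stp n ^ 3)"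
      using M(2) g j by (simp_all add: res_bound_def w_def)
    have tri: "\<bar>x - a - b + y + z + R\<bar> \<le> \<bar>x\<bar> + A + B' + Y + Z + R'"
      if "\<bar>a\<bar> \<le> A" "\<bar>b\<bar> \<le> B'" "\<bar>y\<bar> \<le> Y" "\<bar>z\<bar> \<le> Z" "\<bar>R\<bar> \<le> R'" for x a b y z R A B' Y Z R' :: real
      using that by linarith
    have "E1 n (Suc k) j = E1 n k j - vn n k j * a1 E1 n k j - pn n k j * a1 E2 n k j
     + ((vn n k j)\<^sup>2 + c\<^sup>2) / 2 * s1 E1 n k j + pn n k j * vn n k j * s1 E2 n k j + Rm1 n k j"
      by (simp add: Rm1_def Lin1_def)
    then have 1: "\<bar>E1 n (Suc k) j\<bar> \<le> \<bar>E1 n k j\<bar> + b1 * w + b2 * w + b3 * (2 * r * w) + b4 * (2 * r * w) + M * (w + stp n ^ 3)"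
      using tri[OF p(1-4) R(1), of "E1 n k j"] by simp
    have "E2 n (Suc k) j = E2 n k j - c\<^sup>2 * qn n k j * a1 E1 n k j - vn n k j * a1 E2 n k j
     + c\<^sup>2 * vn n k j * qn n k j * s1 E1 n k j + ((vn n k j)\<^sup>2 + c\<^sup>2) / 2 * s1 E2 n k j + Rm2 n k j"
      by (simp add: Rm2_def Lin2_def)
    then have 2: "\<bar>E2 n (Suc k) j\<bar> \<le> \<bar>E2 n k j\<bar> + b5 * w + b1 * w + b6 * (2 * r * w) + b3 * (2 * r * w) + M * (w + stp n ^ 3)"
      using tri[OF p(5-8) R(2), of "E2 n k j"] by simp
    have "ee n (Suc k) j \<le> ee n k j + (2 * b1 + b2 + b5 + 2 * r * (2 * b3 + b4 + b6)) * w + 2 * M * (w + stp n ^ 3)"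
      using 1 2 by (simp add: ee_def algebra_simps)
    also have "\<dots> \<le> ee n k j + (2 * b1 + b2 + b5 + 2 * r * (2 * b3 + b4 + b6)) * (w + stp n ^ 3) + 2 * M * (w + stp n ^ 3)"
      using M'0 h by (intro add_right_mono add_left_mono mult_left_mono) auto
    finally show "ee n (Suc k) j \<le> ee n k j + M' * (stp n * eb n k j + stp n ^ 3)"
      by (simp add: M'_def w_def distrib_right)
  qed
qed

definition mean where "mean n k = (\<Sum>j\<in>{- wd n k..wd n k}. ee n k j) / (2 * of_int (wd n k) + 1)"

text \<open>Cauchy-Schwarz turns the energy bound into sums of order h^(3/2) sqrt m. Another factor
  h comes from the step, or from expressing oscillation by difference quotients, and division by the
  number of points leaves h^(5/2) / sqrt m.\<close>

lemma mean_step: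
  assumes F: "F n k \<le> C' * stp n ^ 3" and C': "0 \<le> C'" and g: "good n k"
    and M: "0 \<le> M" "\<And>j. \<bar>j\<bar> < wd n k \<Longrightarrow> ee n (Suc k) j \<le> ee n k j + M * (stp n * eb n k j + stp n ^ 3)"
  shows "mean n (Suc k) \<le> mean n k
    + (2 / r + M) * sqrt (108 * Cq * C') * ((stp n)\<^sup>2 * sqrt (stp n)) * (1 / sqrt (of_int (wd n k))) + M * stp n ^ 3"
proof -
  define m where "m = wd n k"
  define h where "h = stp n"
  define Z where "Z = sqrt (108 * Cq * C')"
  let ?I = "{- m + 1..m - 1}" and ?m = "of_int m :: real"
  have n: "0 < n" "k \<le> n" and kn: "k < n" using g by (auto simp: good_def)
  have h: "0 < h" using stp_pos[OF n(1)] by (simp add: h_def)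
  have m: "1 \<le> m" using kn by (simp add: m_def wd_def)
  then have m1: "1 \<le> ?m" by simp
  have Z: "0 \<le> Z" using Cq_pos C' by (simp add: Z_def)
  have A: "0 \<le> 36 * Cq * C'" using Cq_pos C' by simp
  have Zs: "(\<Sum>j\<in>?I. eb n k j) \<le> Z * (h * sqrt h) * sqrt ?m" "(\<Sum>j\<in>{- m..m}. mag n k j) \<le> Z * (h * sqrt h) * sqrt ?m"
  proof -
    have Ch: "Cq * F n k \<le> Cq * (C' * h ^ 3)" "0 \<le> Cq * (C' * h ^ 3)"
      using F C' Cq_pos h by (auto simp: h_def intro: mult_left_mono)
    have "(\<Sum>j\<in>?I. (eb n k j)\<^sup>2) \<le> 36 * Cq * C' * h ^ 3" "(\<Sum>j\<in>{- m..m}. (mag n k j)\<^sup>2) \<le> 36 * Cq * C' * h ^ 3"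
      using sum_eb[OF n] sum_mag[OF n] Ch unfolding m_def by (simp_all add: mult.assoc)
    \<comment> \<open>2 m + 1 is at most 3 m as m is at least 1; with the 36 of
      \<open>sum_eb\<close> this gives the 108.\<close>
    moreover have "real (card ?I) \<le> 3 * ?m" "real (card {- m..m}) \<le> 3 * ?m" using m by simp_all
    ultimately show "(\<Sum>j\<in>?I. eb n k j) \<le> Z * (h * sqrt h) * sqrt ?m" "(\<Sum>j\<in>{- m..m}. mag n k j) \<le> Z * (h * sqrt h) * sqrt ?m"
      using sum_le_sqrt[OF _ _ _ h A, of ?I ?m "eb n k"] sum_le_sqrt[OF _ _ _ h A, of "{- m..m}" ?m "mag n k"]
      by (simp_all add: Z_def mult.assoc)
  qed
  \<comment> \<open>Total variation of \<open>ee\<close> over the slice, which bounds the excess of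
    any value over the boundary values.\<close>
  define D where "D = (\<Sum>l\<in>{- m..m - 1}. \<bar>ee n k (l + 1) - ee n k l\<bar>)"
  have D: "D \<le> h / r * (Z * (h * sqrt h) * sqrt ?m)"
  proof -
    have "\<bar>ee n k (l + 1) - ee n k l\<bar> \<le> h / r * mag n k l" if l: "l \<in> {- m..m - 1}" for l
    proof -
      have l': "- wd n k \<le> l" "l < wd n k" using l by (auto simp: m_def)
      have "\<bar>ee n k (l + 1) - ee n k l\<bar> \<le> \<bar>E1 n k (l + 1) - E1 n k l\<bar> + \<bar>E2 n k (l + 1) - E2 n k l\<bar>"
        unfolding ee_def by linarith
      also have "\<dots> = h / r * (\<bar>Gd E1 n k l\<bar> + \<bar>Gd E2 n k l\<bar>)"
        unfolding E_diff[OF l' n(1)] h_def[symmetric] using h r_pos by (simp add: abs_mult distrib_left)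
      also have "\<dots> \<le> h / r * mag n k l" using h r_pos by (intro mult_left_mono) (auto simp: mag_def)
      finally show ?thesis .
    qed
    then have "D \<le> (\<Sum>l\<in>{- m..m - 1}. h / r * mag n k l)" unfolding D_def by (rule sum_mono)
    also have "\<dots> \<le> (\<Sum>l\<in>{- m..m}. h / r * mag n k l)" using h r_pos mag_nonneg by (intro sum_mono2) auto
    also have "\<dots> = h / r * (\<Sum>l\<in>{- m..m}. mag n k l)" by (simp only: sum_distrib_left)
    also have "\<dots> \<le> h / r * (Z * (h * sqrt h) * sqrt ?m)" using Zs(2) h r_pos by (intro mult_left_mono) auto
    finally show ?thesis .
  qed
  let ?W = "Z * (h\<^sup>2 * sqrt h) * (1 / sqrt ?m)"
  have sq: "sqrt ?m / ?m = 1 / sqrt ?m" using m1 by (simp add: real_div_sqrt divide_simps)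
  have "2 * D / (2 * ?m + 1) \<le> 2 * (h / r * (Z * (h * sqrt h) * sqrt ?m)) / ?m"
    using D m1 h r_pos Z by (intro frac_le) auto
  also have "\<dots> = 2 / r * (Z * (h\<^sup>2 * sqrt h) * (sqrt ?m / ?m))" by (simp add: power2_eq_square)
  finally have D': "2 * D / (2 * ?m + 1) \<le> 2 / r * ?W" unfolding sq .
  have "(\<Sum>j\<in>?I. eb n k j) / (2 * ?m - 1) \<le> (Z * (h * sqrt h) * sqrt ?m) / ?m"
    using Zs(1) m1 h Z by (intro frac_le) auto
  then have "M * h * ((\<Sum>j\<in>?I. eb n k j) / (2 * ?m - 1)) \<le> M * h * ((Z * (h * sqrt h) * sqrt ?m) / ?m)"
    using M(1) h by (intro mult_left_mono) auto
  also have "\<dots> = M * (Z * (h\<^sup>2 * sqrt h) * (sqrt ?m / ?m))" by (simp add: power2_eq_square)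
  finally have E': "M * h * ((\<Sum>j\<in>?I. eb n k j) / (2 * ?m - 1)) \<le> M * ?W" unfolding sq .
  have card: "real (card ?I) = 2 * ?m - 1" using m by simp
  have "(\<Sum>j\<in>?I. ee n (Suc k) j) \<le> (\<Sum>j\<in>?I. ee n k j + M * (h * eb n k j + h ^ 3))"
    using M(2) unfolding h_def by (intro sum_mono) (auto simp: m_def)
  also have "\<dots> = (\<Sum>j\<in>?I. ee n k j) + M * (h * (\<Sum>j\<in>?I. eb n k j) + (2 * ?m - 1) * h ^ 3)"
    by (simp only: sum.distrib sum_distrib_left[symmetric] sum_constant card)
  finally have "(\<Sum>j\<in>?I. ee n (Suc k) j) / (2 * ?m - 1)
      \<le> ((\<Sum>j\<in>?I. ee n k j) + M * (h * (\<Sum>j\<in>?I. eb n k j) + (2 * ?m - 1) * h ^ 3)) / (2 * ?m - 1)"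
    using m1 by (intro divide_right_mono) auto
  also have "\<dots> = (\<Sum>j\<in>?I. ee n k j) / (2 * ?m - 1) + M * h * ((\<Sum>j\<in>?I. eb n k j) / (2 * ?m - 1)) + M * h ^ 3"
    using m1 by (simp add: add_divide_distrib distrib_left)
  also have "\<dots> \<le> ((\<Sum>j\<in>{- m..m}. ee n k j) / (2 * ?m + 1) + 2 * D / (2 * ?m + 1)) + M * ?W + M * h ^ 3"
    using m unfolding D_def by (intro add_mono mean_shrink E' order_refl conjI oscillation_le) auto
  finally have "(\<Sum>j\<in>?I. ee n (Suc k) j) / (2 * ?m - 1) \<le> mean n k + 2 / r * ?W + M * ?W + M * h ^ 3"
    using D' unfolding mean_def m_def[symmetric] by linarith
  moreover have "wd n (Suc k) = m - 1" by (simp add: m_def wd_def)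
  then have "mean n (Suc k) = (\<Sum>j\<in>?I. ee n (Suc k) j) / (2 * ?m - 1)" by (simp add: mean_def)
  ultimately show ?thesis
    unfolding Z_def[symmetric] m_def[symmetric] h_def[symmetric] by (simp add: distrib_right mult.assoc add_divide_distrib)
qed

text \<open>Summed over all levels the bounds give h^(5/2) times 2 sqrt n, that is 2 h^2 sqrt t0
  since n h = t0; the n cubic terms add t0 h^2.\<close>

lemma apex_error:
  obtains C' n1 where "n0 \<le> n1" "\<And>n. n1 \<le> n \<Longrightarrow> ee n n 0 \<le> C' * (stp n)\<^sup>2"
proof -
  obtain C' n1 where C': "0 \<le> C'" "n0 \<le> n1" "\<And>n k. \<lbrakk>n1 \<le> n; k \<le> n\<rbrakk> \<Longrightarrow> F n k \<le> C' * stp n ^ 3"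
    "\<And>n k. \<lbrakk>n1 \<le> n; k < n\<rbrakk> \<Longrightarrow> good n k"
    by (rule energy_bound) (rule that)
  obtain M where M: "0 \<le> M" "\<And>n k j. \<lbrakk>good n k; \<bar>j\<bar> < wd n k\<rbrakk> \<Longrightarrow> ee n (Suc k) j \<le> ee n k j + M * (stp n * eb n k j + stp n ^ 3)"
    by (rule one_step) (rule that)
  define Z where "Z = (2 / r + M) * sqrt (108 * Cq * C')"
  have Z: "0 \<le> Z" using M(1) r_pos Cq_pos C'(1) by (simp add: Z_def)
  show ?thesis
  proof (rule that[OF C'(2), of "2 * Z * sqrt t0 + M * t0"])
    fix n assume n: "n1 \<le> n"
    then have n0n: "0 < n" using n0_pos C'(2) by simp
    note h = stp_pos[OF n0n]
    let ?w = "Z * ((stp n)\<^sup>2 * sqrt (stp n))"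
    have "mean n k \<le> ?w * (2 * (sqrt (real n) - sqrt (of_int (wd n k)))) + M * stp n ^ 3 * real k" if "k \<le> n" for k
      using that
    proof (induction k)
      case 0
      have "mean n 0 = 0" unfolding mean_def by (simp add: ee_def error_0 abs_le_iff)
      then show ?case by (simp add: wd_def)
    next
      case (Suc k)
      have k: "k < n" using Suc.prems by simp
      have m: "1 \<le> (of_int (wd n k) :: real)" using k by (simp add: wd_def)
      have wS: "of_int (wd n (Suc k)) = (of_int (wd n k) - 1 :: real)" by (simp add: wd_def)
      have "mean n (Suc k) \<le> mean n k + ?w * (1 / sqrt (of_int (wd n k))) + M * stp n ^ 3"
        unfolding Z_def using mean_step[OF C'(3)[OF n] C'(1) C'(4)[OF n k] M(1) M(2)[OF C'(4)[OF n k]]] k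
        by (simp add: mult.assoc)
      also have "\<dots> \<le> (?w * (2 * (sqrt (real n) - sqrt (of_int (wd n k)))) + M * stp n ^ 3 * real k)
          + ?w * (2 * (sqrt (of_int (wd n k)) - sqrt (of_int (wd n k) - 1))) + M * stp n ^ 3"
        using Suc.IH k h Z by (intro add_mono mult_left_mono inverse_sqrt_le m order_refl) auto
      finally show ?case unfolding wS by (simp add: algebra_simps)
    qed
    \<comment> \<open>At level n the slice is the apex alone, so the mean is the error
      there.\<close>
    from this[of n] have "ee n n 0 \<le> ?w * (2 * sqrt (real n)) + M * stp n ^ 3 * real n"
      by (simp add: mean_def wd_def)
    also have "\<dots> = 2 * Z * (stp n)\<^sup>2 * sqrt (real n * stp n) + M * (stp n)\<^sup>2 * (real n * stp n)"
      by (simp add: real_sqrt_mult power2_eq_square power3_eq_cube)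
    also have "\<dots> = (2 * Z * sqrt t0 + M * t0) * (stp n)\<^sup>2"
      unfolding stp_n[OF n0n] by (simp add: algebra_simps)
    finally show "ee n n 0 \<le> (2 * Z * sqrt t0 + M * t0) * (stp n)\<^sup>2" .
  qed
qed

end

section \<open>Second order convergence at an arbitrary cone point\<close>

context pipe_grid
begin

lemma second_order_u:
  assumes cfl: "2 * r * c \<le> 1" and cone: "(t0, x0) \<in> cone_points T L r"
  shows "(\<lambda>n. norm (lw_error cf D K \<rho>a r u t0 x0 n)) \<in> O(\<lambda>n. (t0 / real n)\<^sup>2)"
proof -
  obtain \<delta> where \<delta>: "0 < \<delta>" "\<And>t x. \<lbrakk>t \<in> {0..T}; x \<in> {0..L}\<rbrakk> \<Longrightarrow> \<delta> \<le> \<bar>P t x\<bar>"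
    using smooth_nonzero_bound[OF smooth_P] P_nonzero by blast
  obtain q q' B where b: "0 < q" "0 \<le> B"
    "\<And>t x. \<lbrakk>t \<in> {0..T}; x \<in> {0..L}\<rbrakk> \<Longrightarrow> q \<le> \<bar>c * Q t x\<bar> \<and> \<bar>c * Q t x\<bar> \<le> q'"
    "\<And>t x y. \<lbrakk>t \<in> {0..T}; x \<in> {0..L}; y \<in> {0..L}\<rbrakk> \<Longrightarrow>
       \<bar>V t y - V t x\<bar> \<le> B * (r * \<bar>y - x\<bar>) \<and> \<bar>Q t y - Q t x\<bar> \<le> B * (r * \<bar>y - x\<bar>)"
    "\<And>t s x. \<lbrakk>t \<in> {0..T}; s \<in> {0..T}; x \<in> {0..L}\<rbrakk> \<Longrightarrow> \<bar>Q s x - Q t x\<bar> \<le> B * \<bar>s - t\<bar>"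
    by (rule uniform_bounds) (rule that)
  define n0 where "n0 = Suc (nat \<lceil>2 * t0 / \<delta>\<rceil>)"
  have n0: "t0 / real n0 \<le> \<delta> / 2"
  proof -
    have "2 * t0 / \<delta> \<le> real n0" unfolding n0_def by linarith
    then show ?thesis using \<delta>(1) by (simp add: n0_def field_simps)
  qed
  interpret pipe_cone_bounds T L cf D K \<rho>a u r t0 x0 \<delta> n0 q q' B
    by unfold_locales (use cone cfl \<delta> b n0 in \<open>auto simp: n0_def\<close>)
  obtain C' n1 where n1: "n0 \<le> n1" "\<And>n. n1 \<le> n \<Longrightarrow> ee n n 0 \<le> C' * (stp n)\<^sup>2"
    by (rule apex_error) (rule that)
  show ?thesis
  proof (rule bigoI[where c = C'])
    show "\<forall>\<^sub>F n in sequentially. norm (norm (lw_error cf D K \<rho>a r u t0 x0 n)) \<le> C' * norm ((t0 / real n)\<^sup>2)"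
    proof (rule eventually_sequentiallyI[of n1])
      fix n assume n: "n1 \<le> n"
      then have "0 < n" using n1(1) n0_pos by simp
      then have e: "lw_error cf D K \<rho>a r u t0 x0 n $ 1 = E1 n n 0" "lw_error cf D K \<rho>a r u t0 x0 n $ 2 = E2 n n 0"
        by (simp_all add: lw_error_def E1_def E2_def U_def pn_eq vn_eq stp_n pos_def stp_def P_def V_def)
      have "norm (lw_error cf D K \<rho>a r u t0 x0 n) \<le> ee n n 0"
        using norm_le_l1_cart[of "lw_error cf D K \<rho>a r u t0 x0 n"] unfolding ee_def sum_2 e .
      also have "\<dots> \<le> C' * (stp n)\<^sup>2" by (rule n1(2)[OF n])
      finally show "norm (norm (lw_error cf D K \<rho>a r u t0 x0 n)) \<le> C' * norm ((t0 / real n)\<^sup>2)"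
        by (simp add: stp_def)
    qed
  qed
qed

end

section \<open>A flow with an error term of order two\<close>

text \<open>For data constant in space the scheme is the second order Taylor method for \<open>y' = - C y\<^sup>2\<close>.
  In terms of \<open>z = 1 / y\<close>, for which \<open>z' = C\<close>, its error has a closed form recursion.\<close>

locale riccati =
  fixes C v0 :: real
  assumes C_pos: "0 < C" and v0_pos: "0 < v0"
begin

definition z where "z t = 1 / v0 + C * t"
definition y where "y t = 1 / z t"
text \<open>To leading order 1 / num equals z - h^2 e: each step loses about (h C)^3 y^2, and
  \<open>e\<close> is the integral of C^3 y^2 along the exact solution.\<close>

definition e where "e t = C\<^sup>2 * (v0 - y t)"

primrec num :: "real \<Rightarrow> nat \<Rightarrow> real" where
  "num h 0 = v0"
| "num h (Suc n) = num h n - h * C * (num h n)\<^sup>2 + h\<^sup>2 * C\<^sup>2 * (num h n) ^ 3"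

lemma z_ge: "0 \<le> t \<Longrightarrow> 1 / v0 \<le> z t" and z_pos: "0 \<le> t \<Longrightarrow> 0 < z t"
  using C_pos v0_pos by (simp_all add: z_def add_pos_nonneg)

lemma num_pos: "0 < num h n"
proof (induction n)
  case (Suc n)
  define a where "a = h * C * num h n"
  have "0 < 1 - a + a\<^sup>2"
  proof -
    have "0 \<le> (2 * a - 1)\<^sup>2" by simp
    then show ?thesis by (simp add: power2_eq_square algebra_simps)
  qed
  moreover have "num h (Suc n) = num h n * (1 - a + a\<^sup>2)"
    by (simp add: a_def power2_eq_square power3_eq_cube algebra_simps)
  ultimately show ?case using Suc by simp
qed (simp add: v0_pos)

definition w where "w h n = 1 / num h n"

lemma w_pos: "0 < w h n"
  by (simp add: w_def num_pos)

lemma den_ge: "3 / 4 * a\<^sup>2 \<le> a\<^sup>2 - b * a + b\<^sup>2" for a b :: real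
proof -
  have "0 \<le> (a / 2 - b)\<^sup>2" by simp
  then show ?thesis by (simp add: power2_eq_square algebra_simps)
qed

text \<open>Sum of cubes: with a = h C the denominator divides w^3 + a^3, which separates the exact
  increment a of \<open>z\<close> from a cubic local error.\<close>

lemma w_Suc: "w h (Suc n) = w h n + h * C - (h * C) ^ 3 / ((w h n)\<^sup>2 - h * C * w h n + (h * C)\<^sup>2)"
proof -
  have p: "0 < w h n" and q: "0 < (w h n)\<^sup>2 - h * C * w h n + (h * C)\<^sup>2"
    using w_pos[of h n] den_ge[of "w h n" "h * C"] zero_less_power[of "w h n" 2] by linarith+
  have "num h n = 1 / w h n" by (simp add: w_def)
  then have "num h (Suc n) = ((w h n)\<^sup>2 - h * C * w h n + (h * C)\<^sup>2) / w h n ^ 3"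
    using p by (simp add: field_simps power2_eq_square power3_eq_cube)
  then have "w h (Suc n) = w h n ^ 3 / ((w h n)\<^sup>2 - h * C * w h n + (h * C)\<^sup>2)"
    by (simp add: w_def)
  also have "w h n ^ 3 = (w h n + h * C) * ((w h n)\<^sup>2 - h * C * w h n + (h * C)\<^sup>2) - (h * C) ^ 3"
    by (simp add: power2_eq_square power3_eq_cube algebra_simps)
  finally show ?thesis using q by (simp add: diff_divide_distrib)
qed

lemma den_bound:
  assumes "1 / v0 \<le> w h n"
  shows "0 < (w h n)\<^sup>2 - h * C * w h n + (h * C)\<^sup>2"
    "1 / ((w h n)\<^sup>2 - h * C * w h n + (h * C)\<^sup>2) \<le> 2 * v0\<^sup>2"
proof -
  let ?d = "(w h n)\<^sup>2 - h * C * w h n + (h * C)\<^sup>2"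
  show d: "0 < ?d" using den_ge[of "w h n" "h * C"] zero_less_power[OF w_pos[of h n], of 2] by linarith
  have "(1 / v0)\<^sup>2 \<le> (w h n)\<^sup>2" using assms v0_pos by (intro power_mono) auto
  moreover have "1 / (2 * v0\<^sup>2) = (1 / v0)\<^sup>2 / 2" by (simp add: power_divide)
  ultimately have "1 / (2 * v0\<^sup>2) \<le> ?d"
    using den_ge[of "w h n" "h * C"] zero_le_power2[of "1 / v0"] by linarith
  then have "1 / ?d \<le> 1 / (1 / (2 * v0\<^sup>2))"
    using v0_pos by (intro divide_left_mono mult_pos_pos d) auto
  then show "1 / ?d \<le> 2 * v0\<^sup>2" by simp
qed

text \<open>For h C v0 \<le> 1 the cubic loss is at most the gain h C, so w does not fall below its
  initial value. This bounds the denominators from below, and the losses accumulate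
  linearly.\<close>

lemma w_bounds:
  assumes "0 < h" "h * C * v0 \<le> 1"
  shows w_ge: "1 / v0 \<le> w h n" and w_diff_z: "\<bar>w h n - z (n * h)\<bar> \<le> n * (h ^ 3 * (2 * C ^ 3 * v0\<^sup>2))"
proof (induction n)
  case 0
  show "1 / v0 \<le> w h 0" "\<bar>w h 0 - z (real 0 * h)\<bar> \<le> real 0 * (h ^ 3 * (2 * C ^ 3 * v0\<^sup>2))"
    by (simp_all add: w_def z_def)
next
  case (Suc n)
  have p: "0 < w h n" by (rule w_pos)
  let ?d = "(w h n)\<^sup>2 - h * C * w h n + (h * C)\<^sup>2"
  note d = den_bound[OF Suc(1)]
  have "(h * C) ^ 3 / ?d \<le> h * C"
  proof -
    have hC: "h * C \<le> 1 / v0" using assms(2) v0_pos by (simp add: pos_le_divide_eq)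
    then have "h * C \<le> w h n" using Suc(1) by linarith
    then have "0 \<le> w h n * (w h n - h * C)" using p by simp
    then have "(h * C)\<^sup>2 \<le> ?d" by (simp add: power2_eq_square algebra_simps)
    then have "(h * C) * (h * C)\<^sup>2 \<le> h * C * ?d" using assms(1) C_pos by (intro mult_left_mono) auto
    then show ?thesis using d by (simp add: pos_divide_le_eq power3_eq_cube power2_eq_square mult_ac)
  qed
  then show "1 / v0 \<le> w h (Suc n)" using Suc(1) by (simp add: w_Suc)
  have "(h * C) ^ 3 * (1 / ?d) \<le> (h * C) ^ 3 * (2 * v0\<^sup>2)"
    using d(2) assms(1) C_pos by (intro mult_left_mono) auto
  then have "(h * C) ^ 3 / ?d \<le> (h * C) ^ 3 * (2 * v0\<^sup>2)" by simp
  also have "\<dots> = h ^ 3 * (2 * C ^ 3 * v0\<^sup>2)" by (simp add: power_mult_distrib)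
  finally have le: "(h * C) ^ 3 / ?d \<le> h ^ 3 * (2 * C ^ 3 * v0\<^sup>2)" .
  have ge: "0 \<le> (h * C) ^ 3 / ?d" using assms(1) C_pos d by simp
  have "w h (Suc n) - z (real (Suc n) * h) = (w h n - z (real n * h)) - (h * C) ^ 3 / ?d"
    by (simp add: w_Suc z_def algebra_simps)
  then have "\<bar>w h (Suc n) - z (real (Suc n) * h)\<bar> \<le> \<bar>w h n - z (real n * h)\<bar> + (h * C) ^ 3 / ?d"
    using ge by linarith
  also have "\<dots> \<le> real (Suc n) * (h ^ 3 * (2 * C ^ 3 * v0\<^sup>2))"
    using le Suc(2) by (simp add: distrib_right)
  finally show "\<bar>w h (Suc n) - z (real (Suc n) * h)\<bar> \<le> real (Suc n) * (h ^ 3 * (2 * C ^ 3 * v0\<^sup>2))" .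
qed

text \<open>From 1 / z t - 1 / z (t + h) = C h / (z t z (t + h)). The increments of \<open>e\<close>
  are known exactly and can be compared with the losses of \<open>w\<close> step by step.\<close>

lemma e_step:
  assumes "0 \<le> t" "0 \<le> h"
  shows "e (t + h) - e t = C ^ 3 * h / (z t * z (t + h))"
proof -
  have "z t \<noteq> 0" "z (t + h) \<noteq> 0" using z_pos[of t] z_pos[of "t + h"] assms by auto
  moreover have "z (t + h) = z t + C * h" by (simp add: z_def algebra_simps)
  ultimately show ?thesis by (simp add: e_def y_def field_simps power2_eq_square power3_eq_cube)
qed

lemma inverse_z_le:
  assumes "0 \<le> t"
  shows "1 / z t \<le> v0"
  using z_ge[OF assms] z_pos[OF assms] v0_pos by (simp add: field_simps)

text \<open>The bound of order h^2 is weakened by h C v0 \<le> 1; order h is all that the comparison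
  of denominators requires.\<close>

lemma w_diff_z_linear:
  assumes h: "0 < h" "h * C * v0 \<le> 1" "real n * h \<le> T"
  shows "\<bar>w h n - z (n * h)\<bar> \<le> 2 * T * C\<^sup>2 * v0 * h"
proof -
  have nh: "real n * (h ^ 3 * (2 * C ^ 3 * v0\<^sup>2)) = (real n * h) * ((h * C * v0) * (2 * C\<^sup>2 * v0 * h))"
    by (simp add: power2_eq_square power3_eq_cube)
  have "(h * C * v0) * (2 * C\<^sup>2 * v0 * h) \<le> 1 * (2 * C\<^sup>2 * v0 * h)"
    by (rule mult_right_mono) (use h C_pos v0_pos in \<open>auto simp: zero_le_mult_iff\<close>)
  then have "(real n * h) * ((h * C * v0) * (2 * C\<^sup>2 * v0 * h)) \<le> T * (2 * C\<^sup>2 * v0 * h)"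
    using h(1,3) C_pos v0_pos order_trans[of 0 "real n * h" T] by (intro mult_mono[OF h(3)]) auto
  with w_diff_z[OF h(1,2), of n] have "\<bar>w h n - z (n * h)\<bar> \<le> T * (2 * C\<^sup>2 * v0 * h)"
    unfolding nh by linarith
  also have "\<dots> = 2 * T * C\<^sup>2 * v0 * h" by simp
  finally show ?thesis .
qed

text \<open>In one step w - z loses (h C)^3 / d while h^2 e gains (h C)^3 / (z t z (t + h)). The
  denominators differ by O(h), so the sum changes by O(h^4) only, and there are at most T / h
  steps.\<close>

lemma expansion_w:
  assumes T: "0 < T"
  obtains M where "0 \<le> M"
    "\<And>h n. \<lbrakk>0 < h; h * C * v0 \<le> 1; real n * h \<le> T\<rbrakk> \<Longrightarrow> \<bar>w h n - z (n * h) + h\<^sup>2 * e (n * h)\<bar> \<le> M * h ^ 3"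
proof -
  \<comment> \<open>\<open>h0\<close> is the largest admissible step, \<open>S\<close> bounds w + z
    up to time T, and h \<open>N\<close> bounds the difference of the denominators, which is (w - z)
    (w + z) - h C (w + z) + h^2 C^2.\<close>
  define \<beta> where "\<beta> = 2 * T * C\<^sup>2 * v0"
  define h0 where "h0 = 1 / (C * v0)"
  define S where "S = 2 * z T + \<beta> * h0"
  define N where "N = \<beta> * S + C * S + C\<^sup>2 * h0"
  have pos: "0 < h0" "0 \<le> \<beta>" "0 \<le> S" "0 \<le> N"
    using T C_pos v0_pos z_pos[of T] by (simp_all add: h0_def \<beta>_def S_def N_def)
  have bound: "\<bar>w h n - z (n * h) + h\<^sup>2 * e (n * h)\<bar> \<le> real n * (h ^ 4 * (2 * C ^ 3 * v0 ^ 4 * N))"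
    if h: "0 < h" "h * C * v0 \<le> 1" and n: "real n * h \<le> T" for h n
    using n
  proof (induction n)
    case 0
    then show ?case by (simp add: w_def z_def e_def y_def)
  next
    case (Suc n)
    let ?t = "real n * h"
    let ?d = "(w h n)\<^sup>2 - h * C * w h n + (h * C)\<^sup>2"
    have t: "0 \<le> ?t" "?t \<le> T" "real (Suc n) * h = ?t + h"
      using Suc.prems h by (auto simp: algebra_simps)
    have "h \<le> h0" using h C_pos v0_pos by (simp add: h0_def pos_le_divide_eq mult_ac)
    have wz: "\<bar>w h n - z ?t\<bar> \<le> \<beta> * h" using w_diff_z_linear[OF h t(2)] by (simp add: \<beta>_def)
    have "z ?t \<le> z T" using t C_pos by (simp add: z_def)
    moreover have "\<beta> * h \<le> \<beta> * h0" using pos \<open>h \<le> h0\<close> by (intro mult_left_mono)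
    ultimately have S: "w h n + z ?t \<le> S" using wz unfolding S_def by linarith
    have wz_pos: "0 < w h n" "0 < z ?t" "0 < z (?t + h)" using w_pos z_pos t h by auto
    have "?d - z ?t * z (?t + h) = (w h n - z ?t) * (w h n + z ?t) - h * C * (w h n + z ?t) + h * (C\<^sup>2 * h)"
      by (simp add: z_def power2_eq_square algebra_simps)
    also have "\<bar>\<dots>\<bar> \<le> \<bar>(w h n - z ?t) * (w h n + z ?t)\<bar> + \<bar>h * C * (w h n + z ?t)\<bar> + \<bar>h * (C\<^sup>2 * h)\<bar>"
      by linarith
    also have "\<dots> \<le> (\<beta> * h) * S + h * C * S + h * (C\<^sup>2 * h0)"
    proof (intro add_mono)
      show "\<bar>(w h n - z ?t) * (w h n + z ?t)\<bar> \<le> (\<beta> * h) * S"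
        unfolding abs_mult using wz S wz_pos pos h by (intro mult_mono) auto
      show "\<bar>h * C * (w h n + z ?t)\<bar> \<le> h * C * S"
        unfolding abs_mult using S wz_pos h C_pos by (intro mult_mono) auto
      show "\<bar>h * (C\<^sup>2 * h)\<bar> \<le> h * (C\<^sup>2 * h0)"
        unfolding abs_mult using h C_pos \<open>h \<le> h0\<close> by (intro mult_mono) auto
    qed
    also have "\<dots> = h * N" by (simp add: N_def algebra_simps)
    finally have dN: "\<bar>?d - z ?t * z (?t + h)\<bar> \<le> h * N" .
    note db = den_bound[OF w_ge[OF h], of n]
    have "\<bar>C ^ 3 * h ^ 3 * ((?d - z ?t * z (?t + h)) * ((1 / z ?t) * (1 / z (?t + h)) * (1 / ?d)))\<bar>
        = C ^ 3 * h ^ 3 * (\<bar>?d - z ?t * z (?t + h)\<bar> * ((1 / z ?t) * (1 / z (?t + h)) * (1 / ?d)))"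
      using wz_pos db(1) h C_pos by (simp add: abs_mult)
    also have "\<dots> \<le> C ^ 3 * h ^ 3 * (h * N * (v0 * v0 * (2 * v0\<^sup>2)))"
      using wz_pos db h C_pos v0_pos t pos
      by (intro mult_left_mono mult_mono dN inverse_z_le) auto
    also have "\<dots> = h ^ 4 * (2 * C ^ 3 * v0 ^ 4 * N)"
      by (simp add: power2_eq_square power3_eq_cube power4_eq_xxxx)
    finally have inc: "\<bar>C ^ 3 * h ^ 3 * ((?d - z ?t * z (?t + h)) * ((1 / z ?t) * (1 / z (?t + h)) * (1 / ?d)))\<bar>
        \<le> h ^ 4 * (2 * C ^ 3 * v0 ^ 4 * N)" .
    have "w h (Suc n) - z (?t + h) + h\<^sup>2 * e (?t + h) - (w h n - z ?t + h\<^sup>2 * e ?t)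
        = - ((h * C) ^ 3 / ?d) + h\<^sup>2 * (C ^ 3 * h / (z ?t * z (?t + h)))"
      using e_step[OF t(1), of h] h by (simp add: w_Suc z_def algebra_simps)
    also have "\<dots> = C ^ 3 * h ^ 3 * ((?d - z ?t * z (?t + h)) * ((1 / z ?t) * (1 / z (?t + h)) * (1 / ?d)))"
    proof -
      have "- ((h * C) ^ 3 / d) + h\<^sup>2 * (C ^ 3 * h / (a * b)) = C ^ 3 * h ^ 3 * ((d - a * b) * ((1 / a) * (1 / b) * (1 / d)))"
        if "d \<noteq> 0" "a \<noteq> 0" "b \<noteq> 0" for a b d
        using that by (simp add: field_simps power2_eq_square power3_eq_cube)
      then show ?thesis using db(1) wz_pos by auto
    qed
    finally have "\<bar>w h (Suc n) - z (?t + h) + h\<^sup>2 * e (?t + h)\<bar> \<le> \<bar>w h n - z ?t + h\<^sup>2 * e ?t\<bar> + h ^ 4 * (2 * C ^ 3 * v0 ^ 4 * N)"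
      using inc by linarith
    also have "\<bar>w h n - z ?t + h\<^sup>2 * e ?t\<bar> \<le> real n * (h ^ 4 * (2 * C ^ 3 * v0 ^ 4 * N))"
      by (rule Suc.IH[OF t(2)])
    finally show ?case unfolding t(3) by (simp add: distrib_right)
  qed
  have count: "real n * (h ^ 4 * (2 * C ^ 3 * v0 ^ 4 * N)) \<le> T * (2 * C ^ 3 * v0 ^ 4 * N) * h ^ 3"
    if "0 < h" "real n * h \<le> T" for h n
  proof -
    have "(real n * h) * ((2 * C ^ 3 * v0 ^ 4 * N) * h ^ 3) \<le> T * ((2 * C ^ 3 * v0 ^ 4 * N) * h ^ 3)"
      using that pos C_pos v0_pos by (intro mult_right_mono) auto
    then show ?thesis by (simp add: power3_eq_cube power4_eq_xxxx mult_ac)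
  qed
  show ?thesis
    by (rule that[of "T * (2 * C ^ 3 * v0 ^ 4 * N)"], use pos T C_pos v0_pos in simp)
       (rule order_trans[OF bound count])
qed

lemma y_pos: "0 \<le> t \<Longrightarrow> 0 < y t" and y_le: "0 \<le> t \<Longrightarrow> y t \<le> v0"
  unfolding y_def by (simp add: z_pos, rule inverse_z_le)

lemma e_bounds: "0 \<le> t \<Longrightarrow> 0 \<le> e t" "0 \<le> t \<Longrightarrow> e t \<le> C\<^sup>2 * v0"
  unfolding e_def using y_pos[of t] y_le[of t] by (simp, intro mult_left_mono, simp_all)

lemma e_pos:
  assumes "0 < t"
  shows "0 < e t"
proof -
  have "1 / v0 < z t" using assms C_pos by (simp add: z_def)
  then have "y t < v0" using v0_pos z_pos[of t] assms by (simp add: y_def field_simps)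
  then show ?thesis using C_pos by (simp add: e_def)
qed

text \<open>Back from reciprocals: num - y = -(w - z) num y. After insertion of the expansion of w -
  z, replacing num y by y^2 in the leading term costs h^3, because w and z differ by O(h).\<close>

lemma expansion_num:
  assumes T: "0 < T"
  obtains M where "0 \<le> M"
    "\<And>h n. \<lbrakk>0 < h; h * C * v0 \<le> 1; real n * h \<le> T\<rbrakk> \<Longrightarrow>
       \<bar>num h n - y (n * h) - h\<^sup>2 * (e (n * h) * (y (n * h))\<^sup>2)\<bar> \<le> M * h ^ 3"
proof -
  obtain M where M: "0 \<le> M"
    "\<And>h n. \<lbrakk>0 < h; h * C * v0 \<le> 1; real n * h \<le> T\<rbrakk> \<Longrightarrow> \<bar>w h n - z (n * h) + h\<^sup>2 * e (n * h)\<bar> \<le> M * h ^ 3"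
    by (rule expansion_w[OF T]) (rule that)
  define \<beta> where "\<beta> = 2 * T * C\<^sup>2 * v0"
  have \<beta>: "0 \<le> \<beta>" using T v0_pos by (simp add: \<beta>_def)
  show ?thesis
  proof (rule that[of "M * (v0 * v0) + C\<^sup>2 * v0 * \<beta> * (v0 * v0\<^sup>2)"])
    show "0 \<le> M * (v0 * v0) + C\<^sup>2 * v0 * \<beta> * (v0 * v0\<^sup>2)" using M(1) v0_pos \<beta> by simp
    fix h n assume h: "0 < h" "h * C * v0 \<le> 1" "real n * h \<le> T"
    let ?t = "real n * h"
    have t: "0 \<le> ?t" using h by simp
    have y: "0 < y ?t" "y ?t \<le> v0" using y_pos[OF t] y_le[OF t] by auto
    have num: "0 < num h n" "num h n \<le> v0"
      using num_pos w_ge[OF h(1,2), of n] v0_pos by (auto simp: w_def field_simps)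
    have id: "a - b - h\<^sup>2 * (E * b\<^sup>2) = - ((1 / a - 1 / b + h\<^sup>2 * E) * (a * b)) + h\<^sup>2 * E * (1 / b - 1 / a) * (a * b\<^sup>2)"
      if "a \<noteq> 0" "b \<noteq> 0" for a b E :: real
      using that by (simp add: field_simps power2_eq_square)
    have wz: "w h n = 1 / num h n" "z ?t = 1 / y ?t" by (simp_all add: w_def y_def)
    have eq: "num h n - y ?t - h\<^sup>2 * (e ?t * (y ?t)\<^sup>2) =
        - ((w h n - z ?t + h\<^sup>2 * e ?t) * (num h n * y ?t)) + h\<^sup>2 * e ?t * (z ?t - w h n) * (num h n * (y ?t)\<^sup>2)"
      unfolding wz by (rule id) (use y num in auto)
    have "\<bar>num h n - y ?t - h\<^sup>2 * (e ?t * (y ?t)\<^sup>2)\<bar> \<le> \<bar>(w h n - z ?t + h\<^sup>2 * e ?t) * (num h n * y ?t)\<bar> + \<bar>h\<^sup>2 * e ?t * (z ?t - w h n) * (num h n * (y ?t)\<^sup>2)\<bar>"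
      unfolding eq by linarith
    also have "\<dots> \<le> M * h ^ 3 * (v0 * v0) + h\<^sup>2 * (C\<^sup>2 * v0) * (\<beta> * h) * (v0 * v0\<^sup>2)"
    proof (rule add_mono)
      have "\<bar>num h n * y ?t\<bar> \<le> v0 * v0"
        unfolding abs_mult by (rule mult_mono) (use y num v0_pos in simp_all)
      then show "\<bar>(w h n - z ?t + h\<^sup>2 * e ?t) * (num h n * y ?t)\<bar> \<le> M * h ^ 3 * (v0 * v0)"
        unfolding abs_mult[of "w h n - z ?t + h\<^sup>2 * e ?t"] using M h(1) by (intro mult_mono[OF M(2)[OF h]]) auto
      have "\<bar>h\<^sup>2 * e ?t\<bar> \<le> h\<^sup>2 * (C\<^sup>2 * v0)"
        unfolding abs_mult by (rule mult_mono) (use e_bounds[OF t] in simp_all)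
      moreover have "\<bar>z ?t - w h n\<bar> \<le> \<beta> * h"
        using w_diff_z_linear[OF h] unfolding \<beta>_def by linarith
      moreover have "\<bar>num h n * (y ?t)\<^sup>2\<bar> \<le> v0 * v0\<^sup>2"
        unfolding abs_mult by (rule mult_mono) (use y num v0_pos in \<open>simp_all add: power_mono\<close>)
      ultimately have "\<bar>h\<^sup>2 * e ?t\<bar> * \<bar>z ?t - w h n\<bar> * \<bar>num h n * (y ?t)\<^sup>2\<bar> \<le> h\<^sup>2 * (C\<^sup>2 * v0) * (\<beta> * h) * (v0 * v0\<^sup>2)"
        using \<beta> h(1) v0_pos by (intro mult_mono) simp_all
      then show "\<bar>h\<^sup>2 * e ?t * (z ?t - w h n) * (num h n * (y ?t)\<^sup>2)\<bar> \<le> h\<^sup>2 * (C\<^sup>2 * v0) * (\<beta> * h) * (v0 * v0\<^sup>2)"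
        by (simp only: abs_mult)
    qed
    also have "\<dots> = (M * (v0 * v0) + C\<^sup>2 * v0 * \<beta> * (v0 * v0\<^sup>2)) * h ^ 3"
      by (simp add: power2_eq_square power3_eq_cube algebra_simps)
    finally show "\<bar>num h n - y ?t - h\<^sup>2 * (e ?t * (y ?t)\<^sup>2)\<bar> \<le> (M * (v0 * v0) + C\<^sup>2 * v0 * \<beta> * (v0 * v0\<^sup>2)) * h ^ 3" .
  qed
qed

end

section \<open>Conservation form\<close>

text \<open>The velocity equation is the momentum balance minus v times the mass balance, divided by
  the density; k is the derivative of the pressure.\<close>

lemma balance_iff:
  fixes \<rho> :: real
  assumes "\<rho> \<noteq> 0"
  shows "\<rho>t + (\<rho> * vx + \<rho>x * v) = 0 \<and> (\<rho> * vt + \<rho>t * v) + (\<rho>x * v\<^sup>2 + \<rho> * (2 * v * vx) + k * \<rho>x) = - (s * \<rho>)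
    \<longleftrightarrow> \<rho>t = - (v * \<rho>x + \<rho> * vx) \<and> vt = - (k / \<rho> * \<rho>x + v * vx) - s"
proof -
  have "vt = - (k / \<rho> * \<rho>x + v * vx) - s \<longleftrightarrow> \<rho> * vt = - (k * \<rho>x + \<rho> * v * vx) - s * \<rho>"
    using assms by (simp add: field_simps)
  moreover have "\<rho> * vt + \<rho>t * v + (\<rho>x * v\<^sup>2 + \<rho> * (2 * v * vx) + k * \<rho>x) = \<rho> * vt + (k * \<rho>x + \<rho> * v * vx)"
    if "\<rho>t = - (v * \<rho>x + \<rho> * vx)"
    unfolding that by (simp add: algebra_simps power2_eq_square)
  moreover have "\<rho>t + (\<rho> * vx + \<rho>x * v) = 0 \<longleftrightarrow> \<rho>t = - (v * \<rho>x + \<rho> * vx)"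
    by (auto simp: algebra_simps)
  ultimately show ?thesis by (simp add: cong: conj_cong) linarith
qed

context rectangle
begin

text \<open>Smoothness is given for density and velocity, so q is replaced by \<rho> v on the
  rectangle and all derivatives follow from the product rule.\<close>

lemma conservation_iff_quasilinear:
  assumes u: "smooth (density_velocity \<rho> q)" and \<rho>a: "\<rho>a \<noteq> 0" and pos: "\<And>t x. \<lbrakk>t \<in> {0..T}; x \<in> {0..L}\<rbrakk> \<Longrightarrow> 0 < \<rho> t x"
  shows "conservation_form T L cf D K \<rho>a pa \<rho> q \<longleftrightarrow> quasilinear_form T L cf D K \<rho>a (density_velocity \<rho> q)"
  unfolding conservation_form_def quasilinear_form_def
proof (intro ball_cong refl)
  fix t x assume tx: "t \<in> {0..T}" "x \<in> {0..L}"
  let ?u = "density_velocity \<rho> q"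
  define v where "v t x = q t x / \<rho> t x" for t x
  have nth: "(\<lambda>t x. ?u t x $ 1) = \<rho>" "(\<lambda>t x. ?u t x $ 2) = v"
    by (simp_all add: density_velocity_def v_def fun_eq_iff)
  have sm: "smooth \<rho>" "smooth v" using smooth_nth[OF u, of 1] smooth_nth[OF u, of 2] unfolding nth .
  have q: "q t x = \<rho> t x * v t x" if "t \<in> {0..T}" "x \<in> {0..L}" for t x
    using pos[OF that] by (simp add: v_def)
  note d = DERIV_dt[OF sm(1) tx] DERIV_dt[OF sm(2) tx] DERIV_dx[OF sm(1) tx] DERIV_dx[OF sm(2) tx]
  have qt: "dt T q t x = \<rho> t x * dt T v t x + dt T \<rho> t x * v t x"
    using DERIV_mult[OF d(1,2)] q[OF _ tx(2)] by (intro dt_eqI[OF _ tx(1)]) (auto simp: add.commute mult.commute)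
  have qx: "dx L q t x = \<rho> t x * dx L v t x + dx L \<rho> t x * v t x"
    using DERIV_mult[OF d(3,4)] q[OF tx(1)] by (intro dx_eqI[OF _ tx(2)]) (auto simp: add.commute mult.commute)
  have "((\<lambda>y. \<rho> t y * (v t y)\<^sup>2 + (pa + K * ((\<rho> t y - \<rho>a) / \<rho>a))) has_real_derivative
      (dx L \<rho> t x * (v t x)\<^sup>2 + \<rho> t x * (2 * v t x * dx L v t x)) + K / \<rho>a * dx L \<rho> t x) (at x within {0..L})"
    by (rule derivative_eq_intros d refl \<rho>a)+ (use \<rho>a in \<open>simp add: field_simps\<close>)
  then have flux: "dx L (\<lambda>t x. (q t x)\<^sup>2 / \<rho> t x + pressure K \<rho>a pa (\<rho> t x)) t x =
      dx L \<rho> t x * (v t x)\<^sup>2 + \<rho> t x * (2 * v t x * dx L v t x) + K / \<rho>a * dx L \<rho> t x"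
  proof (rule dx_eqI[OF _ tx(2)])
    show "(q t y)\<^sup>2 / \<rho> t y + pressure K \<rho>a pa (\<rho> t y) = \<rho> t y * (v t y)\<^sup>2 + (pa + K * ((\<rho> t y - \<rho>a) / \<rho>a))"
      if "y \<in> {0..L}" for y
      using pos[OF tx(1) that] by (simp add: q[OF tx(1) that] pressure_def power2_eq_square)
  qed
  have source: "- (cf * \<bar>q t x\<bar> * q t x) / (2 * D * \<rho> t x) = - (cf / (2 * D) * v t x * \<bar>v t x\<bar> * \<rho> t x)"
    using pos[OF tx] by (simp add: q[OF tx] abs_mult)
  have "?u t x $ 1 = \<rho> t x" "?u t x $ 2 = v t x" by (simp_all add: density_velocity_def v_def)
  then have form: "dt T ?u t x = - (A_matrix K \<rho>a (?u t x) *v dx L ?u t x) + B_vector cf D (?u t x) \<longleftrightarrow>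
      dt T \<rho> t x = - (v t x * dx L \<rho> t x + \<rho> t x * dx L v t x) \<and>
      dt T v t x = - (K / \<rho>a / \<rho> t x * dx L \<rho> t x + v t x * dx L v t x) - cf / (2 * D) * v t x * \<bar>v t x\<bar>"
    unfolding vec_eq_iff forall_2 vector_add_component vector_uminus_component A_matrix_times
      dt_dx_nth[OF u tx, symmetric] nth by (simp add: B_vector_def)
  show "(dt T \<rho> t x + dx L q t x = 0 \<and>
        dt T q t x + dx L (\<lambda>t x. (q t x)\<^sup>2 / \<rho> t x + pressure K \<rho>a pa (\<rho> t x)) t x
          = - (cf * \<bar>q t x\<bar> * q t x) / (2 * D * \<rho> t x)) \<longleftrightarrow>
     dt T ?u t x = - (A_matrix K \<rho>a (?u t x) *v dx L ?u t x) + B_vector cf D (?u t x)"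
    unfolding form qt qx flux source using pos[OF tx] by (intro balance_iff) simp
qed

end

section \<open>Order of accuracy\<close>

context rectangle
begin

lemma smooth_taylor2:
  assumes u: "smooth u"
  shows "taylor2_in_time T L u"
proof -
  have "\<exists>M\<ge>0. \<forall>t\<in>{0..T}. \<forall>s\<in>{0..T}. \<forall>x\<in>{0..L}. \<bar>rest_t (\<lambda>t x. u t x $ i) t s x\<bar> \<le> M * \<bar>s - t\<bar> ^ 3" for i
    by (rule rest_t_bounds[OF smooth_nth[OF u, of i]]) blast
  then obtain M where M: "\<And>i. \<forall>t\<in>{0..T}. \<forall>s\<in>{0..T}. \<forall>x\<in>{0..L}. \<bar>rest_t (\<lambda>t x. u t x $ i) t s x\<bar> \<le> M i * \<bar>s - t\<bar> ^ 3"
    by metis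
  have dtt: "dt T (dt T (\<lambda>t x. u t x $ i)) t x = dt T (dt T u) t x $ i" if "t \<in> {0..T}" "x \<in> {0..L}" for i t x
  proof (rule dt_eqI[OF _ that(1)])
    show "((\<lambda>s. dt T u s x $ i) has_real_derivative dt T (dt T u) t x $ i) (at t within {0..T})"
      using DERIV_dt[OF smooth_nth[OF smooth_dt[OF u]] that, of i] unfolding dt_dx_nth(1)[OF smooth_dt[OF u] that] .
  qed (rule dt_dx_nth(1)[OF u _ that(2)])
  show ?thesis
    unfolding taylor2_in_time_def
  proof (intro exI[of _ "M 1 + M 2"] ballI allI impI)
    fix t x \<tau> assume t: "t \<in> {0..T}" "x \<in> {0..L}" and s: "t + \<tau> \<in> {0..T}"
    let ?R = "u (t + \<tau>) x - (u t x + \<tau> *\<^sub>R dt T u t x + (\<tau>\<^sup>2 / 2) *\<^sub>R dt T (dt T u) t x)"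
    have nth: "?R $ i = rest_t (\<lambda>t x. u t x $ i) t (t + \<tau>) x" for i
      unfolding rest_t_def dtt[OF t] dt_dx_nth(1)[OF u t] by simp
    have "norm ?R \<le> \<bar>?R $ 1\<bar> + \<bar>?R $ 2\<bar>" using norm_le_l1_cart[of ?R] unfolding sum_2 .
    also have "\<dots> \<le> M 1 * \<bar>\<tau>\<bar> ^ 3 + M 2 * \<bar>\<tau>\<bar> ^ 3"
      unfolding nth using M[of 1] M[of 2] t s by (intro add_mono) fastforce+
    finally show "norm ?R \<le> (M 1 + M 2) * \<bar>\<tau>\<bar> ^ 3" by (simp add: distrib_right)
  qed
qed

end

section \<open>The flow with constant density and decaying velocity\<close>

locale riccati_pipe = rectangle T L + riccati C v0 for T L C v0 +
  fixes cf D K \<rho>a p r :: real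
  assumes cf_pos: "0 < cf" and D_pos: "0 < D" and K_pos: "0 < K" and \<rho>a_pos: "0 < \<rho>a"
    and C_eq: "C = cf / (2 * D)" and v0_less: "v0 < sqrt (K / \<rho>a)" and p_pos: "0 < p" and r_pos: "0 < r"
begin

definition u :: "real \<Rightarrow> real \<Rightarrow> real^2" where "u t x = vector [p, y t]"

text \<open>Pairs of a constant and a multiple of a power of 1 / z form a class closed under both
  partial derivatives, whence smoothness by induction. The vanishing x-derivative is written with 0
  / z^0 to stay in the class.\<close>

lemma power_z_has_derivative:
  assumes "s \<in> {0..T}"
  shows "((\<lambda>(t, x). vector [\<alpha>, \<beta> / z t ^ m] :: real^2) has_derivative
      (\<lambda>(s', x'). s' *\<^sub>R vector [0, - (real m * C * \<beta>) / z s ^ Suc m] + x' *\<^sub>R vector [0, 0 / z s ^ 0]))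
     (at (s, x) within {0..T} \<times> {0..L})"
proof -
  have zs: "z s \<noteq> 0" using z_pos[of s] assms by simp
  have "((\<lambda>t. \<beta> / z t ^ m) has_real_derivative - (real m * C * \<beta>) / z s ^ Suc m) (at s)"
  proof -
    have dz: "(z has_real_derivative C) (at s)" unfolding z_def[abs_def] by (auto intro!: derivative_eq_intros)
    have "(0 * z s ^ m - real m * (C * z s ^ (m - Suc 0)) * \<beta>) / (z s ^ m) ^ Suc (Suc 0) = - (real m * C * \<beta>) / z s ^ Suc m"
      using zs by (cases m) (simp_all add: divide_simps)
    then show ?thesis
      using DERIV_quotient[OF DERIV_const DERIV_power[OF dz], of m \<beta>] zs by simp
  qed
  then have "((\<lambda>t. \<beta> / z t ^ m) has_derivative (\<lambda>h. - (real m * C * \<beta>) / z s ^ Suc m * h)) (at (fst (s, x)))"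
    unfolding has_field_derivative_def fst_conv .
  from has_derivative_compose[OF has_derivative_fst[OF has_derivative_ident] this]
  have "((\<lambda>i. \<beta> / z (fst i) ^ m) has_derivative (\<lambda>i. - (real m * C * \<beta>) / z s ^ Suc m * fst i)) (at (s, x) within {0..T} \<times> {0..L})" .
  then have "((\<lambda>i. vector [\<alpha>, \<beta> / z (fst i) ^ m] :: real^2) has_derivative
      (\<lambda>i. vector [0, - (real m * C * \<beta>) / z s ^ Suc m * fst i])) (at (s, x) within {0..T} \<times> {0..L})"
    by (intro has_derivative_vector_2) (simp_all only: vector_2 has_derivative_const)
  moreover have "(\<lambda>i. vector [0, - (real m * C * \<beta>) / z s ^ Suc m * fst i] :: real^2) =
     (\<lambda>(s', x'). s' *\<^sub>R vector [0, - (real m * C * \<beta>) / z s ^ Suc m] + x' *\<^sub>R vector [0, 0 / z s ^ 0])"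
    by (simp add: fun_eq_iff vec_eq_iff forall_2)
  ultimately show ?thesis by (simp only: case_prod_unfold)
qed

lemma Ck_on_power_z: "Ck_on k ({0..T} \<times> {0..L}) (\<lambda>(t, x). vector [\<alpha>, \<beta> / z t ^ m] :: real^2)"
proof (induction k arbitrary: \<alpha> \<beta> m)
  case 0
  show ?case
    unfolding Ck_on.simps continuous_on_eq_continuous_within
    using has_derivative_continuous[OF power_z_has_derivative] by auto
next
  case (Suc k)
  let ?ft = "\<lambda>(t, x). vector [0, - (real m * C * \<beta>) / z t ^ Suc m] :: real^2" and ?fx = "\<lambda>(t, x). vector [0, 0 / z t ^ 0] :: real^2"
  show ?case
    unfolding Ck_on.simps
  proof (rule exI[of _ ?ft], rule exI[of _ ?fx], intro conjI ballI)
    show "Ck_on k ({0..T} \<times> {0..L}) ?ft" "Ck_on k ({0..T} \<times> {0..L}) ?fx" by (rule Suc.IH)+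
    fix i assume "i \<in> {0..T} \<times> {0..L}"
    then obtain s x where i: "i = (s, x)" "s \<in> {0..T}" by blast
    show "((\<lambda>(t, x). vector [\<alpha>, \<beta> / z t ^ m]) has_derivative (\<lambda>(s', x'). s' *\<^sub>R ?ft i + x' *\<^sub>R ?fx i)) (at i within {0..T} \<times> {0..L})"
      unfolding i(1) prod.case by (rule power_z_has_derivative[OF i(2)])
  qed
qed

lemma smooth_u: "smooth u"
  using Ck_on_power_z[of _ p 1 1] unfolding Cinf_on_def u_def y_def by simp

lemma u_flow: "u \<in> pipe_flows T L cf D K \<rho>a"
proof -
  let ?c = "sqrt (K / \<rho>a)"
  have c2: "?c * ?c = K / \<rho>a" using K_pos \<rho>a_pos by simp
  have nth: "u t x $ 1 = p" "u t x $ 2 = y t" for t x by (simp_all add: u_def)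
  have eig: "eigenvalue_of (A_matrix K \<rho>a (u t x)) (y t + \<sigma> * ?c)" if "\<sigma> = 1 \<or> \<sigma> = -1" for t x \<sigma>
    unfolding eigenvalue_of_def
  \<comment> \<open>Right eigenvector for the characteristic speed y + \<sigma> c.\<close>
  proof (intro exI[of _ "vector [p, \<sigma> * ?c]"] conjI)
    show "(vector [p, \<sigma> * ?c] :: real^2) \<noteq> 0" using p_pos by (auto simp: vec_eq_iff forall_2)
    define X where "X = \<sigma> * ?c"
    have "X * X = K / \<rho>a" using c2 that by (auto simp: X_def)
    then show "A_matrix K \<rho>a (u t x) *v vector [p, \<sigma> * ?c] = (y t + \<sigma> * ?c) *\<^sub>R vector [p, \<sigma> * ?c]"
      using p_pos unfolding vec_eq_iff forall_2 A_matrix_times nth X_def[symmetric]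
      by (simp add: algebra_simps)
  qed
  have "hyperbolic T L K \<rho>a u"
    unfolding hyperbolic_def
  proof (intro ballI exI conjI)
    fix t x assume "t \<in> {0..T}" "x \<in> {0..L}"
    then have "0 < y t" "y t < ?c" using y_pos[of t] y_le[of t] v0_less by auto
    then show "y t + (-1) * ?c < 0" "0 < y t + 1 * ?c" by auto
  qed (rule eig; simp)+
  moreover have "quasilinear_form T L cf D K \<rho>a u"
    unfolding quasilinear_form_def
  proof (intro ballI)
    fix t x assume tx: "t \<in> {0..T}" "x \<in> {0..L}"
    have "((\<lambda>(t, x). u t x) has_derivative (\<lambda>(s', x'). s' *\<^sub>R vector [0, - (real 1 * C * 1) / z t ^ Suc 1] + x' *\<^sub>R vector [0, 0 / z t ^ 0]))
     (at (t, x) within {0..T} \<times> {0..L})"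
      using power_z_has_derivative[OF tx(1), of p 1 1 x] by (simp add: u_def y_def)
    from has_partials(3,4)[OF this tx]
    have d: "dt T u t x = vector [0, - C / (z t)\<^sup>2]" "dx L u t x = 0"
      by (simp_all add: power2_eq_square vec_eq_iff forall_2)
    have "0 < y t" using y_pos tx by simp
    then have "y t * \<bar>y t\<bar> = 1 / (z t)\<^sup>2" by (simp add: y_def power2_eq_square)
    then show "dt T u t x = - (A_matrix K \<rho>a (u t x) *v dx L u t x) + B_vector cf D (u t x)"
      unfolding d B_vector_def nth by (simp add: vec_eq_iff forall_2 C_eq mult.assoc)
  qed
  ultimately show ?thesis
    using smooth_u smooth_taylor2[OF smooth_u] p_pos by (simp add: pipe_flows_def nth)
qed

lemma lw_solution_u: "lw_solution cf D K \<rho>a r (u 0) h n x = vector [p, num h n]"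
proof (induction n arbitrary: x)
  case 0
  show ?case using v0_pos by (simp add: u_def y_def z_def)
next
  case (Suc n)
  have "\<bar>num h n\<bar> = num h n" using num_pos[of h n] by simp
  then show ?case
    unfolding lw_solution.simps Suc.IH lax_wendroff_def D0_def D2_def Let_def C_eq[symmetric]
    by (simp add: power2_eq_square power3_eq_cube mult_ac)
qed

lemma second_error_term:
  "error_expansion T L cf D K \<rho>a r u 2 (\<lambda>k t x. if k = 2 then vector [0, e t * (y t)\<^sup>2] else 0)"
  unfolding error_expansion_def
proof (intro conjI ballI)
  fix k x
  have "e 0 = 0" using v0_pos by (simp add: e_def y_def z_def)
  then show "(if k = (2::nat) then vector [0, e 0 * (y 0)\<^sup>2] else 0) = (0 :: real^2)" by (simp add: vec_eq_iff forall_2)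
next
  fix i assume i: "i \<in> cone_points T L r"
  obtain t0 x0 where tx: "i = (t0, x0)" by (cases i)
  have t0: "0 < t0" using i tx by (simp add: cone_points_def)
  obtain M where M: "0 \<le> M" "\<And>h n. \<lbrakk>0 < h; h * C * v0 \<le> 1; real n * h \<le> t0\<rbrakk> \<Longrightarrow>
       \<bar>num h n - y (n * h) - h\<^sup>2 * (e (n * h) * (y (n * h))\<^sup>2)\<bar> \<le> M * h ^ 3"
    by (rule expansion_num[OF t0]) (rule that)
  let ?V = "\<lambda>k t x. if k = 2 then vector [0, e t * (y t)\<^sup>2] else (0 :: real^2)"
  let ?R = "\<lambda>n. lw_error cf D K \<rho>a r u t0 x0 n - (\<Sum>k=1..2. (t0 / real n) ^ k *\<^sub>R ?V k t0 x0)"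
  have "(\<lambda>n. norm (?R n)) \<in> O(\<lambda>n. (t0 / real n) ^ (2 + 1))"
  proof (rule bigoI[where c=M])
    show "\<forall>\<^sub>F n in sequentially. norm (norm (?R n)) \<le> M * norm ((t0 / real n) ^ (2 + 1))"
    \<comment> \<open>From this index on the step h = t0 / n satisfies h C v0 \<le> 1; the successor
      keeps n positive.\<close>
    proof (rule eventually_sequentiallyI[of "Suc (nat \<lceil>t0 * C * v0\<rceil>)"])
      fix n assume n: "Suc (nat \<lceil>t0 * C * v0\<rceil>) \<le> n"
      have n0: "0 < n" using n by simp
      have "t0 * C * v0 \<le> real n" using n by linarith
      then have h: "0 < t0 / real n" "t0 / real n * C * v0 \<le> 1" using n0 t0 by (simp_all add: pos_divide_le_eq)
      have nh: "real n * (t0 / real n) = t0" using n0 by simp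
      have "(\<Sum>k=1..2. (t0 / real n) ^ k *\<^sub>R ?V k t0 x0) = (t0 / real n)\<^sup>2 *\<^sub>R vector [0, e t0 * (y t0)\<^sup>2]"
        by (simp add: numeral_2_eq_2)
      then have R: "?R n = vector [0, num (t0 / real n) n - y t0 - (t0 / real n)\<^sup>2 * (e t0 * (y t0)\<^sup>2)]"
        unfolding lw_error_def lw_solution_u by (simp add: u_def vec_eq_iff forall_2)
      have "norm (?R n) \<le> \<bar>num (t0 / real n) n - y t0 - (t0 / real n)\<^sup>2 * (e t0 * (y t0)\<^sup>2)\<bar>"
        using norm_le_l1_cart[of "?R n"] unfolding sum_2 R by simp
      also have "\<dots> \<le> M * (t0 / real n) ^ 3" using M(2)[OF h, of n] unfolding nh by simp
      finally show "norm (norm (?R n)) \<le> M * norm ((t0 / real n) ^ (2 + 1))" using t0 by simp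
    qed
  qed
  then show "case i of (t0, x0) \<Rightarrow> (\<lambda>n. norm (lw_error cf D K \<rho>a r u t0 x0 n
      - (\<Sum>k=1..2. (t0 / real n) ^ k *\<^sub>R ?V k t0 x0))) \<in> O(\<lambda>n. (t0 / real n) ^ (2 + 1))"
    unfolding tx by simp
qed

lemma second_error_term_nonzero: "\<not> vanishes T L r (\<lambda>t x. vector [0, e t * (y t)\<^sup>2] :: real^2)"
proof
  assume v: "vanishes T L r (\<lambda>t x. vector [0, e t * (y t)\<^sup>2] :: real^2)"
  \<comment> \<open>The cone with apex above the midpoint has base half-width t0 / r, which must not
    exceed L / 2.\<close>
  define t0 where "t0 = min T (r * (L / 2))"
  have t0: "0 < t0" "t0 \<le> T" "t0 \<le> r * (L / 2)" using T_pos L_pos r_pos by (simp_all add: t0_def)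
  have "cone r t0 (L / 2) \<subseteq> {0..T} \<times> {0..L}"
  proof
    fix i assume "i \<in> cone r t0 (L / 2)"
    then obtain t x where i: "i = (t, x)" "0 \<le> t" "t \<le> t0" "\<bar>r * (x - L / 2)\<bar> \<le> t0 - t" by (auto simp: cone_def)
    have "r * \<bar>x - L / 2\<bar> = \<bar>r * (x - L / 2)\<bar>" using r_pos by (simp add: abs_mult)
    also have "\<dots> \<le> t0 - t" by (rule i(4))
    also have "\<dots> \<le> r * (L / 2)" using t0 i(2) by linarith
    finally have "r * \<bar>x - L / 2\<bar> \<le> r * (L / 2)" .
    then have "\<bar>x - L / 2\<bar> \<le> L / 2" using r_pos by (rule mult_left_le_imp_le)
    then have "0 \<le> x" "x \<le> L" unfolding abs_le_iff by linarith+
    then show "i \<in> {0..T} \<times> {0..L}" using i t0 by simp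
  qed
  then have "(t0, L / 2) \<in> cone_points T L r" using t0 by (simp add: cone_points_def)
  with v have "(vector [0, e t0 * (y t0)\<^sup>2] :: real^2) = 0" unfolding vanishes_def by blast
  then have "e t0 * (y t0)\<^sup>2 = 0" by (simp add: vec_eq_iff forall_2)
  then show False using e_pos[OF t0(1)] y_pos[of t0] t0 by simp
qed

end

theorem theorem1:
  fixes T L cf D K \<rho>a pa :: real
  assumes "0 < T" "0 < L" "0 < cf" "0 < D" "0 < K" "0 < \<rho>a"
  shows "(\<forall>\<rho> q. Cinf_on ({0..T} \<times> {0..L}) (\<lambda>(t, x). density_velocity \<rho> q t x) \<and>
              (\<forall>t\<in>{0..T}. \<forall>x\<in>{0..L}. 0 < \<rho> t x) \<longrightarrow>
            (conservation_form T L cf D K \<rho>a pa \<rho> q \<longleftrightarrow>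
             quasilinear_form T L cf D K \<rho>a (density_velocity \<rho> q))) \<and>
         (\<forall>u\<in>pipe_flows T L cf D K \<rho>a. \<forall>r>0. consistent T L cf D K \<rho>a r u) \<and>
         (\<exists>\<epsilon> :: real \<Rightarrow> real. \<forall>b>0. 0 < \<epsilon> b \<and> \<epsilon> b < 1 \<and>
            (\<forall>r>0. r * sqrt (K / \<rho>a) \<le> \<epsilon> b \<longrightarrow>
               order_of_accuracy T L cf D K \<rho>a r
                 {u \<in> pipe_flows T L cf D K \<rho>a. sup_bounded T L b u} 2 \<and>
               (\<forall>u\<in>pipe_flows T L cf D K \<rho>a. sup_bounded T L b u \<longrightarrow>
                  l2_stable T L cf D K \<rho>a r u \<and>
                  (\<forall>(t0, x0)\<in>cone_points T L r.
                     (\<lambda>n. norm (lw_error cf D K \<rho>a r u t0 x0 n)) \<in> O(\<lambda>n. (t0 / real n)\<^sup>2)))))"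
proof -
  have rect: "rectangle T L" using assms by unfold_locales
  have grid: "pipe_grid T L cf D K \<rho>a u r" if "u \<in> pipe_flows T L cf D K \<rho>a" "0 < r" for u r
    using that assms by unfold_locales
  have second: "l2_stable T L cf D K \<rho>a r u" "\<forall>(t0, x0)\<in>cone_points T L r.
       (\<lambda>n. norm (lw_error cf D K \<rho>a r u t0 x0 n)) \<in> O(\<lambda>n. (t0 / real n)\<^sup>2)"
    if u: "u \<in> pipe_flows T L cf D K \<rho>a" and r: "0 < r" "r * sqrt (K / \<rho>a) \<le> 1 / 2" for u r
  proof -
    interpret pipe_grid T L cf D K \<rho>a u r by (rule grid[OF u r(1)])
    have cfl: "2 * r * c \<le> 1" using r(2) by (simp add: c_def)
    show "l2_stable T L cf D K \<rho>a r u" by (rule l2_stable_u[OF cfl])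
    show "\<forall>(t0, x0)\<in>cone_points T L r. (\<lambda>n. norm (lw_error cf D K \<rho>a r u t0 x0 n)) \<in> O(\<lambda>n. (t0 / real n)\<^sup>2)"
      using second_order_u[OF cfl] by blast
  qed
  have order: "order_of_accuracy T L cf D K \<rho>a r {u \<in> pipe_flows T L cf D K \<rho>a. sup_bounded T L b u} 2"
    if b: "0 < b" and r: "0 < r" "r * sqrt (K / \<rho>a) \<le> 1 / 2" for b r
    unfolding order_of_accuracy_def
  proof (intro conjI ballI)
    fix u assume "u \<in> {u \<in> pipe_flows T L cf D K \<rho>a. sup_bounded T L b u}"
    \<comment> \<open>For p - 1 = 1 the only error term has index 1; if it is taken to be zero, the
      remainder bound is second order convergence.\<close>
    then have "error_expansion T L cf D K \<rho>a r u (2 - 1) (\<lambda>_ _ _. 0)"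
      using second(2)[OF _ r, of u] by (simp add: error_expansion_def numeral_2_eq_2)
    then show "\<exists>V. error_expansion T L cf D K \<rho>a r u (2 - 1) V \<and> (\<forall>k\<in>{1..<2}. vanishes T L r (V k))"
      by (intro exI[of _ "\<lambda>_ _ _. 0"]) (simp add: vanishes_def)
  next
    \<comment> \<open>Density and velocity of at most b / 2 keep the norm below \<open>b\<close>;
      half the sound speed makes the flow hyperbolic.\<close>
    define v0 where "v0 = min (b / 2) (sqrt (K / \<rho>a) / 2)"
    have v0: "0 < v0" "v0 \<le> b / 2" "v0 < sqrt (K / \<rho>a)"
      using b assms by (auto simp: v0_def min_less_iff_disj)
    interpret riccati_pipe T L "cf / (2 * D)" v0 cf D K \<rho>a "b / 2" r
      using assms v0 b r by unfold_locales auto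
    have "sup_bounded T L b u"
      unfolding sup_bounded_def
    proof (intro ballI)
      fix t x assume t: "t \<in> {0..T}" "x \<in> {0..L}"
      have "norm (u t x) \<le> \<bar>b / 2\<bar> + \<bar>y t\<bar>" using norm_le_l1_cart[of "u t x"] by (simp add: sum_2 u_def)
      also have "\<dots> \<le> b" using y_pos[of t] y_le[of t] t v0(2) b by simp
      finally show "norm (u t x) \<le> b" .
    qed
    then show "\<exists>u\<in>{u \<in> pipe_flows T L cf D K \<rho>a. sup_bounded T L b u}.
        \<exists>V. error_expansion T L cf D K \<rho>a r u 2 V \<and> (\<forall>k\<in>{1..<2}. vanishes T L r (V k)) \<and> \<not> vanishes T L r (V 2)"
      using u_flow second_error_term second_error_term_nonzero
      by (intro bexI[of _ u] exI[of _ "\<lambda>k t x. if k = 2 then vector [0, e t * (y t)\<^sup>2] else 0"])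
         (auto simp: vanishes_def)
  qed simp
  show ?thesis
  \<comment> \<open>Hyperbolicity already bounds the velocity by the sound speed, so one threshold
    serves every \<open>b\<close>.\<close>
  proof (intro conjI allI impI ballI exI[of _ "\<lambda>_. 1 / 2"])
    fix \<rho> q
    assume *: "Cinf_on ({0..T} \<times> {0..L}) (\<lambda>(t, x). density_velocity \<rho> q t x) \<and> (\<forall>t\<in>{0..T}. \<forall>x\<in>{0..L}. 0 < \<rho> t x)"
    show "conservation_form T L cf D K \<rho>a pa \<rho> q = quasilinear_form T L cf D K \<rho>a (density_velocity \<rho> q)"
      using * by (intro rectangle.conservation_iff_quasilinear[OF rect]) (use assms in auto)
  next
    show "consistent T L cf D K \<rho>a r u" if "u \<in> pipe_flows T L cf D K \<rho>a" "0 < r" for u r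
      by (rule pipe_grid.consistent_u[OF grid[OF that]])
  next
    show "l2_stable T L cf D K \<rho>a r u" if "u \<in> pipe_flows T L cf D K \<rho>a" "0 < r" "r * sqrt (K / \<rho>a) \<le> 1 / 2" for u r
      by (rule second(1)[OF that])
  next
    fix r u i
    assume "0 < r" "r * sqrt (K / \<rho>a) \<le> 1 / 2" "u \<in> pipe_flows T L cf D K \<rho>a" "i \<in> cone_points T L r"
    then show "case i of (t0, x0) \<Rightarrow> (\<lambda>n. norm (lw_error cf D K \<rho>a r u t0 x0 n)) \<in> O(\<lambda>n. (t0 / real n)\<^sup>2)"
      using second(2) by blast
  qed (simp_all add: order)
qed

end
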